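(* Let $M$ be a smooth $3$-dimensional manifold, let $\pi$ be a Poisson structure on $M$, and let $p\in M$ be a point with $\pi(p)=0$ whose isotropy Lie algebra satisfies $\mathfrak{g}_p\simeq\mathfrak{sl}_2(\mathbb{R})$. Assume that $\pi$ is unimodular locally around $p$, i.e. there exists a volume form $\mu$ on an open neighborhood of $p$ in $M$ with $\mathrm{d}\,\iota_\pi\mu=0$ on that neighborhood. Then $\pi$ is linearizable around $p$, i.e. there exist open neighborhoods $O\subset M$ of $p$ and $V\subset\mathfrak{g}_p^*=T_pM$ of $0$ and a smooth Poisson diffeomorphism $$\Phi:(O,\pi|_O)\to(V,\pi_{\mathfrak{g}_p}|_V)\qquad\text{with}\qquad\Phi(p)=0.$$
   Context: All objects are smooth ($C^\infty$) and real. Isotropy Lie algebra: if $\pi$ is a Poisson structure on $M$ with $\pi(p)=0$, the isotropy Lie algebra $\mathfrak{g}_p$ is the vector space $T_p^*M$ with the (well-defined) Lie bracket $$[\mathrm{d}_pg,\mathrm{d}_ph]:=\mathrm{d}_p\big(\pi(\mathrm{d}g,\mathrm{d}h)\big),\qquad g,h\in C^\infty(M).$$ Linear Poisson structure: for a Lie algebra $(\mathfrak{g},[\cdot,\cdot])$, the Poisson structure $\pi_{\mathfrak{g}}$ on the dual space $\mathfrak{g}^*$ is defined by $\pi_{\mathfrak{g},\xi}(X,Y):=\xi([X,Y])$ for $\xi\in\mathfrak{g}^*$ and $X,Y\in\mathfrak{g}$ (elements of $\mathfrak{g}$ are regarded as covectors on $\mathfrak{g}^*$). For $\mathfrak{g}=\mathfrak{g}_p$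 one has $\mathfrak{g}_p^*=T_pM$. A volume form is a nowhere vanishing $3$-form, and $\iota_\pi\mu$ is the contraction of $\mu$ with the bivector field $\pi$, which is a one-form. *)

theory Defs
  imports "HOL-Analysis.Analysis" "HOL-Library.Function_Algebras"
begin

text \<open>
  Tangent vectors, covectors and elements of dual spaces are functions. Function types get the
  pointwise vector space structure, so that the sets of such functions are subspaces.
\<close>

instantiation "fun" :: (type, real_vector) real_vector
begin

definition scaleR_fun :: "real \<Rightarrow> ('a \<Rightarrow> 'b) \<Rightarrow> 'a \<Rightarrow> 'b" where
  "scaleR_fun c f = (\<lambda>x. c *\<^sub>R f x)"

instance
  by standard (auto simp: scaleR_fun_def fun_eq_iff algebra_simps)

end

definition linear_on :: "'v::real_vector set \<Rightarrow> ('v \<Rightarrow> 'w::real_vector) \<Rightarrow> bool" where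
  "linear_on W F \<longleftrightarrow>
     (\<forall>x\<in>W. \<forall>y\<in>W. F (x + y) = F x + F y) \<and> (\<forall>c. \<forall>x\<in>W. F (c *\<^sub>R x) = c *\<^sub>R F x)"

text \<open>Functionals on a subspace are normalised to be \<open>0\<close> outside it.\<close>

definition dual_space :: "'v::real_vector set \<Rightarrow> ('v \<Rightarrow> real) set" where
  "dual_space W = {\<alpha>. linear_on W \<alpha> \<and> (\<forall>x. x \<notin> W \<longrightarrow> \<alpha> x = 0)}"


section \<open>Smooth 3-manifolds\<close>

text \<open>The following two notions are only used for open sets \<open>S\<close>.\<close>

primrec Ck_on :: "nat \<Rightarrow> 'a::real_normed_vector set \<Rightarrow> ('a \<Rightarrow> 'b::real_normed_vector) \<Rightarrow> bool" where
  "Ck_on 0 S f \<longleftrightarrow> continuous_on S f"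
| "Ck_on (Suc k) S f \<longleftrightarrow>
     (\<forall>x\<in>S. f differentiable (at x)) \<and> (\<forall>v. Ck_on k S (\<lambda>x. frechet_derivative f (at x) v))"

definition smooth_on :: "'a::real_normed_vector set \<Rightarrow> ('a \<Rightarrow> 'b::real_normed_vector) \<Rightarrow> bool" where
  "smooth_on S f \<longleftrightarrow> (\<forall>k. Ck_on k S f)"

type_synonym 'a chart = "'a set \<times> ('a \<Rightarrow> real^3)"

record 'a manifold =
  mtop :: "'a topology"
  atlas :: "'a chart set"

abbreviation mspc :: "'a manifold \<Rightarrow> 'a set" where
  "mspc M \<equiv> topspace (mtop M)"

definition smooth_manifold :: "'a manifold \<Rightarrow> bool" where
  "smooth_manifold M \<longleftrightarrow>
     Hausdorff_space (mtop M) \<and> second_countable (mtop M) \<and>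
     (\<Union>(U, \<phi>)\<in>atlas M. U) = mspc M \<and>
     (\<forall>(U, \<phi>)\<in>atlas M. openin (mtop M) U \<and> open (\<phi> ` U) \<and>
        homeomorphic_map (subtopology (mtop M) U) (top_of_set (\<phi> ` U)) \<phi>) \<and>
     (\<forall>(U, \<phi>)\<in>atlas M. \<forall>(V, \<psi>)\<in>atlas M. smooth_on (\<phi> ` (U \<inter> V)) (\<psi> \<circ> inv_into U \<phi>))"

text \<open>\<open>C\<^sup>\<infinity>(S)\<close> for an open subset \<open>S\<close> of \<open>M\<close>; values outside \<open>S\<close> are irrelevant.\<close>

definition smooth_functions :: "'a manifold \<Rightarrow> 'a set \<Rightarrow> ('a \<Rightarrow> real) set" where
  "smooth_functions M S =
     {f. \<forall>(U, \<phi>)\<in>atlas M. smooth_on (\<phi> ` (U \<inter> S)) (f \<circ> inv_into U \<phi>)}"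

definition smooth_near :: "'a manifold \<Rightarrow> 'a \<Rightarrow> ('a \<Rightarrow> real) \<Rightarrow> bool" where
  "smooth_near M p f \<longleftrightarrow> (\<exists>S. openin (mtop M) S \<and> p \<in> S \<and> f \<in> smooth_functions M S)"

definition smooth_map :: "'a manifold \<Rightarrow> 'a set \<Rightarrow> 'b manifold \<Rightarrow> ('a \<Rightarrow> 'b) \<Rightarrow> bool" where
  "smooth_map M S N F \<longleftrightarrow>
     continuous_map (subtopology (mtop M) S) (mtop N) F \<and>
     (\<forall>(U, \<phi>)\<in>atlas M. \<forall>(V, \<psi>)\<in>atlas N.
        smooth_on (\<phi> ` (U \<inter> S \<inter> F -` V)) (\<psi> \<circ> F \<circ> inv_into U \<phi>))"


section \<open>Tangent and cotangent spaces\<close>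

type_synonym 'a tangent = "('a \<Rightarrow> real) \<Rightarrow> real"
type_synonym 'a cotangent = "'a tangent \<Rightarrow> real"

text \<open>
  Tangent vectors at \<open>p\<close> are the derivations at \<open>p\<close> of the functions that are smooth near \<open>p\<close>,
  normalised to be \<open>0\<close> on all other functions. Such a \<open>v\<close> only depends on germs: if \<open>f\<close>
  vanishes on a neighbourhood \<open>S\<close> of \<open>p\<close>, then \<open>f = f * g\<close> for the indicator function \<open>g\<close>
  of the complement of \<open>S\<close>, and the product rule gives \<open>v f = 0\<close>. Hence open subsets of \<open>M\<close>
  have literally the same tangent spaces as \<open>M\<close>.
\<close>

definition tangent_space :: "'a manifold \<Rightarrow> 'a \<Rightarrow> 'a tangent set" where
  "tangent_space M p = {v.
     linear_on {f. smooth_near M p f} v \<and>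
     (\<forall>f g. smooth_near M p f \<longrightarrow> smooth_near M p g \<longrightarrow>
        v (\<lambda>x. f x * g x) = f p * v g + g p * v f) \<and>
     (\<forall>f. \<not> smooth_near M p f \<longrightarrow> v f = 0)}"

definition cotangent_space :: "'a manifold \<Rightarrow> 'a \<Rightarrow> 'a cotangent set" where
  "cotangent_space M p = dual_space (tangent_space M p)"

definition differential :: "'a manifold \<Rightarrow> 'a \<Rightarrow> ('a \<Rightarrow> real) \<Rightarrow> 'a cotangent" where
  "differential M p f = (\<lambda>v. if v \<in> tangent_space M p then v f else 0)"

definition pushforward :: "'b manifold \<Rightarrow> ('a \<Rightarrow> 'b) \<Rightarrow> 'a \<Rightarrow> 'a tangent \<Rightarrow> 'b tangent" where
  "pushforward N F x v = (\<lambda>f. if smooth_near N (F x) f then v (f \<circ> F) else 0)"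

definition pullback ::
    "'a manifold \<Rightarrow> 'b manifold \<Rightarrow> ('a \<Rightarrow> 'b) \<Rightarrow> 'a \<Rightarrow> 'b cotangent \<Rightarrow> 'a cotangent" where
  "pullback M N F x \<alpha> = (\<lambda>v. if v \<in> tangent_space M x then \<alpha> (pushforward N F x v) else 0)"

definition coord :: "'a chart \<Rightarrow> 3 \<Rightarrow> 'a \<Rightarrow> real" where
  "coord c i = (\<lambda>x. snd c x $ i)"

definition coord_vector :: "'a manifold \<Rightarrow> 'a chart \<Rightarrow> 3 \<Rightarrow> 'a \<Rightarrow> 'a tangent" where
  "coord_vector M c i x = (\<lambda>f. if smooth_near M x f
     then frechet_derivative (f \<circ> inv_into (fst c) (snd c)) (at (snd c x)) (axis i 1) else 0)"


section \<open>Poisson structures\<close>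

text \<open>Bivectors at \<open>x\<close> are skew-symmetric bilinear forms on the cotangent space at \<open>x\<close>.\<close>

type_synonym 'a bivector_field = "'a \<Rightarrow> 'a cotangent \<Rightarrow> 'a cotangent \<Rightarrow> real"

definition smooth_bivector_field :: "'a manifold \<Rightarrow> 'a bivector_field \<Rightarrow> bool" where
  "smooth_bivector_field M \<pi> \<longleftrightarrow>
     (\<forall>x\<in>mspc M. \<forall>\<alpha>\<in>cotangent_space M x.
        linear_on (cotangent_space M x) (\<pi> x \<alpha>) \<and>
        (\<forall>\<beta>\<in>cotangent_space M x. \<pi> x \<alpha> \<beta> = - \<pi> x \<beta> \<alpha>)) \<and>
     (\<forall>c\<in>atlas M. \<forall>i j.
        (\<lambda>x. \<pi> x (differential M x (coord c i)) (differential M x (coord c j)))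
          \<in> smooth_functions M (fst c))"

definition poisson_bracket ::
    "'a manifold \<Rightarrow> 'a bivector_field \<Rightarrow> ('a \<Rightarrow> real) \<Rightarrow> ('a \<Rightarrow> real) \<Rightarrow> 'a \<Rightarrow> real" where
  "poisson_bracket M \<pi> f g = (\<lambda>x. \<pi> x (differential M x f) (differential M x g))"

definition poisson_structure :: "'a manifold \<Rightarrow> 'a bivector_field \<Rightarrow> bool" where
  "poisson_structure M \<pi> \<longleftrightarrow>
     smooth_bivector_field M \<pi> \<and>
     (\<forall>f\<in>smooth_functions M (mspc M). \<forall>g\<in>smooth_functions M (mspc M).
        \<forall>h\<in>smooth_functions M (mspc M). \<forall>x\<in>mspc M.
          poisson_bracket M \<pi> f (poisson_bracket M \<pi> g h) x +
          poisson_bracket M \<pi> g (poisson_bracket M \<pi> h f) x +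
          poisson_bracket M \<pi> h (poisson_bracket M \<pi> f g) x = 0)"

text \<open>A Poisson diffeomorphism from the open set \<open>U\<close> in \<open>(M, \<pi>)\<close> to the open set \<open>V\<close> in \<open>(N, \<rho>)\<close>.\<close>

definition poisson_diffeo :: "'a manifold \<Rightarrow> 'a bivector_field \<Rightarrow> 'a set \<Rightarrow>
    'b manifold \<Rightarrow> 'b bivector_field \<Rightarrow> 'b set \<Rightarrow> ('a \<Rightarrow> 'b) \<Rightarrow> bool" where
  "poisson_diffeo M \<pi> U N \<rho> V F \<longleftrightarrow>
     bij_betw F U V \<and> smooth_map M U N F \<and> smooth_map N V M (inv_into U F) \<and>
     (\<forall>x\<in>U. \<forall>\<alpha>\<in>cotangent_space N (F x). \<forall>\<beta>\<in>cotangent_space N (F x).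
        \<rho> (F x) \<alpha> \<beta> = \<pi> x (pullback M N F x \<alpha>) (pullback M N F x \<beta>))"


section \<open>Unimodularity\<close>

definition volume_form ::
    "'a manifold \<Rightarrow> 'a set \<Rightarrow> ('a \<Rightarrow> 'a tangent \<Rightarrow> 'a tangent \<Rightarrow> 'a tangent \<Rightarrow> real) \<Rightarrow> bool" where
  "volume_form M S \<mu> \<longleftrightarrow>
     (\<forall>x\<in>S.
        (\<forall>u\<in>tangent_space M x. \<forall>v\<in>tangent_space M x.
           linear_on (tangent_space M x) (\<mu> x u v) \<and>
           (\<forall>w\<in>tangent_space M x. \<mu> x u v w = - \<mu> x v u w \<and> \<mu> x u v w = - \<mu> x u w v)) \<and>
        (\<exists>u\<in>tangent_space M x. \<exists>v\<in>tangent_space M x. \<exists>w\<in>tangent_space M x. \<mu> x u v w \<noteq> 0)) \<and>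
     (\<forall>c\<in>atlas M. \<forall>i j k.
        (\<lambda>x. \<mu> x (coord_vector M c i x) (coord_vector M c j x) (coord_vector M c k x))
          \<in> smooth_functions M (fst c \<inter> S))"

text \<open>
  The contraction and the exterior derivative are given by their formulas in local coordinates,
  which yield the same value for every chart around \<open>x\<close>. For a decomposable bivector the
  contraction is \<open>\<iota>(X \<and> Y) \<mu> = \<mu>(X, Y, -)\<close>.
\<close>

definition chart_at :: "'a manifold \<Rightarrow> 'a \<Rightarrow> 'a chart" where
  "chart_at M x = (SOME c. c \<in> atlas M \<and> x \<in> fst c)"

definition contraction :: "'a manifold \<Rightarrow> 'a bivector_field \<Rightarrow>
    ('a \<Rightarrow> 'a tangent \<Rightarrow> 'a tangent \<Rightarrow> 'a tangent \<Rightarrow> real) \<Rightarrow> 'a \<Rightarrow> 'a cotangent" where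
  "contraction M \<pi> \<mu> x = (\<lambda>w. let c = chart_at M x in
     (1/2) * (\<Sum>i\<in>UNIV. \<Sum>j\<in>UNIV.
        \<pi> x (differential M x (coord c i)) (differential M x (coord c j)) *
        \<mu> x (coord_vector M c i x) (coord_vector M c j x) w))"

text \<open>
  In coordinates \<open>d\<alpha> = (\<Sum>i j. \<partial>\<^sub>i \<alpha>\<^sub>j dx\<^sub>i \<and> dx\<^sub>j)\<close>.
\<close>

definition ext_deriv :: "'a manifold \<Rightarrow> ('a \<Rightarrow> 'a cotangent) \<Rightarrow> 'a \<Rightarrow> 'a tangent \<Rightarrow> 'a tangent \<Rightarrow> real" where
  "ext_deriv M \<alpha> x u v = (let c = chart_at M x in
     \<Sum>i\<in>UNIV. \<Sum>j\<in>UNIV.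
       coord_vector M c i x (\<lambda>y. \<alpha> y (coord_vector M c j y)) *
       (u (coord c i) * v (coord c j) - u (coord c j) * v (coord c i)))"

definition unimodular_near :: "'a manifold \<Rightarrow> 'a bivector_field \<Rightarrow> 'a \<Rightarrow> bool" where
  "unimodular_near M \<pi> p \<longleftrightarrow>
     (\<exists>S \<mu>. openin (mtop M) S \<and> p \<in> S \<and> volume_form M S \<mu> \<and>
        (\<forall>x\<in>S. \<forall>u\<in>tangent_space M x. \<forall>v\<in>tangent_space M x.
           ext_deriv M (contraction M \<pi> \<mu>) x u v = 0))"


section \<open>Lie algebras and linear Poisson structures\<close>

definition lie_isomorphic :: "'v::real_vector set \<Rightarrow> ('v \<Rightarrow> 'v \<Rightarrow> 'v) \<Rightarrow>
    'w::real_vector set \<Rightarrow> ('w \<Rightarrow> 'w \<Rightarrow> 'w) \<Rightarrow> bool" where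
  "lie_isomorphic \<gg> br \<hh> br' \<longleftrightarrow>
     (\<exists>F. linear_on \<gg> F \<and> bij_betw F \<gg> \<hh> \<and> (\<forall>x\<in>\<gg>. \<forall>y\<in>\<gg>. F (br x y) = br' (F x) (F y)))"

definition sl2 :: "(real^2^2) set" where
  "sl2 = {A. trace A = 0}"

definition commutator :: "real^2^2 \<Rightarrow> real^2^2 \<Rightarrow> real^2^2" where
  "commutator A B = A ** B - B ** A"

text \<open>
  The bracket of the isotropy Lie algebra on \<open>cotangent_space M p\<close>; it is well defined if \<open>\<pi>\<close>
  vanishes at \<open>p\<close>.
\<close>

definition isotropy_bracket ::
    "'a manifold \<Rightarrow> 'a bivector_field \<Rightarrow> 'a \<Rightarrow> 'a cotangent \<Rightarrow> 'a cotangent \<Rightarrow> 'a cotangent" where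
  "isotropy_bracket M \<pi> p \<alpha> \<beta> = (THE \<gamma>.
     \<exists>g\<in>smooth_functions M (mspc M). \<exists>h\<in>smooth_functions M (mspc M).
       differential M p g = \<alpha> \<and> differential M p h = \<beta> \<and>
       \<gamma> = differential M p (poisson_bracket M \<pi> g h))"

text \<open>A three-dimensional vector space as a manifold; the linear isomorphisms to \<open>\<real>\<^sup>3\<close> are the charts.\<close>

definition linear_coords :: "'v::real_vector set \<Rightarrow> ('v \<Rightarrow> real^3) set" where
  "linear_coords W = {\<phi>. linear_on W \<phi> \<and> bij_betw \<phi> W UNIV}"

definition linear_manifold :: "'v::real_vector set \<Rightarrow> 'v manifold" where
  "linear_manifold W =
     \<lparr>mtop = topology_generated_by {W \<inter> \<phi> -` B | \<phi> B. \<phi> \<in> linear_coords W \<and> open B},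
      atlas = {W} \<times> linear_coords W\<rparr>"

text \<open>
  The Poisson structure on the dual of the Lie algebra \<open>(\<gg>, br)\<close>. An element \<open>X\<close> of \<open>\<gg>\<close> is
  regarded as a covector at \<open>\<xi>\<close> through the differential of the linear function \<open>\<eta> \<mapsto> \<eta> X\<close>;
  every covector at \<open>\<xi>\<close> is of this form for a unique \<open>X\<close>.
\<close>

definition covector_to_lie :: "'v::real_vector set \<Rightarrow> ('v \<Rightarrow> real) \<Rightarrow> ('v \<Rightarrow> real) cotangent \<Rightarrow> 'v" where
  "covector_to_lie \<gg> \<xi> \<alpha> =
     (THE X. X \<in> \<gg> \<and> differential (linear_manifold (dual_space \<gg>)) \<xi> (\<lambda>\<eta>. \<eta> X) = \<alpha>)"

definition linear_poisson ::
    "'v::real_vector set \<Rightarrow> ('v \<Rightarrow> 'v \<Rightarrow> 'v) \<Rightarrow> ('v \<Rightarrow> real) bivector_field" where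
  "linear_poisson \<gg> br \<xi> \<alpha> \<beta> = \<xi> (br (covector_to_lie \<gg> \<xi> \<alpha>) (covector_to_lie \<gg> \<xi> \<beta>))"

definition linearizable_at :: "'a manifold \<Rightarrow> 'a bivector_field \<Rightarrow> 'a \<Rightarrow> bool" where
  "linearizable_at M \<pi> p \<longleftrightarrow>
     (let \<gg> = cotangent_space M p; N = linear_manifold (dual_space \<gg>) in
      \<exists>U V \<Phi>. openin (mtop M) U \<and> p \<in> U \<and> openin (mtop N) V \<and> 0 \<in> V \<and>
        poisson_diffeo M \<pi> U N (linear_poisson \<gg> (isotropy_bracket M \<pi> p)) V \<Phi> \<and> \<Phi> p = 0)"

end

theory Submission imports Defs
begin

text \<open>
  In a chart, unimodularity makes \<open>\<iota>\<^sub>\<pi> \<mu>\<close> a closed one-form, so it equals \<open>df\<close> by the Poincare lemma, and the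
  bracket becomes \<open>{u, v} = g det(\<nabla>u, \<nabla>v, \<nabla>f)\<close> with \<open>g\<close> nowhere zero. Since the isotropy Lie algebra is
  \<open>sl\<^sub>2(\<real>)\<close>, \<open>f\<close> has a critical point at \<open>p\<close> with Hessian of signature \<open>(2,1)\<close> up to sign, and the Morse
  lemma turns \<open>f\<close> into \<open>Q = x\<^sup>2 + y\<^sup>2 - z\<^sup>2\<close>; only the density \<open>1/g\<close> remains to be normalised. Rotating by an
  angle that depends on the point preserves \<open>Q\<close> and replaces \<open>1/g\<close> by its average over the circle action
  around the \<open>z\<close>-axis. By Whitney's theorem on even functions the average is a smooth function of \<open>Q\<close> and \<open>z\<close>.
  Integrating it in \<open>z\<close> along the levels of \<open>Q\<close> gives a new coordinate \<open>\<zeta>\<close>, and multiplying \<open>(x, y)\<close> by a suitable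
  invariant function makes the new quadric a function of \<open>Q\<close>. The resulting coordinates
  have linear brackets.
\<close>

text \<open>The last change of coordinates has the form (\<kappa> x, \<kappa> y, \<zeta>) with
  \<kappa> and \<zeta> functions of (Q, z), and two conditions meet in it. The density asks that the
  z-derivative of \<zeta> be the given function C, which leaves a function of Q free in \<zeta>. The
  quadric asks for \<kappa>^2 (Q + z^2) = \<zeta>^2 + h(Q) with some h, and for a smooth quotient
  the right side must be divisible by Q + z^2 = x^2 + y^2, so it must vanish on the z-axis. This is
  arranged by making \<zeta> odd along the axis: \<zeta> = z k(Q) there, and h(Q) = Q k(Q)^2. That Q
  goes to h(Q) and not to Q does no harm, because Q is a Casimir function: the factor h'(Q) in the
  gradient cancels the same factor in the Jacobian determinant. Whitney's theorem acts as an
  extension theorem: invariant functions are given on the region Q + z^2 >= 0 only, with the axis as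
  its boundary, and have to be continued smoothly beyond it. This is done by Seeley's reflection,
  with weights taken from an entire function that vanishes at the powers of two.\<close>

section \<open>Smooth maps between normed spaces\<close>

text \<open>The direction precedes the point, so that \<open>dir_deriv f v\<close> is again a
  function of the point and derivatives can be iterated.\<close>

definition dir_deriv :: "('a::real_normed_vector \<Rightarrow> 'b::real_normed_vector) \<Rightarrow> 'a \<Rightarrow> 'a \<Rightarrow> 'b" where
  "dir_deriv f v x = frechet_derivative f (at x) v"

text \<open>Smoothness on some neighbourhood of the point. Being an open condition on germs, it has
  closure rules in which no common domain must be carried along.\<close>

definition smooth_at :: "'a::real_normed_vector \<Rightarrow> ('a \<Rightarrow> 'b::real_normed_vector) \<Rightarrow> bool" where
  "smooth_at x f \<longleftrightarrow> (\<exists>S. open S \<and> x \<in> S \<and> smooth_on S f)"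

lemma dir_deriv_eqI: "(f has_derivative f') (at x) \<Longrightarrow> dir_deriv f v x = f' v"
  unfolding dir_deriv_def by (metis frechet_derivative_at)

lemma has_derivative_dir_deriv:
  "f differentiable (at x) \<Longrightarrow> (f has_derivative (\<lambda>v. dir_deriv f v x)) (at x)"
  unfolding dir_deriv_def using frechet_derivative_works by auto

lemma linear_dir_deriv: "f differentiable (at x) \<Longrightarrow> linear (\<lambda>v. dir_deriv f v x)"
  using has_derivative_dir_deriv has_derivative_linear by blast

text \<open>Equal germs have the same set of derivatives, and \<open>frechet_derivative\<close> is a
  choice from this set; so the values agree even at points without a derivative.\<close>

lemma dir_deriv_cong_ev:
  assumes "\<forall>\<^sub>F y in nhds x. f y = g y"
  shows "dir_deriv f v x = dir_deriv g v x" "f differentiable (at x) \<longleftrightarrow> g differentiable (at x)"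
proof -
  obtain S where S: "open S" "x \<in> S" "\<And>y. y \<in> S \<Longrightarrow> f y = g y"
    using assms unfolding eventually_nhds by auto
  then have *: "(f has_derivative h) (at x) \<longleftrightarrow> (g has_derivative h) (at x)" for h
    using has_derivative_transform_within_open[of f h x UNIV S g]
      has_derivative_transform_within_open[of g h x UNIV S f] by auto
  show "dir_deriv f v x = dir_deriv g v x"
    unfolding dir_deriv_def frechet_derivative_def * ..
  show "f differentiable (at x) \<longleftrightarrow> g differentiable (at x)"
    unfolding differentiable_def * ..
qed

section \<open>Calculus of C^k functions on open sets\<close>

lemma Ck_on_Suc:
  "Ck_on (Suc k) S f \<longleftrightarrow> (\<forall>x\<in>S. f differentiable (at x)) \<and> (\<forall>v. Ck_on k S (dir_deriv f v))"
  unfolding dir_deriv_def[abs_def] by simp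

declare Ck_on.simps(2) [simp del]

lemma eventually_eq_open: "open S \<Longrightarrow> x \<in> S \<Longrightarrow> (\<And>x. x \<in> S \<Longrightarrow> P x) \<Longrightarrow> \<forall>\<^sub>F y in nhds x. P y"
  unfolding eventually_nhds by auto

lemma Ck_on_cong:
  assumes "open S" "\<And>x. x \<in> S \<Longrightarrow> f x = g x" shows "Ck_on k S f \<longleftrightarrow> Ck_on k S g"
  using assms(2)
proof (induction k arbitrary: f g)
  case 0 then show ?case by (auto cong: continuous_on_cong)
next
  case (Suc k)
  have ev: "\<forall>\<^sub>F y in nhds x. f y = g y" if "x \<in> S" for x
    using eventually_eq_open[OF assms(1) that, of "\<lambda>y. f y = g y"] Suc.prems by simp
  have "f differentiable (at x) \<longleftrightarrow> g differentiable (at x)" "dir_deriv f v x = dir_deriv g v x"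
    if "x \<in> S" for x v
    using dir_deriv_cong_ev[OF ev[OF that]] by auto
  then show ?case unfolding Ck_on_Suc using Suc.IH[of "dir_deriv f _" "dir_deriv g _"] by auto
qed

lemma Ck_on_subset: "Ck_on k S f \<Longrightarrow> T \<subseteq> S \<Longrightarrow> Ck_on k T f"
  by (induction k arbitrary: f) (auto simp: Ck_on_Suc intro: continuous_on_subset)

lemma Ck_on_SucD: "Ck_on (Suc k) S f \<Longrightarrow> Ck_on k S f"
proof (induction k arbitrary: f)
  case 0 then show ?case
    by (auto simp: Ck_on_Suc intro!: continuous_at_imp_continuous_on differentiable_imp_continuous_within)
qed (simp add: Ck_on_Suc)

lemma Ck_on_local:
  assumes "\<And>x. x \<in> S \<Longrightarrow> \<exists>T. open T \<and> x \<in> T \<and> Ck_on k T f" shows "Ck_on k S f"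
  using assms
proof (induction k arbitrary: f)
  case 0
  then show ?case
    by (metis Ck_on.simps(1) continuous_at_imp_continuous_on continuous_on_eq_continuous_at)
next
  case (Suc k)
  then show ?case unfolding Ck_on_Suc by metis
qed

lemma Ck_on_const [simp]: "Ck_on k S (\<lambda>x. c)"
proof (induction k arbitrary: c)
  case (Suc k)
  have "dir_deriv (\<lambda>x. c) v = (\<lambda>x. 0)" for v :: 'a by (rule ext, rule dir_deriv_eqI) simp
  with Suc show ?case by (simp add: Ck_on_Suc)
qed simp

lemma Ck_on_linear: assumes "bounded_linear f" shows "Ck_on k S f"
proof (cases k)
  case 0 then show ?thesis using assms by (simp add: linear_continuous_on)
next
  case (Suc j)
  have "dir_deriv f v = (\<lambda>x. f v)" for v
    by (rule ext, rule dir_deriv_eqI) (rule bounded_linear_imp_has_derivative[OF assms])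
  with Suc assms show ?thesis
    by (simp add: Ck_on_Suc bounded_linear_imp_differentiable)
qed

lemma dir_deriv_add:
  "f differentiable (at x) \<Longrightarrow> g differentiable (at x) \<Longrightarrow>
   dir_deriv (\<lambda>x. f x + g x) v x = dir_deriv f v x + dir_deriv g v x"
  by (rule dir_deriv_eqI) (intro has_derivative_add has_derivative_dir_deriv)

lemma Ck_on_add: "open S \<Longrightarrow> Ck_on k S f \<Longrightarrow> Ck_on k S g \<Longrightarrow> Ck_on k S (\<lambda>x. f x + g x)"
proof (induction k arbitrary: f g)
  case 0 then show ?case by (simp add: continuous_on_add)
next
  case (Suc k)
  have "Ck_on k S (dir_deriv (\<lambda>x. f x + g x) v) \<longleftrightarrow> Ck_on k S (\<lambda>x. dir_deriv f v x + dir_deriv g v x)" for v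
    using Suc.prems by (intro Ck_on_cong dir_deriv_add) (auto simp: Ck_on_Suc)
  with Suc show ?case by (auto simp: Ck_on_Suc)
qed

lemma Ck_on_sum:
  "finite I \<Longrightarrow> open S \<Longrightarrow> (\<And>i. i \<in> I \<Longrightarrow> Ck_on k S (f i)) \<Longrightarrow> Ck_on k S (\<lambda>x. \<Sum>i\<in>I. f i x)"
  by (induction I rule: finite_induct) (auto simp: Ck_on_add)

lemma dir_deriv_bilinear:
  assumes "bounded_bilinear pr" "f differentiable (at x)" "g differentiable (at x)"
  shows "dir_deriv (\<lambda>x. pr (f x) (g x)) v x = pr (f x) (dir_deriv g v x) + pr (dir_deriv f v x) (g x)"
  using bounded_bilinear.FDERIV[OF assms(1) has_derivative_dir_deriv[OF assms(2)] has_derivative_dir_deriv[OF assms(3)]]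
  by (rule dir_deriv_eqI)

lemma Ck_on_bilinear:
  assumes "bounded_bilinear pr" "open S"
  shows "Ck_on k S f \<Longrightarrow> Ck_on k S g \<Longrightarrow> Ck_on k S (\<lambda>x. pr (f x) (g x))"
proof (induction k arbitrary: f g)
  case 0 then show ?case using assms by (simp add: bounded_bilinear.continuous_on)
next
  case (Suc k)
  have "Ck_on k S (dir_deriv (\<lambda>x. pr (f x) (g x)) v) \<longleftrightarrow>
      Ck_on k S (\<lambda>x. pr (f x) (dir_deriv g v x) + pr (dir_deriv f v x) (g x))" for v
    using Suc.prems assms by (intro Ck_on_cong dir_deriv_bilinear) (auto simp: Ck_on_Suc)
  moreover have "Ck_on k S (\<lambda>x. pr (f x) (dir_deriv g v x) + pr (dir_deriv f v x) (g x))" for v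
    using Suc.prems Ck_on_SucD[OF Suc.prems(1)] Ck_on_SucD[OF Suc.prems(2)]
    by (intro Ck_on_add Suc.IH assms) (simp_all add: Ck_on_Suc)
  moreover have "(\<lambda>x. pr (f x) (g x)) differentiable (at x)" if "x \<in> S" for x
    using Suc.prems that assms
    by (auto simp: Ck_on_Suc intro!: differentiableI[OF bounded_bilinear.FDERIV[OF assms(1)]] has_derivative_dir_deriv)
  ultimately show ?case by (auto simp: Ck_on_Suc)
qed

text \<open>In the first form the direction in which \<open>g\<close> is differentiated varies with
  \<open>x\<close>. Expanding it in the basis leaves derivatives of \<open>g\<close> in fixed
  directions, to which the induction hypothesis of \<open>Ck_on_compose\<close> applies.\<close>

lemma dir_deriv_compose:
  fixes f :: "'a::real_normed_vector \<Rightarrow> 'b::euclidean_space"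
  assumes "f differentiable (at x)" "g differentiable (at (f x))"
  shows "dir_deriv (\<lambda>x. g (f x)) v x = dir_deriv g (dir_deriv f v x) (f x)"
    and "dir_deriv (\<lambda>x. g (f x)) v x = (\<Sum>b\<in>Basis. (dir_deriv f v x \<bullet> b) *\<^sub>R dir_deriv g b (f x))"
proof -
  show *: "dir_deriv (\<lambda>x. g (f x)) v x = dir_deriv g (dir_deriv f v x) (f x)"
    using has_derivative_compose[OF has_derivative_dir_deriv[OF assms(1)] has_derivative_dir_deriv[OF assms(2)]]
    by (rule dir_deriv_eqI)
  show "dir_deriv (\<lambda>x. g (f x)) v x = (\<Sum>b\<in>Basis. (dir_deriv f v x \<bullet> b) *\<^sub>R dir_deriv g b (f x))"
    unfolding * using linear_sum[OF linear_dir_deriv[OF assms(2)], of "\<lambda>b. (dir_deriv f v x \<bullet> b) *\<^sub>R b" Basis]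
    by (simp add: euclidean_representation linear_scale[OF linear_dir_deriv[OF assms(2)]])
qed

lemma Ck_on_compose:
  fixes f :: "'a::real_normed_vector \<Rightarrow> 'b::euclidean_space"
  assumes "open S" "open T" "f ` S \<subseteq> T"
  shows "Ck_on k S f \<Longrightarrow> Ck_on k T g \<Longrightarrow> Ck_on k S (\<lambda>x. g (f x))"
  using assms(3)
proof (induction k arbitrary: f g)
  case 0 then show ?case using continuous_on_compose2 by (metis Ck_on.simps(1))
next
  case (Suc k)
  have d: "f differentiable (at x)" "g differentiable (at (f x))" if "x \<in> S" for x
    using Suc.prems that by (auto simp: Ck_on_Suc)
  have "Ck_on k S (dir_deriv (\<lambda>x. g (f x)) v) \<longleftrightarrow>
      Ck_on k S (\<lambda>x. \<Sum>b\<in>Basis. (dir_deriv f v x \<bullet> b) *\<^sub>R dir_deriv g b (f x))" for v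
    using d assms by (intro Ck_on_cong dir_deriv_compose) auto
  moreover have "Ck_on k S (\<lambda>x. (dir_deriv f v x \<bullet> b) *\<^sub>R dir_deriv g b (f x))" for v b
    using Suc.prems assms(1) Ck_on_SucD[OF Suc.prems(1)]
    by (intro Ck_on_bilinear[OF bounded_bilinear_scaleR] Suc.IH Ck_on_bilinear[OF bounded_bilinear_inner] Ck_on_const)
      (simp_all add: Ck_on_Suc)
  moreover have "(\<lambda>x. g (f x)) differentiable (at x)" if "x \<in> S" for x
    using d[OF that] differentiable_chain_at[of f x g] by (simp add: o_def)
  ultimately show ?case using assms by (auto simp: Ck_on_Suc intro!: Ck_on_sum)
qed

section \<open>Smoothness at a point and its closure rules\<close>

lemma smooth_on_imp_at: "open S \<Longrightarrow> smooth_on S f \<Longrightarrow> x \<in> S \<Longrightarrow> smooth_at x f"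
  unfolding smooth_at_def by auto

lemma smooth_onI: "(\<And>x. x \<in> S \<Longrightarrow> smooth_at x f) \<Longrightarrow> smooth_on S f"
  unfolding smooth_on_def smooth_at_def by (meson Ck_on_local)

lemma smooth_on_iff: "open S \<Longrightarrow> smooth_on S f \<longleftrightarrow> (\<forall>x\<in>S. smooth_at x f)"
  using smooth_on_imp_at smooth_onI by metis

lemma smooth_on_subset: "smooth_on S f \<Longrightarrow> T \<subseteq> S \<Longrightarrow> smooth_on T f"
  unfolding smooth_on_def using Ck_on_subset by blast

lemma smooth_at_eventually: "smooth_at x f \<Longrightarrow> \<forall>\<^sub>F y in nhds x. smooth_at y f"
  unfolding smooth_at_def eventually_nhds by blast

lemma smooth_at_cong:
  assumes "\<forall>\<^sub>F y in nhds x. f y = g y" shows "smooth_at x f \<longleftrightarrow> smooth_at x g"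
proof -
  have "smooth_at x g" if ev: "\<forall>\<^sub>F y in nhds x. f y = g y" and sf: "smooth_at x f" for f g :: "'a \<Rightarrow> 'b"
  proof -
    obtain S where S: "open S" "x \<in> S" "\<And>y. y \<in> S \<Longrightarrow> f y = g y"
      using ev unfolding eventually_nhds by auto
    obtain T where T: "open T" "x \<in> T" "smooth_on T f" using sf unfolding smooth_at_def by auto
    have "smooth_on (S \<inter> T) g"
      using Ck_on_cong[of "S \<inter> T" f g] smooth_on_subset[OF T(3), of "S \<inter> T"] S T unfolding smooth_on_def by auto
    then show ?thesis unfolding smooth_at_def using S T by (metis IntI open_Int)
  qed
  from this[OF assms] this[of g f] show ?thesis using assms by (auto simp: eq_commute[of "g _" "f _"])
qed

lemma smooth_at_differentiable: "smooth_at x f \<Longrightarrow> f differentiable (at x)"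
  unfolding smooth_at_def smooth_on_def using Ck_on_Suc by blast

lemma smooth_at_isCont: "smooth_at x f \<Longrightarrow> isCont f x"
  using smooth_at_differentiable differentiable_imp_continuous_within by blast

lemma smooth_at_continuous_on: "(\<And>x. x \<in> S \<Longrightarrow> smooth_at x f) \<Longrightarrow> continuous_on S f"
  by (simp add: continuous_at_imp_continuous_on smooth_at_isCont)

lemma smooth_at_has_derivative: "smooth_at x f \<Longrightarrow> (f has_derivative (\<lambda>v. dir_deriv f v x)) (at x)"
  by (simp add: has_derivative_dir_deriv smooth_at_differentiable)

lemma smooth_at_has_derivative_compose:
  "smooth_at (g x) f \<Longrightarrow> (g has_derivative g') (at x within S) \<Longrightarrow>
   ((\<lambda>x. f (g x)) has_derivative (\<lambda>v. dir_deriv f (g' v) (g x))) (at x within S)"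
  using has_derivative_compose[OF _ smooth_at_has_derivative] by blast

named_theorems smooth_intros

lemma smooth_at_dir_deriv [smooth_intros]: "smooth_at x f \<Longrightarrow> smooth_at x (dir_deriv f v)"
  unfolding smooth_at_def smooth_on_def using Ck_on_Suc by blast

lemma smooth_at_linear: "bounded_linear f \<Longrightarrow> smooth_at x f"
  unfolding smooth_at_def smooth_on_def using Ck_on_linear by (metis open_UNIV UNIV_I)

lemma smooth_at_ident [smooth_intros, simp]: "smooth_at x (\<lambda>x. x)"
  by (rule smooth_at_linear) simp

lemma smooth_at_const [smooth_intros, simp]: "smooth_at x (\<lambda>x. c)"
  unfolding smooth_at_def smooth_on_def by (metis Ck_on_const open_UNIV UNIV_I)

lemma smooth_at_compose:
  fixes f :: "'a::real_normed_vector \<Rightarrow> 'b::euclidean_space"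
  assumes "smooth_at x f" "smooth_at (f x) g" shows "smooth_at x (\<lambda>x. g (f x))"
proof -
  obtain S where S: "open S" "x \<in> S" "smooth_on S f" using assms unfolding smooth_at_def by auto
  obtain T where T: "open T" "f x \<in> T" "smooth_on T g" using assms unfolding smooth_at_def by auto
  have "open (S \<inter> f -` T)"
    using S T by (metis Ck_on.simps(1) continuous_open_preimage smooth_on_def)
  then have "smooth_on (S \<inter> f -` T) (\<lambda>x. g (f x))"
    using S T Ck_on_compose[of "S \<inter> f -` T" T f _ g] Ck_on_subset[of _ S f "S \<inter> f -` T"]
    unfolding smooth_on_def by auto
  then show ?thesis using \<open>open (S \<inter> f -` T)\<close> S T unfolding smooth_at_def by blast
qed

lemma smooth_at_bilinear:
  assumes "bounded_bilinear pr" "smooth_at x f" "smooth_at x g" shows "smooth_at x (\<lambda>x. pr (f x) (g x))"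
proof -
  obtain S where S: "open S" "x \<in> S" "smooth_on S f" using assms unfolding smooth_at_def by auto
  obtain T where T: "open T" "x \<in> T" "smooth_on T g" using assms unfolding smooth_at_def by auto
  have "smooth_on (S \<inter> T) (\<lambda>x. pr (f x) (g x))" unfolding smooth_on_def
    using S T by (auto intro!: Ck_on_bilinear[OF assms(1)] intro: Ck_on_subset simp: smooth_on_def open_Int)
  then show ?thesis unfolding smooth_at_def using S T by (metis IntI open_Int)
qed

lemmas smooth_at_mult [smooth_intros] = smooth_at_bilinear[OF bounded_bilinear_mult]
lemmas smooth_at_scaleR [smooth_intros] = smooth_at_bilinear[OF bounded_bilinear_scaleR]
lemmas smooth_at_inner [smooth_intros] = smooth_at_bilinear[OF bounded_bilinear_inner]

lemma smooth_at_add [smooth_intros]: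
  assumes "smooth_at x f" "smooth_at x g" shows "smooth_at x (\<lambda>x. f x + g x)"
proof -
  obtain S where S: "open S" "x \<in> S" "smooth_on S f" using assms unfolding smooth_at_def by auto
  obtain T where T: "open T" "x \<in> T" "smooth_on T g" using assms unfolding smooth_at_def by auto
  have "smooth_on (S \<inter> T) (\<lambda>x. f x + g x)" unfolding smooth_on_def
    using S T by (auto intro!: Ck_on_add intro: Ck_on_subset simp: smooth_on_def open_Int)
  then show ?thesis unfolding smooth_at_def using S T by (metis IntI open_Int)
qed

lemma smooth_at_sum [smooth_intros]:
  "(\<And>i. i \<in> I \<Longrightarrow> smooth_at x (f i)) \<Longrightarrow> smooth_at x (\<lambda>x. \<Sum>i\<in>I. f i x)"
  by (induction I rule: infinite_finite_induct) (auto intro: smooth_intros)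

lemma smooth_at_minus [smooth_intros]: "smooth_at x f \<Longrightarrow> smooth_at x (\<lambda>x. - f x)"
  using smooth_at_scaleR[of x "\<lambda>x. -1" f] by simp

lemma smooth_at_diff [smooth_intros]:
  "smooth_at x f \<Longrightarrow> smooth_at x g \<Longrightarrow> smooth_at x (\<lambda>x. f x - g x)"
  using smooth_at_add[OF _ smooth_at_minus, of x f g] by simp

lemma smooth_at_power [smooth_intros]:
  fixes f :: "'a::real_normed_vector \<Rightarrow> real" shows "smooth_at x f \<Longrightarrow> smooth_at x (\<lambda>x. f x ^ n)"
  by (induction n) (auto intro: smooth_intros)

text \<open>Complements \<open>smooth_at_compose\<close>, which asks for a Euclidean space in the
  middle: a bounded linear outer map commutes with derivatives, so any normed space can take that
  place.\<close>

lemma smooth_at_bounded_linear_compose: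
  assumes "bounded_linear h" "smooth_at x f" shows "smooth_at x (\<lambda>x. h (f x))"
  using smooth_at_bilinear[OF bounded_bilinear_scaleR smooth_at_const, of x f 1]
proof -
  obtain S where S: "open S" "x \<in> S" "smooth_on S f" using assms unfolding smooth_at_def by auto
  have "Ck_on k S (\<lambda>x. h (f x))" if "Ck_on k S f" for k
    using that
  proof (induction k arbitrary: f)
    case 0 then show ?case using assms by (simp add: bounded_linear.continuous_on)
  next
    case (Suc k)
    have d: "((\<lambda>x. h (f x)) has_derivative (\<lambda>v. h (dir_deriv f v x))) (at x)" if "x \<in> S" for x
      using Suc.prems that
      by (auto simp: Ck_on_Suc intro!: bounded_linear.has_derivative[OF assms(1)] has_derivative_dir_deriv)
    have "Ck_on k S (dir_deriv (\<lambda>x. h (f x)) v) \<longleftrightarrow> Ck_on k S (\<lambda>x. h (dir_deriv f v x))" for v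
      using d S by (intro Ck_on_cong dir_deriv_eqI) auto
    with Suc d show ?case by (auto simp: Ck_on_Suc differentiable_def)
  qed
  then show ?thesis using S unfolding smooth_at_def smooth_on_def by blast
qed

lemmas smooth_at_component [smooth_intros] = smooth_at_bounded_linear_compose[OF bounded_linear_vec_nth]
lemmas smooth_at_fst [smooth_intros] = smooth_at_bounded_linear_compose[OF bounded_linear_fst]
lemmas smooth_at_snd [smooth_intros] = smooth_at_bounded_linear_compose[OF bounded_linear_snd]

lemma bounded_linear_Pair_left: "bounded_linear (\<lambda>x. (x, 0))"
  and bounded_linear_Pair_right: "bounded_linear (\<lambda>x. (0, x))"
  by (auto intro!: bounded_linear_Pair bounded_linear_ident bounded_linear_zero)

lemma smooth_at_Pair [smooth_intros]:
  assumes "smooth_at x f" "smooth_at x g" shows "smooth_at x (\<lambda>x. (f x, g x))"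
  using smooth_at_add[OF smooth_at_bounded_linear_compose[OF bounded_linear_Pair_left assms(1)]
      smooth_at_bounded_linear_compose[OF bounded_linear_Pair_right assms(2)]] by simp

lemma smooth_at_vec_iff:
  fixes f :: "'a::real_normed_vector \<Rightarrow> real^'n"
  shows "smooth_at x f \<longleftrightarrow> (\<forall>i. smooth_at x (\<lambda>x. f x $ i))"
proof
  assume *: "\<forall>i. smooth_at x (\<lambda>x. f x $ i)"
  have eq: "f = (\<lambda>x. \<Sum>i\<in>UNIV. (f x $ i) *\<^sub>R axis i 1)"
    by (rule ext) (simp add: vec_eq_iff axis_def if_distrib cong: if_cong)
  moreover have "smooth_at x (\<lambda>x. \<Sum>i\<in>UNIV. (f x $ i) *\<^sub>R (axis i 1 :: real^'n))"
    using * by (intro smooth_at_sum smooth_at_scaleR smooth_at_const) auto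
  ultimately show "smooth_at x f" by (subst eq)
qed (auto intro: smooth_intros)

text \<open>\<open>P\<close> describes a class of functions closed under directional derivatives, up
  to equality on \<open>S\<close>. This fits functions given by integrals, whose derivatives are
  integrals of the same kind.\<close>

lemma smooth_on_coinduct:
  assumes "open S" "P f"
    and "\<And>f x. P f \<Longrightarrow> x \<in> S \<Longrightarrow> f differentiable (at x)"
    and "\<And>f v. P f \<Longrightarrow> \<exists>g. P g \<and> (\<forall>x\<in>S. dir_deriv f v x = g x)"
  shows "smooth_on S f"
proof -
  have "Ck_on k S f" if "P f" for k f
    using that
  proof (induction k arbitrary: f)
    case 0 then show ?case
      by (auto intro!: continuous_at_imp_continuous_on differentiable_imp_continuous_within assms(3))
  next
    case (Suc k)
    have "Ck_on k S (dir_deriv f v)" for v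
      using assms(4)[OF Suc.prems, of v] Suc.IH Ck_on_cong[OF assms(1)] by metis
    then show ?case using assms(3) Suc.prems by (auto simp: Ck_on_Suc)
  qed
  then show ?thesis using assms(2) unfolding smooth_on_def by auto
qed

section \<open>Elementary real functions\<close>

lemma Ck_on_real:
  fixes g :: "real \<Rightarrow> real"
  assumes "open T" "\<And>x. x \<in> T \<Longrightarrow> (g has_real_derivative g' x) (at x)" "Ck_on k T g'"
  shows "Ck_on (Suc k) T g"
proof -
  have "dir_deriv g v x = g' x * v" if "x \<in> T" for x v
    by (rule dir_deriv_eqI[OF assms(2)[OF that, unfolded has_field_derivative_def]])
  then have "Ck_on k T (dir_deriv g v)" for v
    using Ck_on_cong[OF assms(1), of "dir_deriv g v" "\<lambda>x. g' x * v"]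
      Ck_on_bilinear[OF bounded_bilinear_mult assms(1,3), of "\<lambda>x. v"] by auto
  then show ?thesis using assms(2) by (auto simp: Ck_on_Suc real_differentiable_def intro!: differentiableI[OF assms(2)[unfolded has_field_derivative_def]])
qed

text \<open>Bootstrapping on a differential equation: the derivative is a smooth expression in the
  function itself, so each order of differentiability yields the next. The same pattern serves for
  \<open>sqrt\<close> and for the pair \<open>sin\<close>, \<open>cos\<close>.\<close>

lemma Ck_on_inverse: "Ck_on k (- {0}) (inverse :: real \<Rightarrow> real)"
proof (induction k)
  case 0 show ?case by (simp add: continuous_on_inverse)
next
  case (Suc k)
  have o: "open (- {0::real})" by (simp add: open_Compl)
  have "Ck_on k (- {0}) (\<lambda>x::real. -1 * (inverse x * inverse x))"
    by (intro Ck_on_bilinear[OF bounded_bilinear_mult o] Suc Ck_on_const)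
  moreover have "(inverse has_real_derivative -1 * (inverse x * inverse x)) (at x)"
    if "x \<in> - {0}" for x :: real
    using DERIV_inverse[of x UNIV] that by simp
  ultimately show ?case by (intro Ck_on_real[OF o])
qed

lemma smooth_at_inverse [smooth_intros]:
  fixes f :: "'a::real_normed_vector \<Rightarrow> real"
  shows "smooth_at x f \<Longrightarrow> f x \<noteq> 0 \<Longrightarrow> smooth_at x (\<lambda>x. inverse (f x))"
  using Ck_on_inverse
  by (intro smooth_at_compose[of x f inverse]) (auto simp: smooth_at_def[of _ inverse] smooth_on_def open_Compl)

lemma smooth_at_divide [smooth_intros]:
  fixes f :: "'a::real_normed_vector \<Rightarrow> real"
  shows "smooth_at x f \<Longrightarrow> smooth_at x g \<Longrightarrow> g x \<noteq> 0 \<Longrightarrow> smooth_at x (\<lambda>x. f x / g x)"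
  unfolding divide_inverse by (intro smooth_intros)

lemma Ck_on_sqrt: "Ck_on k {0<..} sqrt"
proof (induction k)
  case 0 show ?case by (simp add: continuous_on_real_sqrt)
next
  case (Suc k)
  have "Ck_on k {0<..} (\<lambda>x. inverse (sqrt x))"
    by (rule Ck_on_compose[OF _ _ _ Suc Ck_on_inverse]) (auto simp: open_Compl)
  then have "Ck_on k {0<..} (\<lambda>x. inverse (sqrt x) * (1/2))"
    by (intro Ck_on_bilinear[OF bounded_bilinear_mult]) auto
  moreover have "(sqrt has_real_derivative inverse (sqrt x) * (1/2)) (at x)" if "x \<in> {0<..}" for x :: real
    using DERIV_real_sqrt[of x] that by simp
  ultimately show ?case by (intro Ck_on_real[OF open_greaterThan])
qed

lemma smooth_at_sqrt [smooth_intros]: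
  "smooth_at x f \<Longrightarrow> f x > 0 \<Longrightarrow> smooth_at x (\<lambda>x. sqrt (f x))"
  using Ck_on_sqrt smooth_on_imp_at[OF open_greaterThan, of 0 sqrt]
  by (intro smooth_at_compose[of x f sqrt]) (auto simp: smooth_on_def)

lemma Ck_on_sin_cos: "Ck_on k UNIV (sin :: real \<Rightarrow> real) \<and> Ck_on k UNIV (cos :: real \<Rightarrow> real)"
proof (induction k)
  case 0 show ?case by (simp add: continuous_on_sin continuous_on_cos)
next
  case (Suc k)
  have "Ck_on k UNIV (\<lambda>x::real. -1 * sin x)"
    using Suc by (intro Ck_on_bilinear[OF bounded_bilinear_mult] Ck_on_const) auto
  then have "Ck_on k UNIV (\<lambda>x::real. - sin x)" by simp
  with Suc show ?case
    by (intro conjI Ck_on_real[where g'=cos] Ck_on_real[where g'="\<lambda>x. - sin x"] open_UNIV DERIV_sin DERIV_cos) auto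
qed

lemma smooth_at_sin [smooth_intros]: "smooth_at x f \<Longrightarrow> smooth_at x (\<lambda>x. sin (f x :: real))"
  and smooth_at_cos [smooth_intros]: "smooth_at x f \<Longrightarrow> smooth_at x (\<lambda>x. cos (f x :: real))"
proof -
  have "smooth_at y sin" "smooth_at y cos" for y :: real
    using Ck_on_sin_cos by (auto simp: smooth_at_def smooth_on_def)
  then show "smooth_at x f \<Longrightarrow> smooth_at x (\<lambda>x. sin (f x))" "smooth_at x f \<Longrightarrow> smooth_at x (\<lambda>x. cos (f x))"
    using smooth_at_compose[of x f sin] smooth_at_compose[of x f cos] by auto
qed

abbreviation smooth :: "('a::real_normed_vector \<Rightarrow> 'b::real_normed_vector) \<Rightarrow> bool" where
  "smooth f \<equiv> \<forall>x. smooth_at x f"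

lemma smooth_at_compose_smooth:
  fixes f :: "'a::real_normed_vector \<Rightarrow> 'b::euclidean_space"
  shows "smooth g \<Longrightarrow> smooth_at x f \<Longrightarrow> smooth_at x (\<lambda>x. g (f x))"
  using smooth_at_compose[of x f g] by auto

lemma smooth_on_UNIV_iff: "smooth_on UNIV f \<longleftrightarrow> smooth f"
  by (simp add: smooth_on_iff)

subsection \<open>Integrals depending on a parameter\<close>

lemma has_derivative_integral_parameter:
  fixes F :: "'a::euclidean_space \<times> real \<Rightarrow> real"
  assumes "smooth F"
  shows "((\<lambda>x. integral {a..b} (\<lambda>t. F (x, t))) has_derivative
    (\<lambda>v. integral {a..b} (\<lambda>t. dir_deriv F (v, 0) (x, t)))) (at x)"
proof -
  \<comment> \<open>\<open>leibniz_rule\<close> wants the derivative as a continuous map into the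
    bounded linear maps. In finite dimension this continuity can be tested on single
    vectors.\<close>
  let ?D = "\<lambda>x t. Blinfun (\<lambda>v. dir_deriv F (v, 0) (x, t))"
  have d: "((\<lambda>x. F (x, t)) has_derivative (\<lambda>v. dir_deriv F (v, 0) (x, t))) (at x)" for x t
    using assms by (intro smooth_at_has_derivative_compose has_derivative_Pair has_derivative_ident
        has_derivative_const) auto
  have D: "blinfun_apply (?D x t) = (\<lambda>v. dir_deriv F (v, 0) (x, t))" for x t
    by (rule bounded_linear_Blinfun_apply[OF has_derivative_bounded_linear[OF d]])
  have D': "blinfun_apply (Blinfun (\<lambda>v. dir_deriv F (v, 0) z)) = (\<lambda>v. dir_deriv F (v, 0) z)" for z
    using D[of "fst z" "snd z"] by simp
  have c: "continuous_on S (\<lambda>z. dir_deriv F (v, 0) z)" for S v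
    using assms by (intro smooth_at_continuous_on smooth_intros) auto
  have cD: "continuous_on (UNIV \<times> cbox a b) (\<lambda>(x, t). ?D x t)"
    by (rule continuous_on_blinfun_componentwise) (simp add: D' split_beta c)
  have cF: "continuous_on S (\<lambda>t. F (x, t))" for S x
    using assms by (intro smooth_at_continuous_on smooth_at_compose_smooth[OF assms] smooth_intros)
  have "((\<lambda>x. integral (cbox a b) (\<lambda>t. F (x, t))) has_derivative integral (cbox a b) (?D x)) (at x)"
    by (rule leibniz_rule[OF _ _ cD])
      (auto simp: D intro!: d integrable_continuous_interval cF)
  moreover have "integral (cbox a b) (?D x) v = integral {a..b} (\<lambda>t. dir_deriv F (v, 0) (x, t))" for v
  proof -
    have "continuous_on (cbox a b) (?D x)"
      using continuous_on_compose2[OF cD, of "cbox a b" "\<lambda>t. (x, t)"]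
      by (simp add: image_subset_iff continuous_on_Pair)
    then have "integral (cbox a b) ((\<lambda>L. blinfun_apply L v) \<circ> ?D x) = integral (cbox a b) (?D x) v"
      by (intro integral_linear integrable_continuous bounded_linear_intros)
    then show ?thesis by (simp add: o_def D)
  qed
  then have "blinfun_apply (integral (cbox a b) (?D x)) = (\<lambda>v. integral {a..b} (\<lambda>t. dir_deriv F (v, 0) (x, t)))"
    by (rule ext)
  ultimately show ?thesis by (simp only: cbox_interval)
qed

lemma smooth_integral_parameter:
  fixes F :: "'a::euclidean_space \<times> real \<Rightarrow> real"
  assumes "smooth F"
  shows "smooth (\<lambda>x. integral {a..b} (\<lambda>t. F (x, t)))"
proof -
  have "smooth_on UNIV (\<lambda>x. integral {a..b} (\<lambda>t. F (x, t)))"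
  proof (rule smooth_on_coinduct[where P="\<lambda>f. \<exists>F. smooth F \<and> f = (\<lambda>x. integral {a..b} (\<lambda>t. F (x, t)))"])
    show "f differentiable (at x)"
      if "\<exists>F. smooth F \<and> f = (\<lambda>x. integral {a..b} (\<lambda>t. F (x, t)))" for f :: "'a \<Rightarrow> real" and x
      using that has_derivative_integral_parameter differentiableI by blast
    show "\<exists>g. (\<exists>F. smooth F \<and> g = (\<lambda>x. integral {a..b} (\<lambda>t. F (x, t)))) \<and> (\<forall>x\<in>UNIV. dir_deriv f v x = g x)"
      if f: "\<exists>F. smooth F \<and> f = (\<lambda>x. integral {a..b} (\<lambda>t. F (x, t)))" for f :: "'a \<Rightarrow> real" and v
    proof -
      obtain F where "smooth F" "f = (\<lambda>x. integral {a..b} (\<lambda>t. F (x, t)))" using f by auto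
      then show ?thesis
        by (intro exI[of _ "\<lambda>x. integral {a..b} (\<lambda>t. dir_deriv F (v, 0) (x, t))"] conjI exI[of _ "dir_deriv F (v, 0)"])
          (auto intro!: smooth_intros dir_deriv_eqI[OF has_derivative_integral_parameter])
    qed
  qed (use assms in auto)
  then show ?thesis by (simp add: smooth_on_UNIV_iff)
qed

lemma integral_dir_deriv_segment:
  fixes f :: "'a::real_normed_vector \<Rightarrow> real"
  assumes "smooth f" "0 \<le> s"
  shows "((\<lambda>t. dir_deriv f v (x + t *\<^sub>R v)) has_integral f (x + s *\<^sub>R v) - f x) {0..s}"
proof -
  have "((\<lambda>t. f (x + t *\<^sub>R v)) has_vector_derivative dir_deriv f v (x + t *\<^sub>R v)) (at t within {0..s})" for t
  proof -
    have "((\<lambda>t. f (x + t *\<^sub>R v)) has_derivative (\<lambda>h. dir_deriv f (h *\<^sub>R v) (x + t *\<^sub>R v))) (at t within {0..s})"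
      by (rule smooth_at_has_derivative_compose) (use assms in \<open>auto intro!: derivative_eq_intros\<close>)
    moreover have "dir_deriv f (h *\<^sub>R v) y = h *\<^sub>R dir_deriv f v y" for h y
      using linear_scale[OF linear_dir_deriv[OF smooth_at_differentiable]] assms(1) by blast
    ultimately show ?thesis by (simp add: has_vector_derivative_def)
  qed
  from fundamental_theorem_of_calculus[OF assms(2) this] show ?thesis by simp
qed

text \<open>Write d_v for the derivative in direction v. Integrating d_v f along a segment of
  direction v and differentiating the result by w under the integral shows that d_w f(x + s v) - d_w
  f(x) is the integral of d_w d_v f over the segment. The derivative of this in s at 0 is the
  claim.\<close>

lemma dir_deriv_commute_smooth:
  fixes f :: "'a::euclidean_space \<Rightarrow> real"
  assumes "smooth f"
  shows "dir_deriv (dir_deriv f v) w x = dir_deriv (dir_deriv f w) v x"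
proof -
  let ?g = "\<lambda>s. dir_deriv f w (x + s *\<^sub>R v)"
  have lin: "dir_deriv g (h *\<^sub>R v) y = h *\<^sub>R dir_deriv g v y" if "smooth g" for h y and g :: "'a \<Rightarrow> real" and v
    using linear_scale[OF linear_dir_deriv[OF smooth_at_differentiable]] that by blast
  have sv: "smooth (dir_deriv f v)" and sw: "smooth (dir_deriv f w)"
    using assms by (auto intro: smooth_intros)
  have eq: "?g s = ?g 0 + integral {0..s} (\<lambda>t. dir_deriv (dir_deriv f v) w (x + t *\<^sub>R v))" if "0 \<le> s" for s
  proof -
    let ?F = "\<lambda>(y, t). dir_deriv f v (y + t *\<^sub>R v)"
    have sF: "smooth ?F"
      unfolding split_beta by (intro allI smooth_at_compose_smooth[OF sv] smooth_intros)
    have "dir_deriv (\<lambda>y. f (y + s *\<^sub>R v) - f y) w x = integral {0..s} (\<lambda>t. dir_deriv ?F (w, 0) (x, t))"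
      using has_derivative_integral_parameter[OF sF, of 0 s x]
        integral_unique[OF integral_dir_deriv_segment[OF assms that]]
      by (intro dir_deriv_eqI) simp
    moreover have "dir_deriv (\<lambda>y. f (y + s *\<^sub>R v) - f y) w x = ?g s - ?g 0"
    proof (rule dir_deriv_eqI[THEN trans])
      show "((\<lambda>y. f (y + s *\<^sub>R v) - f y) has_derivative
          (\<lambda>h. dir_deriv f h (x + s *\<^sub>R v) - dir_deriv f h x)) (at x)"
        using assms by (intro has_derivative_diff smooth_at_has_derivative_compose smooth_at_has_derivative)
          (auto intro!: derivative_eq_intros)
    qed simp
    moreover have "dir_deriv ?F (w, 0) (x, t) = dir_deriv (dir_deriv f v) w (x + t *\<^sub>R v)" for t
    proof (rule dir_deriv_eqI[THEN trans])
      show "(?F has_derivative (\<lambda>h. dir_deriv (dir_deriv f v) (fst h + snd h *\<^sub>R v) (x + t *\<^sub>R v))) (at (x, t))"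
        unfolding split_beta
        using smooth_at_has_derivative_compose[of "\<lambda>p. fst p + snd p *\<^sub>R v" "(x, t)" "dir_deriv f v",
            OF _ bounded_linear_imp_has_derivative[of "\<lambda>p. fst p + snd p *\<^sub>R v"]] sv
        by (simp add: bounded_linear_add bounded_linear_fst
            bounded_linear_compose[OF bounded_linear_scaleR_left bounded_linear_snd])
    qed simp
    ultimately show ?thesis by simp
  qed
  have c: "continuous_on S (\<lambda>t. dir_deriv (dir_deriv f v) w (x + t *\<^sub>R v))" for S
  proof -
    have "smooth (dir_deriv (dir_deriv f v) w)" using sv by (auto intro: smooth_intros)
    then show ?thesis
      by (intro smooth_at_continuous_on smooth_at_compose_smooth[of "dir_deriv (dir_deriv f v) w"]
          smooth_at_add smooth_at_scaleR smooth_at_ident smooth_at_const)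
  qed
  \<comment> \<open>The integral formula is available for s >= 0, so the derivatives at 0 are taken
    within [0, 1], where they are still unique.\<close>
  have "((\<lambda>s. ?g 0 + integral {0..s} (\<lambda>t. dir_deriv (dir_deriv f v) w (x + t *\<^sub>R v))) has_vector_derivative
      dir_deriv (dir_deriv f v) w (x + 0 *\<^sub>R v)) (at 0 within {0..1})"
    using has_vector_derivative_add[OF has_vector_derivative_const integral_has_vector_derivative[OF c, of 0 0 1]]
    by simp
  then have "(?g has_vector_derivative dir_deriv (dir_deriv f v) w (x + 0 *\<^sub>R v)) (at 0 within {0..1})"
    by (rule has_vector_derivative_transform[rotated 2]) (use eq in auto)
  moreover have "(?g has_vector_derivative dir_deriv (dir_deriv f w) v x) (at 0 within {0..1})"
  proof -
    have "((\<lambda>s. x + s *\<^sub>R v) has_derivative (\<lambda>h. h *\<^sub>R v)) (at 0 within {0..1})"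
      by (auto intro!: derivative_eq_intros)
    from smooth_at_has_derivative_compose[OF _ this, of "dir_deriv f w"] show ?thesis
      unfolding has_vector_derivative_def using sw by (simp add: lin)
  qed
  ultimately show ?thesis
    using vector_derivative_unique_within[of 0 "{0..1::real}"] by (simp add: trivial_limit_within islimpt_Icc)
qed

subsection \<open>Bump functions\<close>

text \<open>The extra factor \<open>inverse t ^ n\<close> makes the family closed under
  differentiation up to linear combinations, so smoothness can be proved for all \<open>n\<close>
  simultaneously.\<close>

definition flat_fun :: "nat \<Rightarrow> real \<Rightarrow> real" where
  "flat_fun n t = (if t > 0 then exp (- inverse t) * inverse t ^ n else 0)"

text \<open>A single term of the exponential series bounds exp(1/t) from below by (1/t)^(n+2) /
  (n+2)!. The two extra powers leave the order t^2, which makes the difference quotient at 0 tend to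
  0.\<close>

lemma flat_fun_bound: "\<bar>flat_fun n t\<bar> \<le> fact (n + 2) * t\<^sup>2"
proof (cases "t > 0")
  case True
  let ?u = "inverse t"
  have "?u ^ (n + 2) /\<^sub>R fact (n + 2) \<le> exp ?u"
    using sum_le_suminf[OF summable_exp_generic[of ?u], of "{n + 2}"] True by (simp add: exp_def)
  then have "inverse (fact (n + 2)) * ?u ^ (n + 2) \<le> exp ?u" by (simp only: real_scaleR_def)
  moreover have gen: "inverse f * a \<le> e \<Longrightarrow> f > 0 \<Longrightarrow> a \<le> f * e" for f a e :: real
    by (simp add: field_simps)
  ultimately have "?u ^ (n + 2) \<le> fact (n + 2) * exp ?u"
    by (metis fact_gt_zero)
  then have "exp (- ?u) * ?u ^ (n + 2) \<le> exp (- ?u) * (fact (n + 2) * exp ?u)"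
    by (intro mult_left_mono) auto
  also have "\<dots> = fact (n + 2) * (exp (- ?u) * exp ?u)" by (simp only: ac_simps)
  also have "\<dots> = fact (n + 2)" by (simp flip: exp_add)
  finally have "exp (- ?u) * ?u ^ (n + 2) \<le> fact (n + 2)" .
  then have "(exp (- ?u) * ?u ^ (n + 2)) * t^2 \<le> fact (n + 2) * t^2"
    by (rule mult_right_mono) simp
  moreover have B: "?u ^ (n + 2) * t^2 = ?u ^ n"
    using True by (simp add: power_add power2_eq_square divide_inverse[symmetric] inverse_eq_divide)
  ultimately have "exp (- ?u) * ?u ^ n \<le> fact (n + 2) * t\<^sup>2" by (simp only: mult.assoc B)
  then show ?thesis using True by (simp add: flat_fun_def)
qed (simp add: flat_fun_def)

lemma has_derivative_flat_fun:
  "(flat_fun n has_real_derivative flat_fun (n + 2) t - n * flat_fun (n + 1) t) (at t)"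
proof -
  consider "t > 0" | "t < 0" | "t = 0" by linarith
  then show ?thesis
  proof cases
    case 1
    have "((\<lambda>t. exp (- inverse t) * inverse t ^ n) has_real_derivative flat_fun (n + 2) t - n * flat_fun (n + 1) t) (at t)"
    proof (cases n)
      case 0
      then show ?thesis
        using 1 by (auto intro!: derivative_eq_intros simp: flat_fun_def field_simps power2_eq_square)
    next
      case (Suc m)
      have "((\<lambda>t. exp (- inverse t) * inverse t ^ Suc m) has_real_derivative
          exp (- inverse t) * (inverse t ^ 2) * inverse t ^ Suc m +
          exp (- inverse t) * (real (Suc m) * inverse t ^ m * - (inverse t ^ 2))) (at t)"
      proof (rule DERIV_cong[OF DERIV_mult])
        have i: "(inverse has_real_derivative - (inverse t ^ 2)) (at t)"
          using DERIV_inverse[of t UNIV] 1 by (simp add: numeral_2_eq_2)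
        show "((\<lambda>t. inverse t ^ Suc m) has_real_derivative (1 + real m) * (- (inverse t ^ 2) * inverse t ^ m)) (at t)"
          by (rule DERIV_power_Suc[OF i])
        show "((\<lambda>t. exp (- inverse t)) has_real_derivative exp (- inverse t) * inverse t ^ 2) (at t)"
          using DERIV_fun_exp[OF DERIV_minus[OF i]] by simp
      qed (simp add: algebra_simps)
      then show ?thesis
        using 1 Suc by (simp add: flat_fun_def power2_eq_square algebra_simps)
    qed
    then show ?thesis
      by (rule has_field_derivative_transform_within_open[where S="{0<..}"]) (use 1 in \<open>auto simp: flat_fun_def\<close>)
  next
    case 2
    have "((\<lambda>t::real. 0::real) has_real_derivative flat_fun (n + 2) t - n * flat_fun (n + 1) t) (at t)"
      using 2 by (simp add: flat_fun_def)
    then show ?thesis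
      by (rule has_field_derivative_transform_within_open[where S="{..<0}"]) (use 2 in \<open>auto simp: flat_fun_def\<close>)
  next
    case 3
    have "((\<lambda>h. flat_fun n h / h) \<longlongrightarrow> 0) (at 0)"
    proof (rule Lim_null_comparison)
      show "\<forall>\<^sub>F h in at 0. norm (flat_fun n h / h) \<le> fact (n + 2) * \<bar>h\<bar>"
        using flat_fun_bound[of n]
        by (auto simp: eventually_at_filter power2_eq_square abs_mult divide_simps intro!: always_eventually
            simp del: fact_Suc) (metis abs_mult_self_eq mult.assoc)
      show "((\<lambda>h::real. fact (n + 2) * \<bar>h\<bar>) \<longlongrightarrow> 0) (at 0)"
        by (auto intro!: tendsto_eq_intros)
    qed
    then show ?thesis using 3 by (simp add: DERIV_def flat_fun_def)
  qed
qed

lemma smooth_flat_fun: "smooth (flat_fun n)"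
proof -
  have "Ck_on k UNIV (flat_fun n)" for k
  proof (induction k arbitrary: n)
    case 0 show ?case
      using DERIV_isCont[OF has_derivative_flat_fun] by (auto simp: continuous_on_eq_continuous_at)
  next
    case (Suc k)
    have "Ck_on k UNIV (\<lambda>t. flat_fun (n + 2) t + (- n) * flat_fun (n + 1) t)"
      by (intro Ck_on_add Ck_on_bilinear[OF bounded_bilinear_mult] Suc Ck_on_const open_UNIV)
    then show ?case
      by (intro Ck_on_real[where g'="\<lambda>t. flat_fun (n + 2) t - n * flat_fun (n + 1) t"] has_derivative_flat_fun) auto
  qed
  then show ?thesis by (simp flip: smooth_on_UNIV_iff add: smooth_on_def)
qed

lemma exists_bump:
  fixes x0 :: "'a::euclidean_space"
  assumes "r > 0"
  obtains \<eta> :: "'a \<Rightarrow> real" where "smooth \<eta>" "\<And>x. dist x0 x \<le> r \<Longrightarrow> \<eta> x = 1"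
    "\<And>x. dist x0 x \<ge> 2 * r \<Longrightarrow> \<eta> x = 0" "\<And>x. 0 \<le> \<eta> x" "\<And>x. \<eta> x \<le> 1"
proof -
  let ?n = "\<lambda>x. (x - x0) \<bullet> (x - x0)"
  \<comment> \<open>The squared distance is smooth also at \<open>x0\<close>. The open ball of
    radius 2 r, where \<open>?a\<close> is positive, and the exterior of the closed ball of radius
    r, where \<open>?b\<close> is positive, cover the space; hence the denominator of \<eta> has no
    zero.\<close>
  let ?a = "\<lambda>x. flat_fun 0 (4 * r^2 - ?n x)" and ?b = "\<lambda>x. flat_fun 0 (?n x - r^2)"
  define \<eta> where "\<eta> x = ?a x / (?a x + ?b x)" for x
  have pos: "flat_fun 0 t \<ge> 0" "flat_fun 0 t > 0 \<longleftrightarrow> t > 0" "t \<le> 0 \<Longrightarrow> flat_fun 0 t = 0" for t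
    by (auto simp: flat_fun_def)
  have ab: "?a x + ?b x > 0" for x
  proof -
    have "4 * r^2 - ?n x > 0 \<or> ?n x - r^2 > 0" using assms by (smt (verit) zero_less_power)
    then show ?thesis using pos by (meson add_nonneg_pos add_pos_nonneg)
  qed
  have d: "?n x = (dist x0 x)^2" for x
    by (simp add: dist_norm power2_norm_eq_inner norm_minus_commute[of x0])
  have "smooth \<eta>"
    unfolding \<eta>_def using ab
    by (auto intro!: smooth_intros smooth_at_compose_smooth[OF smooth_flat_fun] simp: less_imp_neq[symmetric])
  moreover have "\<eta> x = 1" if "dist x0 x \<le> r" for x
    using ab[of x] pos(3)[of "?n x - r^2"] power_mono[OF that] by (simp add: \<eta>_def d)
  moreover have "\<eta> x = 0" if "dist x0 x \<ge> 2 * r" for x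
    using pos(3)[of "4 * r^2 - ?n x"] power_mono[OF that, of 2] assms by (simp add: \<eta>_def d power_mult_distrib)
  moreover have "0 \<le> \<eta> x" "\<eta> x \<le> 1" for x
    using ab[of x] pos(1) by (auto simp: \<eta>_def)
  ultimately show thesis using that by blast
qed

lemma isCont_tendsto_nhds: "isCont f x \<Longrightarrow> (f \<longlongrightarrow> f x) (nhds x)"
  unfolding isCont_def tendsto_at_iff_tendsto_nhds .

text \<open>The bump function interpolates between \<open>f\<close> and the constant
  \<open>f x0\<close>, not 0, so all values stay within \<open>e\<close> of \<open>f x0\<close>. A
  positive germ thereby extends to a positive function on the whole space, as averaging over full
  circles requires.\<close>

lemma smooth_at_extend:
  fixes f :: "'a::euclidean_space \<Rightarrow> real"
  assumes "smooth_at x0 f" "e > 0"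
  obtains g R where "smooth g" "\<forall>\<^sub>F x in nhds x0. g x = f x" "\<And>x. dist x0 x \<ge> R \<Longrightarrow> g x = f x0"
    "\<And>x. \<bar>g x - f x0\<bar> < e"
proof -
  have "\<forall>\<^sub>F x in nhds x0. smooth_at x f \<and> dist (f x) (f x0) < e"
    using smooth_at_eventually[OF assms(1)] tendstoD[OF isCont_tendsto_nhds[OF smooth_at_isCont[OF assms(1)]] assms(2)]
    by (rule eventually_conj)
  then obtain d where d: "d > 0" "\<And>x. dist x x0 < d \<Longrightarrow> smooth_at x f \<and> dist (f x) (f x0) < e"
    unfolding eventually_nhds_metric by auto
  obtain \<eta> :: "'a \<Rightarrow> real" where \<eta>: "smooth \<eta>" "\<And>x. dist x0 x \<le> d/4 \<Longrightarrow> \<eta> x = 1"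
    "\<And>x. dist x0 x \<ge> 2 * (d/4) \<Longrightarrow> \<eta> x = 0" "\<And>x. 0 \<le> \<eta> x" "\<And>x. \<eta> x \<le> 1"
    using exists_bump[of "d/4" x0] d by auto
  define g where "g x = f x0 + \<eta> x * (f x - f x0)" for x
  show thesis
  proof
    show "smooth g"
    proof
      fix x
      show "smooth_at x g"
      proof (cases "dist x x0 < d")
        case True
        then show ?thesis unfolding g_def[abs_def] using d \<eta>(1) by (intro smooth_intros) auto
      next
        case False
        have "\<forall>\<^sub>F y in nhds x. g y = f x0"
        proof (rule eventually_eq_open[of "- cball x0 (d/2)"])
          show "x \<in> - cball x0 (d/2)" using False d(1) by (auto simp: dist_commute)
        qed (auto simp: g_def \<eta>)
        from smooth_at_cong[OF this] show ?thesis by simp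
      qed
    qed
    show "\<forall>\<^sub>F x in nhds x0. g x = f x"
      by (rule eventually_eq_open[of "ball x0 (d/4)"]) (use d in \<open>auto simp: g_def \<eta>\<close>)
    show "g x = f x0" if "dist x0 x \<ge> d" for x using that d by (simp add: g_def \<eta>)
    show "\<bar>g x - f x0\<bar> < e" for x
    proof (cases "dist x x0 < d")
      case True
      then have "\<bar>f x - f x0\<bar> < e" using d by (auto simp: dist_real_def)
      moreover have "\<bar>\<eta> x\<bar> \<le> 1" using \<eta>(4,5)[of x] by auto
      ultimately show ?thesis
        using mult_mono[of "\<bar>\<eta> x\<bar>" 1 "\<bar>f x - f x0\<bar>" "\<bar>f x - f x0\<bar>"] by (simp add: g_def abs_mult)
    next
      case False then show ?thesis using \<eta>(3)[of x] d(1) assms(2) by (simp add: g_def dist_commute)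
    qed
  qed
qed

lemma dir_deriv_commute:
  fixes f :: "'a::euclidean_space \<Rightarrow> real"
  assumes "smooth_at x f"
  shows "dir_deriv (dir_deriv f v) w x = dir_deriv (dir_deriv f w) v x"
proof -
  obtain g R where g: "smooth g" "\<forall>\<^sub>F x in nhds x. g x = f x"
    using smooth_at_extend[OF assms zero_less_one] by metis
  have "\<forall>\<^sub>F y in nhds x. dir_deriv g u y = dir_deriv f u y" for u
    using eventually_eventually[of "\<lambda>y. g y = f y" x] g(2)
    by (auto elim!: eventually_mono intro: dir_deriv_cong_ev)
  then have "dir_deriv (dir_deriv g u) u' x = dir_deriv (dir_deriv f u) u' x" for u u'
    by (rule dir_deriv_cong_ev(1))
  then show ?thesis using dir_deriv_commute_smooth[OF g(1), of v w x] by simp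
qed

subsection \<open>The inverse function theorem\<close>

definition jac_matrix :: "(real^'n \<Rightarrow> real^'m) \<Rightarrow> real^'n \<Rightarrow> real^'n^'m" where
  "jac_matrix f x = matrix (\<lambda>v. dir_deriv f v x)"

lemma dir_deriv_jac_matrix: "f differentiable (at x) \<Longrightarrow> dir_deriv f v x = jac_matrix f x *v v"
  unfolding jac_matrix_def by (simp add: linear_dir_deriv matrix_works)

lemma smooth_at_prod [smooth_intros]:
  fixes f :: "'i \<Rightarrow> 'a::real_normed_vector \<Rightarrow> real"
  shows "(\<And>i. i \<in> I \<Longrightarrow> smooth_at x (f i)) \<Longrightarrow> smooth_at x (\<lambda>x. \<Prod>i\<in>I. f i x)"
  by (induction I rule: infinite_finite_induct) (auto intro: smooth_intros)

lemma smooth_at_jac_matrix: "smooth_at x f \<Longrightarrow> smooth_at x (\<lambda>x. jac_matrix f x $ i $ j)"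
  unfolding jac_matrix_def matrix_def by (simp add: smooth_at_component smooth_at_dir_deriv)

lemma smooth_at_det:
  "(\<And>i j. smooth_at x (\<lambda>x. A x $ i $ j)) \<Longrightarrow> smooth_at x (\<lambda>x. det (A x) :: real)"
  unfolding det_def by (intro smooth_at_sum smooth_at_mult smooth_at_const smooth_at_prod)

text \<open>The inverse function theorem supplies a continuous inverse \<open>g\<close> with a
  derivative at every point. This derivative is a smooth function of \<open>g y\<close>, so if
  \<open>g\<close> is C^k then it is C^(k+1).\<close>

lemma smooth_inverse_function:
  fixes f :: "real^'n \<Rightarrow> real^'n"
  assumes "smooth_at x f" "det (jac_matrix f x) \<noteq> 0"
  obtains U V g where "open U" "x \<in> U" "open V" "homeomorphism U V f g"
    "\<And>y. y \<in> U \<Longrightarrow> smooth_at y f" "\<And>y. y \<in> V \<Longrightarrow> smooth_at y g" "\<And>y. y \<in> U \<Longrightarrow> det (jac_matrix f y) \<noteq> 0"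
proof -
  have sdet: "smooth_at y (\<lambda>y. det (jac_matrix f y))" if "smooth_at y f" for y
    using that by (intro smooth_at_det smooth_at_jac_matrix)
  have "\<forall>\<^sub>F y in nhds x. smooth_at y f \<and> det (jac_matrix f y) \<noteq> 0"
    using smooth_at_eventually[OF assms(1)]
      tendsto_imp_eventually_ne[OF isCont_tendsto_nhds[OF smooth_at_isCont[OF sdet[OF assms(1)]]] assms(2)]
    by (rule eventually_conj)
  then obtain S where S: "open S" "x \<in> S" and Sf: "\<And>y. y \<in> S \<Longrightarrow> smooth_at y f"
    and Sd: "\<And>y. y \<in> S \<Longrightarrow> det (jac_matrix f y) \<noteq> 0"
    unfolding eventually_nhds by auto
  let ?D = "\<lambda>y. Blinfun (\<lambda>v. dir_deriv f v y)"
  have D: "blinfun_apply (?D y) = (\<lambda>v. dir_deriv f v y)" if "y \<in> S" for y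
    by (rule bounded_linear_Blinfun_apply[OF has_derivative_bounded_linear[OF smooth_at_has_derivative[OF Sf[OF that]]]])
  have J: "dir_deriv f v y = jac_matrix f y *v v" if "y \<in> S" for y v
    using dir_deriv_jac_matrix smooth_at_differentiable Sf that by blast
  have "continuous_on S (\<lambda>y. blinfun_apply (?D y) i)" for i
    using D Sf by (subst continuous_on_cong[OF refl, of S _ "dir_deriv f i"])
      (auto intro!: smooth_at_continuous_on smooth_intros)
  then have cD: "continuous_on S ?D" by (intro continuous_on_blinfun_componentwise)
  obtain B where B: "B ** jac_matrix f x = mat 1"
    using assms(2) unfolding invertible_det_nz[symmetric] invertible_def by blast
  let ?inv = "Blinfun (\<lambda>v. B *v v)"
  have invD: "?inv o\<^sub>L ?D x = id_blinfun"
    by (intro blinfun_eqI) (simp add: D S J bounded_linear_Blinfun_apply matrix_vector_mul_bounded_linear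
      matrix_vector_mul_assoc B)
  have derD: "(f has_derivative blinfun_apply (?D y)) (at y)" if "y \<in> S" for y
    using smooth_at_has_derivative[OF Sf[OF that]] by (simp add: D[OF that])
  obtain U V g g' where U: "open U" "U \<subseteq> S" "x \<in> U" "open V" "f x \<in> V" and hom: "homeomorphism U V f g"
    and dg: "\<And>y. y \<in> V \<Longrightarrow> (g has_derivative g' y) (at y)"
    and g': "\<And>y. y \<in> V \<Longrightarrow> g' y = inv (blinfun_apply (?D (g y)))"
  proof (rule inverse_function_theorem[OF S(1) derD cD S(2) invD], goal_cases)
    case (2 U V g g')
    show ?case by (rule 2(1)[of U V g g']; (rule 2; assumption)?)
  qed auto
  have gV: "g y \<in> U" "g y \<in> S" if "y \<in> V" for y using hom that U(2) unfolding homeomorphism_def by auto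
  \<comment> \<open>Cramer's rule: \<open>h v y\<close> is the solution of
    \<open>jac_matrix f y *v h v y = v\<close>, written as a rational expression in the matrix
    entries.\<close>
  define h where "h v y = (\<chi> k. det (\<chi> i j. if j = k then v $ i else jac_matrix f y $ i $ j) / det (jac_matrix f y))" for v y
  have sh: "smooth_at y (h v)" if "y \<in> S" for y v
  proof -
    have "smooth_at y (\<lambda>y. if b then c else jac_matrix f y $ i $ j)" for b c i j
      using smooth_at_jac_matrix[OF Sf[OF that]] by (cases b) auto
    then have "smooth_at y (\<lambda>y. det (\<chi> i j. if j = k then v $ i else jac_matrix f y $ i $ j) / det (jac_matrix f y))" for k
      using Sd Sf that by (intro smooth_at_divide smooth_at_det) (auto intro!: smooth_at_jac_matrix)
    then show ?thesis unfolding smooth_at_vec_iff h_def by simp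
  qed
  have dgv: "dir_deriv g v y = h v (g y)" if "y \<in> V" for y v
  proof -
    have "jac_matrix f (g y) *v h v (g y) = v"
      using cramer[of "jac_matrix f (g y)" "h v (g y)" v] Sd gV(2)[OF that] by (simp add: h_def)
    moreover have "inj ((*v) (jac_matrix f (g y)))"
      using Sd[OF gV(2)[OF that]] unfolding invertible_det_nz[symmetric] invertible_def
      by (metis matrix_left_invertible_injective)
    ultimately have "g' y v = h v (g y)"
      unfolding g'[OF that] D[OF gV(2)[OF that]] by (intro inv_f_eq) (simp_all add: J gV that)
    then show ?thesis using dir_deriv_eqI[OF dg[OF that]] by simp
  qed
  have "Ck_on k V g" for k
  proof (induction k)
    case 0 then show ?case using hom by (simp add: homeomorphism_def)
  next
    case (Suc k)
    have "Ck_on k V (\<lambda>y. h v (g y))" for v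
    proof (rule Ck_on_compose[OF \<open>open V\<close> \<open>open S\<close> _ Suc])
      show "Ck_on k S (h v)" using smooth_onI[of S "h v"] sh by (auto simp: smooth_on_def)
    qed (use gV in auto)
    then show ?case
      using dgv Ck_on_cong[OF \<open>open V\<close>, of "dir_deriv g _"] differentiableI[OF dg] by (auto simp: Ck_on_Suc)
  qed
  then have "smooth_on V g" by (simp add: smooth_on_def)
  then have "smooth_at y g" if "y \<in> V" for y
    using smooth_on_imp_at[OF \<open>open V\<close>] that by blast
  then show thesis using that[OF U(1,3,4) hom] Sf Sd U(2) by auto
qed

subsection \<open>Even functions as functions of the square\<close>

text \<open>The power series \<open>E\<close> with \<open>E (2 w) = (1 - 2 w) E w\<close> and \<open>E 0 = 1\<close> vanishes at all powers
  \<open>2 ^ j\<close> and not at \<open>1/2\<close>. Its coefficients yield weights \<open>a\<close> with \<open>(\<Sum>k. a k * 2 ^ (k * j)) = 0\<close> for \<open>j > 0\<close>.\<close>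

fun dyadic_coeff :: "nat \<Rightarrow> real" where
  "dyadic_coeff 0 = 1"
| "dyadic_coeff (Suc k) = - 2 * dyadic_coeff k / (2 ^ Suc k - 1)"

text \<open>The ratio of consecutive coefficients decays like 2^(-k), so the radius of convergence
  is infinite. This matters because the series is evaluated at arbitrarily high powers of
  two.\<close>

lemma dyadic_coeff_summable: "summable (\<lambda>k. \<bar>dyadic_coeff k\<bar> * R ^ k)" if "R \<ge> 0"
proof -
  obtain N where N: "4 * R + 1 < 2 ^ N" using real_arch_pow[of 2 "4 * R + 1"] by auto
  show ?thesis
  proof (rule summable_ratio_test[of "1/2" N])
    fix k assume "k \<ge> N"
    then have "4 * R + 1 < 2 ^ Suc k"
      using N power_increasing[of N "Suc k" "2::real"] by linarith
    then have "2 * R / (2 ^ Suc k - 1) \<le> 1/2" using \<open>R \<ge> 0\<close> by (simp add: divide_simps)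
    then have "(2 * R / (2 ^ Suc k - 1)) * (\<bar>dyadic_coeff k\<bar> * R ^ k) \<le> 1/2 * (\<bar>dyadic_coeff k\<bar> * R ^ k)"
      using \<open>R \<ge> 0\<close> by (intro mult_right_mono) auto
    moreover have "(2::real) ^ Suc k - 1 > 0" using one_less_power[of "2::real" "Suc k"] by simp
    ultimately show "norm (\<bar>dyadic_coeff (Suc k)\<bar> * R ^ Suc k) \<le> 1/2 * norm (\<bar>dyadic_coeff k\<bar> * R ^ k)"
      using \<open>R \<ge> 0\<close> by (simp add: abs_mult ac_simps)
  qed simp
qed

text \<open>This entire function is the infinite product of the factors 1 - w / 2^j over j >= 0,
  which explains both its functional equation and its zeros.\<close>

definition dyadic_series :: "real \<Rightarrow> real" where
  "dyadic_series w = (\<Sum>k. dyadic_coeff k * w ^ k)"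

lemma dyadic_series_summable: "summable (\<lambda>k. dyadic_coeff k * w ^ k)"
  by (rule summable_rabs_cancel) (use dyadic_coeff_summable[of "\<bar>w\<bar>"] in \<open>simp add: abs_mult power_abs\<close>)

lemma dyadic_series_double: "dyadic_series (2 * w) = (1 - 2 * w) * dyadic_series w"
proof -
  note sm = dyadic_series_summable
  have rec: "dyadic_coeff (Suc k) * (2 ^ Suc k - 1) = - 2 * dyadic_coeff k" for k
    using one_less_power[of "2::real" "Suc k"] by simp
  have "dyadic_series (2 * w) - dyadic_series w = (\<Sum>k. dyadic_coeff k * (2 * w) ^ k - dyadic_coeff k * w ^ k)"
    unfolding dyadic_series_def by (rule suminf_diff[OF sm sm])
  also have "\<dots> = (\<Sum>k. (dyadic_coeff k * (2 ^ k - 1)) * w ^ k)"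
    by (intro suminf_cong) (simp add: power_mult_distrib algebra_simps)
  also have "\<dots> = (\<Sum>k. (dyadic_coeff (Suc k) * (2 ^ Suc k - 1)) * w ^ Suc k)"
  proof -
    have "summable (\<lambda>k. (dyadic_coeff k * (2 ^ k - 1)) * w ^ k)"
      using summable_diff[OF sm[of "2 * w"] sm[of w]] by (simp add: power_mult_distrib algebra_simps)
    from suminf_split_head[OF this] show ?thesis by simp
  qed
  also have "\<dots> = (\<Sum>k. (- 2 * w) * (dyadic_coeff k * w ^ k))"
    unfolding rec by (simp add: ac_simps)
  also have "\<dots> = (- 2 * w) * dyadic_series w"
    unfolding dyadic_series_def by (rule suminf_mult[OF sm])
  finally show ?thesis by (simp add: algebra_simps)
qed

lemma dyadic_series_power: "dyadic_series (2 ^ j) = 0"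
proof (induction j)
  case 0 show ?case using dyadic_series_double[of "1/2"] by simp
next
  case (Suc j) then show ?case using dyadic_series_double[of "2 ^ j"] by simp
qed

text \<open>A zero at 1/2 would be passed on by the functional equation to 1/4, 1/8 and so on, since
  the factors 1 - 2 w do not vanish there. Continuity would then give a zero at 0, where the value
  is 1.\<close>

lemma dyadic_series_half: "dyadic_series (1/2) \<noteq> 0"
proof
  assume *: "dyadic_series (1/2) = 0"
  have z: "dyadic_series ((1/2) ^ Suc m) = 0" for m
  proof (induction m)
    case (Suc m)
    have "(1/2::real) ^ Suc m < 1" by (rule power_Suc_less_one) auto
    then show ?case using Suc dyadic_series_double[of "(1/2) ^ Suc (Suc m)"] by simp
  qed (use * in simp)
  have "isCont dyadic_series 0"
    unfolding dyadic_series_def[abs_def]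
    by (rule isCont_powser_converges_everywhere[OF dyadic_series_summable])
  moreover have "(\<lambda>m. (1/2::real) ^ Suc m) \<longlonglongrightarrow> 0"
    by (rule LIMSEQ_Suc) (rule LIMSEQ_power_zero, simp)
  ultimately have "(\<lambda>m. dyadic_series ((1/2) ^ Suc m)) \<longlonglongrightarrow> dyadic_series 0"
    by (rule isCont_tendsto_compose)
  then have "dyadic_series 0 = 0" unfolding z using LIMSEQ_const_iff by metis
  moreover have "dyadic_series 0 = 1"
    unfolding dyadic_series_def using powser_zero[of dyadic_coeff] by simp
  ultimately show False by simp
qed

section \<open>Reflection nodes and weights, all of whose moments are one\<close>

definition refl_node :: "nat \<Rightarrow> real" where "refl_node k = 2 * 2 ^ k - 1"
text \<open>The factor (1/2)^k shifts the argument: testing the weights against the powers of 2^j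
  evaluates the series at 2^(j-1), which is a zero for j > 0 and the point 1/2 for j = 0. The
  denominator makes the total weight 1.\<close>

definition refl_weight :: "nat \<Rightarrow> real" where
  "refl_weight k = dyadic_coeff k * (1/2) ^ k / dyadic_series (1/2)"

lemma refl_node_ge_1: "refl_node k \<ge> 1"
  using one_le_power[of "2::real" k] by (simp add: refl_node_def)

lemma refl_weight_sums: "(\<lambda>k. refl_weight k * (2 ^ j) ^ k) sums (if j = 0 then 1 else 0)"
proof -
  have "(\<lambda>k. dyadic_coeff k * (2 ^ j / 2) ^ k / dyadic_series (1/2)) sums
      (dyadic_series (2 ^ j / 2) / dyadic_series (1/2))"
    unfolding dyadic_series_def by (intro sums_divide summable_sums dyadic_series_summable)
  moreover have "dyadic_series (2 ^ j / 2) = 0" if "j \<noteq> 0"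
    using dyadic_series_power[of "j - 1"] that by (cases j) auto
  ultimately show ?thesis
    using dyadic_series_half by (cases "j = 0") (auto simp: refl_weight_def power_divide ac_simps)
qed

text \<open>Each derivative of a reflected term costs one more power of its node, so convergence
  against all powers is what allows any number of derivatives.\<close>

lemma refl_weight_summable: "summable (\<lambda>k. \<bar>refl_weight k\<bar> * refl_node k ^ n)"
proof (rule summable_comparison_test')
  show "summable (\<lambda>k. (2 ^ n / \<bar>dyadic_series (1/2)\<bar>) * (\<bar>dyadic_coeff k\<bar> * (2 ^ n / 2) ^ k))"
    by (intro summable_mult dyadic_coeff_summable) simp
  fix k :: nat
  have "refl_node k ^ n \<le> (2 * 2 ^ k) ^ n"
    using refl_node_ge_1[of k] by (intro power_mono) (simp add: refl_node_def, linarith)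
  then have "\<bar>refl_weight k\<bar> * refl_node k ^ n \<le> \<bar>refl_weight k\<bar> * (2 * 2 ^ k) ^ n"
    by (intro mult_left_mono) auto
  also have "\<dots> = (2 ^ n / \<bar>dyadic_series (1/2)\<bar>) * (\<bar>dyadic_coeff k\<bar> * (2 ^ n / 2) ^ k)"
    by (simp add: refl_weight_def abs_mult power_mult_distrib power_divide power_abs mult.commute
        flip: power_mult)
  finally show "norm (\<bar>refl_weight k\<bar> * refl_node k ^ n) \<le> \<dots>"
    using refl_node_ge_1[of k] by simp
qed

text \<open>Since \<open>- refl_node k\<close> is 1 - 2 * 2^k, the binomial theorem reduces the
  moment to the sums of \<open>refl_weight_sums\<close>, of which the one for i = 0 survives. These
  moments are the conditions for all derivatives of the two sides to match at the boundary of the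
  reflection.\<close>

lemma refl_weight_moment: "(\<Sum>k. refl_weight k * (- refl_node k) ^ n) = 1"
proof -
  have "(\<lambda>k. \<Sum>i\<le>n. (of_nat (n choose i) * (- 2) ^ i) * (refl_weight k * (2 ^ i) ^ k)) sums
      (\<Sum>i\<le>n. (of_nat (n choose i) * (- 2) ^ i) * (if i = 0 then 1 else 0))"
    by (intro sums_sum sums_mult refl_weight_sums)
  moreover have "(\<Sum>i\<le>n. (of_nat (n choose i) * (- 2) ^ i) * (if i = 0 then 1 else 0)) = (1::real)"
    by (subst sum.remove[of _ 0]) auto
  moreover have "(\<Sum>i\<le>n. (of_nat (n choose i) * (- 2) ^ i) * (refl_weight k * (2 ^ i) ^ k)) =
      refl_weight k * (- refl_node k) ^ n" for k
  proof -
    have "(- refl_node k) ^ n = (- 2 * 2 ^ k + 1) ^ n" by (simp add: refl_node_def)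
    also have "\<dots> = (\<Sum>i\<le>n. of_nat (n choose i) * (- 2 * 2 ^ k) ^ i * 1 ^ (n - i))"
      by (rule binomial_ring)
    finally have "(- refl_node k) ^ n = (\<Sum>i\<le>n. of_nat (n choose i) * (- 2 * 2 ^ k) ^ i)" by simp
    moreover have "(- 2 * 2 ^ k) ^ i = (- 2) ^ i * ((2 ^ i) ^ k :: real)" for i
      by (simp only: power_mult_distrib power_mult[symmetric] mult.commute[of i k])
    ultimately show ?thesis
      by (simp add: sum_distrib_left mult.commute mult.left_commute)
  qed
  ultimately show ?thesis by (simp add: sums_iff)
qed

section \<open>Even functions of compact support and their derivative with respect to the
  square\<close>

definition even_bump :: "(real \<times> real \<Rightarrow> real) \<Rightarrow> bool" where
  "even_bump f \<longleftrightarrow> smooth f \<and> (\<forall>p x. f (p, - x) = f (p, x)) \<and>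
     (\<exists>R. \<forall>p x. \<bar>p\<bar> > R \<or> \<bar>x\<bar> > R \<longrightarrow> f (p, x) = 0)"

lemma even_bumpE:
  assumes "even_bump f"
  obtains R where "smooth f" "\<And>p x. f (p, - x) = 1 * f (p, x)" "\<And>p x. \<bar>p\<bar> > R \<or> \<bar>x\<bar> > R \<Longrightarrow> f (p, x) = 0"
proof -
  obtain R where "\<forall>p x. \<bar>p\<bar> > R \<or> \<bar>x\<bar> > R \<longrightarrow> f (p, x) = 0"
    using assms unfolding even_bump_def by blast
  then have "\<bar>p\<bar> > R \<or> \<bar>x\<bar> > R \<Longrightarrow> f (p, x) = 0" for p x by blast
  then show thesis using that[of R] assms unfolding even_bump_def by (metis mult_1)
qed

text \<open>If \<open>f (p, x) = F (p, x\<^sup>2)\<close> then \<open>half_deriv f (p, x)\<close> is the derivative of \<open>F p\<close> at \<open>x\<^sup>2\<close>.\<close>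

definition half_deriv :: "(real \<times> real \<Rightarrow> real) \<Rightarrow> real \<times> real \<Rightarrow> real" where
  "half_deriv f = (\<lambda>z. integral {0..1} (\<lambda>\<tau>. dir_deriv (dir_deriv f (0, 1)) (0, 1) (fst z, \<tau> * snd z)) / 2)"

lemma smooth_half_deriv: assumes "smooth f" shows "smooth (half_deriv f)"
proof -
  have "smooth (\<lambda>(z, \<tau>). dir_deriv (dir_deriv f (0, 1)) (0, 1) (fst z, \<tau> * snd z))"
    unfolding split_beta
  proof (intro allI, rule smooth_at_compose_smooth[of "dir_deriv (dir_deriv f (0, 1)) (0, 1)"])
    show "smooth (dir_deriv (dir_deriv f (0, 1)) (0, 1))"
      using assms by (simp add: smooth_at_dir_deriv)
  qed (intro smooth_at_Pair smooth_at_mult smooth_at_fst smooth_at_snd smooth_at_ident)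
  from smooth_integral_parameter[OF this, of 0 1] show ?thesis
    unfolding half_deriv_def by (auto intro!: smooth_at_divide)
qed

text \<open>The factor \<open>c\<close> treats even functions (c = 1) and odd ones (c = -1) at once;
  differentiating an even function twice in the second variable passes through both.\<close>

lemma dir_deriv_even:
  assumes "smooth f" "\<And>p x. f (p, - x) = c * f (p, x :: real)"
  shows "dir_deriv f (v, - w) (p :: real, - x) = c * (dir_deriv f (v, w) (p, x) :: real)"
proof -
  have "((\<lambda>z. (fst z, - snd z)) has_derivative (\<lambda>h. (fst h, - snd h))) (at (p, x))"
    by (intro has_derivative_Pair has_derivative_minus has_derivative_fst has_derivative_snd has_derivative_ident)
  from smooth_at_has_derivative_compose[OF _ this, of f]
  have d: "((\<lambda>z. f (fst z, - snd z)) has_derivative (\<lambda>h. dir_deriv f (fst h, - snd h) (p, - x))) (at (p, x))"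
    using assms(1) by simp
  have eq: "(\<lambda>z. f (fst z, - snd z)) = (\<lambda>z. c * f z)" using assms(2) by (simp add: fun_eq_iff)
  from d have "((\<lambda>z. c * f z) has_derivative (\<lambda>h. dir_deriv f (fst h, - snd h) (p, - x))) (at (p, x))"
    unfolding eq .
  moreover have "((\<lambda>z. c * f z) has_derivative (\<lambda>h. c * dir_deriv f h (p, x))) (at (p, x))"
    by (intro has_derivative_mult_right smooth_at_has_derivative) (use assms in auto)
  ultimately have "(\<lambda>h. dir_deriv f (fst h, - snd h) (p, - x)) = (\<lambda>h. c * dir_deriv f h (p, x))"
    by (rule has_derivative_unique)
  from fun_cong[OF this, of "(v, w)"] show ?thesis by simp
qed

lemma dir_deriv_smult: "smooth_at z f \<Longrightarrow> dir_deriv f (c *\<^sub>R v) z = c *\<^sub>R dir_deriv f v z"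
  using linear_scale[OF linear_dir_deriv[OF smooth_at_differentiable]] by blast

lemma dir_deriv_plus: "smooth_at z f \<Longrightarrow> dir_deriv f (v + w) z = dir_deriv f v z + dir_deriv f w z"
  using linear_add[OF linear_dir_deriv[OF smooth_at_differentiable]] by blast

lemma dir_deriv_support:
  assumes "\<And>p x. \<bar>p\<bar> > R \<or> \<bar>x\<bar> > R \<Longrightarrow> f (p :: real, x :: real) = (0::real)"
  shows "\<bar>p\<bar> > R \<or> \<bar>x\<bar> > R \<Longrightarrow> dir_deriv f v (p, x) = 0"
proof -
  assume *: "\<bar>p\<bar> > R \<or> \<bar>x\<bar> > R"
  have "open {z. \<bar>fst z\<bar> > R \<or> \<bar>snd z\<bar> > R}"
    by (intro open_Collect_disj open_Collect_less continuous_intros)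
  then have "\<forall>\<^sub>F z in nhds (p, x). f z = (\<lambda>z. 0) z"
    by (rule eventually_eq_open) (use * assms in auto)
  from dir_deriv_cong_ev(1)[OF this] show ?thesis
    using dir_deriv_eqI[OF has_derivative_const] by simp
qed

text \<open>The second partial derivative of an even function is odd and so vanishes at
  \<open>x = 0\<close>. Writing it as an integral over the segment from 0 to \<open>x\<close>
  divides it by \<open>x\<close> without loss of smoothness; the 2 is the chain rule factor of the
  square.\<close>

lemma half_deriv_eq:
  assumes "even_bump f" shows "dir_deriv f (0, 1) (p, x) = 2 * x * half_deriv f (p, x)"
proof -
  have f: "smooth f" "\<And>p x. f (p, - x) = 1 * f (p, x)" using assms by (auto simp: even_bump_def)
  let ?g = "dir_deriv f (0, 1)"
  have sg: "smooth ?g" using f by (auto intro: smooth_intros)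
  have "?g (p, 0) = 0"
    using dir_deriv_even[OF f, of 0 1 p 0] dir_deriv_smult[of "(p, 0)" f "-1" "(0, 1)"] f(1) by simp
  moreover have "((\<lambda>\<tau>. dir_deriv ?g (0, x) ((p, 0) + \<tau> *\<^sub>R (0, x))) has_integral ?g ((p, 0) + 1 *\<^sub>R (0, x)) - ?g (p, 0)) {0..1}"
    by (rule integral_dir_deriv_segment[OF sg]) simp
  moreover have "dir_deriv ?g (0, x) z = x * dir_deriv ?g (0, 1) z" for z
    using dir_deriv_smult[of z ?g x "(0, 1)"] sg by simp
  ultimately have "((\<lambda>\<tau>. x * dir_deriv ?g (0, 1) (p, \<tau> * x)) has_integral ?g (p, x)) {0..1}"
    by simp
  then have "?g (p, x) = integral {0..1} (\<lambda>\<tau>. x * dir_deriv ?g (0, 1) (p, \<tau> * x))"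
    by (rule integral_unique[symmetric])
  then show ?thesis by (simp add: half_deriv_def)
qed

lemma even_bump_half_deriv: assumes "even_bump f" shows "even_bump (half_deriv f)"
proof -
  obtain R where f: "smooth f" "\<And>p x. f (p, - x) = 1 * f (p, x)" "\<And>p x. \<bar>p\<bar> > R \<or> \<bar>x\<bar> > R \<Longrightarrow> f (p, x) = 0"
    by (rule even_bumpE[OF assms]) metis
  let ?g = "dir_deriv f (0, 1)"
  have sg: "smooth ?g" using f by (auto intro: smooth_intros)
  have odd: "?g (p, - x) = - 1 * ?g (p, x)" for p x
    using dir_deriv_even[OF f(1,2), of 0 1 p x] dir_deriv_smult[of "(p, - x)" f "-1" "(0, 1)"] f(1) by simp
  have even: "dir_deriv ?g (0, 1) (p, - x) = dir_deriv ?g (0, 1) (p, x)" for p x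
    using dir_deriv_even[OF sg odd, of 0 1 p x] dir_deriv_smult[of "(p, - x)" ?g "-1" "(0, 1)"] sg by simp
  have g0: "?g (p, x) = 0" if "\<bar>p\<bar> > R \<or> \<bar>x\<bar> > R" for p x
    by (rule dir_deriv_support[OF _ that]) (rule f(3))
  have gg0: "dir_deriv ?g (0, 1) (p, x) = 0" if "\<bar>p\<bar> > R \<or> \<bar>x\<bar> > R" for p x
    by (rule dir_deriv_support[OF _ that]) (rule g0)
  have "half_deriv f (p, x) = 0" if "\<bar>p\<bar> > \<bar>R\<bar> \<or> \<bar>x\<bar> > \<bar>R\<bar>" for p x
  proof (cases "\<bar>p\<bar> > R")
    case True then show ?thesis by (simp add: half_deriv_def gg0)
  next
    case False
    \<comment> \<open>The integral defining \<open>half_deriv\<close> may pass through points inside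
      the support, so its vanishing is read off from \<open>half_deriv_eq\<close>, where
      \<open>x\<close> can be cancelled. The bound |R| keeps \<open>x\<close> away from 0 even if
      \<open>R\<close> is negative.\<close>
    then have "\<bar>x\<bar> > \<bar>R\<bar>" using that by auto
    then have "R < \<bar>x\<bar>" "x \<noteq> 0" by auto
    then show ?thesis using half_deriv_eq[OF assms, of p x] g0[of p x] by simp
  qed
  then show ?thesis
    unfolding even_bump_def using smooth_half_deriv[OF f(1)] even by (auto simp: half_deriv_def intro!: exI[of _ "\<bar>R\<bar>"])
qed

lemma even_bump_dir_deriv: assumes "even_bump f" shows "even_bump (dir_deriv f (1, 0))"
proof -
  obtain R where f: "smooth f" "\<And>p x. f (p, - x) = 1 * f (p, x)" "\<And>p x. \<bar>p\<bar> > R \<or> \<bar>x\<bar> > R \<Longrightarrow> f (p, x) = 0"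
    by (rule even_bumpE[OF assms]) metis
  have "dir_deriv f (1, 0) (p, x) = 0" if "\<bar>p\<bar> > R \<or> \<bar>x\<bar> > R" for p x
    by (rule dir_deriv_support[OF _ that]) (rule f(3))
  then show ?thesis
    unfolding even_bump_def using dir_deriv_even[OF f(1,2), of 1 0] f(1) by (auto intro!: smooth_intros)
qed

text \<open>Compact support pays off here: the Weierstrass test for the reflected series needs a
  bound that is uniform over all nodes.\<close>

lemma even_bump_bounded: assumes "even_bump f" obtains B where "\<And>z. \<bar>f z\<bar> \<le> B"
proof -
  obtain R where f: "smooth f" "\<And>p x. \<bar>p\<bar> > R \<or> \<bar>x\<bar> > R \<Longrightarrow> f (p, x) = 0"
    by (rule even_bumpE[OF assms]) metis
  have "compact (f ` ({- R..R} \<times> {- R..R}))"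
    using f(1) by (intro compact_continuous_image smooth_at_continuous_on compact_Times) auto
  then obtain B where B: "\<And>z. z \<in> {- R..R} \<times> {- R..R} \<Longrightarrow> \<bar>f z\<bar> \<le> B"
    using compact_imp_bounded bounded_iff by (metis imageI real_norm_def)
  have "\<bar>f (p, x)\<bar> \<le> max B 0" for p x
  proof (cases "\<bar>p\<bar> > R \<or> \<bar>x\<bar> > R")
    case False
    then have "\<bar>f (p, x)\<bar> \<le> B" by (intro B) auto
    then show ?thesis by simp
  qed (simp add: f(2))
  then show thesis using that by (metis surj_pair)
qed

text \<open>For n = 0 this is Seeley's reflection, continuing the function t |-> f (p, sqrt t) from
  t >= 0 to t < 0. The index \<open>n\<close> counts derivatives in \<open>t\<close>: each one
  brings a factor \<open>- refl_node k\<close> out of the argument of the k-th term.\<close>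

definition refl_ext :: "nat \<Rightarrow> (real \<times> real \<Rightarrow> real) \<Rightarrow> real \<times> real \<Rightarrow> real" where
  "refl_ext n f = (\<lambda>(p, t). if t \<ge> 0 then f (p, sqrt t)
     else (\<Sum>k. refl_weight k * (- refl_node k) ^ n * f (p, sqrt (refl_node k * - t))))"

lemma refl_ext_bound:
  assumes "\<And>z. \<bar>f z\<bar> \<le> B"
  shows "norm (refl_weight k * (- refl_node k) ^ n * f z) \<le> \<bar>refl_weight k\<bar> * refl_node k ^ n * B"
  using mult_left_mono[OF assms, of "\<bar>refl_weight k\<bar> * refl_node k ^ n" z] refl_node_ge_1[of k]
  by (simp add: abs_mult power_abs)

lemma continuous_refl_ext: assumes "even_bump f" shows "continuous_on UNIV (refl_ext n f)"
proof -
  obtain B where B: "\<And>z. \<bar>f z\<bar> \<le> B" using even_bump_bounded[OF assms] by blast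
  have cf: "continuous_on S f" for S
    using assms by (auto simp: even_bump_def intro!: smooth_at_continuous_on)
  let ?s = "\<lambda>z. \<Sum>k. refl_weight k * (- refl_node k) ^ n * f (fst z, sqrt (refl_node k * - snd z))"
  have "uniform_limit UNIV (\<lambda>N z. \<Sum>k<N. refl_weight k * (- refl_node k) ^ n * f (fst z, sqrt (refl_node k * - snd z))) ?s sequentially"
    by (rule Weierstrass_m_test[OF _ summable_mult2[OF refl_weight_summable, of n B]])
      (rule refl_ext_bound[OF B])
  then have c: "continuous_on UNIV ?s"
    by (rule uniform_limit_theorem[rotated])
      (auto intro!: always_eventually continuous_intros continuous_on_compose2[OF cf])
  have "refl_ext n f = (\<lambda>z. if 0 \<le> snd z then f (fst z, sqrt (snd z)) else ?s z)"
    by (auto simp: refl_ext_def fun_eq_iff)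
  \<comment> \<open>The two branches meet at t = 0 because the n-th moment of the weights is
    1.\<close>
  moreover have "?s z = f (fst z, sqrt (snd z))" if "snd z = 0" for z
  proof -
    have "?s z = (\<Sum>k. refl_weight k * (- refl_node k) ^ n) * f (fst z, 0)"
      unfolding that
      using suminf_mult2[OF summable_rabs_cancel, of "\<lambda>k. refl_weight k * (- refl_node k) ^ n" "f (fst z, 0)"]
        refl_weight_summable[of n] refl_node_ge_1 by (simp add: abs_mult power_abs abs_of_pos order.strict_trans2[OF zero_less_one])
    then show ?thesis using that by (simp add: refl_weight_moment)
  qed
  moreover have "continuous_on UNIV (\<lambda>z. if 0 \<le> snd z then f (fst z, sqrt (snd z)) else ?s z)"
  proof -
    have "continuous_on ({z. 0 \<le> snd z} \<union> {z. snd z \<le> 0}) (\<lambda>z. if 0 \<le> snd z then f (fst z, sqrt (snd z)) else ?s z)"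
    proof (rule continuous_on_cases)
      show "closed {z :: real \<times> real. 0 \<le> snd z}" "closed {z :: real \<times> real. snd z \<le> 0}"
        by (intro closed_Collect_le continuous_intros)+
      show "continuous_on {z. 0 \<le> snd z} (\<lambda>z. f (fst z, sqrt (snd z)))"
        by (intro continuous_on_compose2[OF cf] continuous_intros) auto
      show "continuous_on {z. snd z \<le> 0} ?s" using c continuous_on_subset by blast
    qed (use calculation(2) in force)
    moreover have "{z :: real \<times> real. 0 \<le> snd z} \<union> {z. snd z \<le> 0} = UNIV" by auto
    ultimately show ?thesis by simp
  qed
  ultimately show ?thesis by simp
qed

text \<open>The square root contributes a singular factor 1 / (2 sqrt (c t)), which cancels against
  the factor 2 x in \<open>half_deriv_eq\<close>. The case c = 1 serves the branch t > 0, a negative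
  \<open>c\<close> the reflected terms.\<close>

lemma refl_ext_term_deriv:
  assumes "even_bump f" "c * t > 0"
  shows "((\<lambda>t. f (p, sqrt (c * t))) has_real_derivative half_deriv f (p, sqrt (c * t)) * c) (at t)"
proof -
  have f: "smooth f" using assms by (simp add: even_bump_def)
  have "((\<lambda>t. sqrt (c * t)) has_real_derivative c / (2 * sqrt (c * t))) (at t)"
    using assms(2) by (auto intro!: derivative_eq_intros simp: field_simps)
  then have "((\<lambda>t. (p, sqrt (c * t))) has_derivative (\<lambda>h. (0, c / (2 * sqrt (c * t)) * h))) (at t)"
    unfolding has_field_derivative_def by (intro has_derivative_Pair has_derivative_const)
  from smooth_at_has_derivative_compose[OF _ this, of f] f
  have "((\<lambda>t. f (p, sqrt (c * t))) has_derivative (\<lambda>h. dir_deriv f (0, c / (2 * sqrt (c * t)) * h) (p, sqrt (c * t)))) (at t)"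
    by blast
  moreover have "dir_deriv f (0, c / (2 * sqrt (c * t)) * h) (p, sqrt (c * t)) = half_deriv f (p, sqrt (c * t)) * c * h" for h
  proof -
    have "dir_deriv f (0, c / (2 * sqrt (c * t)) * h) (p, sqrt (c * t)) =
        (c / (2 * sqrt (c * t)) * h) * dir_deriv f (0, 1) (p, sqrt (c * t))"
      using dir_deriv_smult[of "(p, sqrt (c * t))" f "c / (2 * sqrt (c * t)) * h" "(0, 1)"] f by simp
    also have "\<dots> = half_deriv f (p, sqrt (c * t)) * c * h"
      unfolding half_deriv_eq[OF assms(1)] using assms(2) by (cases "t = 0") auto
    finally show ?thesis .
  qed
  ultimately show ?thesis unfolding has_field_derivative_def by simp
qed

lemma refl_ext_summable:
  assumes "\<And>z. \<bar>f z\<bar> \<le> B"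
  shows "summable (\<lambda>k. refl_weight k * (- refl_node k) ^ n * f (h k))"
  by (rule summable_comparison_test'[OF summable_mult2[OF refl_weight_summable, of n B], of 0])
    (rule refl_ext_bound[OF assms])

lemma refl_ext_uniformly_convergent:
  assumes "\<And>z. \<bar>f z\<bar> \<le> B"
  shows "uniformly_convergent_on S (\<lambda>N x. \<Sum>k<N. refl_weight k * (- refl_node k) ^ n * f (h k x))"
  by (rule Weierstrass_m_test'[OF _ summable_mult2[OF refl_weight_summable, of n B]])
    (rule refl_ext_bound[OF assms])

lemma refl_ext_deriv_param:
  assumes "even_bump f"
  shows "((\<lambda>p. refl_ext n f (p, t)) has_real_derivative refl_ext n (dir_deriv f (1, 0)) (p, t)) (at p)"
proof -
  have f: "smooth f" using assms by (simp add: even_bump_def)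
  obtain B where B: "\<And>z. \<bar>f z\<bar> \<le> B" using even_bump_bounded[OF assms] by blast
  obtain B' where B': "\<And>z. \<bar>dir_deriv f (1, 0) z\<bar> \<le> B'"
    using even_bump_bounded[OF even_bump_dir_deriv[OF assms]] by blast
  have base: "((\<lambda>p. f (p, c)) has_real_derivative dir_deriv f (1, 0) (p, c)) (at p within S)" for p c S
  proof -
    have "((\<lambda>p. (p, c)) has_derivative (\<lambda>h. (h, 0))) (at p within S)"
      by (intro has_derivative_Pair has_derivative_const has_derivative_ident)
    from smooth_at_has_derivative_compose[OF _ this, of f] f
    have d: "((\<lambda>p. f (p, c)) has_derivative (\<lambda>h. dir_deriv f (h, 0) (p, c))) (at p within S)" by blast
    have "dir_deriv f (h, 0) (p, c) = dir_deriv f (1, 0) (p, c) * h" for h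
      using dir_deriv_smult[of "(p, c)" f h "(1, 0)"] f by simp
    then have eq: "(\<lambda>h. dir_deriv f (h, 0) (p, c)) = (*) (dir_deriv f (1, 0) (p, c))" by (rule ext)
    show ?thesis using d unfolding eq has_field_derivative_def .
  qed
  show ?thesis
  proof (cases "t \<ge> 0")
    case True then show ?thesis using base by (simp add: refl_ext_def)
  next
    case False
    have "((\<lambda>p. \<Sum>k. refl_weight k * (- refl_node k) ^ n * f (p, sqrt (refl_node k * - t))) has_real_derivative
        (\<Sum>k. refl_weight k * (- refl_node k) ^ n * dir_deriv f (1, 0) (p, sqrt (refl_node k * - t)))) (at p)"
    proof (rule has_field_derivative_series'(2)[of UNIV _ _ 0])
      show "((\<lambda>p. refl_weight k * (- refl_node k) ^ n * f (p, sqrt (refl_node k * - t))) has_real_derivative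
          refl_weight k * (- refl_node k) ^ n * dir_deriv f (1, 0) (p, sqrt (refl_node k * - t))) (at p within UNIV)" for k p
        by (intro DERIV_cmult base)
    qed (rule refl_ext_uniformly_convergent[OF B'] refl_ext_summable[OF B] | simp)+
    then show ?thesis using False by (simp add: refl_ext_def)
  qed
qed

lemma refl_ext_deriv_square_nonzero:
  assumes "even_bump f" "t \<noteq> 0"
  shows "((\<lambda>t. refl_ext n f (p, t)) has_real_derivative refl_ext (Suc n) (half_deriv f) (p, t)) (at t)"
proof (cases "t > 0")
  case True
  have "((\<lambda>t. f (p, sqrt t)) has_real_derivative half_deriv f (p, sqrt t)) (at t)"
    using refl_ext_term_deriv[OF assms(1), of 1 t p] True by simp
  then have "((\<lambda>t. f (p, sqrt t)) has_real_derivative refl_ext (Suc n) (half_deriv f) (p, t)) (at t)"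
    using True by (simp add: refl_ext_def)
  then show ?thesis
    by (rule has_field_derivative_transform_within_open[where S="{0<..}"]) (use True in \<open>auto simp: refl_ext_def\<close>)
next
  case False
  then have t: "t < 0" using assms by simp
  obtain B where B: "\<And>z. \<bar>f z\<bar> \<le> B" using even_bump_bounded[OF assms(1)] by blast
  obtain B' where B': "\<And>z. \<bar>half_deriv f z\<bar> \<le> B'"
    using even_bump_bounded[OF even_bump_half_deriv[OF assms(1)]] by blast
  have "((\<lambda>t. \<Sum>k. refl_weight k * (- refl_node k) ^ n * f (p, sqrt (refl_node k * - t))) has_real_derivative
      (\<Sum>k. refl_weight k * (- refl_node k) ^ Suc n * half_deriv f (p, sqrt (refl_node k * - t)))) (at t)"
  proof (rule has_field_derivative_series'(2)[of "{..<0}" _ _ t])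
    fix k and t :: real assume "t \<in> {..<0}"
    then have "- refl_node k * t > 0" using refl_node_ge_1[of k] by (intro mult_neg_neg) auto
    from DERIV_cmult[OF refl_ext_term_deriv[OF assms(1) this], of "refl_weight k * (- refl_node k) ^ n" p]
    have "((\<lambda>t. refl_weight k * (- refl_node k) ^ n * f (p, sqrt (refl_node k * - t))) has_real_derivative
      refl_weight k * (- refl_node k) ^ Suc n * half_deriv f (p, sqrt (refl_node k * - t))) (at t)"
      by (simp add: mult.assoc mult.commute mult.left_commute)
    then show "((\<lambda>t. refl_weight k * (- refl_node k) ^ n * f (p, sqrt (refl_node k * - t))) has_real_derivative
      refl_weight k * (- refl_node k) ^ Suc n * half_deriv f (p, sqrt (refl_node k * - t))) (at t within {..<0})"
      by (rule has_field_derivative_at_within)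
  qed (rule refl_ext_uniformly_convergent[OF B'] refl_ext_summable[OF B] | simp add: t interior_open)+
  then have "((\<lambda>t. \<Sum>k. refl_weight k * (- refl_node k) ^ n * f (p, sqrt (refl_node k * - t))) has_real_derivative
      refl_ext (Suc n) (half_deriv f) (p, t)) (at t)"
    using t by (simp add: refl_ext_def del: power_Suc)
  then show ?thesis
    by (rule has_field_derivative_transform_within_open[where S="{..<0}"]) (use t in \<open>auto simp: refl_ext_def\<close>)
qed

text \<open>The fundamental theorem of calculus tolerates the exceptional point \<open>c\<close>, so
  \<open>g\<close> is a primitive of the continuous function \<open>g'\<close> and is differentiable
  at \<open>c\<close> as well. It is applied at t = 0, where the two branches of
  \<open>refl_ext\<close> meet.\<close>

lemma DERIV_extend_continuous:
  fixes g :: "real \<Rightarrow> real"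
  assumes "continuous_on UNIV g" "continuous_on UNIV g'" "\<And>t. t \<noteq> c \<Longrightarrow> (g has_real_derivative g' t) (at t)"
  shows "(g has_real_derivative g' t) (at t)"
proof -
  have int: "(g' has_integral (g u - g (t - 1))) {t - 1..u}" if "t - 1 \<le> u" for u
  proof (rule fundamental_theorem_of_calculus_interior_strong[of "{c}"])
    show "(g has_vector_derivative g' x) (at x)" if "x \<in> {t - 1<..<u} - {c}" for x
      using assms(3)[of x] that by (simp add: has_real_derivative_iff_has_vector_derivative)
  qed (use that assms(1) continuous_on_subset in auto)
  have "((\<lambda>u. g (t - 1) + integral {t - 1..u} g') has_vector_derivative 0 + g' t) (at t within {t - 1..t + 1})"
    by (intro has_vector_derivative_add has_vector_derivative_const integral_has_vector_derivative)
      (use assms(2) continuous_on_subset in auto)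
  then have "((\<lambda>u. g (t - 1) + integral {t - 1..u} g') has_vector_derivative g' t) (at t)"
    using at_within_Icc_at[of "t - 1" t "t + 1"] by simp
  then have "(g has_vector_derivative g' t) (at t)"
  proof (rule has_vector_derivative_transform_within_open[where S="{t - 1<..}"])
    show "g (t - 1) + integral {t - 1..u} g' = g u" if "u \<in> {t - 1<..}" for u
      using integral_unique[OF int[of u]] that by simp
  qed auto
  then show ?thesis by (simp add: has_real_derivative_iff_has_vector_derivative)
qed

lemma refl_ext_deriv_square:
  assumes "even_bump f"
  shows "((\<lambda>t. refl_ext n f (p, t)) has_real_derivative refl_ext (Suc n) (half_deriv f) (p, t)) (at t)"
proof (rule DERIV_extend_continuous[OF _ _ refl_ext_deriv_square_nonzero[OF assms]])
  have "continuous_on UNIV (\<lambda>t. refl_ext n f (p, t))" if "even_bump f" for n f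
    by (rule continuous_on_compose2[OF continuous_refl_ext[OF that]]) (auto intro!: continuous_intros)
  then show "continuous_on UNIV (\<lambda>t. refl_ext n f (p, t))" "continuous_on UNIV (\<lambda>t. refl_ext (Suc n) (half_deriv f) (p, t))"
    using assms even_bump_half_deriv by auto
qed

text \<open>Both partial derivatives are again reflections of even functions of compact support; on
  this the induction for smoothness runs.\<close>

lemma has_derivative_refl_ext:
  assumes "even_bump f"
  shows "(refl_ext n f has_derivative
    (\<lambda>v. fst v * refl_ext n (dir_deriv f (1, 0)) z + snd v * refl_ext (Suc n) (half_deriv f) z)) (at z)"
proof -
  obtain p t where z: "z = (p, t)" by (cases z)
  let ?D = "refl_ext (Suc n) (half_deriv f)"
  have "((\<lambda>(p, t). refl_ext n f (p, t)) has_derivative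
      (\<lambda>(v, w). refl_ext n (dir_deriv f (1, 0)) (p, t) * v + blinfun_apply (blinfun_mult_right (?D (p, t))) w))
      (at (p, t) within UNIV \<times> UNIV)"
  proof (rule has_derivative_partialsI)
    show "((\<lambda>p. refl_ext n f (p, t)) has_derivative (*) (refl_ext n (dir_deriv f (1, 0)) (p, t))) (at p within UNIV)"
      using refl_ext_deriv_param[OF assms] by (simp add: has_field_derivative_def)
    show "((\<lambda>t. refl_ext n f (p, t)) has_derivative blinfun_apply (blinfun_mult_right (?D (p, t)))) (at t within UNIV)" for p t
      using refl_ext_deriv_square[OF assms, of n p t] by (simp add: has_field_derivative_def)
    have "continuous_on UNIV ?D" by (rule continuous_refl_ext[OF even_bump_half_deriv[OF assms]])
    then have "continuous_on UNIV (\<lambda>z. blinfun_mult_right (?D z))"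
      by (rule bounded_linear.continuous_on[OF bounded_linear_blinfun_mult_right])
    then have "isCont (\<lambda>z. blinfun_mult_right (?D z)) (p, t)"
      using continuous_on_eq_continuous_at[OF open_UNIV] by blast
    moreover have "(\<lambda>(p, t). blinfun_mult_right (?D (p, t))) = (\<lambda>z. blinfun_mult_right (?D z))"
      by (rule ext) (simp add: split_beta)
    ultimately show "continuous (at (p, t) within UNIV \<times> UNIV) (\<lambda>(p, t). blinfun_mult_right (?D (p, t)))"
      by (simp only: UNIV_Times_UNIV)
  qed auto
  then show ?thesis by (simp add: z case_prod_unfold mult.commute)
qed

lemma smooth_refl_ext: assumes "even_bump f" shows "smooth (refl_ext n f)"
proof -
  have "Ck_on k UNIV (refl_ext n f)" if "even_bump f" for k n f
    using that
  proof (induction k arbitrary: n f)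
    case 0 then show ?case by (simp add: continuous_refl_ext)
  next
    case (Suc k)
    have "dir_deriv (refl_ext n f) v = (\<lambda>z. fst v * refl_ext n (dir_deriv f (1, 0)) z + snd v * refl_ext (Suc n) (half_deriv f) z)" for v
      by (rule ext, rule dir_deriv_eqI[OF has_derivative_refl_ext[OF Suc.prems]])
    moreover have "Ck_on k UNIV (\<lambda>z. fst v * refl_ext n (dir_deriv f (1, 0)) z + snd v * refl_ext (Suc n) (half_deriv f) z)" for v :: "real \<times> real"
      by (intro Ck_on_add Ck_on_bilinear[OF bounded_bilinear_mult] Ck_on_const open_UNIV Suc.IH
          even_bump_half_deriv even_bump_dir_deriv Suc.prems)
    ultimately show ?case
      using differentiableI[OF has_derivative_refl_ext[OF Suc.prems]] by (simp add: Ck_on_Suc)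
  qed
  then have "smooth_on UNIV (refl_ext n f)" using assms by (simp add: smooth_on_def)
  then show ?thesis by (simp add: smooth_on_UNIV_iff)
qed

theorem smooth_even_is_function_of_square:
  fixes f :: "real \<times> real \<Rightarrow> real"
  assumes "smooth f" "\<And>p x. f (p, - x) = f (p, x)"
  obtains g where "smooth g" "\<forall>\<^sub>F z in nhds (0, 0). g (fst z, (snd z)\<^sup>2) = f z"
proof -
  obtain \<eta> :: "real \<times> real \<Rightarrow> real" where \<eta>: "smooth \<eta>" "\<And>x. dist (0, 0) x \<le> 1 \<Longrightarrow> \<eta> x = 1"
    "\<And>x. dist (0, 0) x \<ge> 2 * 1 \<Longrightarrow> \<eta> x = 0"
    by (rule exists_bump[of 1 "(0 :: real, 0 :: real)"]) (simp, blast)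
  \<comment> \<open>The cut-off is symmetrised by hand, because \<open>exists_bump\<close> says
    nothing about the parity of \<eta>.\<close>
  let ?h = "\<lambda>z. \<eta> z * \<eta> (fst z, - snd z) * f z"
  have d0: "dist (0, 0) z = norm z" for z :: "real \<times> real"
    by (metis dist_0_norm zero_prod_def)
  have big: "dist (0, 0) (p, x) \<ge> 2" if "\<bar>p\<bar> > 2 \<or> \<bar>x\<bar> > 2" for p x :: real
    using that norm_fst_le[of p x] norm_snd_le[of x p] unfolding d0 by (auto simp: real_norm_def)
  have "smooth ?h"
    using \<eta>(1) assms(1)
    by (intro allI smooth_at_mult smooth_at_compose_smooth[OF \<eta>(1)] smooth_at_Pair smooth_at_minus
        smooth_at_fst smooth_at_snd smooth_at_ident) auto
  then have "even_bump ?h"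
    unfolding even_bump_def using \<eta>(3) big assms(2) by (intro conjI exI[of _ 2]) auto
  then have "smooth (refl_ext 0 ?h)" by (rule smooth_refl_ext)
  moreover have "\<forall>\<^sub>F z in nhds (0, 0). refl_ext 0 ?h (fst z, (snd z)\<^sup>2) = f z"
  proof (rule eventually_eq_open)
    show "open (ball (0 :: real \<times> real) 1)" "(0, 0) \<in> ball (0 :: real \<times> real) 1" by (auto simp: zero_prod_def[symmetric])
    fix z :: "real \<times> real" assume "z \<in> ball 0 1"
    moreover obtain p x where z: "z = (p, x)" by (cases z)
    ultimately have "norm (p, x) < 1" by simp
    then have "norm (p, \<bar>x\<bar>) \<le> 1" "norm (p, - \<bar>x\<bar>) \<le> 1" by (auto simp: norm_Pair)
    then have "\<eta> (p, \<bar>x\<bar>) = 1" "\<eta> (p, - \<bar>x\<bar>) = 1"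
      by (auto intro!: \<eta>(2) simp only: d0)
    moreover have "f (p, \<bar>x\<bar>) = f (p, x)" using assms(2)[of p x] by (cases "x \<ge> 0") auto
    ultimately show "refl_ext 0 ?h (fst z, (snd z)\<^sup>2) = f z" by (simp add: refl_ext_def z)
  qed
  ultimately show thesis by (rule that)
qed

section \<open>Local normal form on three-dimensional space\<close>

definition grad :: "(real^3 \<Rightarrow> real) \<Rightarrow> real^3 \<Rightarrow> real^3" where
  "grad f x = (\<chi> i. dir_deriv f (axis i 1) x)"

definition triple :: "real^3 \<Rightarrow> real^3 \<Rightarrow> real^3 \<Rightarrow> real" where
  "triple a b c = det (vector [a, b, c] :: real^3^3)"

lemma triple_eq: "triple a b c = a$1 * b$2 * c$3 + a$2 * b$3 * c$1 + a$3 * b$1 * c$2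
    - a$1 * b$3 * c$2 - a$2 * b$1 * c$3 - a$3 * b$2 * c$1"
  by (simp add: triple_def det_3)

lemma triple_linear:
  "triple (x + y) b c = triple x b c + triple y b c" "triple (r *\<^sub>R x) b c = r * triple x b c"
  "triple a (x + y) c = triple a x c + triple a y c" "triple a (r *\<^sub>R x) c = r * triple a x c"
  by (simp_all add: triple_eq algebra_simps)

lemma triple_scaleR: "triple a b (r *\<^sub>R c) = r * triple a b c"
  by (simp add: triple_eq algebra_simps)

lemma triple_vector_matrix_mult: "triple (a v* J) (b v* J) (c v* J) = triple a b c * det J"
proof -
  have "(vector [a v* J, b v* J, c v* J] :: real^3^3) = vector [a, b, c] ** J"
    by (simp add: vec_eq_iff forall_3 vector_matrix_mult_def matrix_matrix_mult_def sum_3 mult.commute)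
  then show ?thesis by (simp add: triple_def det_mul)
qed

lemma dir_deriv_grad:
  assumes "smooth_at x f" shows "dir_deriv f v x = (\<Sum>i\<in>UNIV. v $ i * grad f x $ i)"
proof -
  have "dir_deriv f (\<Sum>i\<in>UNIV. v $ i *\<^sub>R axis i 1) x = (\<Sum>i\<in>UNIV. v $ i * dir_deriv f (axis i 1) x)"
    using linear_dir_deriv[OF smooth_at_differentiable[OF assms]] linear_sum linear_scale
    by (simp add: linear_sum[OF linear_dir_deriv[OF smooth_at_differentiable[OF assms]]]
        linear_scale[OF linear_dir_deriv[OF smooth_at_differentiable[OF assms]]])
  moreover have "(\<Sum>i\<in>UNIV. v $ i *\<^sub>R axis i 1) = v"
    by (simp add: vec_eq_iff axis_def if_distrib cong: if_cong)
  ultimately show ?thesis by (simp add: grad_def)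
qed

lemma grad_eqI: "(f has_derivative f') (at x) \<Longrightarrow> grad f x $ i = f' (axis i 1)"
  by (simp add: grad_def dir_deriv_eqI)

lemma grad_cong_ev: "\<forall>\<^sub>F y in nhds x. f y = g y \<Longrightarrow> grad f x = grad g x"
  by (simp add: grad_def dir_deriv_cong_ev(1)[of f g])

lemma jac_matrix_nth: "jac_matrix f x $ i $ j = dir_deriv f (axis j 1) x $ i"
  by (simp add: jac_matrix_def matrix_def)

lemma jac_matrix_row:
  assumes "smooth_at x f" shows "jac_matrix f x $ i = grad (\<lambda>x. f x $ i) x"
proof -
  have "((\<lambda>x. f x $ i) has_derivative (\<lambda>v. dir_deriv f v x $ i)) (at x)"
    by (rule bounded_linear.has_derivative[OF bounded_linear_vec_nth smooth_at_has_derivative[OF assms]])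
  then show ?thesis by (simp add: vec_eq_iff jac_matrix_nth grad_eqI)
qed

lemma grad_compose:
  fixes \<psi> :: "real^3 \<Rightarrow> real^3"
  assumes "smooth_at x \<psi>" "smooth_at (\<psi> x) u"
  shows "grad (\<lambda>x. u (\<psi> x)) x = grad u (\<psi> x) v* jac_matrix \<psi> x"
proof -
  have "grad (\<lambda>x. u (\<psi> x)) x $ j = dir_deriv u (dir_deriv \<psi> (axis j 1) x) (\<psi> x)" for j
    using dir_deriv_compose(1)[OF assms[THEN smooth_at_differentiable]] by (simp add: grad_def)
  then show ?thesis
    by (simp add: dir_deriv_grad[OF assms(2)] vec_eq_iff vector_matrix_mult_def jac_matrix_nth mult.commute)
qed

text \<open>The Poisson structures on \<open>\<real>\<^sup>3\<close> under consideration have the brackets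
  \<open>{u, v} = g * triple (grad u) (grad v) (grad f)\<close>.\<close>

definition linear_form :: "(real^3 \<Rightarrow> real) \<Rightarrow> (real^3 \<Rightarrow> real) \<Rightarrow> (real^3 \<Rightarrow> real^3) \<Rightarrow> (3 \<Rightarrow> 3 \<Rightarrow> 3 \<Rightarrow> real) \<Rightarrow> bool" where
  "linear_form g f w c \<longleftrightarrow> smooth_at 0 w \<and> w 0 = 0 \<and> det (jac_matrix w 0) \<noteq> 0 \<and>
     (\<forall>\<^sub>F x in nhds 0. \<forall>i j. g x * triple (grad (\<lambda>x. w x $ i) x) (grad (\<lambda>x. w x $ j) x) (grad f x) =
        (\<Sum>k\<in>UNIV. c i j k * w x $ k))"

lemma isCont_eventually: "isCont f x \<Longrightarrow> \<forall>\<^sub>F y in nhds (f x). P y \<Longrightarrow> \<forall>\<^sub>F y in nhds x. P (f y)"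
  using isCont_tendsto_nhds[of x f] by (simp add: filterlim_iff)

text \<open>A triple product of pulled back gradients acquires the factor det J. With the gradient
  of f' o \<psi> equal to l times that of f, the condition on the densities says exactly that \<psi>
  carries the bracket of (g, f) to that of (g', f'). Proportional gradients instead of equal
  functions allow the Casimir function to be reparametrised.\<close>

lemma linear_form_transform:
  fixes \<psi> :: "real^3 \<Rightarrow> real^3"
  assumes lf: "linear_form g' f' w c"
    and \<psi>: "smooth_at 0 \<psi>" "\<psi> 0 = 0" "det (jac_matrix \<psi> 0) \<noteq> 0" and f': "smooth_at 0 f'"
    and ev: "\<forall>\<^sub>F x in nhds 0. grad (\<lambda>x. f' (\<psi> x)) x = l x *\<^sub>R grad f x \<and> l x \<noteq> 0 \<and>
      g' (\<psi> x) * l x = g x * det (jac_matrix \<psi> x)"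
  shows "linear_form g f (\<lambda>x. w (\<psi> x)) c"
proof -
  have w: "smooth_at 0 w" "w 0 = 0" "det (jac_matrix w 0) \<noteq> 0" using lf by (auto simp: linear_form_def)
  have sw: "smooth_at 0 (\<lambda>x. w (\<psi> x))" by (rule smooth_at_compose[OF \<psi>(1)]) (simp add: \<psi> w)
  have row: "grad (\<lambda>x. w (\<psi> x) $ i) x = grad (\<lambda>x. w x $ i) (\<psi> x) v* jac_matrix \<psi> x"
    if "smooth_at x \<psi>" "smooth_at (\<psi> x) w" for i x
    using grad_compose[OF that(1), of "\<lambda>x. w x $ i"] that by (simp add: smooth_at_component)
  have "jac_matrix (\<lambda>x. w (\<psi> x)) 0 = jac_matrix w 0 ** jac_matrix \<psi> 0"
    using row[of 0] w \<psi> jac_matrix_row[OF sw] jac_matrix_row[OF w(1)]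
    by (simp add: vec_eq_iff vector_matrix_mult_def matrix_matrix_mult_def mult.commute)
  then have d: "det (jac_matrix (\<lambda>x. w (\<psi> x)) 0) \<noteq> 0" using w \<psi> by (simp add: det_mul)
  have c\<psi>: "isCont \<psi> 0" by (rule smooth_at_isCont[OF \<psi>(1)])
  have ev2: "\<forall>\<^sub>F x in nhds 0. P (\<psi> x)" if "\<forall>\<^sub>F x in nhds 0. P x" for P
    by (rule isCont_eventually[OF c\<psi>]) (simp add: that \<psi>)
  have "\<forall>\<^sub>F x in nhds 0. \<forall>i j. g' x * triple (grad (\<lambda>x. w x $ i) x) (grad (\<lambda>x. w x $ j) x) (grad f' x) =
        (\<Sum>k\<in>UNIV. c i j k * w x $ k)" using lf by (simp add: linear_form_def)
  from ev2[OF this] ev2[OF smooth_at_eventually[OF w(1)]] ev2[OF smooth_at_eventually[OF f']]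
    smooth_at_eventually[OF \<psi>(1)] ev
  have "\<forall>\<^sub>F x in nhds 0. \<forall>i j. g x * triple (grad (\<lambda>x. w (\<psi> x) $ i) x) (grad (\<lambda>x. w (\<psi> x) $ j) x) (grad f x) =
        (\<Sum>k\<in>UNIV. c i j k * w (\<psi> x) $ k)"
  proof eventually_elim
    case (elim x)
    show ?case
    proof (intro allI)
      fix i j
      let ?a = "grad (\<lambda>x. w x $ i) (\<psi> x)" and ?b = "grad (\<lambda>x. w x $ j) (\<psi> x)" and ?J = "jac_matrix \<psi> x"
      have "l x * triple (?a v* ?J) (?b v* ?J) (grad f x) = triple (?a v* ?J) (?b v* ?J) (grad f' (\<psi> x) v* ?J)"
        using elim grad_compose[of x \<psi> f'] by (simp add: triple_scaleR)
      also have "\<dots> = triple ?a ?b (grad f' (\<psi> x)) * det ?J" by (rule triple_vector_matrix_mult)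
      finally have "l x * (g x * triple (?a v* ?J) (?b v* ?J) (grad f x)) =
          (g x * det ?J) * triple ?a ?b (grad f' (\<psi> x))" by (simp add: mult.commute mult.left_commute)
      also have "\<dots> = l x * (g' (\<psi> x) * triple ?a ?b (grad f' (\<psi> x)))"
      proof -
        have "g x * det ?J = g' (\<psi> x) * l x" using elim by simp
        then show ?thesis by (simp only: ac_simps)
      qed
      finally have "g x * triple (?a v* ?J) (?b v* ?J) (grad f x) = g' (\<psi> x) * triple ?a ?b (grad f' (\<psi> x))"
        using elim by simp
      then show "g x * triple (grad (\<lambda>x. w (\<psi> x) $ i) x) (grad (\<lambda>x. w (\<psi> x) $ j) x) (grad f x) =
          (\<Sum>k\<in>UNIV. c i j k * w (\<psi> x) $ k)"
        using elim row by simp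
    qed
  qed
  then show ?thesis using sw d w \<psi> by (simp add: linear_form_def)
qed

definition quad :: "real^3 \<Rightarrow> real" where "quad x = (x$1)\<^sup>2 + (x$2)\<^sup>2 - (x$3)\<^sup>2"

lemma smooth_quad: "smooth_at x quad"
  unfolding quad_def[abs_def]
  by (intro smooth_at_diff smooth_at_add smooth_at_power smooth_at_component smooth_at_ident)

lemma has_derivative_quad:
  "(quad has_derivative (\<lambda>h. 2 * x$1 * h$1 + 2 * x$2 * h$2 - 2 * x$3 * h$3)) (at x within S)"
  unfolding quad_def[abs_def]
  by (rule has_derivative_eq_rhs, (rule derivative_intros bounded_linear.has_derivative[OF bounded_linear_vec_nth])+)
    (auto simp: fun_eq_iff)

lemma grad_quad: "grad quad x = vector [2 * x$1, 2 * x$2, - 2 * x$3]"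
  by (simp add: vec_eq_iff forall_3 grad_eqI[OF has_derivative_quad] axis_def)

lemma linear_form_quad: "\<exists>w c. linear_form (\<lambda>x. 1) quad w c"
proof (intro exI)
  let ?w = "\<lambda>x::real^3. x"
  have g: "grad (\<lambda>x. x $ i) x = axis i 1" for i :: 3 and x
    by (simp add: vec_eq_iff grad_eqI[OF bounded_linear_imp_has_derivative[OF bounded_linear_vec_nth]] axis_def)
  let ?c = "\<lambda>i j k. if k = 3 then - 2 * triple (axis i 1) (axis j 1) (axis k 1) else 2 * triple (axis i 1) (axis j 1) (axis k 1)"
  have "jac_matrix ?w 0 = mat 1"
    using jac_matrix_row[OF smooth_at_ident, of 0] by (simp add: vec_eq_iff g axis_def mat_def)
  moreover have "triple a b (grad quad x) = (\<Sum>k\<in>UNIV. (if k = 3 then - 2 * triple a b (axis k 1) else 2 * triple a b (axis k 1)) * x $ k)" for a b x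
    by (simp add: sum_3 triple_eq grad_quad axis_def algebra_simps)
  ultimately show "linear_form (\<lambda>x. 1) quad ?w ?c"
    by (simp add: linear_form_def g)
qed

subsection \<open>Rotationally symmetric densities\<close>

lemma has_derivative_pair_compose:
  fixes F :: "real \<times> real \<Rightarrow> real"
  assumes "smooth_at (a x, b x) F" "(a has_derivative a') (at x)" "(b has_derivative b') (at x)"
  shows "((\<lambda>x. F (a x, b x)) has_derivative
    (\<lambda>h. a' h * dir_deriv F (1, 0) (a x, b x) + b' h * dir_deriv F (0, 1) (a x, b x))) (at x)"
proof -
  have d: "((\<lambda>x. F (a x, b x)) has_derivative (\<lambda>h. dir_deriv F (a' h, b' h) (a x, b x))) (at x)"
    using smooth_at_has_derivative_compose[OF _ has_derivative_Pair[OF assms(2,3)], of F] assms(1) by simp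
  have "dir_deriv F (p, q) z = p * dir_deriv F (1, 0) z + q * dir_deriv F (0, 1) z"
    if "smooth_at z F" for p q z
    using dir_deriv_plus[OF that, of "(p, 0)" "(0, q)"] dir_deriv_smult[OF that, of p "(1, 0)"]
      dir_deriv_smult[OF that, of q "(0, 1)"] by simp
  from this[OF assms(1)] show ?thesis
    by (intro has_derivative_eq_rhs[OF d] ext)
qed

text \<open>With q the value of \<open>quad\<close> and s = z^2, the sum s + q is the squared
  distance from the z-axis. So this splits off the value on the axis and divides the rest by x^2 +
  y^2.\<close>

lemma hadamard_antidiagonal:
  fixes \<phi> :: "real \<times> real \<Rightarrow> real"
  assumes "smooth \<phi>"
  obtains \<phi>1 where "smooth \<phi>1" "\<And>q s. \<phi> (q, s) = \<phi> (q, - q) + (s + q) * \<phi>1 (q, s)"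
proof -
  let ?g = "dir_deriv \<phi> (0, 1)"
  have sg: "smooth ?g" using assms by (auto intro: smooth_at_dir_deriv)
  let ?F = "\<lambda>z :: (real \<times> real) \<times> real. ?g (fst (fst z), - fst (fst z) + snd z * (snd (fst z) + fst (fst z)))"
  let ?\<phi>1 = "\<lambda>z. integral {0..1} (\<lambda>\<tau>. ?F (z, \<tau>))"
  have "smooth ?F"
    by (intro allI smooth_at_compose_smooth[OF sg])
      (intro smooth_at_Pair smooth_at_add smooth_at_minus smooth_at_mult smooth_at_fst smooth_at_snd smooth_at_ident)
  then have "smooth ?\<phi>1" by (rule smooth_integral_parameter)
  moreover have "\<phi> (q, s) = \<phi> (q, - q) + (s + q) * ?\<phi>1 (q, s)" for q s
  proof -
    have "((\<lambda>\<tau>. dir_deriv \<phi> (0, s + q) ((q, - q) + \<tau> *\<^sub>R (0, s + q))) has_integral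
        \<phi> ((q, - q) + 1 *\<^sub>R (0, s + q)) - \<phi> (q, - q)) {0..1}"
      by (rule integral_dir_deriv_segment[OF assms]) simp
    moreover have "dir_deriv \<phi> (0, s + q) z = (s + q) * ?g z" for z
      using dir_deriv_smult[of z \<phi> "s + q" "(0, 1)"] assms by simp
    ultimately have "((\<lambda>\<tau>. (s + q) * ?F ((q, s), \<tau>)) has_integral \<phi> (q, s) - \<phi> (q, - q)) {0..1}" by simp
    from integral_unique[OF this] show ?thesis by simp
  qed
  ultimately show thesis by (rule that)
qed

text \<open>The function \<open>\<zeta>\<close> is, on each level set of \<open>quad\<close>, a primitive of the density \<open>C\<close>,
  normalised such that \<open>\<zeta>\<^sup>2 + q k\<^sup>2\<close> is divisible by \<open>q + z\<^sup>2\<close>.\<close>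

lemma exists_action_function:
  fixes C :: "real \<times> real \<Rightarrow> real"
  assumes "smooth C" "C (0, 0) > 0"
  obtains k K \<zeta> where "smooth k" "smooth K" "smooth \<zeta>"
    "\<And>q z. (q + z\<^sup>2) * K (q, z) = (\<zeta> (q, z))\<^sup>2 + q * (k q)\<^sup>2"
    "\<forall>\<^sub>F p in nhds (0, 0). dir_deriv \<zeta> (0, 1) p = C p" "k 0 > 0" "K (0, 0) > 0" "\<zeta> (0, 0) = 0"
proof -
  let ?J = "\<lambda>z. integral {0..1} (\<lambda>\<tau>. C (fst z, \<tau> * snd z))"
  have "smooth (\<lambda>z :: (real \<times> real) \<times> real. C (fst (fst z), snd z * snd (fst z)))"
    by (intro allI smooth_at_compose_smooth[OF assms(1)])
      (intro smooth_at_Pair smooth_at_mult smooth_at_fst smooth_at_snd smooth_at_ident)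
  note sF = this
  from smooth_integral_parameter[OF this] have sJ: "smooth ?J" by simp
  have sJ': "smooth (\<lambda>z. ?J (fst z, - snd z))"
    by (rule allI, rule smooth_at_compose_smooth[OF sJ])
      (intro smooth_at_Pair smooth_at_minus smooth_at_fst smooth_at_snd smooth_at_ident)
  \<comment> \<open>\<open>z * ?J\<close> is the primitive of \<open>C\<close> in \<open>z\<close>
    that vanishes at z = 0. Its odd part is \<open>z * ?E\<close> and its even part is
    \<open>?N\<close>; both \<open>?E\<close> and \<open>?N\<close> are even in \<open>z\<close>,
    hence functions of q and z^2.\<close>
  let ?E = "\<lambda>z. (?J z + ?J (fst z, - snd z)) / 2" and ?N = "\<lambda>z. snd z * (?J z - ?J (fst z, - snd z)) / 2"
  have sE: "smooth ?E" and sN: "smooth ?N"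
    using sJ sJ' by (auto intro!: smooth_at_divide smooth_at_add smooth_at_diff smooth_at_mult smooth_at_snd)
  obtain e where e: "smooth e" "\<forall>\<^sub>F z in nhds (0, 0). e (fst z, (snd z)\<^sup>2) = ?E z"
    by (rule smooth_even_is_function_of_square[OF sE]) (auto simp: add.commute)
  obtain n where n: "smooth n" "\<forall>\<^sub>F z in nhds (0, 0). n (fst z, (snd z)\<^sup>2) = ?N z"
    by (rule smooth_even_is_function_of_square[OF sN]) (auto simp: algebra_simps)
  obtain e1 where e1: "smooth e1" "\<And>q s. e (q, s) = e (q, - q) + (s + q) * e1 (q, s)"
    by (rule hadamard_antidiagonal[OF e(1)]) blast
  obtain n1 where n1: "smooth n1" "\<And>q s. n (q, s) = n (q, - q) + (s + q) * n1 (q, s)"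
    by (rule hadamard_antidiagonal[OF n(1)]) blast
  \<comment> \<open>On the axis s = - q the function \<open>?E\<close> has the value
    \<open>k q\<close>, which becomes the leading coefficient of \<zeta>. The value of
    \<open>?N\<close> there depends on q alone and is dropped, which leaves the z-derivative intact.
    The remainders are multiples of q + z^2 and are collected in \<open>m\<close>.\<close>
  define k where "k q = e (q, - q)" for q
  define m where "m z = snd z * e1 (fst z, (snd z)\<^sup>2) + n1 (fst z, (snd z)\<^sup>2)" for z
  define \<zeta> where "\<zeta> z = snd z * k (fst z) + (fst z + (snd z)\<^sup>2) * m z" for z
  \<comment> \<open>\<open>K\<close> is the quotient of \<zeta>^2 + q k^2 by q + z^2. It exists
    because \<zeta> is z k modulo q + z^2, and z^2 k^2 + q k^2 = (q + z^2) k^2.\<close>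
  define K where "K z = (k (fst z))\<^sup>2 + 2 * snd z * k (fst z) * m z + (fst z + (snd z)\<^sup>2) * (m z)\<^sup>2" for z
  have sq: "smooth (\<lambda>z :: real \<times> real. (fst z, (snd z)\<^sup>2))"
    by (intro allI smooth_at_Pair smooth_at_power smooth_at_fst smooth_at_snd smooth_at_ident)
  have sk: "smooth k"
    unfolding k_def[abs_def]
    by (intro allI smooth_at_compose_smooth[OF e(1)] smooth_at_Pair smooth_at_minus smooth_at_ident)
  have skf: "smooth (\<lambda>z :: real \<times> real. k (fst z))"
    by (intro allI smooth_at_compose_smooth[OF sk] smooth_at_fst smooth_at_ident)
  have sm: "smooth m"
    unfolding m_def[abs_def]
    by (intro allI smooth_at_add smooth_at_mult smooth_at_compose_smooth[OF e1(1)] smooth_at_compose_smooth[OF n1(1)]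
        smooth_at_snd smooth_at_ident) (use sq in auto)
  have s\<zeta>: "smooth \<zeta>" and sK: "smooth K"
    unfolding \<zeta>_def[abs_def] K_def[abs_def] using sm skf
    by (auto intro!: smooth_at_add smooth_at_mult smooth_at_power smooth_at_snd smooth_at_fst)
  have id: "(q + z\<^sup>2) * K (q, z) = (\<zeta> (q, z))\<^sup>2 + q * (k q)\<^sup>2" for q z
    by (simp add: K_def \<zeta>_def power2_eq_square algebra_simps)
  have e0: "e (0, 0) = C (0, 0)" using eventually_nhds_x_imp_x[OF e(2)] by simp
  have \<zeta>J: "\<forall>\<^sub>F z in nhds (0, 0). \<zeta> z = snd z * ?J z - n (fst z, - fst z)"
    using e(2) n(2)
  proof eventually_elim
    case (elim z)
    let ?q = "fst z" and ?z = "snd z"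
    have "\<zeta> z = ?z * (k ?q + (?z\<^sup>2 + ?q) * e1 (?q, ?z\<^sup>2)) + (?z\<^sup>2 + ?q) * n1 (?q, ?z\<^sup>2)"
      by (simp add: \<zeta>_def m_def algebra_simps)
    also have "\<dots> = ?z * e (?q, ?z\<^sup>2) + n (?q, ?z\<^sup>2) - n (?q, - ?q)"
      using e1(2)[of ?q "?z\<^sup>2"] n1(2)[of ?q "?z\<^sup>2"] by (simp add: k_def)
    also have "?z * e (?q, ?z\<^sup>2) + n (?q, ?z\<^sup>2) = ?z * ?J z"
      unfolding elim by (simp add: field_simps)
    finally show ?case .
  qed
  have dJ: "dir_deriv (\<lambda>z. snd z * ?J z - n (fst z, - fst z)) (0, 1) (q, z) = C (q, z)" for q z
  proof -
    let ?P = "\<lambda>z. snd z * ?J z - n (fst z, - fst z)"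
    let ?D = "dir_deriv C (0, 1)"
    let ?F = "\<lambda>z :: (real \<times> real) \<times> real. C (fst (fst z), snd z * snd (fst z))"
    have "dir_deriv ?F ((0, 1), 0) ((q, z), \<tau>) = \<tau> * ?D (q, \<tau> * z)" for \<tau>
    proof -
      have "(?F has_derivative (\<lambda>h. fst (fst h) * dir_deriv C (1, 0) (fst (fst ((q, z), \<tau>)), snd ((q, z), \<tau>) * snd (fst ((q, z), \<tau>))) +
          (\<tau> * snd (fst h) + snd h * z) * ?D (fst (fst ((q, z), \<tau>)), snd ((q, z), \<tau>) * snd (fst ((q, z), \<tau>))))) (at ((q, z), \<tau>))"
      proof (rule has_derivative_pair_compose)
        show "((\<lambda>z :: (real \<times> real) \<times> real. fst (fst z)) has_derivative (\<lambda>h. fst (fst h))) (at ((q, z), \<tau>))"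
          by (intro has_derivative_fst has_derivative_ident)
        have "((\<lambda>z :: (real \<times> real) \<times> real. snd z * snd (fst z)) has_derivative
            (\<lambda>h. snd ((q, z), \<tau>) * snd (fst h) + snd h * snd (fst ((q, z), \<tau>)))) (at ((q, z), \<tau>))"
          by (intro has_derivative_mult has_derivative_fst has_derivative_snd has_derivative_ident)
        then show "((\<lambda>z :: (real \<times> real) \<times> real. snd z * snd (fst z)) has_derivative
            (\<lambda>h. \<tau> * snd (fst h) + snd h * z)) (at ((q, z), \<tau>))" by simp
      qed (use assms in simp)
      from dir_deriv_eqI[OF this] show ?thesis by simp
    qed
    then have DJ: "(?J has_derivative (\<lambda>v. integral {0..1} (\<lambda>\<tau>. dir_deriv ?F (v, 0) ((q, z), \<tau>)))) (at (q, z))"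
      and J1: "integral {0..1} (\<lambda>\<tau>. dir_deriv ?F ((0, 1), 0) ((q, z), \<tau>)) = integral {0..1} (\<lambda>\<tau>. \<tau> * ?D (q, \<tau> * z))"
      using has_derivative_integral_parameter[of ?F 0 1 "(q, z)"] sF by auto
    have sD: "smooth ?D" using assms by (auto intro: smooth_at_dir_deriv)
    have cont: "continuous_on S (\<lambda>\<tau>. G (q, \<tau> * z))" if "smooth G" for S and G :: "real \<times> real \<Rightarrow> real"
      by (intro smooth_at_continuous_on smooth_at_compose_smooth[OF that] smooth_at_Pair smooth_at_mult
          smooth_at_const smooth_at_ident)
    \<comment> \<open>The integrand is the \<tau>-derivative of \<tau> C(q, \<tau> z). Integrated
      over [0, 1] it shows that C is ?J plus z times the z-derivative of ?J, that is, the
      z-derivative of z ?J.\<close>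
    have "((\<lambda>\<tau>. C (q, \<tau> * z) + z * (\<tau> * ?D (q, \<tau> * z))) has_integral 1 * C (q, 1 * z) - 0 * C (q, 0 * z)) {0..1}"
    proof (rule fundamental_theorem_of_calculus)
      fix \<tau> :: real
      have "((\<lambda>\<tau>. \<tau> * z) has_derivative (\<lambda>h. h * z)) (at \<tau>)"
        by (intro has_derivative_mult_left has_derivative_ident)
      from has_derivative_pair_compose[OF _ has_derivative_const this, of q C] assms(1)
      have "((\<lambda>\<tau>. C (q, \<tau> * z)) has_derivative (\<lambda>h. 0 * dir_deriv C (1, 0) (q, \<tau> * z) + h * z * ?D (q, \<tau> * z))) (at \<tau>)"
        by blast
      from has_derivative_mult[OF has_derivative_ident this]
      have "((\<lambda>\<tau>. \<tau> * C (q, \<tau> * z)) has_derivative (\<lambda>h. h *\<^sub>R (C (q, \<tau> * z) + z * (\<tau> * ?D (q, \<tau> * z))))) (at \<tau>)"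
        by (rule has_derivative_eq_rhs) (simp add: fun_eq_iff algebra_simps)
      then show "((\<lambda>\<tau>. \<tau> * C (q, \<tau> * z)) has_vector_derivative (C (q, \<tau> * z) + z * (\<tau> * ?D (q, \<tau> * z)))) (at \<tau> within {0..1})"
        unfolding has_vector_derivative_def by (rule has_derivative_at_withinI)
    qed simp
    then have "C (q, z) = integral {0..1} (\<lambda>\<tau>. C (q, \<tau> * z) + z * (\<tau> * ?D (q, \<tau> * z)))"
      by (simp add: integral_unique)
    also have "\<dots> = integral {0..1} (\<lambda>\<tau>. C (q, \<tau> * z)) + integral {0..1} (\<lambda>\<tau>. z * (\<tau> * ?D (q, \<tau> * z)))"
      by (intro Henstock_Kurzweil_Integration.integral_add integrable_continuous_interval continuous_on_mult
          continuous_on_const continuous_on_id cont assms sD)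
    finally have C: "C (q, z) = ?J (q, z) + z * integral {0..1} (\<lambda>\<tau>. \<tau> * ?D (q, \<tau> * z))" by simp
    have "((\<lambda>z. snd z * ?J z) has_derivative (\<lambda>h. snd (q, z) * integral {0..1} (\<lambda>\<tau>. dir_deriv ?F (h, 0) ((q, z), \<tau>)) +
        snd h * ?J (q, z))) (at (q, z))"
      by (intro has_derivative_mult has_derivative_snd has_derivative_ident DJ)
    moreover have "((\<lambda>z. n (fst z, - fst z)) has_derivative (\<lambda>h. fst h * dir_deriv n (1, 0) (fst (q, z), - fst (q, z)) +
        - fst h * dir_deriv n (0, 1) (fst (q, z), - fst (q, z)))) (at (q, z))"
      by (intro has_derivative_pair_compose has_derivative_minus has_derivative_fst has_derivative_ident) (use n in simp)
    ultimately have "(?P has_derivative (\<lambda>h. (snd (q, z) * integral {0..1} (\<lambda>\<tau>. dir_deriv ?F (h, 0) ((q, z), \<tau>)) +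
        snd h * ?J (q, z)) - (fst h * dir_deriv n (1, 0) (fst (q, z), - fst (q, z)) +
        - fst h * dir_deriv n (0, 1) (fst (q, z), - fst (q, z))))) (at (q, z))"
      by (rule has_derivative_diff)
    from dir_deriv_eqI[OF this] show ?thesis using C by (simp add: J1)
  qed
  have "\<forall>\<^sub>F p in nhds (0, 0). dir_deriv \<zeta> (0, 1) p = C p"
  proof -
    have "\<forall>\<^sub>F p in nhds (0, 0). \<forall>\<^sub>F z in nhds p. \<zeta> z = snd z * ?J z - n (fst z, - fst z)"
      using \<zeta>J by (simp add: eventually_eventually)
    then show ?thesis
    proof eventually_elim
      case (elim p)
      show ?case using dir_deriv_cong_ev(1)[OF elim, of "(0, 1)"] dJ[of "fst p" "snd p"] by simp
    qed
  qed
  moreover have "k 0 > 0" "K (0, 0) > 0" "\<zeta> (0, 0) = 0"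
    using e0 assms(2) by (auto simp: k_def K_def \<zeta>_def)
  ultimately show thesis using that[OF sk sK s\<zeta> id] by blast
qed

section \<open>Rotations about the third axis\<close>

definition rot :: "real \<Rightarrow> real^3 \<Rightarrow> real^3" where
  "rot t x = vector [x$1 * cos t - x$2 * sin t, x$1 * sin t + x$2 * cos t, x$3]"

lemma rot_nth [simp]: "rot t x $ 1 = x$1 * cos t - x$2 * sin t" "rot t x $ 2 = x$1 * sin t + x$2 * cos t"
  "rot t x $ 3 = x$3"
  by (simp_all add: rot_def)

lemma rot_rot: "rot t (rot s x) = rot (t + s) x"
  by (simp add: vec_eq_iff forall_3 cos_add sin_add algebra_simps)

lemma rot_2pi: "rot (2 * pi) x = x" and rot_0: "rot 0 x = x"
  by (simp_all add: vec_eq_iff forall_3)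

lemma quad_rot: "quad (rot t x) = quad x"
proof -
  have "(a * c - b * s)\<^sup>2 + (a * s + b * c)\<^sup>2 = (a\<^sup>2 + b\<^sup>2) * (s\<^sup>2 + c\<^sup>2)" for a b c s :: real
    by (simp add: power2_eq_square algebra_simps)
  from this[of "x$1" "cos t" "x$2" "sin t"]
  show ?thesis by (simp add: quad_def)
qed

lemma smooth_at_vector_3:
  "smooth_at x a \<Longrightarrow> smooth_at x b \<Longrightarrow> smooth_at x c \<Longrightarrow> smooth_at x (\<lambda>x. vector [a x, b x, c x] :: real^3)"
  by (simp add: smooth_at_vec_iff forall_3)

lemma smooth_at_rot: "smooth_at x t \<Longrightarrow> smooth_at x f \<Longrightarrow> smooth_at x (\<lambda>x. rot (t x) (f x))"
  unfolding rot_def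
  by (intro smooth_at_vector_3 smooth_at_diff smooth_at_add smooth_at_mult smooth_at_cos smooth_at_sin smooth_at_component)

lemma jac_matrix_eqI:
  fixes w :: "real^3 \<Rightarrow> real^3"
  assumes "smooth_at x w" "\<And>i. ((\<lambda>x. w x $ i) has_derivative D i) (at x)"
  shows "jac_matrix w x $ i $ j = D i (axis j 1)"
  using jac_matrix_row[OF assms(1)] grad_eqI[OF assms(2)] by simp

text \<open>The left side is the Jacobian determinant of (\<kappa> x1, \<kappa> x2, \<zeta>) at (x1,
  x2, z), where \<kappa> and \<zeta> depend on q = x1^2 + x2^2 - z^2 and z. \<open>D1\<close> and
  \<open>D2\<close> are the q- and z-derivatives of a relation \<kappa>^2 (q + z^2) = \<zeta>^2 +
  H(q), with h = H'(q). They make the terms with \<zeta>q cancel.\<close>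

lemma jacobian_det_identity:
  fixes \<kappa> :: real
  assumes D1: "2 * \<kappa> * \<kappa>q * (x1\<^sup>2 + x2\<^sup>2) + \<kappa>\<^sup>2 = h + 2 * \<zeta> * \<zeta>q"
    and D2: "2 * \<kappa> * \<kappa>z * (x1\<^sup>2 + x2\<^sup>2) + 2 * z * \<kappa>\<^sup>2 = 2 * \<zeta> * \<zeta>z"
  shows "(\<kappa> + 2 * x1 * \<kappa>q * x1) * (\<kappa> + 2 * x2 * \<kappa>q * x2) * (\<zeta>z - 2 * z * \<zeta>q)
    + (2 * x2 * \<kappa>q * x1) * ((\<kappa>z - 2 * z * \<kappa>q) * x2) * (2 * x1 * \<zeta>q)
    + ((\<kappa>z - 2 * z * \<kappa>q) * x1) * (2 * x1 * \<kappa>q * x2) * (2 * x2 * \<zeta>q)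
    - (\<kappa> + 2 * x1 * \<kappa>q * x1) * ((\<kappa>z - 2 * z * \<kappa>q) * x2) * (2 * x2 * \<zeta>q)
    - (2 * x2 * \<kappa>q * x1) * (2 * x1 * \<kappa>q * x2) * (\<zeta>z - 2 * z * \<zeta>q)
    - ((\<kappa>z - 2 * z * \<kappa>q) * x1) * (\<kappa> + 2 * x2 * \<kappa>q * x2) * (2 * x1 * \<zeta>q) = \<zeta>z * h"
    (is "?L = _")
proof -
  have "?L = \<zeta>z * (2 * \<kappa> * \<kappa>q * (x1\<^sup>2 + x2\<^sup>2) + \<kappa>\<^sup>2) - \<zeta>q * (2 * \<kappa> * \<kappa>z * (x1\<^sup>2 + x2\<^sup>2) + 2 * z * \<kappa>\<^sup>2)"
    by (simp add: power2_eq_square algebra_simps)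
  also have "\<dots> = \<zeta>z * h" unfolding D1 D2 by (simp add: algebra_simps)
  finally show ?thesis .
qed

lemma real_fun_derivative:
  fixes k :: "real \<Rightarrow> real"
  assumes "smooth_at (a x) k" "(a has_derivative a') (at x)"
  shows "((\<lambda>x. k (a x)) has_derivative (\<lambda>h. a' h * dir_deriv k 1 (a x))) (at x)"
proof -
  have d: "((\<lambda>x. k (a x)) has_derivative (\<lambda>h. dir_deriv k (a' h) (a x))) (at x)"
    by (rule smooth_at_has_derivative_compose[OF assms])
  have "dir_deriv k r (a x) = r * dir_deriv k 1 (a x)" for r
    using dir_deriv_smult[OF assms(1), of r 1] by simp
  then show ?thesis by (intro has_derivative_eq_rhs[OF d] ext)
qed

text \<open>The map \<psi> = (\<kappa> x, \<kappa> y, \<zeta>) pulls \<open>quad\<close> back to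
  h(quad) with h(q) = q k(q)^2, and near 0 its Jacobian determinant is a times h'(quad). The factor
  h' also appears in the gradient of the pulled back function, so the density 1 / a turns into
  1.\<close>

lemma linear_form_symmetric:
  assumes a: "smooth a" "\<And>t x. a (rot t x) = a x" "a 0 > 0"
  shows "\<exists>w c. linear_form (\<lambda>x. 1 / a x) quad w c"
proof -
  \<comment> \<open>Restriction of \<open>a\<close> to the plane of the first and third axes, with
    the third coordinate as parameter. The rotation by pi makes it even.\<close>
  let ?A = "\<lambda>z. a (vector [snd z, 0, fst z])"
  have sA: "smooth ?A"
    by (intro allI smooth_at_compose_smooth[OF a(1)] smooth_at_vector_3 smooth_at_const smooth_at_fst smooth_at_snd smooth_at_ident)
  have "rot pi (vector [x, 0, z]) = vector [- x, 0, z]" for x z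
    by (simp add: vec_eq_iff forall_3)
  then have even: "?A (p, - x) = ?A (p, x)" for p x using a(2)[of pi "vector [x, 0, p]"] by simp
  obtain B where B: "smooth B" "\<forall>\<^sub>F z in nhds (0, 0). B (fst z, (snd z)\<^sup>2) = ?A z"
    by (rule smooth_even_is_function_of_square[OF sA even]) blast
  let ?r = "\<lambda>x :: real^3. sqrt ((x$1)\<^sup>2 + (x$2)\<^sup>2)"
  have ar: "a x = ?A (x$3, ?r x)" for x
  proof -
    obtain r t where t: "x$1 = r * cos t" "x$2 = r * sin t" using polar_Ex[of "x$1" "x$2"] by blast
    have "rot t (vector [r, 0, x$3]) = x" using t by (simp add: vec_eq_iff forall_3)
    then have "a x = ?A (x$3, r)" using a(2)[of t "vector [r, 0, x$3]"] by simp
    also have "\<dots> = ?A (x$3, \<bar>r\<bar>)" using even[of "x$3" r] by (cases "r \<ge> 0") auto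
    also have "\<bar>r\<bar> = ?r x"
    proof -
      have "(x$1)\<^sup>2 + (x$2)\<^sup>2 = r\<^sup>2 * ((cos t)\<^sup>2 + (sin t)\<^sup>2)"
        unfolding t by (simp only: power_mult_distrib distrib_left)
      then show ?thesis by simp
    qed
    finally show ?thesis .
  qed
  have aB: "\<forall>\<^sub>F x in nhds 0. a x = B (x$3, (x$1)\<^sup>2 + (x$2)\<^sup>2)"
  proof -
    have "isCont (\<lambda>x :: real^3. (x$3, ?r x)) 0" by (intro continuous_intros)
    from isCont_eventually[OF this, of "\<lambda>z. B (fst z, (snd z)\<^sup>2) = ?A z"] B(2)
    have "\<forall>\<^sub>F x in nhds 0. B (x$3, (?r x)\<^sup>2) = ?A (x$3, ?r x)" by simp
    then show ?thesis using ar by (auto elim!: eventually_mono)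
  qed
  have B0: "B (0, 0) = a 0" using eventually_nhds_x_imp_x[OF aB] by simp
  \<comment> \<open>The density in the variables (q, z), where the squared radius is q + z^2.
    Through \<open>B\<close> it is defined also for q + z^2 < 0, where no point of space corresponds
    to (q, z).\<close>
  let ?C = "\<lambda>p. B (snd p, fst p + (snd p)\<^sup>2)"
  have sC: "smooth ?C"
    by (intro allI smooth_at_compose_smooth[OF B(1)] smooth_at_Pair smooth_at_add smooth_at_power smooth_at_fst smooth_at_snd smooth_at_ident)
  obtain k K \<zeta> where k: "smooth k" "smooth K" "smooth \<zeta>"
    and KZ: "\<And>q z. (q + z\<^sup>2) * K (q, z) = (\<zeta> (q, z))\<^sup>2 + q * (k q)\<^sup>2"
    and dz: "\<forall>\<^sub>F p in nhds (0, 0). dir_deriv \<zeta> (0, 1) p = ?C p"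
    and k0: "k 0 > 0" "K (0, 0) > 0" "\<zeta> (0, 0) = 0"
    by (rule exists_action_function[OF sC]) (use B0 a(3) in auto)
  let ?p = "\<lambda>x. (quad x, x$3)"
  let ?\<kappa> = "\<lambda>x. sqrt (K (?p x))"
  define \<psi> :: "real^3 \<Rightarrow> real^3" where "\<psi> x = vector [?\<kappa> x * x$1, ?\<kappa> x * x$2, \<zeta> (?p x)]" for x :: "real^3"
  let ?h = "\<lambda>q. q * (k q)\<^sup>2" and ?l = "\<lambda>x. dir_deriv (\<lambda>q. q * (k q)\<^sup>2) 1 (quad x)"
  have sh: "smooth ?h" using k(1) by (auto intro!: smooth_at_mult smooth_at_power)
  have sp: "smooth_at x ?p" for x
    by (intro smooth_at_Pair smooth_quad smooth_at_component smooth_at_ident)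
  have p0: "?p 0 = (0, 0)" by (simp add: quad_def)
  have cp: "isCont ?p 0" by (rule smooth_at_isCont[OF sp])
  have Kpos: "\<forall>\<^sub>F x in nhds 0. K (?p x) > 0"
  proof -
    have "isCont (\<lambda>x. K (?p x)) 0" by (rule smooth_at_isCont[OF smooth_at_compose_smooth[OF k(2) sp]])
    from isCont_eventually[OF this, of "\<lambda>y. y > 0"] k0(2) p0 eventually_eq_open[OF open_greaterThan[of 0]]
    show ?thesis by auto
  qed
  have s\<psi>: "smooth_at x \<psi>" if "K (?p x) > 0" for x
  proof -
    have s: "smooth_at x (\<lambda>x. K (?p x))" "smooth_at x (\<lambda>x. \<zeta> (?p x))"
      using smooth_at_compose_smooth[OF k(2) sp] smooth_at_compose_smooth[OF k(3) sp] .
    show ?thesis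
      unfolding \<psi>_def[abs_def]
      by (intro smooth_at_vector_3 smooth_at_mult smooth_at_sqrt s that smooth_at_component smooth_at_ident)
  qed
  have quad\<psi>: "quad (\<psi> x) = ?h (quad x)" if "K (?p x) > 0" for x
  proof -
    have "quad (\<psi> x) = K (?p x) * ((x$1)\<^sup>2 + (x$2)\<^sup>2) - (\<zeta> (?p x))\<^sup>2"
    proof -
      have "\<psi> x $ 1 = ?\<kappa> x * x$1" "\<psi> x $ 2 = ?\<kappa> x * x$2" "\<psi> x $ 3 = \<zeta> (?p x)" by (simp_all add: \<psi>_def)
      then show ?thesis
        unfolding quad_def[of "\<psi> x"] using that by (simp add: power_mult_distrib algebra_simps)
    qed
    moreover have "(x$1)\<^sup>2 + (x$2)\<^sup>2 = quad x + (x$3)\<^sup>2" by (simp add: quad_def)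
    ultimately show ?thesis using KZ[of "quad x" "x$3"] by (simp add: mult.commute)
  qed
  have det: "det (jac_matrix \<psi> x) = dir_deriv \<zeta> (0, 1) (?p x) * ?l x" if Kx: "K (?p x) > 0" for x
  proof -
    let ?q = "quad x" and ?z = "x$3" and ?\<rho> = "(x$1)\<^sup>2 + (x$2)\<^sup>2"
    let ?Kq = "dir_deriv K (1, 0) (?q, ?z)" and ?Kz = "dir_deriv K (0, 1) (?q, ?z)"
    let ?\<zeta>q = "dir_deriv \<zeta> (1, 0) (?q, ?z)" and ?\<zeta>z = "dir_deriv \<zeta> (0, 1) (?q, ?z)"
    let ?Q = "\<lambda>h :: real^3. 2 * x$1 * h$1 + 2 * x$2 * h$2 - 2 * x$3 * h$3"
    let ?k = "?\<kappa> x"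
    define \<kappa>q where "\<kappa>q = ?Kq / (2 * ?k)"
    define \<kappa>z where "\<kappa>z = ?Kz / (2 * ?k)"
    have kpos: "?k > 0" "?k\<^sup>2 = K (?q, ?z)" using Kx by auto
    have c: "((\<lambda>x. x $ i) has_derivative (\<lambda>h. h $ i)) (at x)" for i and x :: "real^3"
      by (rule bounded_linear_imp_has_derivative[OF bounded_linear_vec_nth])
    have DK: "((\<lambda>x. K (?p x)) has_derivative (\<lambda>h. ?Q h * ?Kq + h$3 * ?Kz)) (at x)"
      by (rule has_derivative_pair_compose[OF _ has_derivative_quad c]) (use k in simp)
    have D\<zeta>: "((\<lambda>x. \<zeta> (?p x)) has_derivative (\<lambda>h. ?Q h * ?\<zeta>q + h$3 * ?\<zeta>z)) (at x)"
      by (rule has_derivative_pair_compose[OF _ has_derivative_quad c]) (use k in simp)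
    have "((\<lambda>x. sqrt (K (?p x))) has_derivative (\<lambda>h. (?Q h * ?Kq + h$3 * ?Kz) * (1 / (2 * ?k)))) (at x)"
      using DK Kx by (auto intro!: derivative_eq_intros simp: field_simps)
    then have D\<kappa>: "(?\<kappa> has_derivative (\<lambda>h. ?Q h * \<kappa>q + h$3 * \<kappa>z)) (at x)"
      by (rule has_derivative_eq_rhs) (simp add: \<kappa>q_def \<kappa>z_def fun_eq_iff add_divide_distrib)
    have "((\<lambda>x. ?\<kappa> x * x $ i) has_derivative (\<lambda>h. ?k * h $ i + (?Q h * \<kappa>q + h$3 * \<kappa>z) * x $ i)) (at x)" for i
      by (rule has_derivative_mult[OF D\<kappa> c])
    then have "((\<lambda>x. \<psi> x $ i) has_derivative (\<lambda>h. if i = 3 then ?Q h * ?\<zeta>q + h$3 * ?\<zeta>z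
        else ?k * h $ i + (?Q h * \<kappa>q + h$3 * \<kappa>z) * x $ i)) (at x)" for i
      using exhaust_3[of i] D\<zeta> by (auto simp: \<psi>_def)
    note J = jac_matrix_eqI[OF s\<psi>[OF Kx] this]
    let ?l0 = "dir_deriv ?h 1 ?q"
    have dh: "(?h has_derivative (\<lambda>r. r * ?l0)) (at ?q)"
      using real_fun_derivative[of "\<lambda>x. x" ?q ?h "\<lambda>x. x"] sh by simp
    have k2: "((\<lambda>z. (fst z + (snd z)\<^sup>2) * K z) has_derivative
        (\<lambda>r. (fst r + 2 * ?z * snd r) * K (?q, ?z) + (?q + ?z\<^sup>2) * (fst r * ?Kq + snd r * ?Kz))) (at (?q, ?z))"
    proof -
      have "(K has_derivative (\<lambda>r. fst r * ?Kq + snd r * ?Kz)) (at (?q, ?z))"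
        using has_derivative_pair_compose[of fst "(?q, ?z)" snd K fst snd] k
        by (simp add: bounded_linear_imp_has_derivative bounded_linear_fst bounded_linear_snd)
      then show ?thesis
        by (auto intro!: derivative_eq_intros simp: fun_eq_iff algebra_simps)
    qed
    have z2: "((\<lambda>z. (\<zeta> z)\<^sup>2 + ?h (fst z)) has_derivative
        (\<lambda>r. 2 * \<zeta> (?q, ?z) * (fst r * ?\<zeta>q + snd r * ?\<zeta>z) + fst r * ?l0)) (at (?q, ?z))"
    proof -
      have "(\<zeta> has_derivative (\<lambda>r. fst r * ?\<zeta>q + snd r * ?\<zeta>z)) (at (?q, ?z))"
        using has_derivative_pair_compose[of fst "(?q, ?z)" snd \<zeta> fst snd] k
        by (simp add: bounded_linear_imp_has_derivative bounded_linear_fst bounded_linear_snd)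
      moreover have "((\<lambda>z. ?h (fst z)) has_derivative (\<lambda>r. fst r * ?l0)) (at (?q, ?z))"
        using real_fun_derivative[of fst "(?q, ?z)" ?h fst] sh by (simp add: bounded_linear_imp_has_derivative bounded_linear_fst)
      ultimately show ?thesis
        by (intro has_derivative_add) (auto intro!: derivative_eq_intros simp: fun_eq_iff algebra_simps)
    qed
    \<comment> \<open>Differentiating the identity \<open>KZ\<close> in both variables gives the two
      relations required by \<open>jacobian_det_identity\<close>.\<close>
    have eqf: "(\<lambda>z. (fst z + (snd z)\<^sup>2) * K z) = (\<lambda>z. (\<zeta> z)\<^sup>2 + ?h (fst z))"
      using KZ by (simp add: fun_eq_iff)
    have "(fst r + 2 * ?z * snd r) * K (?q, ?z) + (?q + ?z\<^sup>2) * (fst r * ?Kq + snd r * ?Kz) =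
        2 * \<zeta> (?q, ?z) * (fst r * ?\<zeta>q + snd r * ?\<zeta>z) + fst r * ?l0" for r
      using fun_cong[OF has_derivative_unique[OF k2[unfolded eqf] z2]] .
    from this[of "(1, 0)"] this[of "(0, 1)"]
    have R: "K (?q, ?z) + ?\<rho> * ?Kq = ?l0 + 2 * \<zeta> (?q, ?z) * ?\<zeta>q"
      "2 * ?z * K (?q, ?z) + ?\<rho> * ?Kz = 2 * \<zeta> (?q, ?z) * ?\<zeta>z"
      by (simp_all add: quad_def)
    have "2 * ?k * \<kappa>q = ?Kq" "2 * ?k * \<kappa>z = ?Kz" using kpos by (simp_all add: \<kappa>q_def \<kappa>z_def)
    then have "2 * ?k * \<kappa>q * ?\<rho> + ?k\<^sup>2 = ?l0 + 2 * \<zeta> (?q, ?z) * ?\<zeta>q"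
      "2 * ?k * \<kappa>z * ?\<rho> + 2 * ?z * ?k\<^sup>2 = 2 * \<zeta> (?q, ?z) * ?\<zeta>z"
      using R kpos(2) by (simp_all add: mult.commute)
    from jacobian_det_identity[OF this]
    show ?thesis by (simp add: det_3 J axis_def)
  qed
  have l0: "?l 0 > 0"
  proof -
    have "(?h has_derivative (\<lambda>r. 0 * (r * 0) + r * (k 0)\<^sup>2)) (at 0)"
    proof -
      have "((\<lambda>q. (k q)\<^sup>2) has_derivative (\<lambda>r. dir_deriv (\<lambda>q. (k q)\<^sup>2) r 0)) (at 0)"
        by (rule smooth_at_has_derivative) (use k in \<open>auto intro!: smooth_at_power\<close>)
      from has_derivative_mult[OF has_derivative_ident this] show ?thesis by simp
    qed
    from dir_deriv_eqI[OF this] show ?thesis using k0(1) by (simp add: quad_def)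
  qed
  have lne: "\<forall>\<^sub>F x in nhds 0. ?l x \<noteq> 0"
  proof -
    have "isCont ?l 0"
      using sh by (intro smooth_at_isCont smooth_at_compose_smooth[of "dir_deriv ?h 1"] smooth_quad)
        (auto intro: smooth_at_dir_deriv)
    from tendsto_imp_eventually_ne[OF isCont_tendsto_nhds[OF this]] l0 show ?thesis by simp
  qed
  have dzx: "\<forall>\<^sub>F x in nhds 0. dir_deriv \<zeta> (0, 1) (?p x) = ?C (?p x)"
    by (rule isCont_eventually[OF cp]) (use dz p0 in simp)
  have apos: "\<forall>\<^sub>F x in nhds 0. a x \<noteq> 0"
    by (rule tendsto_imp_eventually_ne[OF isCont_tendsto_nhds[OF smooth_at_isCont]]) (use a in auto)
  have det2: "\<forall>\<^sub>F x in nhds 0. det (jac_matrix \<psi> x) = a x * ?l x"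
    using dzx Kpos aB
  proof eventually_elim
    case (elim x)
    have "quad x + (x$3)\<^sup>2 = (x$1)\<^sup>2 + (x$2)\<^sup>2" by (simp add: quad_def)
    then show ?case using elim det[of x] by simp
  qed
  obtain w c where wc: "linear_form (\<lambda>x. 1) quad w c" using linear_form_quad by blast
  have "linear_form (\<lambda>x. 1 / a x) quad (\<lambda>x. w (\<psi> x)) c"
  proof (rule linear_form_transform[OF wc])
    show "smooth_at 0 \<psi>" by (rule s\<psi>) (use k0 p0 in simp)
    show "\<psi> 0 = 0" using k0(3) p0 by (simp add: \<psi>_def vec_eq_iff forall_3)
    show "det (jac_matrix \<psi> 0) \<noteq> 0"
      using eventually_nhds_x_imp_x[OF det2] a(3) l0 by simp
    show "\<forall>\<^sub>F x in nhds 0. grad (\<lambda>x. quad (\<psi> x)) x = ?l x *\<^sub>R grad quad x \<and> ?l x \<noteq> 0 \<and>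
      1 * ?l x = 1 / a x * det (jac_matrix \<psi> x)"
      using lne apos det2 eventually_eventually[THEN iffD2, OF Kpos]
    proof eventually_elim
      case (elim x)
      have "\<forall>\<^sub>F x in nhds x. quad (\<psi> x) = ?h (quad x)" using elim(4) quad\<psi> by (auto elim: eventually_mono)
      then have "grad (\<lambda>x. quad (\<psi> x)) x = grad (\<lambda>x. ?h (quad x)) x" by (rule grad_cong_ev)
      also have "\<dots> = ?l x *\<^sub>R grad quad x"
        using grad_eqI[OF real_fun_derivative[OF _ has_derivative_quad, of x ?h]] grad_eqI[OF has_derivative_quad] sh
        by (simp add: vec_eq_iff mult.commute)
      finally show ?case using elim by simp
    qed
  qed (rule smooth_quad)
  then show ?thesis by blast
qed

subsection \<open>Averaging over rotations\<close>

lemma has_derivative_rot: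
  "((\<lambda>t. rot t x) has_derivative (\<lambda>h. h *\<^sub>R vector [- (rot t x $ 2), rot t x $ 1, 0])) (at t within S)"
  unfolding has_derivative_componentwise_within[of "\<lambda>t. rot t x"]
proof
  fix i :: "real^3" assume "i \<in> Basis"
  then obtain j where i: "i = axis j 1" by (auto simp: Basis_vec_def)
  have "((\<lambda>t. rot t x $ j) has_derivative (\<lambda>h. (h *\<^sub>R (vector [- (rot t x $ 2), rot t x $ 1, 0] :: real^3)) $ j)) (at t within S)"
    using exhaust_3[of j] by (auto intro!: derivative_eq_intros simp: algebra_simps)
  then show "((\<lambda>t. rot t x \<bullet> i) has_derivative (\<lambda>h. (h *\<^sub>R vector [- (rot t x $ 2), rot t x $ 1, 0]) \<bullet> i)) (at t within S)"
    by (simp add: i inner_axis)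
qed

lemma has_vector_derivative_along_rot:
  assumes "smooth \<phi>"
  shows "((\<lambda>t. \<phi> (rot t x) :: real) has_vector_derivative
    dir_deriv \<phi> (vector [- (rot t x $ 2), rot t x $ 1, 0]) (rot t x)) (at t within S)"
proof -
  have "((\<lambda>t. \<phi> (rot t x)) has_derivative (\<lambda>h. dir_deriv \<phi> (h *\<^sub>R vector [- (rot t x $ 2), rot t x $ 1, 0]) (rot t x))) (at t within S)"
    by (rule smooth_at_has_derivative_compose[OF _ has_derivative_rot]) (use assms in simp)
  moreover have "dir_deriv \<phi> (h *\<^sub>R v) y = h *\<^sub>R dir_deriv \<phi> v y" for h v y
    by (rule dir_deriv_smult) (use assms in simp)
  ultimately show ?thesis unfolding has_vector_derivative_def by (simp only:)
qed

lemma smooth_along_rot: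
  assumes "smooth \<phi>" shows "smooth (\<lambda>z. \<phi> (rot (snd z) (fst z)))"
  by (intro allI smooth_at_compose_smooth[OF assms] smooth_at_rot smooth_at_fst smooth_at_snd smooth_at_ident)

lemma continuous_on_along_rot:
  assumes "smooth \<phi>" shows "continuous_on S (\<lambda>t. \<phi> (rot t x))"
  by (intro smooth_at_continuous_on smooth_at_compose_smooth[OF assms] smooth_at_rot smooth_at_const smooth_at_ident)

definition rot_mean :: "(real^3 \<Rightarrow> real) \<Rightarrow> real^3 \<Rightarrow> real" where
  "rot_mean a x = integral {0..2 * pi} (\<lambda>t. a (rot t x)) / (2 * pi)"

lemma smooth_rot_mean: assumes "smooth a" shows "smooth (rot_mean a)"
  using smooth_integral_parameter[OF smooth_along_rot[OF assms], of 0 "2 * pi"]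
  unfolding rot_mean_def[abs_def] by (auto intro!: smooth_at_divide)

lemma smooth_dir_deriv_rot_field:
  fixes \<phi> :: "real^3 \<Rightarrow> real"
  assumes "smooth \<phi>" shows "smooth (\<lambda>x. dir_deriv \<phi> (vector [- (x$2), x$1, 0]) x)"
proof -
  have "dir_deriv \<phi> (vector [- (x$2), x$1, 0]) x = - (x$2) * grad \<phi> x $ 1 + x$1 * grad \<phi> x $ 2" for x
    using dir_deriv_grad[of x \<phi> "vector [- (x$2), x$1, 0]"] assms by (simp add: sum_3)
  moreover have "smooth (\<lambda>x. - (x$2) * grad \<phi> x $ 1 + x$1 * grad \<phi> x $ 2)"
    unfolding grad_def using assms
    by (auto intro!: smooth_at_diff smooth_at_mult smooth_at_component smooth_at_dir_deriv)
  ultimately show ?thesis by simp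
qed

text \<open>The integrand depends on s + t alone, so its s-derivative is also its t-derivative, and
  the latter integrates to 0 over a full period.\<close>

lemma rot_mean_rot: assumes "smooth a" shows "rot_mean a (rot s x) = rot_mean a x"
proof -
  let ?\<phi> = "\<lambda>x. dir_deriv a (vector [- (x$2), x$1, 0]) x"
  let ?G = "\<lambda>s. integral {0..2 * pi} (\<lambda>t. a (rot t (rot s x)))"
  let ?F = "\<lambda>z. a (rot (snd z) (rot (fst z) x))"
  have sF: "smooth ?F"
    by (intro allI smooth_at_compose_smooth[OF assms] smooth_at_rot smooth_at_fst smooth_at_snd smooth_at_ident smooth_at_const)
  have "(?G has_derivative (\<lambda>v. integral {0..2 * pi} (\<lambda>t. dir_deriv ?F (v, 0) (s, t)))) (at s)" for s
    using has_derivative_integral_parameter[OF sF] by simp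
  moreover have "integral {0..2 * pi} (\<lambda>t. dir_deriv ?F (v, 0) (s, t)) = 0" for v s
  proof -
    have "dir_deriv ?F (v, 0) (s, t) = v * ?\<phi> (rot t (rot s x))" for t
    proof -
      have F: "?F = (\<lambda>z. a (rot (snd z + fst z) x))" by (simp add: rot_rot)
      have "((\<lambda>z :: real \<times> real. snd z + fst z) has_derivative (\<lambda>h. snd h + fst h)) (at (s, t))"
        by (intro has_derivative_add has_derivative_fst has_derivative_snd has_derivative_ident)
      from has_derivative_compose[OF this, of "\<lambda>t. a (rot t x)"]
        has_vector_derivative_along_rot[OF assms, of x "t + s" UNIV]
      have "(?F has_derivative (\<lambda>h. (snd h + fst h) * ?\<phi> (rot (t + s) x))) (at (s, t))"
        unfolding F has_vector_derivative_def by simp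
      from dir_deriv_eqI[OF this] show ?thesis by (simp add: rot_rot)
    qed
    moreover have "((\<lambda>t. v * ?\<phi> (rot t (rot s x))) has_integral v * (a (rot (2 * pi) (rot s x)) - a (rot 0 (rot s x)))) {0..2 * pi}"
      by (intro has_integral_mult_right fundamental_theorem_of_calculus has_vector_derivative_along_rot assms) simp
    ultimately show ?thesis by (simp only: integral_unique rot_2pi rot_0 diff_self mult_zero_right)
  qed
  ultimately have "(?G has_real_derivative 0) (at s)" for s
    unfolding has_field_derivative_def by (simp add: lambda_zero)
  then have "?G s = ?G 0" by (intro DERIV_isconst_all) auto
  then show ?thesis by (simp add: rot_mean_def rot_0)
qed

lemma has_derivative_linear_rot: "(rot t has_derivative rot t) (at x)"
proof (rule bounded_linear_imp_has_derivative, rule linear_conv_bounded_linear[THEN iffD1], rule linearI)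
qed (simp_all add: vec_eq_iff forall_3 algebra_simps)

text \<open>If \<open>b\<close> has mean \<open>0\<close> on all circles, then \<open>x \<mapsto> (\<integral> t * b (rot t x) dt) / 2\<pi>\<close> is a primitive
  of \<open>b\<close> along the rotations.\<close>

lemma exists_rot_primitive:
  assumes "smooth b" "\<And>x. rot_mean b x = 0"
  obtains u where "smooth u" "\<And>x. x$1 * grad u x $ 2 - x$2 * grad u x $ 1 = b x"
proof -
  let ?u = "\<lambda>x. integral {0..2 * pi} (\<lambda>t. t * b (rot t x)) / (2 * pi)"
  let ?F = "\<lambda>z. snd z * b (rot (snd z) (fst z))"
  have sF: "smooth ?F" using smooth_along_rot[OF assms(1)] by (auto intro!: smooth_at_mult smooth_at_snd)
  have su: "smooth ?u" using smooth_integral_parameter[OF sF, of 0 "2 * pi"] by (auto intro!: smooth_at_divide)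
  have "x$1 * grad ?u x $ 2 - x$2 * grad ?u x $ 1 = b x" for x
  proof -
    let ?v = "vector [- (x$2), x$1, 0] :: real^3"
    let ?\<phi> = "\<lambda>x. dir_deriv b (vector [- (x$2), x$1, 0]) x"
    have "x$1 * grad ?u x $ 2 - x$2 * grad ?u x $ 1 = dir_deriv ?u ?v x"
      using dir_deriv_grad[of x ?u ?v] su by (simp add: sum_3)
    also have "dir_deriv ?u ?v x = integral {0..2 * pi} (\<lambda>t. dir_deriv ?F (?v, 0) (x, t)) / (2 * pi)"
      using dir_deriv_eqI[OF bounded_linear.has_derivative[OF bounded_linear_divide
            has_derivative_integral_parameter[OF sF, of 0 "2 * pi" x]], of "2 * pi" ?v] by simp
    also have "(\<lambda>t. dir_deriv ?F (?v, 0) (x, t)) = (\<lambda>t. t * ?\<phi> (rot t x))"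
    proof
      fix t :: real
      have p: "((\<lambda>y. (y, t)) has_derivative (\<lambda>h. (h, 0))) (at x)"
        by (intro has_derivative_Pair has_derivative_ident has_derivative_const)
      have "((\<lambda>y. ?F (y, t)) has_derivative (\<lambda>h. dir_deriv ?F (h, 0) (x, t))) (at x)"
        by (rule smooth_at_has_derivative_compose[OF _ p]) (use sF in simp)
      then have d1: "((\<lambda>y. t * b (rot t y)) has_derivative (\<lambda>h. dir_deriv ?F (h, 0) (x, t))) (at x)" by simp
      have "((\<lambda>y. t * b (rot t y)) has_derivative (\<lambda>h. t * dir_deriv b (rot t h) (rot t x))) (at x)"
        by (intro has_derivative_mult_right smooth_at_has_derivative_compose has_derivative_linear_rot) (use assms in auto)
      from fun_cong[OF has_derivative_unique[OF d1 this]]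
      have "dir_deriv ?F (?v, 0) (x, t) = t * dir_deriv b (rot t ?v) (rot t x)" .
      \<comment> \<open>The field that generates the rotations is itself invariant under
        them.\<close>
      moreover have "rot t ?v = vector [- (rot t x $ 2), rot t x $ 1, 0]"
        by (simp add: vec_eq_iff forall_3 algebra_simps)
      ultimately show "dir_deriv ?F (?v, 0) (x, t) = t * ?\<phi> (rot t x)" by simp
    qed
    also have "integral {0..2 * pi} (\<lambda>t. t * ?\<phi> (rot t x)) = 2 * pi * b x"
    proof -
      \<comment> \<open>Integration by parts: the boundary term is 2 pi b(x), and the remaining
        integral is a multiple of the mean of b over the circle, which is 0.\<close>
      have "((\<lambda>t. b (rot t x) + t * ?\<phi> (rot t x)) has_integral (2 * pi) * b (rot (2 * pi) x) - 0 * b (rot 0 x)) {0..2 * pi}"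
      proof (rule fundamental_theorem_of_calculus)
        fix t
        have "((\<lambda>t. b (rot t x)) has_vector_derivative ?\<phi> (rot t x)) (at t within {0..2 * pi})"
          by (rule has_vector_derivative_along_rot[OF assms(1)])
        then show "((\<lambda>t. t * b (rot t x)) has_vector_derivative b (rot t x) + t * ?\<phi> (rot t x)) (at t within {0..2 * pi})"
          by (auto intro!: derivative_eq_intros simp: add.commute)
      qed simp
      then have "2 * pi * b x = integral {0..2 * pi} (\<lambda>t. b (rot t x) + t * ?\<phi> (rot t x))"
        by (simp add: integral_unique rot_2pi)
      also have "\<dots> = integral {0..2 * pi} (\<lambda>t. b (rot t x)) + integral {0..2 * pi} (\<lambda>t. t * ?\<phi> (rot t x))"
        by (intro Henstock_Kurzweil_Integration.integral_add integrable_continuous_interval continuous_on_mult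
            continuous_on_id continuous_on_along_rot assms(1) smooth_dir_deriv_rot_field)
      also have "integral {0..2 * pi} (\<lambda>t. b (rot t x)) = 0" using assms(2)[of x] by (simp add: rot_mean_def)
      finally show ?thesis by simp
    qed
    finally show ?thesis by simp
  qed
  then show thesis using that[OF su] by blast
qed

text \<open>The map x |-> rot (u x) x keeps \<open>quad\<close>, and its Jacobian determinant is 1
  plus the derivative of u along the rotations. To change the density a into its mean ?m, this
  derivative must be a / ?m - 1. That function has mean zero on every circle, so a primitive u
  exists.\<close>

lemma linear_form_quad_density:
  assumes g: "smooth_at 0 g" "g 0 > 0"
  shows "\<exists>w c. linear_form g quad w c"
proof -
  have "smooth_at 0 (\<lambda>x. 1 / g x)" using g by (intro smooth_at_divide smooth_at_const) auto
  then obtain a R where a: "smooth a" "\<forall>\<^sub>F x in nhds 0. a x = 1 / g x" "\<And>x. \<bar>a x - 1 / g 0\<bar> < 1 / g 0"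
    by (rule smooth_at_extend[of 0 "\<lambda>x. 1 / g x" "1 / g 0"]) (use g in auto)
  have apos: "a x > 0" for x using a(3)[of x] by linarith
  let ?m = "rot_mean a"
  have sm: "smooth ?m" by (rule smooth_rot_mean[OF a(1)])
  have mpos: "?m x > 0" for x
  proof -
    have "integral {0..2 * pi} (\<lambda>t. a (rot t x)) \<ge> 0"
      by (intro integral_nonneg integrable_continuous_interval continuous_on_along_rot a(1)) (use apos less_imp_le in auto)
    moreover have "integral {0..2 * pi} (\<lambda>t. a (rot t x)) \<noteq> 0"
    proof
      assume *: "integral {0..2 * pi} (\<lambda>t. a (rot t x)) = 0"
      have "a (rot 0 x) = 0"
        using integral_eq_0_iff[of 0 "2 * pi" "\<lambda>t. a (rot t x)", THEN iffD1, OF _ _ _ *] continuous_on_along_rot[OF a(1)] apos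
        by (metis atLeastAtMost_iff less_imp_le order_refl pi_gt_zero zero_less_mult_iff zero_less_numeral)
      then show False using apos[of "rot 0 x"] by simp
    qed
    ultimately show ?thesis by (simp add: rot_mean_def)
  qed
  let ?b = "\<lambda>x. a x / ?m x - 1"
  have mne: "?m x \<noteq> 0" for x using mpos[of x] by simp
  have sb: "smooth ?b" using a(1) sm mne by (auto intro!: smooth_at_diff smooth_at_divide)
  have "rot_mean ?b x = 0" for x
  proof -
    have "integral {0..2 * pi} (\<lambda>t. ?b (rot t x)) = integral {0..2 * pi} (\<lambda>t. a (rot t x) / ?m x) - integral {0..2 * pi} (\<lambda>t. 1)"
      unfolding rot_mean_rot[OF a(1)]
      by (intro Henstock_Kurzweil_Integration.integral_diff integrable_continuous_interval continuous_on_divide continuous_on_const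
          continuous_on_along_rot a(1)) (use mne in auto)
    also have "\<dots> = integral {0..2 * pi} (\<lambda>t. a (rot t x)) / ?m x - 2 * pi" by simp
    also have "\<dots> = 0" using mne[of x] by (simp add: rot_mean_def)
    finally show ?thesis by (simp add: rot_mean_def)
  qed
  then obtain u where u: "smooth u" "\<And>x. x$1 * grad u x $ 2 - x$2 * grad u x $ 1 = ?b x"
    using exists_rot_primitive[OF sb] by blast
  define \<psi> where "\<psi> x = rot (u x) x" for x
  have s\<psi>: "smooth_at x \<psi>" for x
    unfolding \<psi>_def[abs_def] using u(1) by (intro smooth_at_rot smooth_at_ident) auto
  have det: "det (jac_matrix \<psi> x) = a x / ?m x" for x
  proof -
    let ?du = "\<lambda>h. dir_deriv u h x"
    have du: "(u has_derivative ?du) (at x)" by (rule smooth_at_has_derivative) (use u in simp)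
    have c: "((\<lambda>x. x $ i) has_derivative (\<lambda>h. h $ i)) (at x)" for i and x :: "real^3"
      by (rule bounded_linear_imp_has_derivative[OF bounded_linear_vec_nth])
    let ?c = "cos (u x)" and ?s = "sin (u x)"
    have dc: "((\<lambda>x. cos (u x)) has_derivative (\<lambda>h. - ?s * ?du h)) (at x)"
      and ds: "((\<lambda>x. sin (u x)) has_derivative (\<lambda>h. ?c * ?du h)) (at x)"
      using du by (auto intro!: derivative_eq_intros)
    have "((\<lambda>x. \<psi> x $ i) has_derivative (\<lambda>h. if i = 1 then h$1 * ?c - h$2 * ?s - (x$1 * ?s + x$2 * ?c) * ?du h
        else if i = 2 then h$1 * ?s + h$2 * ?c + (x$1 * ?c - x$2 * ?s) * ?du h else h$3)) (at x)" for i
    proof -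
      have "((\<lambda>x. x$1 * cos (u x) - x$2 * sin (u x)) has_derivative
        (\<lambda>h. h$1 * ?c - h$2 * ?s - (x$1 * ?s + x$2 * ?c) * ?du h)) (at x)"
        by (rule has_derivative_eq_rhs[OF has_derivative_diff[OF has_derivative_mult[OF c dc] has_derivative_mult[OF c ds]]])
          (simp add: fun_eq_iff algebra_simps)
      moreover have "((\<lambda>x. x$1 * sin (u x) + x$2 * cos (u x)) has_derivative
        (\<lambda>h. h$1 * ?s + h$2 * ?c + (x$1 * ?c - x$2 * ?s) * ?du h)) (at x)"
        by (rule has_derivative_eq_rhs[OF has_derivative_add[OF has_derivative_mult[OF c ds] has_derivative_mult[OF c dc]]])
          (simp add: fun_eq_iff algebra_simps)
      ultimately show ?thesis using exhaust_3[of i] c by (auto simp: \<psi>_def)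
    qed
    note J = jac_matrix_eqI[OF s\<psi> this]
    have poly: "(c - (x1 * s + x2 * c) * u1) * (c + (x1 * c - x2 * s) * u2) - (- s - (x1 * s + x2 * c) * u2) * (s + (x1 * c - x2 * s) * u1)
        = (s\<^sup>2 + c\<^sup>2) * (1 + (x1 * u2 - x2 * u1))" if "s\<^sup>2 + c\<^sup>2 = 1" for c s x1 x2 u1 u2 :: real
    proof -
      have "(c - (x1 * s + x2 * c) * u1) * (c + (x1 * c - x2 * s) * u2) - (- s - (x1 * s + x2 * c) * u2) * (s + (x1 * c - x2 * s) * u1)
        = (s\<^sup>2 + c\<^sup>2) * (1 + (x1 * u2 - x2 * u1))"
        by (simp add: power2_eq_square algebra_simps)
      then show ?thesis .
    qed
    have "det (jac_matrix \<psi> x) = (?c - (x$1 * ?s + x$2 * ?c) * grad u x $ 1) * (?c + (x$1 * ?c - x$2 * ?s) * grad u x $ 2)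
      - (- ?s - (x$1 * ?s + x$2 * ?c) * grad u x $ 2) * (?s + (x$1 * ?c - x$2 * ?s) * grad u x $ 1)"
      by (simp add: det_3 J axis_def grad_def)
    also have "\<dots> = 1 + (x$1 * grad u x $ 2 - x$2 * grad u x $ 1)"
      using poly[of ?s ?c "x$1" "x$2" "grad u x $ 1" "grad u x $ 2"] by simp
    finally show ?thesis unfolding u(2) by simp
  qed
  have "\<exists>w c. linear_form (\<lambda>x. 1 / ?m x) quad w c"
    by (rule linear_form_symmetric[OF sm rot_mean_rot[OF a(1)] mpos])
  then obtain w c where wc: "linear_form (\<lambda>x. 1 / ?m x) quad w c" by blast
  have "linear_form g quad (\<lambda>x. w (\<psi> x)) c"
  proof (rule linear_form_transform[OF wc s\<psi> _ _ smooth_quad])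
    show "\<psi> 0 = 0" by (simp add: \<psi>_def vec_eq_iff forall_3)
    show "det (jac_matrix \<psi> 0) \<noteq> 0" using det[of 0] apos[of 0] mne[of 0] by simp
    have gne: "\<forall>\<^sub>F x in nhds 0. g x \<noteq> 0"
      using tendsto_imp_eventually_ne[OF isCont_tendsto_nhds[OF smooth_at_isCont[OF g(1)]]] g(2) by simp
    show "\<forall>\<^sub>F x in nhds 0. grad (\<lambda>x. quad (\<psi> x)) x = 1 *\<^sub>R grad quad x \<and> (1::real) \<noteq> 0 \<and>
      1 / ?m (\<psi> x) * 1 = g x * det (jac_matrix \<psi> x)"
      using a(2) gne
    proof eventually_elim
      case (elim x)
      then show ?case by (simp add: \<psi>_def quad_rot rot_mean_rot[OF a(1)] det)
    qed
  qed
  then show ?thesis by blast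
qed

subsection \<open>The Morse lemma and the local normal form\<close>

lemma taylor_quadratic:
  fixes f :: "real^3 \<Rightarrow> real"
  assumes f: "smooth f" "f 0 = 0" "grad f 0 = 0"
  obtains b where "\<And>i j :: 3. smooth (b i j)" "\<And>i j x. b i j x = b j i x"
    "\<And>x. f x = (\<Sum>i\<in>UNIV. \<Sum>j\<in>UNIV. x$i * x$j * b i j x)"
    "\<And>i j. b i j 0 = dir_deriv (dir_deriv f (axis i 1)) (axis j 1) 0 / 2"
proof -
  let ?D = "\<lambda>i j :: 3. dir_deriv (dir_deriv f (axis i 1)) (axis j 1)"
  let ?b = "\<lambda>i j x. integral {0..1} (\<lambda>t. (1 - t) * ?D i j (t *\<^sub>R x))"
  have sd: "smooth (dir_deriv f v)" for v using f(1) by (auto intro: smooth_at_dir_deriv)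
  have sD: "smooth (?D i j)" for i j using sd by (auto intro: smooth_at_dir_deriv)
  have "smooth (\<lambda>z :: (real^3) \<times> real. (1 - snd z) * ?D i j (snd z *\<^sub>R fst z))" for i j
    by (intro allI smooth_at_mult smooth_at_compose_smooth[OF sD] smooth_at_diff smooth_at_scaleR smooth_at_const
        smooth_at_fst smooth_at_snd smooth_at_ident)
  from smooth_integral_parameter[OF this] have sb: "smooth (?b i j)" for i j by simp
  have cD: "continuous_on S (\<lambda>t. (1 - t) * ?D i j (t *\<^sub>R x))" for S i j x
    by (intro smooth_at_continuous_on smooth_at_mult smooth_at_compose_smooth[OF sD] smooth_at_diff smooth_at_scaleR
        smooth_at_const smooth_at_ident)
  have sym: "?b i j x = ?b j i x" for i j x
    using dir_deriv_commute_smooth[OF f(1), of "axis i 1" "axis j 1"] by simp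
  have quadr: "dir_deriv (dir_deriv f v) v y = (\<Sum>i\<in>UNIV. \<Sum>j\<in>UNIV. v$i * v$j * ?D i j y)" for v y
  proof -
    have "dir_deriv (dir_deriv f v) v y = (\<Sum>i\<in>UNIV. v$i * dir_deriv (dir_deriv f v) (axis i 1) y)"
      using dir_deriv_grad[of y "dir_deriv f v" v] sd by (simp only: grad_def) simp
    also have "\<dots> = (\<Sum>i\<in>UNIV. v$i * dir_deriv (dir_deriv f (axis i 1)) v y)"
      using dir_deriv_commute_smooth[OF f(1), of v _ y] by simp
    also have "\<dots> = (\<Sum>i\<in>UNIV. v$i * (\<Sum>j\<in>UNIV. v$j * ?D i j y))"
    proof (intro sum.cong refl arg_cong2[where f="(*)"])
      fix i
      show "dir_deriv (dir_deriv f (axis i 1)) v y = (\<Sum>j\<in>UNIV. v$j * ?D i j y)"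
        using dir_deriv_grad[of y "dir_deriv f (axis i 1)" v] sd by (simp only: grad_def) simp
    qed
    finally show ?thesis by (simp add: sum_distrib_left mult.assoc)
  qed
  have "f x = (\<Sum>i\<in>UNIV. \<Sum>j\<in>UNIV. x$i * x$j * ?b i j x)" for x
  proof -
    have d: "((\<lambda>t. \<phi> (t *\<^sub>R x)) has_vector_derivative dir_deriv \<phi> x (t *\<^sub>R x)) (at t within {0..1})"
      if "smooth \<phi>" for \<phi> :: "real^3 \<Rightarrow> real" and t
    proof -
      have "((\<lambda>t. t *\<^sub>R x) has_derivative (\<lambda>h. h *\<^sub>R x)) (at t within {0..1})"
        by (intro has_derivative_scaleR_left has_derivative_ident)
      from smooth_at_has_derivative_compose[OF _ this, of \<phi>]
      have "((\<lambda>t. \<phi> (t *\<^sub>R x)) has_derivative (\<lambda>h. dir_deriv \<phi> (h *\<^sub>R x) (t *\<^sub>R x))) (at t within {0..1})"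
        using that by blast
      moreover have "dir_deriv \<phi> (h *\<^sub>R x) y = h *\<^sub>R dir_deriv \<phi> x y" for h y
        by (rule dir_deriv_smult) (use that in simp)
      ultimately show ?thesis unfolding has_vector_derivative_def by (simp only:)
    qed
    \<comment> \<open>Along the ray, (1 - t) f' + f has the derivative (1 - t) f''. This yields
      Taylor's formula with integral remainder in one application of the fundamental
      theorem.\<close>
    have "((\<lambda>t. (1 - t) * dir_deriv (dir_deriv f x) x (t *\<^sub>R x)) has_integral
        ((1 - 1) * dir_deriv f x (1 *\<^sub>R x) + f (1 *\<^sub>R x)) - ((1 - 0) * dir_deriv f x (0 *\<^sub>R x) + f (0 *\<^sub>R x))) {0..1}"
    proof (rule fundamental_theorem_of_calculus)
      fix t
      show "((\<lambda>t. (1 - t) * dir_deriv f x (t *\<^sub>R x) + f (t *\<^sub>R x)) has_vector_derivative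
          (1 - t) * dir_deriv (dir_deriv f x) x (t *\<^sub>R x)) (at t within {0..1})"
        by (rule has_vector_derivative_eq_rhs, rule has_vector_derivative_add[OF has_vector_derivative_mult[OF _ d[OF sd]] d[OF f(1)]])
          (auto intro!: derivative_eq_intros)
    qed simp
    moreover have "dir_deriv f x 0 = 0" using dir_deriv_grad[of 0 f x] f by simp
    ultimately have "f x = integral {0..1} (\<lambda>t. (1 - t) * dir_deriv (dir_deriv f x) x (t *\<^sub>R x))"
      using f(2) by (simp add: integral_unique)
    also have "\<dots> = integral {0..1} (\<lambda>t. \<Sum>i\<in>UNIV. \<Sum>j\<in>UNIV. x$i * x$j * ((1 - t) * ?D i j (t *\<^sub>R x)))"
      unfolding quadr by (simp add: sum_distrib_left mult.commute mult.left_commute)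
    also have "\<dots> = (\<Sum>i\<in>UNIV. \<Sum>j\<in>UNIV. integral {0..1} (\<lambda>t. x$i * x$j * ((1 - t) * ?D i j (t *\<^sub>R x))))"
      by (subst integral_sum, simp, intro integrable_continuous_interval continuous_on_sum continuous_on_mult continuous_on_const cD,
          intro sum.cong refl integral_sum integrable_continuous_interval continuous_on_mult continuous_on_const cD) auto
    finally show ?thesis by simp
  qed
  moreover have "?b i j 0 = ?D i j 0 / 2" for i j
  proof -
    have "((\<lambda>t::real. 1 - t) has_integral (1 - 1\<^sup>2 / 2) - (0 - 0\<^sup>2 / 2)) {0..1}"
      by (rule fundamental_theorem_of_calculus) (auto intro!: derivative_eq_intros simp flip: has_real_derivative_iff_has_vector_derivative)
    then have "integral {0..1} (\<lambda>t::real. 1 - t) = 1 / 2" by (simp add: integral_unique)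
    then show ?thesis by simp
  qed
  ultimately show thesis using that[of ?b] sb sym by blast
qed

text \<open>Near 0 the function is a quadratic form whose coefficients depend smoothly on the point.
  Completing squares in the order of the variables works uniformly, because at 0 the form is already
  diagonal with entries 1, 1, -1.\<close>

lemma morse_quad:
  fixes f :: "real^3 \<Rightarrow> real"
  assumes f: "smooth_at 0 f" "f 0 = 0" "grad f 0 = 0"
    and hess: "\<And>i j. dir_deriv (dir_deriv f (axis i 1)) (axis j 1) 0 = (if i = j then (if i = 3 then - 2 else 2) else 0)"
  obtains \<psi> :: "real^3 \<Rightarrow> real^3" where "smooth_at 0 \<psi>" "\<psi> 0 = 0" "det (jac_matrix \<psi> 0) \<noteq> 0" "\<forall>\<^sub>F x in nhds 0. quad (\<psi> x) = f x"
proof -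
  obtain F R where F: "smooth F" "\<forall>\<^sub>F x in nhds 0. F x = f x"
    using smooth_at_extend[OF f(1) zero_less_one] by metis
  have ev: "\<forall>\<^sub>F x in nhds 0. dir_deriv F v x = dir_deriv f v x" for v
    using eventually_eventually[THEN iffD2, OF F(2)] by (auto elim!: eventually_mono intro: dir_deriv_cong_ev)
  have F0: "F 0 = 0" "grad F 0 = 0"
    using eventually_nhds_x_imp_x[OF F(2)] grad_cong_ev[OF F(2)] f by auto
  have FH: "dir_deriv (dir_deriv F (axis i 1)) (axis j 1) 0 = (if i = j then (if i = 3 then - 2 else 2) else 0)" for i j
    using dir_deriv_cong_ev(1)[OF ev] hess by simp
  obtain b where b: "\<And>i j :: 3. smooth (b i j)" "\<And>i j x. b i j x = b j i x"
    "\<And>x. F x = (\<Sum>i\<in>UNIV. \<Sum>j\<in>UNIV. x$i * x$j * b i j x)"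
    "\<And>i j. b i j 0 = dir_deriv (dir_deriv F (axis i 1)) (axis j 1) 0 / 2"
    using taylor_quadratic[OF F(1) F0] by blast
  \<comment> \<open>The pivots of Gaussian elimination: \<open>p\<close>, the Schur complement
    \<open>c22\<close>, and \<open>c33\<close> as the negative of the third pivot. All three are 1
    at 0, so their square roots are smooth nearby; \<open>C\<close> is the resulting triangular
    factor.\<close>
  define p where "p x = b 1 1 x" for x
  define c22 where "c22 x = b 2 2 x - (b 1 2 x)\<^sup>2 / p x" for x
  define c23 where "c23 x = b 2 3 x - b 1 2 x * b 1 3 x / p x" for x
  define c33 where "c33 x = (c23 x)\<^sup>2 / c22 x - (b 3 3 x - (b 1 3 x)\<^sup>2 / p x)" for x
  have v0: "p 0 = 1" "c22 0 = 1" "c23 0 = 0" "c33 0 = 1" "b 1 2 0 = 0" "b 1 3 0 = 0"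
    by (simp_all add: p_def c22_def c23_def c33_def b(4) FH)
  have sp: "smooth_at 0 p" using b(1) unfolding p_def[abs_def] by simp
  have s22: "smooth_at 0 c22" unfolding c22_def[abs_def]
    by (intro smooth_at_diff smooth_at_divide smooth_at_power sp) (use b(1) v0 in auto)
  have s23: "smooth_at 0 c23" unfolding c23_def[abs_def]
    by (intro smooth_at_diff smooth_at_divide smooth_at_mult sp) (use b(1) v0 in auto)
  have s33: "smooth_at 0 c33" unfolding c33_def[abs_def]
    by (intro smooth_at_diff smooth_at_divide smooth_at_power sp s22 s23) (use b(1) v0 in auto)
  define C where "C i j x = (if i = 1 then (if j = 1 then sqrt (p x) else b 1 j x / sqrt (p x))
    else if i = 2 then (if j = 1 then 0 else if j = 2 then sqrt (c22 x) else c23 x / sqrt (c22 x))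
    else (if j = 3 then sqrt (c33 x) else 0 :: real))" for i j :: 3 and x
  define \<psi> :: "real^3 \<Rightarrow> real^3" where "\<psi> x = (\<chi> i. \<Sum>j\<in>UNIV. x$j * C i j x)" for x
  have s0: "smooth_at 0 (\<lambda>x. sqrt (p x))" "smooth_at 0 (\<lambda>x. sqrt (c22 x))" "smooth_at 0 (\<lambda>x. sqrt (c33 x))"
    using sp s22 s33 v0 by (auto intro!: smooth_at_sqrt)
  have sC: "smooth_at 0 (C i j)" for i j
  proof -
    have "smooth_at 0 (\<lambda>x. b 1 j x / sqrt (p x))" "smooth_at 0 (\<lambda>x. c23 x / sqrt (c22 x))"
      using s0 b(1) s23 v0 by (auto intro!: smooth_at_divide)
    then show ?thesis unfolding C_def[abs_def] using s0 by (cases "i = 1"; cases "i = 2"; cases "j = 1"; cases "j = 2"; cases "j = 3") auto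
  qed
  have C0: "C i j 0 = (if i = j then 1 else 0)" for i j
    using exhaust_3[of i] exhaust_3[of j] by (auto simp: C_def v0)
  have s\<psi>: "smooth_at 0 \<psi>"
    unfolding smooth_at_vec_iff \<psi>_def
    by (simp only: vec_lambda_beta, intro allI smooth_at_sum smooth_at_mult smooth_at_component smooth_at_ident sC)
  have \<psi>0: "\<psi> 0 = 0" by (simp add: \<psi>_def vec_eq_iff)
  have D: "((\<lambda>x. \<psi> x $ i) has_derivative (\<lambda>h. \<Sum>j\<in>UNIV. 0 $ j * dir_deriv (C i j) h 0 + h $ j * C i j 0)) (at 0)" for i
    unfolding \<psi>_def vec_lambda_beta
    by (intro has_derivative_sum has_derivative_mult smooth_at_has_derivative[OF sC]
        bounded_linear_imp_has_derivative[OF bounded_linear_vec_nth])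
  have "jac_matrix \<psi> 0 $ i $ j = (if i = j then 1 else 0)" for i j
    using jac_matrix_eqI[OF s\<psi> D, of i j] exhaust_3[of i] exhaust_3[of j]
    unfolding C0 by (auto simp: axis_def sum_3)
  then have "jac_matrix \<psi> 0 = mat 1" by (simp add: vec_eq_iff mat_def)
  then have det: "det (jac_matrix \<psi> 0) \<noteq> 0" by simp
  have pos: "\<forall>\<^sub>F x in nhds 0. c x > 0" if "smooth_at 0 c" "c 0 = 1" for c :: "real^3 \<Rightarrow> real"
    using order_tendstoD(1)[OF isCont_tendsto_nhds[OF smooth_at_isCont[OF that(1)]], of 0] that(2) by simp
  have "\<forall>\<^sub>F x in nhds 0. quad (\<psi> x) = f x"
    using F(2) pos[OF sp v0(1)] pos[OF s22 v0(2)] pos[OF s33 v0(4)]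
  proof eventually_elim
    case (elim x)
    have c: "\<psi> x $ 1 = x$1 * sqrt (p x) + x$2 * (b 1 2 x / sqrt (p x)) + x$3 * (b 1 3 x / sqrt (p x))"
      "\<psi> x $ 2 = x$2 * sqrt (c22 x) + x$3 * (c23 x / sqrt (c22 x))" "\<psi> x $ 3 = x$3 * sqrt (c33 x)"
      by (simp_all add: \<psi>_def sum_3 C_def)
    have sq: "(u * sqrt r + v / sqrt r)\<^sup>2 = u\<^sup>2 * r + 2 * u * v + v\<^sup>2 / r" if "r > 0" for u v r :: real
    proof -
      have "sqrt r * sqrt r = r" "sqrt r \<noteq> 0" using that by auto
      then show ?thesis by (simp add: power2_sum power_mult_distrib power_divide that less_imp_le)
    qed
    have "(\<psi> x $ 1)\<^sup>2 = (x$1)\<^sup>2 * p x + 2 * x$1 * (x$2 * b 1 2 x + x$3 * b 1 3 x) + (x$2 * b 1 2 x + x$3 * b 1 3 x)\<^sup>2 / p x"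
      unfolding c using sq[OF elim(2), of "x$1" "x$2 * b 1 2 x + x$3 * b 1 3 x"] by (simp add: add_divide_distrib add.assoc)
    moreover have "(\<psi> x $ 2)\<^sup>2 = (x$2)\<^sup>2 * c22 x + 2 * x$2 * (x$3 * c23 x) + (x$3 * c23 x)\<^sup>2 / c22 x"
      unfolding c using sq[OF elim(3), of "x$2" "x$3 * c23 x"] by simp
    moreover have "(\<psi> x $ 3)\<^sup>2 = (x$3)\<^sup>2 * c33 x" unfolding c using elim(4) by (simp add: power_mult_distrib)
    moreover have "F x = (x$1)\<^sup>2 * p x + 2 * x$1 * (x$2 * b 1 2 x + x$3 * b 1 3 x)
        + (x$2)\<^sup>2 * b 2 2 x + 2 * x$2 * x$3 * b 2 3 x + (x$3)\<^sup>2 * b 3 3 x"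
      using b(2)[of 2 1 x] b(2)[of 3 1 x] b(2)[of 3 2 x] unfolding b(3)
      by (simp add: sum_3 p_def power2_eq_square algebra_simps)
    moreover have "(x$2)\<^sup>2 * c22 x = (x$2)\<^sup>2 * b 2 2 x - (x$2 * b 1 2 x)\<^sup>2 / p x"
      "2 * x$2 * (x$3 * c23 x) = 2 * x$2 * x$3 * b 2 3 x - 2 * (x$2 * b 1 2 x) * (x$3 * b 1 3 x) / p x"
      by (simp_all add: c22_def c23_def right_diff_distrib power_mult_distrib algebra_simps)
    moreover have "(x$3)\<^sup>2 * c33 x = (x$3 * c23 x)\<^sup>2 / c22 x - (x$3)\<^sup>2 * b 3 3 x + (x$3 * b 1 3 x)\<^sup>2 / p x"
      by (simp add: c33_def power_mult_distrib algebra_simps)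
    moreover have "(x$2 * b 1 2 x + x$3 * b 1 3 x)\<^sup>2 / p x = (x$2 * b 1 2 x)\<^sup>2 / p x
        + 2 * (x$2 * b 1 2 x) * (x$3 * b 1 3 x) / p x + (x$3 * b 1 3 x)\<^sup>2 / p x"
      by (simp add: power2_sum add_divide_distrib)
    ultimately show ?case using elim(1) unfolding quad_def by linarith
  qed
  then show thesis using that s\<psi> \<psi>0 det by blast
qed

text \<open>A constant factor of either sign goes into the structure constants. Thus a density that
  is nonzero at 0 can be replaced by one that is positive there.\<close>

lemma linear_form_scale:
  assumes "linear_form (\<lambda>x. r * g x) f w c" "r \<noteq> 0" shows "linear_form g f w (\<lambda>i j k. c i j k / r)"
proof -
  have "\<forall>\<^sub>F x in nhds 0. \<forall>i j. r * g x * triple (grad (\<lambda>x. w x $ i) x) (grad (\<lambda>x. w x $ j) x) (grad f x) =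
        (\<Sum>k\<in>UNIV. c i j k * w x $ k)" using assms(1) by (simp add: linear_form_def)
  then have "\<forall>\<^sub>F x in nhds 0. \<forall>i j. g x * triple (grad (\<lambda>x. w x $ i) x) (grad (\<lambda>x. w x $ j) x) (grad f x) =
        (\<Sum>k\<in>UNIV. c i j k / r * w x $ k)"
  proof eventually_elim
    case (elim x)
    show ?case
    proof (intro allI)
      fix i j
      let ?t = "triple (grad (\<lambda>x. w x $ i) x) (grad (\<lambda>x. w x $ j) x) (grad f x)"
      have "g x * ?t = (r * g x * ?t) / r" using assms(2) by simp
      also have "\<dots> = (\<Sum>k\<in>UNIV. c i j k * w x $ k) / r" using elim by simp
      finally show "g x * ?t = (\<Sum>k\<in>UNIV. c i j k / r * w x $ k)" by (simp add: sum_divide_distrib)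
    qed
  qed
  then show ?thesis using assms(1) by (simp add: linear_form_def)
qed

lemma jac_matrix_ident: "jac_matrix (\<lambda>x :: real^3. x) x = mat 1"
proof -
  have "jac_matrix (\<lambda>x :: real^3. x) x $ i $ j = axis j 1 $ i" for i j
    by (rule jac_matrix_eqI[OF smooth_at_ident bounded_linear_imp_has_derivative[OF bounded_linear_vec_nth]])
  then show ?thesis by (simp add: vec_eq_iff mat_def axis_def)
qed

theorem exists_linear_form:
  fixes f g :: "real^3 \<Rightarrow> real"
  assumes f: "smooth_at 0 f" "grad f 0 = 0"
    and hess: "\<And>i j. dir_deriv (dir_deriv f (axis i 1)) (axis j 1) 0 = (if i = j then (if i = 3 then - c else c) else 0)"
    and c: "c \<noteq> 0" and g: "smooth_at 0 g" "g 0 \<noteq> 0"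
  shows "\<exists>w c. linear_form g f w c"
proof -
  \<comment> \<open>The shift makes the value at 0 vanish, and the factor 2 / c turns the Hessian
    into diag(2, 2, -2), whatever the sign of \<open>c\<close>.\<close>
  let ?f = "\<lambda>x. (2 / c) * (f x - f 0)"
  have sf: "smooth_at 0 ?f" by (intro smooth_at_mult smooth_at_diff smooth_at_const f)
  have df: "dir_deriv ?f v x = (2 / c) * dir_deriv f v x" if "smooth_at x f" for v x
    using has_derivative_mult_right[OF has_derivative_diff[OF smooth_at_has_derivative[OF that] has_derivative_const], of "2 / c" "f 0"]
    by (intro dir_deriv_eqI[THEN trans]) auto
  have gradf: "grad ?f x = (2 / c) *\<^sub>R grad f x" if "smooth_at x f" for x
    using df[OF that] by (simp add: vec_eq_iff grad_def)
  have ddf: "dir_deriv (dir_deriv ?f v) w 0 = (2 / c) * dir_deriv (dir_deriv f v) w 0" for v w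
  proof -
    have "\<forall>\<^sub>F x in nhds 0. dir_deriv ?f v x = (2 / c) * dir_deriv f v x"
      using smooth_at_eventually[OF f(1)] by eventually_elim (rule df)
    then have "dir_deriv (dir_deriv ?f v) w 0 = dir_deriv (\<lambda>x. (2 / c) * dir_deriv f v x) w 0" by (rule dir_deriv_cong_ev)
    also have "\<dots> = (2 / c) * dir_deriv (dir_deriv f v) w 0"
      by (rule dir_deriv_eqI[OF has_derivative_mult_right[OF smooth_at_has_derivative[OF smooth_at_dir_deriv[OF f(1)]]]])
    finally show ?thesis .
  qed
  obtain \<psi> :: "real^3 \<Rightarrow> real^3" where \<psi>: "smooth_at 0 \<psi>" "\<psi> 0 = 0" "det (jac_matrix \<psi> 0) \<noteq> 0" "\<forall>\<^sub>F x in nhds 0. quad (\<psi> x) = ?f x"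
  proof (rule morse_quad[of ?f])
    show "dir_deriv (dir_deriv ?f (axis i 1)) (axis j 1) 0 = (if i = j then (if i = 3 then - 2 else 2) else 0)" for i j
      unfolding ddf hess using c by simp
    show "grad ?f 0 = 0" unfolding gradf[OF f(1)] f(2) by simp
  qed (use sf in auto)
  obtain U V \<theta> where U: "open U" "0 \<in> U" "open V" and hom: "homeomorphism U V \<psi> \<theta>"
    and s\<theta>: "\<And>y. y \<in> V \<Longrightarrow> smooth_at y \<theta>"
    by (rule smooth_inverse_function[OF \<psi>(1,3)]) blast
  have \<theta>: "\<theta> (\<psi> x) = x" "\<psi> x \<in> V" if "x \<in> U" for x using hom that unfolding homeomorphism_def by auto
  have \<theta>0: "\<theta> 0 = 0" "0 \<in> V" using \<theta>[OF U(2)] \<psi>(2) by auto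
  \<comment> \<open>The density seen in the Morse coordinates; the factor c / 2 compensates the 2 /
    c in \<open>?f\<close>.\<close>
  let ?g = "\<lambda>y. (c / 2) * g (\<theta> y) * det (jac_matrix \<psi> (\<theta> y))"
  have sg: "smooth_at 0 ?g"
  proof -
    have 1: "smooth_at 0 (\<lambda>y. g (\<theta> y))" by (rule smooth_at_compose[OF s\<theta>[OF \<theta>0(2)]]) (simp add: \<theta>0 g)
    have "smooth_at 0 (\<lambda>x. det (jac_matrix \<psi> x))"
      by (intro smooth_at_det smooth_at_jac_matrix \<psi>(1))
    then have "smooth_at 0 (\<lambda>y. det (jac_matrix \<psi> (\<theta> y)))"
      using smooth_at_compose[OF s\<theta>[OF \<theta>0(2)], of "\<lambda>x. det (jac_matrix \<psi> x)"] by (simp add: \<theta>0)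
    with 1 show ?thesis by (intro smooth_at_mult smooth_at_const)
  qed
  have g0: "?g 0 \<noteq> 0" using g(2) c \<psi>(3) by (simp add: \<theta>0)
  \<comment> \<open>Multiplied by its own value at 0, the density becomes positive there.\<close>
  define r where "r = ?g 0"
  have "\<exists>w c. linear_form (\<lambda>y. r * ?g y) quad w c"
  proof (rule linear_form_quad_density)
    have "r \<noteq> 0" using g0 unfolding r_def .
    then have "r * r > 0" by (simp only: not_real_square_gt_zero[of r, symmetric] not_not)
    then show "r * ?g 0 > 0" by (simp only: r_def)
  qed (rule smooth_at_mult[OF smooth_at_const sg])
  then obtain w k where wk: "linear_form (\<lambda>y. r * ?g y) quad w k" by blast
  have "r \<noteq> 0" using g0 unfolding r_def .
  define k' where "k' i j l = k i j l / r" for i j l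
  have k: "linear_form ?g quad w k'"
    unfolding k'_def[abs_def] by (rule linear_form_scale[OF wk \<open>r \<noteq> 0\<close>])
  have k1: "linear_form (\<lambda>x. (c / 2) * g x) ?f (\<lambda>x. w (\<psi> x)) k'"
  proof (rule linear_form_transform[OF k \<psi>(1,2,3) smooth_quad])
    have ev\<theta>: "\<forall>\<^sub>F x in nhds 0. \<theta> (\<psi> x) = x"
      by (rule eventually_eq_open[OF U(1,2)]) (rule \<theta>(1))
    show "\<forall>\<^sub>F x in nhds 0. grad (\<lambda>x. quad (\<psi> x)) x = 1 *\<^sub>R grad ?f x \<and> (1::real) \<noteq> 0 \<and>
      (c / 2) * g (\<theta> (\<psi> x)) * det (jac_matrix \<psi> (\<theta> (\<psi> x))) * 1 = (c / 2) * g x * det (jac_matrix \<psi> x)"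
      using eventually_eventually[THEN iffD2, OF \<psi>(4)] ev\<theta> by eventually_elim (simp add: grad_cong_ev)
  qed
  have "linear_form g f (\<lambda>x. (\<lambda>x. w (\<psi> x)) ((\<lambda>x. x) x)) k'"
  proof (rule linear_form_transform[OF k1 smooth_at_ident _ _ sf])
    show "\<forall>\<^sub>F x in nhds 0. grad (\<lambda>x. ?f x) x = (2 / c) *\<^sub>R grad f x \<and> 2 / c \<noteq> 0 \<and>
      (c / 2) * g x * (2 / c) = g x * det (jac_matrix (\<lambda>x. x) x)"
      using smooth_at_eventually[OF f(1)] by eventually_elim (use c gradf in \<open>simp add: jac_matrix_ident\<close>)
  qed (simp_all add: jac_matrix_ident)
  then show ?thesis by blast
qed

section \<open>Calculus in charts\<close>

definition rep :: "'a chart \<Rightarrow> ('a \<Rightarrow> 'b) \<Rightarrow> real^3 \<Rightarrow> 'b" where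
  "rep c f = f \<circ> inv_into (fst c) (snd c)"

lemma rep_apply: "rep c f z = f (inv_into (fst c) (snd c) z)"
  by (simp add: rep_def)

text \<open>Collects what local calculus in charts rests on, so that the same lemmas serve the given
  manifold and the dual of the isotropy Lie algebra with its linear charts.\<close>

locale charted =
  fixes M :: "'a manifold"
  assumes chart: "c \<in> atlas M \<Longrightarrow> openin (mtop M) (fst c) \<and> open (snd c ` fst c) \<and>
      homeomorphic_map (subtopology (mtop M) (fst c)) (top_of_set (snd c ` fst c)) (snd c)"
    and transition: "c \<in> atlas M \<Longrightarrow> d \<in> atlas M \<Longrightarrow>
      smooth_on (snd c ` (fst c \<inter> fst d)) (rep c (snd d))"

lemma smooth_manifold_charted: "smooth_manifold M \<Longrightarrow> charted M"
  unfolding smooth_manifold_def charted_def rep_def by (auto simp: split_beta)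

context charted begin

lemma chart_subset: "c \<in> atlas M \<Longrightarrow> fst c \<subseteq> mspc M"
  using chart openin_subset by blast

lemma chart_topspace: assumes "c \<in> atlas M" shows "topspace (subtopology (mtop M) (fst c)) = fst c"
  using chart_subset[OF assms] by auto

lemma chart_inj: assumes "c \<in> atlas M" shows "inj_on (snd c) (fst c)"
proof -
  have "inj_on (snd c) (topspace (subtopology (mtop M) (fst c)))"
    by (rule homeomorphic_imp_injective_map) (use chart[OF assms] in blast)
  then show ?thesis unfolding chart_topspace[OF assms] .
qed

lemma chart_inv: "c \<in> atlas M \<Longrightarrow> x \<in> fst c \<Longrightarrow> inv_into (fst c) (snd c) (snd c x) = x"
  by (simp add: chart_inj inv_into_f_f)

lemma chart_open_image:
  assumes "c \<in> atlas M" "openin (mtop M) S" shows "open (snd c ` (fst c \<inter> S))"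
proof -
  have o: "openin (subtopology (mtop M) (fst c)) (fst c \<inter> S)"
    using assms(2) by (auto simp: openin_subtopology)
  have "open_map (subtopology (mtop M) (fst c)) (top_of_set (snd c ` fst c)) (snd c)"
    using chart[OF assms(1)] homeomorphic_imp_open_map by blast
  then have "openin (top_of_set (snd c ` fst c)) (snd c ` (fst c \<inter> S))"
    using o unfolding open_map_def by blast
  then show ?thesis using chart[OF assms(1)] openin_open_trans by blast
qed

lemma chart_open_preimage:
  assumes "c \<in> atlas M" "open T" shows "openin (mtop M) {x \<in> fst c. snd c x \<in> T}"
proof -
  have "continuous_map (subtopology (mtop M) (fst c)) (top_of_set (snd c ` fst c)) (snd c)"
    using chart[OF assms(1)] homeomorphic_imp_continuous_map by blast
  then have "continuous_map (subtopology (mtop M) (fst c)) euclidean (snd c)"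
    by (simp add: continuous_map_in_subtopology)
  then have "openin (subtopology (mtop M) (fst c)) {x \<in> fst c. snd c x \<in> T}"
    using openin_continuous_map_preimage[of _ euclidean "snd c" T] assms(2) chart_topspace[OF assms(1)] by fastforce
  then show ?thesis using chart[OF assms(1)] openin_trans_full by blast
qed

text \<open>Passage from neighbourhoods in the manifold to the filter \<open>nhds\<close> in the
  chart, where the calculus of germs applies; \<open>eventually_chart_source\<close> leads
  back.\<close>

lemma eventually_chart:
  assumes "c \<in> atlas M" "x \<in> fst c" "openin (mtop M) S" "x \<in> S" "\<And>y. y \<in> S \<Longrightarrow> y \<in> fst c \<Longrightarrow> P y"
  shows "\<forall>\<^sub>F z in nhds (snd c x). inv_into (fst c) (snd c) z \<in> fst c \<and> inv_into (fst c) (snd c) z \<in> S \<and>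
    snd c (inv_into (fst c) (snd c) z) = z \<and> P (inv_into (fst c) (snd c) z)"
proof (rule eventually_eq_open[OF chart_open_image[OF assms(1,3)]])
  fix z assume "z \<in> snd c ` (fst c \<inter> S)"
  then obtain y where "y \<in> fst c" "y \<in> S" "z = snd c y" by auto
  then show "inv_into (fst c) (snd c) z \<in> fst c \<and> inv_into (fst c) (snd c) z \<in> S \<and>
    snd c (inv_into (fst c) (snd c) z) = z \<and> P (inv_into (fst c) (snd c) z)"
    using chart_inv[OF assms(1)] assms(5) by auto
qed (use assms in auto)

lemma eventually_chart_source:
  assumes "c \<in> atlas M" "x \<in> fst c" "\<forall>\<^sub>F z in nhds (snd c x). P z"
  obtains S where "openin (mtop M) S" "x \<in> S" "S \<subseteq> fst c" "\<And>y. y \<in> S \<Longrightarrow> P (snd c y)"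
proof -
  obtain T where "open T" "snd c x \<in> T" "\<And>z. z \<in> T \<Longrightarrow> P z" using assms(3) unfolding eventually_nhds by auto
  then show thesis using that[of "{x \<in> fst c. snd c x \<in> T}"] chart_open_preimage[OF assms(1)] assms(2) by auto
qed

lemma transition_smooth_at:
  assumes "c \<in> atlas M" "d \<in> atlas M" "x \<in> fst c" "x \<in> fst d"
  shows "smooth_at (snd c x) (rep c (snd d))"
  using smooth_on_imp_at[OF chart_open_image[OF assms(1)] transition[OF assms(1,2)]] chart[OF assms(2)] assms
  by auto

lemma rep_change:
  assumes "c \<in> atlas M" "d \<in> atlas M" "x \<in> fst c" "x \<in> fst d"
  shows "\<forall>\<^sub>F z in nhds (snd c x). rep c f z = rep d f (rep c (snd d) z)"
proof -
  have "openin (mtop M) (fst d)" using chart[OF assms(2)] by simp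
  from eventually_chart[OF assms(1,3) this assms(4), of "\<lambda>_. True"] show ?thesis
    by (auto elim!: eventually_mono simp: rep_apply chart_inv[OF assms(2)])
qed

lemma smooth_at_rep_change:
  assumes "c \<in> atlas M" "d \<in> atlas M" "x \<in> fst c" "x \<in> fst d" "smooth_at (snd d x) (rep d f)"
  shows "smooth_at (snd c x) (rep c f)"
proof -
  have "rep c (snd d) (snd c x) = snd d x" using assms chart_inv by (simp add: rep_apply)
  then have "smooth_at (snd c x) (\<lambda>z. rep d f (rep c (snd d) z))"
    using assms by (intro smooth_at_compose[OF transition_smooth_at[OF assms(1-4)]]) simp
  then show ?thesis using smooth_at_cong[OF rep_change[OF assms(1-4), of f]] by simp
qed

lemma smooth_near_iff:
  assumes "c \<in> atlas M" "x \<in> fst c"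
  shows "smooth_near M x f \<longleftrightarrow> smooth_at (snd c x) (rep c f)"
proof
  assume "smooth_near M x f"
  then obtain S where S: "openin (mtop M) S" "x \<in> S" "f \<in> smooth_functions M S" unfolding smooth_near_def by auto
  then have "smooth_on (snd c ` (fst c \<inter> S)) (rep c f)"
    using assms(1) unfolding smooth_functions_def rep_def by (auto simp: split_beta)
  then show "smooth_at (snd c x) (rep c f)"
    using smooth_on_imp_at[OF chart_open_image[OF assms(1) S(1)]] assms S by auto
next
  assume "smooth_at (snd c x) (rep c f)"
  from eventually_chart_source[OF assms smooth_at_eventually[OF this]]
  obtain S where S: "openin (mtop M) S" "x \<in> S" "S \<subseteq> fst c" "\<And>y. y \<in> S \<Longrightarrow> smooth_at (snd c y) (rep c f)" by metis
  have "smooth_on (snd d ` (fst d \<inter> S)) (rep d f)" if "d \<in> atlas M" for d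
    using smooth_at_rep_change[OF that assms(1), of _ f] S by (intro smooth_onI) auto
  then have "f \<in> smooth_functions M S" unfolding smooth_functions_def rep_def by (auto simp: split_beta)
  then show "smooth_near M x f" using S unfolding smooth_near_def by auto
qed

lemma smooth_functions_iff:
  assumes "openin (mtop M) S" "S \<subseteq> (\<Union>c\<in>atlas M. fst c)"
  shows "f \<in> smooth_functions M S \<longleftrightarrow> (\<forall>x\<in>S. smooth_near M x f)"
proof
  assume *: "\<forall>x\<in>S. smooth_near M x f"
  have "smooth_on (snd d ` (fst d \<inter> S)) (rep d f)" if "d \<in> atlas M" for d
    using * smooth_near_iff[OF that] by (intro smooth_onI) auto
  then show "f \<in> smooth_functions M S" unfolding smooth_functions_def rep_def by (auto simp: split_beta)
qed (use assms in \<open>auto simp: smooth_near_def\<close>)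

lemma smooth_near_cong:
  assumes "openin (mtop M) S" "x \<in> S" "\<And>y. y \<in> S \<Longrightarrow> f y = g y" "c \<in> atlas M" "x \<in> fst c"
  shows "smooth_near M x f \<longleftrightarrow> smooth_near M x g"
proof -
  have "\<forall>\<^sub>F z in nhds (snd c x). rep c f z = rep c g z"
    using eventually_chart[OF assms(4,5,1,2), of "\<lambda>y. f y = g y"] assms(3) by (auto elim!: eventually_mono simp: rep_apply)
  from smooth_at_cong[OF this] show ?thesis unfolding smooth_near_iff[OF assms(4,5)] .
qed

lemma coord_rep:
  assumes "c \<in> atlas M" "x \<in> fst c"
  shows "\<forall>\<^sub>F z in nhds (snd c x). rep c (coord c i) z = z $ i"
  using eventually_chart[OF assms, of "fst c" "\<lambda>_. True"] chart[OF assms(1)] assms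
  by (auto elim!: eventually_mono simp: coord_def rep_apply)

lemma smooth_near_coord: assumes "c \<in> atlas M" "x \<in> fst c" shows "smooth_near M x (coord c i)"
  unfolding smooth_near_iff[OF assms] smooth_at_cong[OF coord_rep[OF assms]]
  by (intro smooth_at_component smooth_at_ident)

lemma dir_deriv_coord:
  assumes "c \<in> atlas M" "x \<in> fst c" shows "dir_deriv (rep c (coord c i)) v (snd c x) = v $ i"
  unfolding dir_deriv_cong_ev(1)[OF coord_rep[OF assms]]
  by (rule dir_deriv_eqI[OF bounded_linear_imp_has_derivative[OF bounded_linear_vec_nth]])

lemma rep_plus: "rep c (f + g) = (\<lambda>z. rep c f z + rep c g z)"
  and rep_scale: "rep c (r *\<^sub>R h) = (\<lambda>z. r * rep c h z)"
  and rep_mult: "rep c (\<lambda>x. u x * v x) = (\<lambda>z. rep c u z * rep c v z)"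
  for f g h u v :: "'a \<Rightarrow> real"
  by (auto simp: plus_fun_def scaleR_fun_def fun_eq_iff rep_apply)

lemma coord_vector_eq:
  assumes "c \<in> atlas M" "x \<in> fst c"
  shows "coord_vector M c i x f = (if smooth_near M x f then dir_deriv (rep c f) (axis i 1) (snd c x) else 0)"
  by (simp add: coord_vector_def dir_deriv_def rep_def)

lemma smooth_near_plus:
  fixes f g :: "'a \<Rightarrow> real"
  assumes "c \<in> atlas M" "x \<in> fst c"
  shows "smooth_near M x f \<Longrightarrow> smooth_near M x g \<Longrightarrow> smooth_near M x (f + g)"
    and "smooth_near M x f \<Longrightarrow> smooth_near M x (r *\<^sub>R f)"
    and "smooth_near M x f \<Longrightarrow> smooth_near M x g \<Longrightarrow> smooth_near M x (\<lambda>x. f x * g x)"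
  unfolding smooth_near_iff[OF assms] rep_plus rep_scale rep_mult
  by (auto intro: smooth_at_add smooth_at_mult)

lemma smooth_near_const: assumes "c \<in> atlas M" "x \<in> fst c" shows "smooth_near M x (\<lambda>_. r)"
  unfolding smooth_near_iff[OF assms] by (simp add: rep_def o_def)

lemma coord_vector_tangent:
  assumes "c \<in> atlas M" "x \<in> fst c" shows "coord_vector M c i x \<in> tangent_space M x"
proof -
  note sn = smooth_near_iff[OF assms]
  have rep_at: "rep c f (snd c x) = f x" for f :: "'a \<Rightarrow> real" by (simp add: rep_apply chart_inv[OF assms])
  have "coord_vector M c i x (f + g) = coord_vector M c i x f + coord_vector M c i x g"
    if "smooth_near M x f" "smooth_near M x g" for f g
    using that smooth_near_plus(1)[OF assms that]
    by (simp add: coord_vector_eq[OF assms] rep_plus sn dir_deriv_add smooth_at_differentiable)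
  moreover have "coord_vector M c i x (r *\<^sub>R f) = r *\<^sub>R coord_vector M c i x f" if "smooth_near M x f" for f r
    using that smooth_near_plus(2)[OF assms that]
    by (simp add: coord_vector_eq[OF assms] rep_scale sn
        dir_deriv_eqI[OF has_derivative_mult_right[OF smooth_at_has_derivative]])
  moreover have "coord_vector M c i x (\<lambda>x. f x * g x) = f x * coord_vector M c i x g + g x * coord_vector M c i x f"
    if "smooth_near M x f" "smooth_near M x g" for f g
    using that smooth_near_plus(3)[OF assms that]
    by (simp add: coord_vector_eq[OF assms] rep_mult sn dir_deriv_bilinear[OF bounded_bilinear_mult]
        smooth_at_differentiable rep_at)
  ultimately show ?thesis
    unfolding tangent_space_def linear_on_def by (auto simp: coord_vector_def)
qed

lemma tangent_germ:
  assumes v: "v \<in> tangent_space M x" and c: "c \<in> atlas M" "x \<in> fst c"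
    and S: "openin (mtop M) S" "x \<in> S" "\<And>y. y \<in> S \<Longrightarrow> f y = g y" and f: "smooth_near M x f"
  shows "v f = v g"
proof -
  have g: "smooth_near M x g" using smooth_near_cong[OF S c] f by simp
  \<comment> \<open>\<open>?i\<close> is the indicator of the complement of \<open>S\<close>. It is
    constant near \<open>x\<close>, hence admissible in the product rule, and
    \<open>?h = ?h * ?i\<close> with both factors zero at \<open>x\<close>.\<close>
  let ?h = "f + (-1) *\<^sub>R g" and ?i = "\<lambda>y. if y \<in> S then 0 else 1 :: real"
  have h: "smooth_near M x ?h" by (intro smooth_near_plus[OF c] f g)
  have i: "smooth_near M x ?i" using smooth_near_cong[OF S(1,2) _ c, of ?i "\<lambda>_. 0"] smooth_near_const[OF c] by simp
  have h0: "?h y = 0" if "y \<in> S" for y using S(3)[OF that] by (simp add: plus_fun_def scaleR_fun_def)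
  have "?h = (\<lambda>y. ?h y * ?i y)" using h0 by (auto simp: fun_eq_iff)
  then have "v ?h = v (\<lambda>y. ?h y * ?i y)" by (rule arg_cong)
  also have "\<dots> = ?h x * v ?i + ?i x * v ?h"
    using v h i unfolding tangent_space_def by blast
  finally have "v ?h = 0" using h0[OF S(2)] S(2) by simp
  moreover have "v ?h = v f + v ((-1) *\<^sub>R g)"
    using v f smooth_near_plus(2)[OF c g, of "-1"] unfolding tangent_space_def linear_on_def by blast
  moreover have "v ((-1) *\<^sub>R g) = (-1) *\<^sub>R v g"
    using v g unfolding tangent_space_def linear_on_def by blast
  ultimately show ?thesis by simp
qed

lemma hadamard_point:
  fixes F :: "real^3 \<Rightarrow> real"
  assumes "smooth F"
  obtains G where "\<And>i :: 3. smooth (G i)" "\<And>z. F z = F a + (\<Sum>i\<in>UNIV. (z $ i - a $ i) * G i z)"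
    "\<And>i. G i a = dir_deriv F (axis i 1) a"
proof -
  let ?D = "\<lambda>i. dir_deriv F (axis i 1)"
  let ?G = "\<lambda>i z. integral {0..1} (\<lambda>t. ?D i (a + t *\<^sub>R (z - a)))"
  have sD: "smooth (?D i)" for i :: 3 using assms by (auto intro: smooth_at_dir_deriv)
  have "smooth (\<lambda>p :: (real^3) \<times> real. ?D i (a + snd p *\<^sub>R (fst p - a)))" for i :: 3
    by (intro allI smooth_at_compose_smooth[OF sD] smooth_at_add smooth_at_diff smooth_at_scaleR smooth_at_const
        smooth_at_fst smooth_at_snd smooth_at_ident)
  from smooth_integral_parameter[OF this] have sG: "smooth (?G i)" for i by simp
  have "F z = F a + (\<Sum>i\<in>UNIV. (z $ i - a $ i) * ?G i z)" for z
  proof -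
    have ct: "continuous_on {0..1} (\<lambda>t. ?D i (a + t *\<^sub>R (z - a)))" for i
      by (intro smooth_at_continuous_on smooth_at_compose_smooth[OF sD] smooth_at_add smooth_at_scaleR smooth_at_const smooth_at_ident)
    have "((\<lambda>t. dir_deriv F (z - a) (a + t *\<^sub>R (z - a))) has_integral F (a + 1 *\<^sub>R (z - a)) - F a) {0..1}"
      by (rule integral_dir_deriv_segment[OF assms]) simp
    moreover have "dir_deriv F (z - a) y = (\<Sum>i\<in>UNIV. (z $ i - a $ i) * ?D i y)" for y
      using dir_deriv_grad[of y F "z - a"] assms by (simp only: grad_def) simp
    ultimately have "F z - F a = integral {0..1} (\<lambda>t. \<Sum>i\<in>UNIV. (z $ i - a $ i) * ?D i (a + t *\<^sub>R (z - a)))"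
      by (simp add: integral_unique)
    also have "\<dots> = (\<Sum>i\<in>UNIV. integral {0..1} (\<lambda>t. (z $ i - a $ i) * ?D i (a + t *\<^sub>R (z - a))))"
      by (rule integral_sum) (auto intro!: integrable_continuous_interval continuous_on_mult continuous_on_const ct)
    finally show ?thesis by simp
  qed
  moreover have "?G i a = ?D i a" for i by simp
  ultimately show thesis using that[of ?G] sG by blast
qed

text \<open>By Hadamard's lemma, near \<open>x\<close> the function is a constant plus products of
  \<open>coord c i - coord c i x\<close> with smooth functions. A derivation kills the constant, and
  since the first factors vanish at \<open>x\<close>, the product rule retains just the values of
  the second factors there, which are the partial derivatives.\<close>

lemma tangent_apply:
  assumes v: "v \<in> tangent_space M x" and c: "c \<in> atlas M" "x \<in> fst c" and f: "smooth_near M x f"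
  shows "v f = (\<Sum>i\<in>UNIV. v (coord c i) * dir_deriv (rep c f) (axis i 1) (snd c x))"
proof -
  let ?a = "snd c x"
  have lin: "v (g + h) = v g + v h" "v (r *\<^sub>R g) = r * v g" "v (\<lambda>y. g y * h y) = g x * v h + h x * v g"
    if "smooth_near M x g" "smooth_near M x h" for g h r
    using v that unfolding tangent_space_def linear_on_def by auto
  note sn = smooth_near_iff[OF c] and sc = smooth_near_const[OF c] and sco = smooth_near_coord[OF c]
  have v1: "v (\<lambda>_. r) = 0" for r
  proof -
    have "v (\<lambda>_. 1) = 0" using lin(3)[OF sc[of 1] sc[of 1]] by simp
    moreover have "(\<lambda>_. r) = r *\<^sub>R (\<lambda>_ :: 'a. 1 :: real)" by (simp add: scaleR_fun_def)
    ultimately show ?thesis using lin(2)[OF sc[of 1] sc[of 1], of r] by simp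
  qed
  obtain F where F: "smooth F" "\<forall>\<^sub>F z in nhds ?a. F z = rep c f z"
    using smooth_at_extend[OF f[unfolded sn] zero_less_one] by metis
  obtain G where G: "\<And>i :: 3. smooth (G i)" "\<And>z. F z = F ?a + (\<Sum>i\<in>UNIV. (z $ i - ?a $ i) * G i z)"
    "\<And>i. G i ?a = dir_deriv F (axis i 1) ?a"
  proof (rule hadamard_point[OF F(1), of ?a], goal_cases)
    case (1 G)
    show ?case by (rule 1(1)[of G]) (rule 1)+
  qed
  let ?d = "\<lambda>i. coord c i + (\<lambda>_. - (?a $ i))" and ?g = "\<lambda>i y. G i (snd c y)"
  have sd: "smooth_near M x (?d i)" for i by (intro smooth_near_plus[OF c] sco sc)
  have sg: "smooth_near M x (?g i)" for i
  proof -
    have "\<forall>\<^sub>F z in nhds ?a. rep c (?g i) z = G i z"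
      using eventually_chart[OF c, of "fst c" "\<lambda>_. True"] chart[OF c(1)] c by (auto elim!: eventually_mono simp: rep_apply)
    from smooth_at_cong[OF this] G(1) show ?thesis unfolding sn by blast
  qed
  have sp: "smooth_near M x (\<lambda>y. ?d i y * ?g i y)" for i by (rule smooth_near_plus(3)[OF c sd sg])
  let ?T = "\<lambda>i y. ?d i y * ?g i y"
  obtain S where S: "openin (mtop M) S" "x \<in> S" "S \<subseteq> fst c" "\<And>y. y \<in> S \<Longrightarrow> F (snd c y) = rep c f (snd c y)"
    by (rule eventually_chart_source[OF c F(2)]) blast
  have "f y = ((\<lambda>_. F ?a) + (?T 1 + (?T 2 + ?T 3))) y" if "y \<in> S" for y
    using S(4)[OF that] G(2)[of "snd c y"] S(3) that chart_inv[OF c(1), of y]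
    by (auto simp: rep_apply sum_3 coord_def plus_fun_def algebra_simps)
  from tangent_germ[OF v c S(1,2) this f]
  have "v f = v ((\<lambda>_. F ?a) + (?T 1 + (?T 2 + ?T 3)))" .
  also have "\<dots> = v (?T 1) + v (?T 2) + v (?T 3)"
    using v1 lin(1)[OF sc smooth_near_plus(1)[OF c sp smooth_near_plus(1)[OF c sp sp]]]
      lin(1)[OF sp smooth_near_plus(1)[OF c sp sp]] lin(1)[OF sp sp] by simp
  finally have vf: "v f = v (?T 1) + v (?T 2) + v (?T 3)" .
  have vT: "v (?T i) = v (coord c i) * dir_deriv (rep c f) (axis i 1) ?a" for i
  proof -
    have "v (?T i) = ?d i x * v (?g i) + ?g i x * v (?d i)" by (rule lin(3)[OF sd sg])
    moreover have "?d i x = 0" by (simp add: coord_def plus_fun_def)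
    moreover have "v (?d i) = v (coord c i)" using lin(1)[OF sco[of i] sc] v1 by simp
    moreover have "?g i x = dir_deriv (rep c f) (axis i 1) ?a"
      using G(3) dir_deriv_cong_ev(1)[OF F(2)] by simp
    ultimately show ?thesis by simp
  qed
  show ?thesis unfolding vf vT by (simp add: sum_3)
qed

end

subsection \<open>Tensors in charts\<close>

lemma dual_space_add: "\<alpha> \<in> dual_space W \<Longrightarrow> \<beta> \<in> dual_space W \<Longrightarrow> \<alpha> + \<beta> \<in> dual_space W"
  and dual_space_scale: "\<alpha> \<in> dual_space W \<Longrightarrow> r *\<^sub>R \<alpha> \<in> dual_space W"
  by (auto simp: dual_space_def linear_on_def plus_fun_def scaleR_fun_def algebra_simps)

lemma linear_onD:
  "linear_on W F \<Longrightarrow> x \<in> W \<Longrightarrow> y \<in> W \<Longrightarrow> F (x + y) = F x + F y"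
  "linear_on W F \<Longrightarrow> x \<in> W \<Longrightarrow> F (r *\<^sub>R x) = r *\<^sub>R F x"
  by (auto simp: linear_on_def)

lemma linear_on_comb3:
  fixes F :: "'v::real_vector \<Rightarrow> 'w::real_vector"
  assumes "linear_on W F" "x \<in> W" "y \<in> W" "z \<in> W"
    and "\<And>x y. x \<in> W \<Longrightarrow> y \<in> W \<Longrightarrow> x + y \<in> W" "\<And>x r. x \<in> W \<Longrightarrow> r *\<^sub>R x \<in> W"
  shows "F (a *\<^sub>R x + b *\<^sub>R y + c *\<^sub>R z) = a *\<^sub>R F x + b *\<^sub>R F y + c *\<^sub>R F z"
  using assms by (simp add: linear_onD)

lemma sum_axis_mult: "(\<Sum>k\<in>UNIV. axis i (1::real) $ k * f k) = f (i::3)"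
  using exhaust_3[of i] by (auto simp: axis_def sum_3)

context charted begin

lemma tangent_add:
  assumes "v \<in> tangent_space M x" "w \<in> tangent_space M x" shows "v + w \<in> tangent_space M x"
  using assms unfolding tangent_space_def linear_on_def by (auto simp: plus_fun_def algebra_simps)

lemma tangent_scale:
  assumes "v \<in> tangent_space M x" shows "r *\<^sub>R v \<in> tangent_space M x"
  using assms unfolding tangent_space_def linear_on_def by (auto simp: scaleR_fun_def algebra_simps)

lemma coord_vector_coord:
  assumes "c \<in> atlas M" "x \<in> fst c" shows "coord_vector M c i x (coord c j) = (if i = j then 1 else 0)"
  using smooth_near_coord[OF assms] by (simp add: coord_vector_eq[OF assms] dir_deriv_coord[OF assms] axis_def)

lemma tangent_expand:
  assumes "c \<in> atlas M" "x \<in> fst c" "v \<in> tangent_space M x"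
  shows "v = v (coord c 1) *\<^sub>R coord_vector M c 1 x + v (coord c 2) *\<^sub>R coord_vector M c 2 x
    + v (coord c 3) *\<^sub>R coord_vector M c 3 x"
proof
  fix f
  show "v f = (v (coord c 1) *\<^sub>R coord_vector M c 1 x + v (coord c 2) *\<^sub>R coord_vector M c 2 x
    + v (coord c 3) *\<^sub>R coord_vector M c 3 x) f"
  proof (cases "smooth_near M x f")
    case True
    then show ?thesis
      using tangent_apply[OF assms(3,1,2)]
      by (simp add: plus_fun_def scaleR_fun_def coord_vector_eq[OF assms(1,2)] sum_3)
  next
    case False
    then have "v f = 0" using assms(3) by (simp add: tangent_space_def)
    with False show ?thesis by (simp add: plus_fun_def scaleR_fun_def coord_vector_eq[OF assms(1,2)])
  qed
qed

lemma linear_on_tangent: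
  fixes F :: "'a tangent \<Rightarrow> real"
  assumes "c \<in> atlas M" "x \<in> fst c" "v \<in> tangent_space M x" "linear_on (tangent_space M x) F"
  shows "F v = (\<Sum>i\<in>UNIV. v (coord c i) * F (coord_vector M c i x))"
proof -
  have "F v = F (v (coord c 1) *\<^sub>R coord_vector M c 1 x + v (coord c 2) *\<^sub>R coord_vector M c 2 x
    + v (coord c 3) *\<^sub>R coord_vector M c 3 x)" using tangent_expand[OF assms(1-3)] by simp
  then show ?thesis
    using linear_on_comb3[OF assms(4) coord_vector_tangent[OF assms(1,2)] coord_vector_tangent[OF assms(1,2)]
        coord_vector_tangent[OF assms(1,2)] tangent_add tangent_scale]
    by (simp add: sum_3)
qed

lemma cotangent_linear: "\<alpha> \<in> cotangent_space M x \<Longrightarrow> linear_on (tangent_space M x) \<alpha>"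
  by (simp add: cotangent_space_def dual_space_def)

lemma cotangent_add: "\<alpha> \<in> cotangent_space M x \<Longrightarrow> \<beta> \<in> cotangent_space M x \<Longrightarrow> \<alpha> + \<beta> \<in> cotangent_space M x"
  and cotangent_scale: "\<alpha> \<in> cotangent_space M x \<Longrightarrow> r *\<^sub>R \<alpha> \<in> cotangent_space M x"
  by (simp_all add: cotangent_space_def dual_space_add dual_space_scale)

definition covec :: "'a chart \<Rightarrow> 'a \<Rightarrow> 'a cotangent \<Rightarrow> real^3" where
  "covec c x \<alpha> = (\<chi> i. \<alpha> (coord_vector M c i x))"

lemma covec_add: "covec c x (\<alpha> + \<beta>) = covec c x \<alpha> + covec c x \<beta>"
  and covec_scale: "covec c x (r *\<^sub>R \<alpha>) = r *\<^sub>R covec c x \<alpha>"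
  by (simp_all add: covec_def vec_eq_iff plus_fun_def scaleR_fun_def)

lemma cotangent_eqI:
  assumes "c \<in> atlas M" "x \<in> fst c" "\<alpha> \<in> cotangent_space M x" "\<beta> \<in> cotangent_space M x"
    "covec c x \<alpha> = covec c x \<beta>"
  shows "\<alpha> = \<beta>"
proof
  fix v
  show "\<alpha> v = \<beta> v"
  proof (cases "v \<in> tangent_space M x")
    case True
    have "\<alpha> (coord_vector M c i x) = \<beta> (coord_vector M c i x)" for i
      using assms(5) by (simp add: covec_def vec_eq_iff)
    then show ?thesis
      using linear_on_tangent[OF assms(1,2) True cotangent_linear[OF assms(3)]]
        linear_on_tangent[OF assms(1,2) True cotangent_linear[OF assms(4)]] by simp
  next
    case False
    then show ?thesis using assms(3,4) by (simp add: cotangent_space_def dual_space_def)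
  qed
qed

lemma differential_cotangent: "differential M x f \<in> cotangent_space M x"
  using tangent_add tangent_scale
  by (auto simp: differential_def cotangent_space_def dual_space_def linear_on_def plus_fun_def scaleR_fun_def)

lemma covec_differential:
  assumes "c \<in> atlas M" "x \<in> fst c" "smooth_near M x f"
  shows "covec c x (differential M x f) = grad (rep c f) (snd c x)"
  using assms coord_vector_tangent[OF assms(1,2)]
  by (simp add: covec_def differential_def grad_def vec_eq_iff coord_vector_eq)

lemma covec_differential_coord:
  assumes "c \<in> atlas M" "x \<in> fst c" shows "covec c x (differential M x (coord c i)) = axis i 1"
  using coord_vector_tangent[OF assms] coord_vector_coord[OF assms]
  by (simp add: covec_def differential_def vec_eq_iff axis_def)

lemma cotangent_expand:
  assumes "c \<in> atlas M" "x \<in> fst c" "\<alpha> \<in> cotangent_space M x"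
  shows "\<alpha> = covec c x \<alpha> $ 1 *\<^sub>R differential M x (coord c 1) + covec c x \<alpha> $ 2 *\<^sub>R differential M x (coord c 2)
    + covec c x \<alpha> $ 3 *\<^sub>R differential M x (coord c 3)"
  by (rule cotangent_eqI[OF assms])
    (auto intro!: cotangent_add cotangent_scale differential_cotangent
      simp: covec_add covec_scale covec_differential_coord[OF assms(1,2)] vec_eq_iff axis_def forall_3)

lemma differential_cong:
  assumes "c \<in> atlas M" "x \<in> fst c" "openin (mtop M) S" "x \<in> S" "\<And>y. y \<in> S \<Longrightarrow> f y = g y" "smooth_near M x f"
  shows "differential M x f = differential M x g"
  using tangent_germ[OF _ assms] by (auto simp: differential_def)

text \<open>In dimension three a bivector is encoded by the vector of its components 23, 31, 12.
  Evaluation on two covectors then becomes a triple product with this vector.\<close>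

definition bivec :: "'a bivector_field \<Rightarrow> 'a chart \<Rightarrow> 'a \<Rightarrow> real^3" where
  "bivec \<pi> c x = vector [\<pi> x (differential M x (coord c 2)) (differential M x (coord c 3)),
     \<pi> x (differential M x (coord c 3)) (differential M x (coord c 1)),
     \<pi> x (differential M x (coord c 1)) (differential M x (coord c 2))]"

lemma bivector_triple:
  assumes \<pi>: "smooth_bivector_field M \<pi>" and c: "c \<in> atlas M" "x \<in> fst c"
    and \<alpha>: "\<alpha> \<in> cotangent_space M x" and \<beta>: "\<beta> \<in> cotangent_space M x"
  shows "\<pi> x \<alpha> \<beta> = triple (covec c x \<alpha>) (covec c x \<beta>) (bivec \<pi> c x)"
proof -
  let ?d = "\<lambda>i. differential M x (coord c i)"
  note dT = differential_cotangent[of x]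
  have x: "x \<in> mspc M" using chart_subset[OF c(1)] c(2) by auto
  have lin: "linear_on (cotangent_space M x) (\<pi> x \<gamma>)" and asym: "\<delta> \<in> cotangent_space M x \<Longrightarrow> \<pi> x \<gamma> \<delta> = - \<pi> x \<delta> \<gamma>"
    if "\<gamma> \<in> cotangent_space M x" for \<gamma> \<delta>
    using \<pi> x that unfolding smooth_bivector_field_def by (blast, blast)
  have exp: "\<pi> x \<gamma> \<delta> = covec c x \<delta> $ 1 * \<pi> x \<gamma> (?d 1) + covec c x \<delta> $ 2 * \<pi> x \<gamma> (?d 2) + covec c x \<delta> $ 3 * \<pi> x \<gamma> (?d 3)"
    if "\<gamma> \<in> cotangent_space M x" "\<delta> \<in> cotangent_space M x" for \<gamma> \<delta>
    using linear_on_comb3[OF lin[OF that(1)] dT dT dT cotangent_add cotangent_scale]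
      arg_cong[OF cotangent_expand[OF c that(2)], of "\<pi> x \<gamma>"] by simp
  have exp': "\<pi> x \<gamma> (?d i) = - (covec c x \<gamma> $ 1 * \<pi> x (?d i) (?d 1) + covec c x \<gamma> $ 2 * \<pi> x (?d i) (?d 2)
      + covec c x \<gamma> $ 3 * \<pi> x (?d i) (?d 3))" if "\<gamma> \<in> cotangent_space M x" for \<gamma> i
    using exp[OF dT that] asym[OF that dT] by simp
  have z: "\<pi> x (?d i) (?d i) = 0" for i using asym[OF dT dT, of "coord c i" "coord c i"] by simp
  have s: "\<pi> x (?d 2) (?d 1) = - \<pi> x (?d 1) (?d 2)" "\<pi> x (?d 1) (?d 3) = - \<pi> x (?d 3) (?d 1)"
    "\<pi> x (?d 3) (?d 2) = - \<pi> x (?d 2) (?d 3)" using asym[OF dT dT] by blast+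
  show ?thesis
    unfolding exp[OF \<alpha> \<beta>] exp'[OF \<alpha>] z s triple_eq bivec_def by (simp add: algebra_simps)
qed

lemma poisson_bracket_triple:
  assumes \<pi>: "smooth_bivector_field M \<pi>" and c: "c \<in> atlas M" "x \<in> fst c"
    and "smooth_near M x f" "smooth_near M x g"
  shows "poisson_bracket M \<pi> f g x = triple (grad (rep c f) (snd c x)) (grad (rep c g) (snd c x)) (bivec \<pi> c x)"
  unfolding poisson_bracket_def bivector_triple[OF \<pi> c differential_cotangent differential_cotangent]
  using covec_differential[OF c] assms(4,5) by simp

lemma smooth_near_bivec:
  assumes \<pi>: "smooth_bivector_field M \<pi>" and c: "c \<in> atlas M" "x \<in> fst c"
  shows "smooth_near M x (\<lambda>x. bivec \<pi> c x $ k)"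
proof -
  have "smooth_near M x (\<lambda>x. \<pi> x (differential M x (coord c i)) (differential M x (coord c j)))" for i j
    using \<pi> c chart[OF c(1)] unfolding smooth_bivector_field_def smooth_near_def by blast
  then show ?thesis using exhaust_3[of k] by (auto simp: bivec_def)
qed

definition vol :: "('a \<Rightarrow> 'a tangent \<Rightarrow> 'a tangent \<Rightarrow> 'a tangent \<Rightarrow> real) \<Rightarrow> 'a chart \<Rightarrow> 'a \<Rightarrow> real" where
  "vol \<mu> c x = \<mu> x (coord_vector M c 1 x) (coord_vector M c 2 x) (coord_vector M c 3 x)"

definition comps :: "'a chart \<Rightarrow> 'a tangent \<Rightarrow> real^3" where
  "comps c v = (\<chi> i. v (coord c i))"

lemma volume_form_triple:
  assumes \<mu>: "volume_form M S \<mu>" and c: "c \<in> atlas M" "x \<in> fst c" and x: "x \<in> S"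
    and "u \<in> tangent_space M x" "v \<in> tangent_space M x" "w \<in> tangent_space M x"
  shows "\<mu> x u v w = triple (comps c u) (comps c v) (comps c w) * vol \<mu> c x"
proof -
  let ?T = "tangent_space M x" and ?d = "\<lambda>i. coord_vector M c i x"
  have lin: "linear_on ?T (\<mu> x u v)" and a: "\<mu> x u v w = - \<mu> x v u w" "\<mu> x u v w = - \<mu> x u w v"
    if "u \<in> ?T" "v \<in> ?T" "w \<in> ?T" for u v w
    using \<mu> x that unfolding volume_form_def by (blast, blast, blast)
  have cyc: "\<mu> x u v w = \<mu> x w u v" if "u \<in> ?T" "v \<in> ?T" "w \<in> ?T" for u v w
    using a(2)[of u v w] a(1)[of u w v] that by simp
  note dT = coord_vector_tangent[OF c]
  have e: "\<mu> x u v w = (\<Sum>k\<in>UNIV. w (coord c k) * \<mu> x (?d k) u v)" if "u \<in> ?T" "v \<in> ?T" "w \<in> ?T" for u v w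
    using linear_on_tangent[OF c that(3) lin[OF that]] cyc[OF that(1,2) dT] by simp
  define E where "E i j k = \<mu> x (?d i) (?d j) (?d k)" for i j k
  have "\<mu> x u v w = (\<Sum>k\<in>UNIV. w (coord c k) * (\<Sum>j\<in>UNIV. v (coord c j) * (\<Sum>i\<in>UNIV. u (coord c i) * E i j k)))"
    using e[OF assms(5-7)] e[OF dT assms(5,6)] e[OF dT dT assms(5)] by (simp add: E_def)
  moreover have en: "E i j k = - E j i k" "E i j k = - E i k j" for i j k
    unfolding E_def by (rule a[OF dT dT dT])+
  have "E i i k = 0" "E i k k = 0" "E i k i = 0" for i k
    using en(1)[of i i k] en(2)[of i k k] en(1)[of i k i] en(2)[of k i i] by linarith+
  moreover have "E 2 1 3 = - E 1 2 3" "E 1 3 2 = - E 1 2 3" "E 3 2 1 = - E 1 2 3" "E 2 3 1 = E 1 2 3" "E 3 1 2 = E 1 2 3"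
    using en(1)[of 2 1 3] en(2)[of 1 3 2] en(1)[of 3 2 1] en(2)[of 2 3 1] en(1)[of 3 1 2] by linarith+
  ultimately show ?thesis
    by (simp add: sum_3 triple_eq comps_def vol_def E_def[symmetric] algebra_simps)
qed

lemma vol_nonzero:
  assumes \<mu>: "volume_form M S \<mu>" and c: "c \<in> atlas M" "x \<in> fst c" and x: "x \<in> S"
  shows "vol \<mu> c x \<noteq> 0"
proof -
  obtain u v w where "u \<in> tangent_space M x" "v \<in> tangent_space M x" "w \<in> tangent_space M x" "\<mu> x u v w \<noteq> 0"
    using \<mu> x unfolding volume_form_def by blast
  then show ?thesis using volume_form_triple[OF assms] by force
qed

lemma smooth_near_vol:
  assumes \<mu>: "volume_form M S \<mu>" "openin (mtop M) S" and c: "c \<in> atlas M" "x \<in> fst c" and x: "x \<in> S"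
  shows "smooth_near M x (vol \<mu> c)"
proof -
  have "openin (mtop M) (fst c \<inter> S)" using chart[OF c(1)] assms(2) by blast
  moreover have "vol \<mu> c \<in> smooth_functions M (fst c \<inter> S)"
    using \<mu>(1) c(1) unfolding volume_form_def vol_def[abs_def] by blast
  ultimately show ?thesis using c x unfolding smooth_near_def by blast
qed

lemma comps_change:
  assumes "c \<in> atlas M" "x \<in> fst c" "d \<in> atlas M" "x \<in> fst d" "w \<in> tangent_space M x"
  shows "comps d w $ a = (\<Sum>k\<in>UNIV. comps c w $ k * grad (rep c (coord d a)) (snd c x) $ k)"
  using tangent_apply[OF assms(5,1,2) smooth_near_coord[OF assms(3,4)]] by (simp add: comps_def grad_def)

lemma comps_coord_vector:
  assumes "c \<in> atlas M" "x \<in> fst c" shows "comps c (coord_vector M c k x) = axis k 1"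
  using coord_vector_coord[OF assms] by (simp add: comps_def vec_eq_iff axis_def)

text \<open>\<open>contraction\<close> uses a chart chosen separately at each point, with no
  continuity in the choice. Only after its value is known to be the same in all charts can it be
  differentiated in a fixed one.\<close>

lemma contraction_change:
  assumes \<pi>: "smooth_bivector_field M \<pi>" and \<mu>: "volume_form M S \<mu>" and x: "x \<in> S"
    and c: "c \<in> atlas M" "x \<in> fst c" and d: "d \<in> atlas M" "x \<in> fst d" and w: "w \<in> tangent_space M x"
  shows "vol \<mu> d x * (\<Sum>a\<in>UNIV. comps d w $ a * bivec \<pi> d x $ a) = vol \<mu> c x * (\<Sum>a\<in>UNIV. comps c w $ a * bivec \<pi> c x $ a)"
proof -
  let ?J = "\<lambda>a. grad (rep c (coord d a)) (snd c x)" and ?p = "bivec \<pi> c x" and ?w = "comps c w"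
  note cv = coord_vector_tangent[OF c]
  have J: "comps d (coord_vector M c k x) $ a = ?J a $ k" for k a
    unfolding comps_change[OF c d cv] comps_coord_vector[OF c] by (rule sum_axis_mult)
  have v: "vol \<mu> c x = triple (?J 1) (?J 2) (?J 3) * vol \<mu> d x"
    using volume_form_triple[OF \<mu> d x cv[of 1] cv[of 2] cv[of 3]] by (simp add: vol_def[of \<mu> c] triple_eq J algebra_simps)
  have "\<pi> x (differential M x (coord d a)) (differential M x (coord d b)) = triple (?J a) (?J b) ?p" for a b
    unfolding bivector_triple[OF \<pi> c differential_cotangent differential_cotangent]
      covec_differential[OF c smooth_near_coord[OF d]] ..
  then have p: "bivec \<pi> d x = vector [triple (?J 2) (?J 3) ?p, triple (?J 3) (?J 1) ?p, triple (?J 1) (?J 2) ?p]"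
    by (simp add: bivec_def)
  \<comment> \<open>\<open>bivec\<close> transforms with the cofactors of the Jacobian matrix and
    \<open>comps\<close> with the matrix itself, so their pairing gains its determinant;
    \<open>vol\<close> gains the inverse factor.\<close>
  have "(\<Sum>a\<in>UNIV. (\<Sum>k\<in>UNIV. ?w $ k * ?J a $ k) * bivec \<pi> d x $ a) = triple (?J 1) (?J 2) (?J 3) * (\<Sum>a\<in>UNIV. ?w $ a * ?p $ a)"
    unfolding p by (simp add: sum_3 triple_eq algebra_simps)
  then show ?thesis unfolding comps_change[OF c d w] v by simp
qed

lemma contraction_eq:
  assumes \<pi>: "smooth_bivector_field M \<pi>" and \<mu>: "volume_form M S \<mu>" and x: "x \<in> S"
    and c: "c \<in> atlas M" "x \<in> fst c" and w: "w \<in> tangent_space M x"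
  shows "contraction M \<pi> \<mu> x w = vol \<mu> c x * (\<Sum>a\<in>UNIV. comps c w $ a * bivec \<pi> c x $ a)"
proof -
  define d where "d = chart_at M x"
  have "d \<in> atlas M \<and> x \<in> fst d" unfolding d_def chart_at_def by (rule someI[of _ c]) (use c in simp)
  then have d: "d \<in> atlas M" "x \<in> fst d" by auto
  let ?p = "bivec \<pi> d x"
  have "\<pi> x (differential M x (coord d i)) (differential M x (coord d j)) = triple (axis i 1) (axis j 1) ?p" for i j
    unfolding bivector_triple[OF \<pi> d differential_cotangent differential_cotangent] covec_differential_coord[OF d] ..
  moreover have "\<mu> x (coord_vector M d i x) (coord_vector M d j x) w = triple (axis i 1) (axis j 1) (comps d w) * vol \<mu> d x" for i j
    using volume_form_triple[OF \<mu> d x coord_vector_tangent[OF d] coord_vector_tangent[OF d] w] comps_coord_vector[OF d] by simp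
  ultimately have "contraction M \<pi> \<mu> x w =
      1/2 * (\<Sum>i\<in>UNIV. \<Sum>j\<in>UNIV. triple (axis i 1) (axis j 1) ?p * (triple (axis i 1) (axis j 1) (comps d w) * vol \<mu> d x))"
    by (simp add: contraction_def Let_def d_def[symmetric])
  also have "\<dots> = vol \<mu> d x * (\<Sum>a\<in>UNIV. comps d w $ a * ?p $ a)"
    by (simp add: sum_3 triple_eq axis_def algebra_simps)
  also have "\<dots> = vol \<mu> c x * (\<Sum>a\<in>UNIV. comps c w $ a * bivec \<pi> c x $ a)"
    by (rule contraction_change[OF \<pi> \<mu> x c d w])
  finally show ?thesis .
qed

text \<open>The components of the one-form \<open>contraction M \<pi> \<mu>\<close> in the chart \<open>c\<close>.\<close>

definition contr_comp :: "'a bivector_field \<Rightarrow> ('a \<Rightarrow> 'a tangent \<Rightarrow> 'a tangent \<Rightarrow> 'a tangent \<Rightarrow> real) \<Rightarrow> 'a chart \<Rightarrow> 3 \<Rightarrow> 'a \<Rightarrow> real" where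
  "contr_comp \<pi> \<mu> c k x = vol \<mu> c x * bivec \<pi> c x $ k"

lemma smooth_near_contr_comp:
  assumes "smooth_bivector_field M \<pi>" "volume_form M S \<mu>" "openin (mtop M) S" "c \<in> atlas M" "x \<in> fst c" "x \<in> S"
  shows "smooth_near M x (contr_comp \<pi> \<mu> c k)"
  unfolding contr_comp_def[abs_def]
  by (rule smooth_near_plus(3)[OF assms(4,5) smooth_near_vol[OF assms(2-6)] smooth_near_bivec[OF assms(1,4,5)]])

lemma contr_comp_change:
  assumes \<pi>: "smooth_bivector_field M \<pi>" and \<mu>: "volume_form M S \<mu>" and x: "x \<in> S"
    and c: "c \<in> atlas M" "x \<in> fst c" and d: "d \<in> atlas M" "x \<in> fst d"
  shows "contr_comp \<pi> \<mu> c k x = (\<Sum>a\<in>UNIV. grad (rep c (coord d a)) (snd c x) $ k * contr_comp \<pi> \<mu> d a x)"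
proof -
  note cv = coord_vector_tangent[OF c, of k]
  have "contr_comp \<pi> \<mu> c k x = vol \<mu> c x * (\<Sum>a\<in>UNIV. comps c (coord_vector M c k x) $ a * bivec \<pi> c x $ a)"
    unfolding comps_coord_vector[OF c] contr_comp_def by (simp add: sum_axis_mult)
  also have "\<dots> = vol \<mu> d x * (\<Sum>a\<in>UNIV. comps d (coord_vector M c k x) $ a * bivec \<pi> d x $ a)"
    by (rule contraction_change[OF \<pi> \<mu> x c d cv, symmetric])
  also have "comps d (coord_vector M c k x) $ a = grad (rep c (coord d a)) (snd c x) $ k" for a
    unfolding comps_change[OF c d cv] comps_coord_vector[OF c] by (rule sum_axis_mult)
  then have "vol \<mu> d x * (\<Sum>a\<in>UNIV. comps d (coord_vector M c k x) $ a * bivec \<pi> d x $ a) =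
      (\<Sum>a\<in>UNIV. grad (rep c (coord d a)) (snd c x) $ k * contr_comp \<pi> \<mu> d a x)"
    by (simp add: contr_comp_def sum_distrib_left mult.commute mult.left_commute)
  finally show ?thesis .
qed

text \<open>\<open>ext_deriv\<close> is computed in the chart picked by \<open>chart_at\<close>,
  while the Poincare lemma needs closedness in one fixed chart. Under the transition map the
  derivatives of the components gain second derivatives of the transition, which are symmetric in j
  and k, and a term quadratic in the first derivatives, which is symmetric because the form is
  closed in the chosen chart.\<close>

lemma contraction_closed:
  assumes \<pi>: "smooth_bivector_field M \<pi>" and \<mu>: "volume_form M S \<mu>" "openin (mtop M) S"
    and closed: "\<And>x u v. x \<in> S \<Longrightarrow> u \<in> tangent_space M x \<Longrightarrow> v \<in> tangent_space M x \<Longrightarrow>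
      ext_deriv M (contraction M \<pi> \<mu>) x u v = 0"
    and c: "c \<in> atlas M" "x \<in> fst c" and x: "x \<in> S"
  shows "dir_deriv (rep c (contr_comp \<pi> \<mu> c k)) (axis j 1) (snd c x) =
    dir_deriv (rep c (contr_comp \<pi> \<mu> c j)) (axis k 1) (snd c x)"
proof -
  define d where "d = chart_at M x"
  have "d \<in> atlas M \<and> x \<in> fst d" unfolding d_def chart_at_def by (rule someI[of _ c]) (use c in simp)
  then have d: "d \<in> atlas M" "x \<in> fst d" by auto
  let ?A = "\<lambda>a. rep d (contr_comp \<pi> \<mu> d a)"
  define X where "X i j = coord_vector M d i x (\<lambda>y. contraction M \<pi> \<mu> y (coord_vector M d j y))" for i j
  have o: "openin (mtop M) (fst d \<inter> S)" using chart[OF d(1)] \<mu>(2) by blast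
  have snc: "smooth_near M x (contr_comp \<pi> \<mu> d j)" for j by (rule smooth_near_contr_comp[OF \<pi> \<mu> d x])
  \<comment> \<open>At \<open>y\<close> the contraction is built from the chart chosen at
    \<open>y\<close>, possibly other than \<open>d\<close>. The two functions agree on a whole
    neighbourhood of \<open>x\<close>, and tangent vectors at \<open>x\<close> depend on
    germs.\<close>
  have "contr_comp \<pi> \<mu> d j y = contraction M \<pi> \<mu> y (coord_vector M d j y)" if "y \<in> fst d \<inter> S" for y j
  proof -
    have y: "y \<in> S" "y \<in> fst d" using that by auto
    show ?thesis
      unfolding contraction_eq[OF \<pi> \<mu>(1) y(1) d(1) y(2) coord_vector_tangent[OF d(1) y(2)]] comps_coord_vector[OF d(1) y(2)]
      by (simp add: contr_comp_def sum_axis_mult)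
  qed
  from tangent_germ[OF coord_vector_tangent[OF d] d o _ this snc]
  have X: "X i j = dir_deriv (?A j) (axis i 1) (snd d x)" for i j
    unfolding X_def using d x snc by (simp add: coord_vector_eq[OF d])
  have XX: "X a b = X b a" for a b
  proof -
    have "(\<Sum>i\<in>UNIV. \<Sum>j\<in>UNIV. X i j * (coord_vector M d a x (coord d i) * coord_vector M d b x (coord d j)
       - coord_vector M d a x (coord d j) * coord_vector M d b x (coord d i))) = 0"
      using closed[OF x coord_vector_tangent[OF d, of a] coord_vector_tangent[OF d, of b]]
      by (simp add: ext_deriv_def Let_def d_def[symmetric] X_def)
    then show ?thesis
      using exhaust_3[of a] exhaust_3[of b] by (auto simp: coord_vector_coord[OF d] sum_3)
  qed
  let ?\<tau> = "rep c (snd d)" and ?z = "snd c x"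
  have s\<tau>: "smooth_at ?z ?\<tau>" by (rule transition_smooth_at[OF c(1) d(1) c(2) d(2)])
  have \<tau>x: "?\<tau> ?z = snd d x" by (simp add: rep_apply chart_inv[OF c])
  have co: "rep c (coord d a) = (\<lambda>z. ?\<tau> z $ a)" for a by (simp add: rep_def coord_def fun_eq_iff)
  have s\<tau>a: "smooth_at ?z (\<lambda>z. ?\<tau> z $ a)" for a by (rule smooth_at_component[OF s\<tau>])
  have sA: "smooth_at (snd d x) (?A a)" for a using snc unfolding smooth_near_iff[OF d] .
  define B where "B a k = dir_deriv (\<lambda>z. ?\<tau> z $ a) (axis k 1)" for a k
  have sB: "smooth_at ?z (B a k)" for a k unfolding B_def by (rule smooth_at_dir_deriv[OF s\<tau>a])
  have "\<forall>\<^sub>F z in nhds ?z. rep c (contr_comp \<pi> \<mu> c k) z = (\<Sum>a\<in>UNIV. B a k z * ?A a (?\<tau> z))" for k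
  proof -
    have "contr_comp \<pi> \<mu> c k y = (\<Sum>a\<in>UNIV. B a k (snd c y) * ?A a (snd d y))" if "y \<in> fst d \<inter> S" "y \<in> fst c" for y
    proof -
      have y: "y \<in> S" "y \<in> fst d" using that by auto
      have "?A a (snd d y) = contr_comp \<pi> \<mu> d a y" for a by (simp add: rep_apply chart_inv[OF d(1) y(2)])
      then show ?thesis
        unfolding contr_comp_change[OF \<pi> \<mu>(1) y(1) c(1) that(2) d(1) y(2)] by (simp add: B_def co grad_def)
    qed
    then have "\<forall>\<^sub>F z in nhds ?z. inv_into (fst c) (snd c) z \<in> fst c \<and> inv_into (fst c) (snd c) z \<in> fst d \<inter> S \<and>
        snd c (inv_into (fst c) (snd c) z) = z \<and> contr_comp \<pi> \<mu> c k (inv_into (fst c) (snd c) z) =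
        (\<Sum>a\<in>UNIV. B a k (snd c (inv_into (fst c) (snd c) z)) * ?A a (snd d (inv_into (fst c) (snd c) z)))"
      by (intro eventually_chart[OF c o]) (use d x in auto)
    then show ?thesis by eventually_elim (simp add: rep_apply[of c])
  qed
  note ev = dir_deriv_cong_ev(1)[OF this]
  have D: "dir_deriv (rep c (contr_comp \<pi> \<mu> c k)) (axis j 1) ?z =
      (\<Sum>a\<in>UNIV. dir_deriv (B a k) (axis j 1) ?z * ?A a (snd d x)) + (\<Sum>a\<in>UNIV. \<Sum>b\<in>UNIV. B a k ?z * B b j ?z * X b a)" for k j
  proof -
    have dA: "((\<lambda>z. ?A a (?\<tau> z)) has_derivative (\<lambda>h. dir_deriv (?A a) (dir_deriv ?\<tau> h ?z) (snd d x))) (at ?z)" for a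
      using smooth_at_has_derivative_compose[OF _ smooth_at_has_derivative[OF s\<tau>], of "?A a"] sA \<tau>x by simp
    have "((\<lambda>z. \<Sum>a\<in>UNIV. B a k z * ?A a (?\<tau> z)) has_derivative (\<lambda>h. \<Sum>a\<in>UNIV. B a k ?z * dir_deriv (?A a) (dir_deriv ?\<tau> h ?z) (snd d x)
        + dir_deriv (B a k) h ?z * ?A a (?\<tau> ?z))) (at ?z)"
      by (intro has_derivative_sum has_derivative_mult dA smooth_at_has_derivative sB)
    from dir_deriv_eqI[OF this, of "axis j 1"]
    have "dir_deriv (rep c (contr_comp \<pi> \<mu> c k)) (axis j 1) ?z = (\<Sum>a\<in>UNIV. B a k ?z * dir_deriv (?A a) (dir_deriv ?\<tau> (axis j 1) ?z) (snd d x)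
        + dir_deriv (B a k) (axis j 1) ?z * ?A a (snd d x))"
      unfolding ev \<tau>x .
    moreover have "dir_deriv ?\<tau> (axis j 1) ?z $ b = B b j ?z" for b
      unfolding B_def by (rule dir_deriv_eqI[symmetric, OF bounded_linear.has_derivative[OF bounded_linear_vec_nth smooth_at_has_derivative[OF s\<tau>]]])
    then have "dir_deriv (?A a) (dir_deriv ?\<tau> (axis j 1) ?z) (snd d x) = (\<Sum>b\<in>UNIV. B b j ?z * X b a)" for a
      unfolding dir_deriv_grad[OF sA] by (simp add: X grad_def)
    ultimately show ?thesis
      by (simp add: sum.distrib sum_distrib_left mult.assoc add.commute)
  qed
  have "dir_deriv (B a k) (axis j 1) ?z = dir_deriv (B a j) (axis k 1) ?z" for a
    unfolding B_def by (rule dir_deriv_commute[OF s\<tau>a])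
  moreover have "(\<Sum>a\<in>UNIV. \<Sum>b\<in>UNIV. B a k ?z * B b j ?z * X b a) = (\<Sum>a\<in>UNIV. \<Sum>b\<in>UNIV. B a j ?z * B b k ?z * X b a)"
    by (subst sum.swap) (simp add: XX mult.commute)
  ultimately show ?thesis unfolding D by simp
qed

end

subsection \<open>The Poincare lemma and the normal form up to linear changes of coordinates\<close>

text \<open>The primitive is the integral of the form along the segment from \<open>a\<close> to
  \<open>z\<close>. By closedness the i-th partial derivative of its integrand is the t-derivative
  of t A_i(a + t (z - a)), so the integral is A_i(z). The argument stays in a ball around
  \<open>a\<close>, which contains these segments; the components are first extended so that all
  integrals are smooth.\<close>

lemma poincare_one_form:
  fixes A :: "3 \<Rightarrow> real^3 \<Rightarrow> real"
  assumes A: "\<And>k. smooth_at a (A k)"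
    and closed: "\<forall>\<^sub>F z in nhds a. \<forall>j k. dir_deriv (A k) (axis j 1) z = dir_deriv (A j) (axis k 1) z"
  obtains F where "smooth F" "\<forall>\<^sub>F z in nhds a. \<forall>k. grad F z $ k = A k z"
proof -
  have "\<exists>g. smooth g \<and> (\<forall>\<^sub>F z in nhds a. g z = A k z)" for k
    by (rule smooth_at_extend[OF A[of k] zero_less_one]) blast
  then obtain B where B: "\<And>k. smooth (B k)" "\<And>k. \<forall>\<^sub>F z in nhds a. B k z = A k z" by metis
  have dB: "\<forall>\<^sub>F z in nhds a. dir_deriv (B k) v z = dir_deriv (A k) v z" for k v
    using eventually_eventually[THEN iffD2, OF B(2)] by eventually_elim (rule dir_deriv_cong_ev)
  have dB': "\<forall>\<^sub>F z in nhds a. \<forall>j k. dir_deriv (B k) (axis j 1) z = dir_deriv (A k) (axis j 1) z"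
    by (intro eventually_all_finite allI dB)
  have B2: "\<forall>\<^sub>F z in nhds a. \<forall>k. B k z = A k z" by (intro eventually_all_finite B(2))
  from closed dB' B2
  have "\<forall>\<^sub>F z in nhds a. (\<forall>j k. dir_deriv (B k) (axis j 1) z = dir_deriv (B j) (axis k 1) z) \<and> (\<forall>k. B k z = A k z)"
    by eventually_elim simp
  then obtain r where r: "r > 0" and cB: "\<And>z j k. dist z a < r \<Longrightarrow> dir_deriv (B k) (axis j 1) z = dir_deriv (B j) (axis k 1) z"
    and BA: "\<And>z k. dist z a < r \<Longrightarrow> B k z = A k z"
    unfolding eventually_nhds_metric by blast
  let ?G = "\<lambda>p :: (real^3) \<times> real. \<Sum>k\<in>UNIV. B k (a + snd p *\<^sub>R (fst p - a)) * (fst p $ k - a $ k)"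
  let ?F = "\<lambda>z. integral {0..1} (\<lambda>t. ?G (z, t))"
  have sG: "smooth ?G"
    by (intro allI smooth_at_sum smooth_at_mult smooth_at_compose_smooth[OF B(1)] smooth_at_add smooth_at_diff smooth_at_scaleR
        smooth_at_component smooth_at_const smooth_at_fst smooth_at_snd smooth_at_ident)
  have sF: "smooth ?F" by (rule smooth_integral_parameter[OF sG])
  have "grad ?F z $ i = A i z" if z: "dist z a < r" for z i
  proof -
    have D: "dir_deriv ?G (axis i 1, 0) (z, t) =
        B i (a + t *\<^sub>R (z - a)) + t * dir_deriv (B i) (z - a) (a + t *\<^sub>R (z - a))" if t: "t \<in> {0..1}" for t
    proof -
      let ?y = "a + t *\<^sub>R (z - a)"
      have "dist ?y a = t * dist z a" using t by (simp add: dist_norm)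
      also have "\<dots> \<le> dist z a" using t by (simp add: mult_left_le_one_le)
      finally have y: "dist ?y a < r" using z by simp
      have p: "((\<lambda>z. (z, t)) has_derivative (\<lambda>h. (h, 0))) (at z)"
        by (intro has_derivative_Pair has_derivative_ident has_derivative_const)
      have d1: "((\<lambda>z. ?G (z, t)) has_derivative (\<lambda>h. dir_deriv ?G (h, 0) (z, t))) (at z)"
        by (rule smooth_at_has_derivative_compose[OF _ p]) (use sG in blast)
      have "((\<lambda>z. a + t *\<^sub>R (z - a)) has_derivative (\<lambda>h. t *\<^sub>R h)) (at z)"
        by (auto intro!: derivative_eq_intros)
      from smooth_at_has_derivative_compose[OF _ this]
      have "((\<lambda>z. B k (a + t *\<^sub>R (z - a))) has_derivative (\<lambda>h. dir_deriv (B k) (t *\<^sub>R h) ?y)) (at z)" for k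
        using B(1) by blast
      moreover have "dir_deriv (B k) (t *\<^sub>R h) ?y = t * dir_deriv (B k) h ?y" for k h
        using dir_deriv_smult[of ?y "B k" t h] B(1) by simp
      ultimately have "((\<lambda>z. B k (a + t *\<^sub>R (z - a))) has_derivative (\<lambda>h. t * dir_deriv (B k) h ?y)) (at z)" for k
        by (simp only:)
      moreover have "((\<lambda>z. z $ k - a $ k) has_derivative (\<lambda>h. h $ k)) (at z)" for k
        by (auto intro!: derivative_eq_intros bounded_linear_imp_has_derivative[OF bounded_linear_vec_nth])
      ultimately have d2: "((\<lambda>z. \<Sum>k\<in>UNIV. B k (a + t *\<^sub>R (z - a)) * (z $ k - a $ k)) has_derivative
          (\<lambda>h. \<Sum>k\<in>UNIV. B k ?y * h $ k + t * dir_deriv (B k) h ?y * (z $ k - a $ k))) (at z)"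
        by (intro has_derivative_sum has_derivative_mult)
      have "dir_deriv ?G (axis i 1, 0) (z, t) = (\<Sum>k\<in>UNIV. B k ?y * axis i 1 $ k + t * dir_deriv (B k) (axis i 1) ?y * (z $ k - a $ k))"
        using fun_cong[OF has_derivative_unique[OF d1[unfolded fst_conv snd_conv] d2]] .
      also have "\<dots> = (\<Sum>k\<in>UNIV. axis i 1 $ k * B k ?y) + t * (\<Sum>k\<in>UNIV. (z - a) $ k * dir_deriv (B i) (axis k 1) ?y)"
        using cB[OF y] by (simp add: sum.distrib sum_distrib_left mult.commute mult.left_commute)
      also have "(\<Sum>k\<in>UNIV. (z - a) $ k * dir_deriv (B i) (axis k 1) ?y) = dir_deriv (B i) (z - a) ?y"
        using dir_deriv_grad[of ?y "B i" "z - a"] B(1) by (simp only: grad_def vec_lambda_beta)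
      finally show ?thesis by (simp only: sum_axis_mult)
    qed
    have "((\<lambda>t. B i (a + t *\<^sub>R (z - a)) + t * dir_deriv (B i) (z - a) (a + t *\<^sub>R (z - a))) has_integral
        1 * B i (a + 1 *\<^sub>R (z - a)) - 0 * B i (a + 0 *\<^sub>R (z - a))) {0..1}"
    proof (rule fundamental_theorem_of_calculus)
      fix t :: real
      have "((\<lambda>t. a + t *\<^sub>R (z - a)) has_derivative (\<lambda>h. h *\<^sub>R (z - a))) (at t within {0..1})"
        by (auto intro!: derivative_eq_intros)
      from smooth_at_has_derivative_compose[OF _ this, of "B i"] B(1)
      have "((\<lambda>t. B i (a + t *\<^sub>R (z - a))) has_derivative (\<lambda>h. dir_deriv (B i) (h *\<^sub>R (z - a)) (a + t *\<^sub>R (z - a)))) (at t within {0..1})"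
        by blast
      moreover have "dir_deriv (B i) (h *\<^sub>R (z - a)) y = h *\<^sub>R dir_deriv (B i) (z - a) y" for h y
        by (rule dir_deriv_smult) (use B(1) in blast)
      ultimately have "((\<lambda>t. B i (a + t *\<^sub>R (z - a))) has_vector_derivative dir_deriv (B i) (z - a) (a + t *\<^sub>R (z - a))) (at t within {0..1})"
        unfolding has_vector_derivative_def by (simp only:)
      from has_vector_derivative_mult[OF has_vector_derivative_id[unfolded id_def] this]
      show "((\<lambda>t. t * B i (a + t *\<^sub>R (z - a))) has_vector_derivative
          B i (a + t *\<^sub>R (z - a)) + t * dir_deriv (B i) (z - a) (a + t *\<^sub>R (z - a))) (at t within {0..1})"
        by (simp add: add.commute)
    qed simp
    then have "integral {0..1} (\<lambda>t. B i (a + t *\<^sub>R (z - a)) + t * dir_deriv (B i) (z - a) (a + t *\<^sub>R (z - a))) = B i z"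
      by (simp add: integral_unique)
    moreover have "integral {0..1} (\<lambda>t. dir_deriv ?G (axis i 1, 0) (z, t)) =
        integral {0..1} (\<lambda>t. B i (a + t *\<^sub>R (z - a)) + t * dir_deriv (B i) (z - a) (a + t *\<^sub>R (z - a)))"
      by (rule integral_cong) (rule D)
    ultimately have "integral {0..1} (\<lambda>t. dir_deriv ?G (axis i 1, 0) (z, t)) = B i z" by (simp only:)
    then show ?thesis
      using dir_deriv_eqI[OF has_derivative_integral_parameter[OF sG], of 0 1 "axis i 1" z] BA[OF z] by (simp add: grad_def)
  qed
  then have "\<forall>\<^sub>F z in nhds a. \<forall>k. grad ?F z $ k = A k z"
    unfolding eventually_nhds_metric using r by blast
  then show thesis by (rule that[OF sF])
qed

lemma dir_deriv_linear_compose: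
  assumes "bounded_linear L" "smooth_at (L x) f"
  shows "dir_deriv (\<lambda>x. f (L x)) v x = dir_deriv f (L v) (L x)"
  by (rule dir_deriv_eqI[OF smooth_at_has_derivative_compose[OF assms(2) bounded_linear_imp_has_derivative[OF assms(1)]]])

text \<open>The hypotheses say that the linear forms \<open>T1\<close>, \<open>T2\<close>, \<open>T3\<close> satisfy the bracket relations of
  \<open>sl\<^sub>2(\<real>)\<close> with respect to the linear part of the bracket at \<open>0\<close>.\<close>

theorem exists_linear_form_sl2:
  fixes f g :: "real^3 \<Rightarrow> real"
  assumes f: "smooth_at 0 f" "grad f 0 = 0" and g: "smooth_at 0 g" "g 0 \<noteq> 0"
    and d0: "triple T1 T2 T3 \<noteq> 0"
    and T12: "\<And>l. g 0 * triple T1 T2 (grad (dir_deriv f (axis l 1)) 0) = T3 $ l"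
    and T23: "\<And>l. g 0 * triple T2 T3 (grad (dir_deriv f (axis l 1)) 0) = - T1 $ l"
    and T31: "\<And>l. g 0 * triple T3 T1 (grad (dir_deriv f (axis l 1)) 0) = - T2 $ l"
  shows "\<exists>w c. linear_form g f w c"
proof -
  define d where "d = triple T1 T2 T3"
  define cr :: "real^3 \<Rightarrow> real^3 \<Rightarrow> real^3" where
    "cr u v = vector [u$2 * v$3 - u$3 * v$2, u$3 * v$1 - u$1 * v$3, u$1 * v$2 - u$2 * v$1]" for u v
  have cr: "(\<Sum>k\<in>UNIV. cr u v $ k * x $ k) = triple u v x" for u v x
    by (simp add: cr_def sum_3 triple_eq algebra_simps)
  \<comment> \<open>The inverse of \<open>T\<close> by cofactors: cross products of its rows divided
    by its determinant.\<close>
  define R :: "real^3 \<Rightarrow> real^3" where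
    "R z = (1/d) *\<^sub>R (z$1 *\<^sub>R cr T2 T3 + z$2 *\<^sub>R cr T3 T1 + z$3 *\<^sub>R cr T1 T2)" for z
  define T :: "real^3 \<Rightarrow> real^3" where "T y = vector [T1, T2, T3] *v y" for y
  have blT: "bounded_linear T" unfolding T_def[abs_def] by (rule matrix_vector_mul_bounded_linear)
  have blR: "bounded_linear R"
    unfolding R_def[abs_def]
    by (intro bounded_linear_intros bounded_linear_vec_nth)
  have dT: "det (vector [T1, T2, T3] :: real^3^3) = d" by (simp add: d_def triple_def)
  have RT: "R (T y) = y" for y
  proof -
    have dy: "d *\<^sub>R y = (T y)$1 *\<^sub>R cr T2 T3 + (T y)$2 *\<^sub>R cr T3 T1 + (T y)$3 *\<^sub>R cr T1 T2"
      by (simp add: T_def matrix_vector_mult_def sum_3 cr_def d_def triple_eq vec_eq_iff forall_3 algebra_simps)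
    have "R (T y) = (1/d) *\<^sub>R (d *\<^sub>R y)" by (simp only: R_def dy)
    also have "\<dots> = y" using d0 by (simp add: d_def)
    finally show ?thesis .
  qed
  have sT: "smooth_at x T" and sR: "smooth_at x R" for x by (rule smooth_at_linear[OF blT], rule smooth_at_linear[OF blR])
  have R0: "R 0 = 0" and T0: "T 0 = 0" by (simp_all add: R_def T_def)
  let ?f = "\<lambda>z. f (R z)" and ?g = "\<lambda>z. d * g (R z)"
  have sf: "smooth_at 0 ?f" by (rule smooth_at_compose[OF sR]) (simp add: R0 f)
  have sg: "smooth_at 0 ?g" by (intro smooth_at_mult smooth_at_const smooth_at_compose[OF sR]) (simp add: R0 g)
  have df: "dir_deriv ?f v z = dir_deriv f (R v) (R z)" if "smooth_at (R z) f" for v z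
    by (rule dir_deriv_linear_compose[OF blR that])
  have gradf: "grad ?f 0 = 0"
    using df[of 0] dir_deriv_grad[of 0 f] f by (simp add: R0 grad_def[of ?f] vec_eq_iff)
  have "isCont R 0" by (rule smooth_at_isCont[OF sR])
  from isCont_eventually[OF this] smooth_at_eventually[OF f(1)]
  have evR: "\<forall>\<^sub>F z in nhds 0. smooth_at (R z) f" by (simp add: R0)
  have ddf: "dir_deriv (dir_deriv ?f v) w 0 = dir_deriv (dir_deriv f (R v)) (R w) 0" for v w
  proof -
    have "\<forall>\<^sub>F z in nhds 0. dir_deriv ?f v z = dir_deriv f (R v) (R z)" using evR by eventually_elim (rule df)
    then have "dir_deriv (dir_deriv ?f v) w 0 = dir_deriv (\<lambda>z. dir_deriv f (R v) (R z)) w 0" by (rule dir_deriv_cong_ev)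
    also have "\<dots> = dir_deriv (dir_deriv f (R v)) (R w) (R 0)"
      by (rule dir_deriv_linear_compose[OF blR]) (simp add: R0 smooth_at_dir_deriv f)
    finally show ?thesis by (simp only: R0)
  qed
  have bil: "dir_deriv (dir_deriv f u) v 0 = (\<Sum>l\<in>UNIV. v $ l * (\<Sum>k\<in>UNIV. u $ k * grad (dir_deriv f (axis l 1)) 0 $ k))" for u v
  proof -
    have "dir_deriv (dir_deriv f u) v 0 = (\<Sum>l\<in>UNIV. v $ l * dir_deriv (dir_deriv f u) (axis l 1) 0)"
      using dir_deriv_grad[OF smooth_at_dir_deriv[OF f(1)], of u v] by (simp only: grad_def vec_lambda_beta)
    also have "\<dots> = (\<Sum>l\<in>UNIV. v $ l * dir_deriv (dir_deriv f (axis l 1)) u 0)"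
      by (simp only: dir_deriv_commute[OF f(1), of u])
    finally show ?thesis by (simp only: dir_deriv_grad[OF smooth_at_dir_deriv[OF f(1)], of _ u])
  qed
  have Re: "R (axis 1 1) = (1/d) *\<^sub>R cr T2 T3" "R (axis 2 1) = (1/d) *\<^sub>R cr T3 T1" "R (axis 3 1) = (1/d) *\<^sub>R cr T1 T2"
    by (simp_all add: R_def axis_def)
  \<comment> \<open>The hypotheses say that the Hessian of \<open>f\<close> at 0, multiplied by g 0,
    sends the cross products of T1 T2, T2 T3, T3 T1 to T3, -T1, -T2. In the coordinates given by
    \<open>T\<close> the Hessian is thus diagonal with entries -1, -1, 1 over g 0 * d, which fixes
    \<open>c\<close>.\<close>
  define c where "c = - 1 / (g 0 * d)"
  have c0: "c \<noteq> 0" using g d0 by (simp add: c_def d_def)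
  let ?h = "\<lambda>l. grad (dir_deriv f (axis l 1)) 0"
  have sl: "(\<Sum>k\<in>UNIV. cr u v $ k * x $ k / d) = triple u v x / d" for u v x
    unfolding sum_divide_distrib[symmetric] cr ..
  have t: "triple T1 T2 (?h l) = T3 $ l / g 0" "triple T2 T3 (?h l) = - T1 $ l / g 0" "triple T3 T1 (?h l) = - T2 $ l / g 0" for l
    using T12[of l] T23[of l] T31[of l] g(2) by (auto simp: field_simps)
  have hess: "dir_deriv (dir_deriv ?f (axis i 1)) (axis j 1) 0 = (if i = j then (if i = 3 then - c else c) else 0)" for i j
  proof -
    define \<epsilon> where "\<epsilon> = (if i = 3 then 1 else - 1 :: real)"
    define Ti where "Ti = (if i = 1 then T1 else if i = 2 then T2 else T3)"
    have "(\<Sum>k\<in>UNIV. R (axis i 1) $ k * ?h l $ k) = \<epsilon> * Ti $ l / (g 0 * d)" for l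
      using exhaust_3[of i] by (auto simp: Re sl t \<epsilon>_def Ti_def)
    then have "dir_deriv (dir_deriv ?f (axis i 1)) (axis j 1) 0 = (\<Sum>l\<in>UNIV. R (axis j 1) $ l * (\<epsilon> * Ti $ l / (g 0 * d)))"
      unfolding ddf bil by simp
    also have "\<dots> = \<epsilon> / (g 0 * d) * (\<Sum>l\<in>UNIV. R (axis j 1) $ l * Ti $ l)"
      by (simp add: sum_distrib_left ac_simps)
    also have "(\<Sum>l\<in>UNIV. R (axis j 1) $ l * Ti $ l) = (if i = j then 1 else 0)"
      using exhaust_3[of i] exhaust_3[of j] d0
      by (auto simp: Re sl Ti_def; simp add: d_def triple_eq)
    finally show ?thesis by (simp add: c_def \<epsilon>_def)
  qed
  have "?g 0 \<noteq> 0" using g(2) d0 by (simp add: R0 d_def)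
  then obtain w k where wk: "linear_form ?g ?f w k"
    using exists_linear_form[OF sf gradf hess c0 sg] by blast
  have jT: "jac_matrix T x = vector [T1, T2, T3]" for x
    unfolding jac_matrix_def by (simp add: dir_deriv_eqI[OF bounded_linear_imp_has_derivative[OF blT]] T_def)
  have "linear_form g f (\<lambda>x. w (T x)) k"
  proof (rule linear_form_transform[OF wk sT T0 _ sf])
    show "det (jac_matrix T 0) \<noteq> 0" using d0 by (simp add: jT dT d_def)
    show "\<forall>\<^sub>F x in nhds 0. grad (\<lambda>x. f (R (T x))) x = 1 *\<^sub>R grad f x \<and> (1::real) \<noteq> 0 \<and>
        d * g (R (T x)) * 1 = g x * det (jac_matrix T x)"
      by (simp add: RT jT dT)
  qed
  then show ?thesis by blast
qed

section \<open>The isotropy Lie algebra\<close>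

context charted begin

lemma smooth_near_bracket:
  assumes \<pi>: "smooth_bivector_field M \<pi>" and c: "c \<in> atlas M" "x \<in> fst c"
    and f: "smooth_near M x f" and g: "smooth_near M x g"
  shows "\<forall>\<^sub>F z in nhds (snd c x). rep c (poisson_bracket M \<pi> f g) z =
      triple (grad (rep c f) z) (grad (rep c g) z) (\<chi> k. rep c (\<lambda>x. bivec \<pi> c x $ k) z)"
    and "smooth_near M x (poisson_bracket M \<pi> f g)"
proof -
  have "\<forall>\<^sub>F z in nhds (snd c x). smooth_at z (rep c f) \<and> smooth_at z (rep c g)"
    using f g unfolding smooth_near_iff[OF c] by (intro eventually_conj smooth_at_eventually)
  moreover have "\<forall>\<^sub>F z in nhds (snd c x). inv_into (fst c) (snd c) z \<in> fst c \<and> snd c (inv_into (fst c) (snd c) z) = z"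
    using eventually_chart[OF c, of "fst c" "\<lambda>_. True"] chart[OF c(1)] c by (auto elim: eventually_mono)
  ultimately show ev: "\<forall>\<^sub>F z in nhds (snd c x). rep c (poisson_bracket M \<pi> f g) z =
      triple (grad (rep c f) z) (grad (rep c g) z) (\<chi> k. rep c (\<lambda>x. bivec \<pi> c x $ k) z)"
  proof eventually_elim
    case (elim z)
    let ?y = "inv_into (fst c) (snd c) z"
    have y: "?y \<in> fst c" "snd c ?y = z" using elim by auto
    have "smooth_near M ?y f" "smooth_near M ?y g" unfolding smooth_near_iff[OF c(1) y(1)] y(2) using elim by auto
    from poisson_bracket_triple[OF \<pi> c(1) y(1) this] show ?case by (simp add: y(2) rep_apply[of c "poisson_bracket M \<pi> f g"]
      rep_apply[of c "\<lambda>x. bivec \<pi> c x $ _"])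
  qed
  have b: "smooth_at (snd c x) (rep c (\<lambda>x. bivec \<pi> c x $ k))" for k
    using smooth_near_bivec[OF \<pi> c] unfolding smooth_near_iff[OF c] .
  have gr: "smooth_at (snd c x) (\<lambda>z. grad h z $ k)" if "smooth_at (snd c x) h" for h k
    using that by (simp add: grad_def smooth_at_dir_deriv)
  have "smooth_at (snd c x) (\<lambda>z. triple (grad (rep c f) z) (grad (rep c g) z) (\<chi> k. rep c (\<lambda>x. bivec \<pi> c x $ k) z))"
    unfolding triple_eq vec_lambda_beta using f g unfolding smooth_near_iff[OF c]
    by (intro smooth_at_add smooth_at_diff smooth_at_mult gr b)
  then show "smooth_near M x (poisson_bracket M \<pi> f g)"
    unfolding smooth_near_iff[OF c] smooth_at_cong[OF ev] .
qed

lemma bivec_zero: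
  assumes "\<forall>\<alpha>\<in>cotangent_space M p. \<forall>\<beta>\<in>cotangent_space M p. \<pi> p \<alpha> \<beta> = 0"
  shows "bivec \<pi> c p = 0"
  using assms differential_cotangent by (simp add: bivec_def vec_eq_iff forall_3)

text \<open>As the bivector vanishes at \<open>p\<close>, the product rule leaves only its own
  derivative, multiplied by first derivatives of \<open>f\<close> and \<open>g\<close> at
  \<open>p\<close>. Hence the result depends on the two differentials alone, and the isotropy
  bracket is well defined.\<close>

lemma covec_differential_bracket:
  assumes \<pi>: "smooth_bivector_field M \<pi>" and c: "c \<in> atlas M" "p \<in> fst c"
    and z: "\<forall>\<alpha>\<in>cotangent_space M p. \<forall>\<beta>\<in>cotangent_space M p. \<pi> p \<alpha> \<beta> = 0"
    and f: "smooth_near M p f" and g: "smooth_near M p g"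
  shows "covec c p (differential M p (poisson_bracket M \<pi> f g)) $ l =
    triple (covec c p (differential M p f)) (covec c p (differential M p g))
      (\<chi> k. dir_deriv (rep c (\<lambda>x. bivec \<pi> c x $ k)) (axis l 1) (snd c p))"
proof -
  let ?a = "snd c p" and ?b = "\<lambda>k. rep c (\<lambda>x. bivec \<pi> c x $ k)" and ?u = "grad (rep c f)" and ?v = "grad (rep c g)"
  define q where "q k z = (if k = 1 then ?u z $ 2 * ?v z $ 3 - ?u z $ 3 * ?v z $ 2
      else if k = 2 then ?u z $ 3 * ?v z $ 1 - ?u z $ 1 * ?v z $ 3 else ?u z $ 1 * ?v z $ 2 - ?u z $ 2 * ?v z $ 1)" for k :: 3 and z
  have tq: "triple (?u z) (?v z) w = (\<Sum>k\<in>UNIV. q k z * w $ k)" for z w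
    by (simp add: q_def sum_3 triple_eq algebra_simps)
  have b: "smooth_at ?a (?b k)" for k using smooth_near_bivec[OF \<pi> c] unfolding smooth_near_iff[OF c] .
  have gr: "smooth_at ?a (\<lambda>z. grad h z $ k)" if "smooth_at ?a h" for h k
    using that by (simp add: grad_def smooth_at_dir_deriv)
  have sf: "smooth_at ?a (rep c f)" "smooth_at ?a (rep c g)" using f g unfolding smooth_near_iff[OF c] .
  have sq: "smooth_at ?a (q k)" for k
  proof -
    have "smooth_at ?a (\<lambda>z. ?u z $ i * ?v z $ j - ?u z $ j * ?v z $ i)" for i j
      by (intro smooth_at_diff smooth_at_mult gr sf)
    then show ?thesis unfolding q_def[abs_def] by (cases "k = 1"; cases "k = 2") auto
  qed
  have b0: "?b k ?a = 0" for k using bivec_zero[where \<pi>=\<pi> and p=p and c=c, OF z] by (simp add: rep_apply chart_inv[OF c])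
  have "covec c p (differential M p (poisson_bracket M \<pi> f g)) $ l = dir_deriv (rep c (poisson_bracket M \<pi> f g)) (axis l 1) ?a"
    unfolding covec_differential[OF c smooth_near_bracket(2)[OF \<pi> c f g]] by (simp add: grad_def)
  also have "\<dots> = dir_deriv (\<lambda>z. \<Sum>k\<in>UNIV. q k z * ?b k z) (axis l 1) ?a"
    using dir_deriv_cong_ev(1)[OF smooth_near_bracket(1)[OF \<pi> c f g]] by (simp add: tq)
  also have "\<dots> = (\<Sum>k\<in>UNIV. q k ?a * dir_deriv (?b k) (axis l 1) ?a + dir_deriv (q k) (axis l 1) ?a * ?b k ?a)"
    by (rule dir_deriv_eqI) (intro has_derivative_sum has_derivative_mult smooth_at_has_derivative sq b)
  also have "\<dots> = triple (?u ?a) (?v ?a) (\<chi> k. dir_deriv (?b k) (axis l 1) ?a)" by (simp add: b0 tq)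
  finally show ?thesis unfolding covec_differential[OF c f] covec_differential[OF c g] .
qed

text \<open>\<open>isotropy_bracket\<close> is formulated with functions smooth on all of
  \<open>M\<close>, whereas coordinates live on chart domains. A cut-off germ is extended by zero
  beyond the chart; this is smooth because its support lies in a compact set, which the Hausdorff
  property makes closed in \<open>M\<close>.\<close>

lemma smooth_function_extension:
  assumes M: "smooth_manifold M" and c: "c \<in> atlas M" "p \<in> fst c" and f: "smooth_near M p f"
  obtains g S where "g \<in> smooth_functions M (mspc M)" "openin (mtop M) S" "p \<in> S" "\<And>y. y \<in> S \<Longrightarrow> g y = f y"
proof -
  let ?a = "snd c p" and ?inv = "inv_into (fst c) (snd c)"
  have cover: "mspc M = (\<Union>c\<in>atlas M. fst c)" and haus: "Hausdorff_space (mtop M)"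
    using M unfolding smooth_manifold_def by (auto simp: split_beta)
  obtain F where F: "smooth F" "\<forall>\<^sub>F z in nhds ?a. F z = rep c f z"
    by (rule smooth_at_extend[OF f[unfolded smooth_near_iff[OF c]] zero_less_one]) blast
  have "open (snd c ` fst c)" using chart[OF c(1)] by blast
  then obtain r where r: "r > 0" "cball ?a r \<subseteq> snd c ` fst c" using c(2) open_contains_cball by blast
  obtain \<eta> :: "real^3 \<Rightarrow> real" where \<eta>: "smooth \<eta>" "\<And>x. dist ?a x \<le> r/2 \<Longrightarrow> \<eta> x = 1" "\<And>x. dist ?a x \<ge> 2 * (r/2) \<Longrightarrow> \<eta> x = 0"
    by (rule exists_bump[of "r/2" ?a]) (use r in auto)
  define g where "g x = (if x \<in> fst c then \<eta> (snd c x) * F (snd c x) else 0)" for x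
  let ?K = "?inv ` cball ?a r"
  have Kc: "?K \<subseteq> fst c" using r(2) by (auto intro: inv_into_into)
  have closed: "closedin (mtop M) ?K"
  proof -
    have "homeomorphic_map (top_of_set (snd c ` fst c)) (subtopology (mtop M) (fst c)) ?inv"
    proof -
      have h: "homeomorphic_map (subtopology (mtop M) (fst c)) (top_of_set (snd c ` fst c)) (snd c)" using chart[OF c(1)] by blast
      then obtain k where k: "homeomorphic_maps (subtopology (mtop M) (fst c)) (top_of_set (snd c ` fst c)) (snd c) k"
        unfolding homeomorphic_map_maps by blast
      have "k z = ?inv z" if "z \<in> snd c ` fst c" for z
        using k that chart_inv[OF c(1)] chart_topspace[OF c(1)] unfolding homeomorphic_maps_def by auto
      moreover have "homeomorphic_map (top_of_set (snd c ` fst c)) (subtopology (mtop M) (fst c)) k"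
        using k homeomorphic_maps_sym homeomorphic_maps_map by blast
      ultimately show ?thesis using homeomorphic_map_eq[of "top_of_set (snd c ` fst c)" _ k ?inv] by simp
    qed
    then have "continuous_map (top_of_set (snd c ` fst c)) (subtopology (mtop M) (fst c)) ?inv"
      by (rule homeomorphic_imp_continuous_map)
    then have "continuous_map (top_of_set (snd c ` fst c)) (mtop M) ?inv"
      by (simp add: continuous_map_in_subtopology)
    moreover have "compactin (top_of_set (snd c ` fst c)) (cball ?a r)"
      using r(2) by (simp add: compactin_subtopology)
    ultimately have "compactin (mtop M) ?K" by (rule image_compactin[rotated])
    then show ?thesis by (rule compactin_imp_closedin[OF haus])
  qed
  have sn: "smooth_near M x g" if x: "x \<in> mspc M" for x
  proof (cases "x \<in> fst c")
    case True
    have "\<forall>\<^sub>F z in nhds (snd c x). rep c g z = \<eta> z * F z"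
      using eventually_chart[OF c(1) True, of "fst c" "\<lambda>_. True"] chart[OF c(1)] True
      by (auto elim!: eventually_mono simp: rep_apply g_def)
    from smooth_at_cong[OF this] \<eta>(1) F(1) show ?thesis
      unfolding smooth_near_iff[OF c(1) True] by (simp add: smooth_at_mult)
  next
    case False
    obtain d where d: "d \<in> atlas M" "x \<in> fst d" using x cover by auto
    have o: "openin (mtop M) (mspc M - ?K)" using closed by blast
    have "g y = (\<lambda>_. 0) y" if "y \<in> mspc M - ?K" for y
    proof (cases "y \<in> fst c")
      case True
      then have "snd c y \<notin> cball ?a r" using that chart_inv[OF c(1) True] by force
      then show ?thesis using \<eta>(3) by (simp add: g_def)
    qed (simp add: g_def)
    moreover have "x \<in> mspc M - ?K" using x False Kc by auto
    ultimately have "smooth_near M x g \<longleftrightarrow> smooth_near M x (\<lambda>_. 0)" by (intro smooth_near_cong[OF o _ _ d])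
    then show ?thesis using smooth_near_const[OF d] by simp
  qed
  have "\<forall>\<^sub>F z in nhds ?a. F z = rep c f z \<and> dist ?a z < r/2"
    by (intro eventually_conj F(2) eventually_eq_open[of "ball ?a (r/2)"]) (use r in auto)
  then obtain S where S: "openin (mtop M) S" "p \<in> S" "S \<subseteq> fst c" "\<And>y. y \<in> S \<Longrightarrow> F (snd c y) = rep c f (snd c y) \<and> dist ?a (snd c y) < r/2"
    by (rule eventually_chart_source[OF c]) blast
  show thesis
  proof (rule that[of g S])
    show "g \<in> smooth_functions M (mspc M)"
      using smooth_functions_iff[OF openin_topspace eq_refl[OF cover], of g] sn by blast
    show "g y = f y" if "y \<in> S" for y
      using S(3) S(4)[OF that] that \<eta>(2)[of "snd c y"] chart_inv[OF c(1), of y] by (auto simp: g_def rep_apply)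
  qed (use S in auto)
qed

lemma smooth_near_of_smooth_functions: "f \<in> smooth_functions M (mspc M) \<Longrightarrow> x \<in> mspc M \<Longrightarrow> smooth_near M x f"
  unfolding smooth_near_def using openin_topspace by blast

text \<open>Germs are replaced by global functions with the same differentials, which gives
  existence for the definite description; \<open>covec_differential_bracket\<close> gives
  uniqueness.\<close>

lemma isotropy_bracket_eq:
  assumes M: "smooth_manifold M" and \<pi>: "smooth_bivector_field M \<pi>" and c: "c \<in> atlas M" "p \<in> fst c"
    and z: "\<forall>\<alpha>\<in>cotangent_space M p. \<forall>\<beta>\<in>cotangent_space M p. \<pi> p \<alpha> \<beta> = 0"
    and f: "smooth_near M p f" and g: "smooth_near M p g"
  shows "isotropy_bracket M \<pi> p (differential M p f) (differential M p g) = differential M p (poisson_bracket M \<pi> f g)"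
proof -
  have p: "p \<in> mspc M" using chart_subset[OF c(1)] c(2) by auto
  have ext: "\<exists>k\<in>smooth_functions M (mspc M). differential M p k = differential M p h" if h: "smooth_near M p h" for h
  proof -
    obtain k S where k: "k \<in> smooth_functions M (mspc M)" "openin (mtop M) S" "p \<in> S" "\<And>y. y \<in> S \<Longrightarrow> k y = h y"
      by (rule smooth_function_extension[OF M c h]) blast
    have "differential M p k = differential M p h"
      by (rule differential_cong[OF c k(2,3,4) smooth_near_of_smooth_functions[OF k(1) p]])
    then show ?thesis using k(1) by blast
  qed
  have eq: "differential M p (poisson_bracket M \<pi> f' g') = differential M p (poisson_bracket M \<pi> f g)"
    if "f' \<in> smooth_functions M (mspc M)" "g' \<in> smooth_functions M (mspc M)"
      "differential M p f' = differential M p f" "differential M p g' = differential M p g" for f' g'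
    using covec_differential_bracket[OF \<pi> c z smooth_near_of_smooth_functions[OF that(1) p] smooth_near_of_smooth_functions[OF that(2) p]]
      covec_differential_bracket[OF \<pi> c z f g] that(3,4)
    by (intro cotangent_eqI[OF c differential_cotangent differential_cotangent]) (simp add: vec_eq_iff)
  obtain f' g' where "f' \<in> smooth_functions M (mspc M)" "g' \<in> smooth_functions M (mspc M)"
    "differential M p f' = differential M p f" "differential M p g' = differential M p g"
    using ext[OF f] ext[OF g] by blast
  then show ?thesis
    unfolding isotropy_bracket_def using eq by (intro the_equality) (metis, metis)
qed

lemma differential_lincomb:
  assumes c: "c \<in> atlas M" "x \<in> fst c" and "smooth_near M x f1" "smooth_near M x f2" "smooth_near M x f3"
  shows "smooth_near M x (\<lambda>y. a1 * f1 y + a2 * f2 y + a3 * f3 y)"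
    and "differential M x (\<lambda>y. a1 * f1 y + a2 * f2 y + a3 * f3 y) =
      a1 *\<^sub>R differential M x f1 + a2 *\<^sub>R differential M x f2 + a3 *\<^sub>R differential M x f3"
proof -
  have e: "(\<lambda>y. a1 * f1 y + a2 * f2 y + a3 * f3 y) = a1 *\<^sub>R f1 + a2 *\<^sub>R f2 + a3 *\<^sub>R f3"
    by (simp add: plus_fun_def scaleR_fun_def)
  note sp = smooth_near_plus[OF c]
  show "smooth_near M x (\<lambda>y. a1 * f1 y + a2 * f2 y + a3 * f3 y)"
    unfolding e by (intro sp(1,2) assms(3-5))
  show "differential M x (\<lambda>y. a1 * f1 y + a2 * f2 y + a3 * f3 y) =
      a1 *\<^sub>R differential M x f1 + a2 *\<^sub>R differential M x f2 + a3 *\<^sub>R differential M x f3"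
  proof
    fix v
    show "differential M x (\<lambda>y. a1 * f1 y + a2 * f2 y + a3 * f3 y) v =
      (a1 *\<^sub>R differential M x f1 + a2 *\<^sub>R differential M x f2 + a3 *\<^sub>R differential M x f3) v"
    proof (cases "v \<in> tangent_space M x")
      case True
      then have "linear_on {f. smooth_near M x f} v" by (simp add: tangent_space_def)
      from linear_on_comb3[OF this] True show ?thesis
        unfolding e using assms(3-5) sp by (simp add: differential_def plus_fun_def scaleR_fun_def)
    qed (simp add: differential_def plus_fun_def scaleR_fun_def)
  qed
qed

lemma covector_is_differential:
  assumes c: "c \<in> atlas M" "x \<in> fst c" and "\<alpha> \<in> cotangent_space M x"
  obtains f where "smooth_near M x f" "differential M x f = \<alpha>"
  using differential_lincomb[OF c smooth_near_coord[OF c] smooth_near_coord[OF c] smooth_near_coord[OF c],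
      of "covec c x \<alpha> $ 1" 1 "covec c x \<alpha> $ 2" 2 "covec c x \<alpha> $ 3" 3] cotangent_expand[OF assms] that by metis

text \<open>The basis with \<open>[e\<^sub>1, e\<^sub>2] = e\<^sub>3\<close>, \<open>[e\<^sub>2, e\<^sub>3] = -e\<^sub>1\<close>, \<open>[e\<^sub>3, e\<^sub>1] = -e\<^sub>2\<close> corresponds to the matrices
  \<open>E1\<close>, \<open>E2\<close>, \<open>E3\<close> below.\<close>

lemma isotropy_sl2_basis:
  assumes M: "smooth_manifold M" and \<pi>: "smooth_bivector_field M \<pi>" and c: "c \<in> atlas M" "p \<in> fst c"
    and z: "\<forall>\<alpha>\<in>cotangent_space M p. \<forall>\<beta>\<in>cotangent_space M p. \<pi> p \<alpha> \<beta> = 0"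
    and iso: "lie_isomorphic (cotangent_space M p) (isotropy_bracket M \<pi> p) sl2 commutator"
  obtains T1 T2 T3 where "triple T1 T2 T3 \<noteq> 0"
    "\<And>l. triple T1 T2 (\<chi> k. dir_deriv (rep c (\<lambda>x. bivec \<pi> c x $ k)) (axis l 1) (snd c p)) = T3 $ l"
    "\<And>l. triple T2 T3 (\<chi> k. dir_deriv (rep c (\<lambda>x. bivec \<pi> c x $ k)) (axis l 1) (snd c p)) = - T1 $ l"
    "\<And>l. triple T3 T1 (\<chi> k. dir_deriv (rep c (\<lambda>x. bivec \<pi> c x $ k)) (axis l 1) (snd c p)) = - T2 $ l"
proof -
  let ?G = "cotangent_space M p" and ?br = "isotropy_bracket M \<pi> p"
  let ?D = "\<lambda>l. \<chi> k. dir_deriv (rep c (\<lambda>x. bivec \<pi> c x $ k)) (axis l 1) (snd c p)"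
  obtain F where F: "linear_on ?G F" "bij_betw F ?G sl2" "\<And>x y. x \<in> ?G \<Longrightarrow> y \<in> ?G \<Longrightarrow> F (?br x y) = commutator (F x) (F y)"
    using iso unfolding lie_isomorphic_def by blast
  have br: "?br \<alpha> \<beta> \<in> ?G" "covec c p (?br \<alpha> \<beta>) $ l = triple (covec c p \<alpha>) (covec c p \<beta>) (?D l)" if A: "\<alpha> \<in> ?G" and B: "\<beta> \<in> ?G" for \<alpha> \<beta> l
  proof -
    obtain f where f: "smooth_near M p f" "differential M p f = \<alpha>" by (rule covector_is_differential[OF c A])
    obtain g where g: "smooth_near M p g" "differential M p g = \<beta>" by (rule covector_is_differential[OF c B])
    note e = isotropy_bracket_eq[OF M \<pi> c z f(1) g(1), unfolded f(2) g(2)]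
    show "?br \<alpha> \<beta> \<in> ?G" unfolding e by (rule differential_cotangent)
    show "covec c p (?br \<alpha> \<beta>) $ l = triple (covec c p \<alpha>) (covec c p \<beta>) (?D l)"
      unfolding e covec_differential_bracket[OF \<pi> c z f(1) g(1)] f(2) g(2) ..
  qed
  have inj: "x = y" if "F x = F y" "x \<in> ?G" "y \<in> ?G" for x y using F(2) that by (auto simp: bij_betw_def inj_on_def)
  have surj: "\<exists>x\<in>?G. F x = A" if "A \<in> sl2" for A using F(2) that unfolding bij_betw_def by (metis imageE)
  \<comment> \<open>Two symmetric matrices and a skew one; the factor 1/2 removes the 2 from their
    commutators.\<close>
  define E1 E2 E3 :: "real^2^2" where "E1 = vector [vector [1/2, 0], vector [0, -1/2]]"
    and "E2 = vector [vector [0, 1/2], vector [1/2, 0]]" and "E3 = vector [vector [0, 1/2], vector [-1/2, 0]]"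
  note E = E1_def E2_def E3_def
  have sE: "E1 \<in> sl2" "E2 \<in> sl2" "E3 \<in> sl2" by (simp_all add: sl2_def E trace_def sum_2)
  have cE: "commutator E1 E2 = E3" "commutator E2 E3 = (-1) *\<^sub>R E1" "commutator E3 E1 = (-1) *\<^sub>R E2"
    by (simp_all add: commutator_def E vec_eq_iff forall_2 matrix_matrix_mult_def sum_2)
  obtain e1 e2 e3 where e: "e1 \<in> ?G" "F e1 = E1" "e2 \<in> ?G" "F e2 = E2" "e3 \<in> ?G" "F e3 = E3"
    using surj[OF sE(1)] surj[OF sE(2)] surj[OF sE(3)] by blast
  have Fs: "F (r *\<^sub>R x) = r *\<^sub>R F x" if "x \<in> ?G" for x r using linear_onD(2)[OF F(1) that] .
  have b12: "?br e1 e2 = e3" by (rule inj) (use F(3) e cE br(1) in simp_all)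
  have b23: "?br e2 e3 = (-1) *\<^sub>R e1"     by (rule inj[OF _ br(1)[OF e(3,5)] cotangent_scale[OF e(1)]])
      (simp only: F(3)[OF e(3,5)] Fs[OF e(1)] e(2,4,6) cE)
  have b31: "?br e3 e1 = (-1) *\<^sub>R e2"     by (rule inj[OF _ br(1)[OF e(5,1)] cotangent_scale[OF e(3)]])
      (simp only: F(3)[OF e(5,1)] Fs[OF e(3)] e(2,4,6) cE)
  let ?T1 = "covec c p e1" and ?T2 = "covec c p e2" and ?T3 = "covec c p e3"
  have span: "\<exists>a1 a2 a3. \<alpha> = a1 *\<^sub>R e1 + a2 *\<^sub>R e2 + a3 *\<^sub>R e3" if "\<alpha> \<in> ?G" for \<alpha>
  proof -
    let ?A = "F \<alpha>"
    have "?A \<in> sl2" using F(2) that by (auto simp: bij_betw_def)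
    then have tr: "?A $ 2 $ 2 = - ?A $ 1 $ 1" by (simp add: sl2_def trace_def sum_2)
    let ?b = "(2 * ?A $ 1 $ 1) *\<^sub>R e1 + (?A $ 1 $ 2 + ?A $ 2 $ 1) *\<^sub>R e2 + (?A $ 1 $ 2 - ?A $ 2 $ 1) *\<^sub>R e3"
    have "F ?b = (2 * ?A $ 1 $ 1) *\<^sub>R E1 + (?A $ 1 $ 2 + ?A $ 2 $ 1) *\<^sub>R E2 + (?A $ 1 $ 2 - ?A $ 2 $ 1) *\<^sub>R E3"
      using linear_on_comb3[OF F(1) e(1,3,5) cotangent_add cotangent_scale] unfolding e(2,4,6) .
    also have "\<dots> = ?A" by (simp add: E vec_eq_iff forall_2 tr algebra_simps)
    finally have "F \<alpha> = F ?b" by simp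
    then have "\<alpha> = ?b" by (rule inj) (intro that cotangent_add cotangent_scale e)+
    then show ?thesis by blast
  qed
  \<comment> \<open>Independence of the three covectors comes from spanning: their combinations
    contain all unit vectors, which yields a left inverse of the matrix with these rows.\<close>
  have "\<exists>a. axis j 1 = a v* (vector [?T1, ?T2, ?T3] :: real^3^3)" for j :: 3
  proof -
    obtain a1 a2 a3 where "differential M p (coord c j) = a1 *\<^sub>R e1 + a2 *\<^sub>R e2 + a3 *\<^sub>R e3"
      using span[OF differential_cotangent] by blast
    from arg_cong[OF this, of "covec c p"] have "axis j 1 = a1 *\<^sub>R ?T1 + a2 *\<^sub>R ?T2 + a3 *\<^sub>R ?T3"
      unfolding covec_differential_coord[OF c] covec_add covec_scale .
    then have "axis j 1 = vector [a1, a2, a3] v* (vector [?T1, ?T2, ?T3] :: real^3^3)"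
      by (simp add: vec_eq_iff vector_matrix_mult_def sum_3 mult.commute)
    then show ?thesis by blast
  qed
  then obtain a where a: "\<And>j :: 3. axis j 1 = a j v* (vector [?T1, ?T2, ?T3] :: real^3^3)" by metis
  have "(\<chi> j. a j) ** (vector [?T1, ?T2, ?T3] :: real^3^3) = mat 1"
  proof -
    have "((\<chi> j. a j) ** (vector [?T1, ?T2, ?T3] :: real^3^3)) $ j = a j v* (vector [?T1, ?T2, ?T3] :: real^3^3)" for j
      by (simp add: vec_eq_iff matrix_matrix_mult_def vector_matrix_mult_def mult.commute)
    then show ?thesis unfolding a[symmetric] by (simp add: vec_eq_iff mat_def axis_def)
  qed
  from arg_cong[OF this, of det] have "triple ?T1 ?T2 ?T3 \<noteq> 0" by (auto simp: det_mul triple_def)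
  moreover have "triple ?T1 ?T2 (?D l) = ?T3 $ l" "triple ?T2 ?T3 (?D l) = - ?T1 $ l" "triple ?T3 ?T1 (?D l) = - ?T2 $ l" for l
    using br(2)[OF e(1,3), of l] br(2)[OF e(3,5), of l] br(2)[OF e(5,1), of l]
    unfolding b12 b23 b31 covec_scale by simp_all
  ultimately show thesis by (rule that)
qed

end

section \<open>Linearization\<close>

context charted begin

text \<open>In a chart the contraction has the components vol * bivec. A primitive F of it gives
  bivec = grad F / vol, so the bracket has the density 1 / vol and the Casimir function F. After a
  shift of \<open>p\<close> to 0 the normal form for \<open>sl2\<close> applies.\<close>

lemma linear_poisson_coordinates:
  assumes M: "smooth_manifold M" and \<pi>: "smooth_bivector_field M \<pi>" and c: "c \<in> atlas M" "p \<in> fst c"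
    and z: "\<forall>\<alpha>\<in>cotangent_space M p. \<forall>\<beta>\<in>cotangent_space M p. \<pi> p \<alpha> \<beta> = 0"
    and iso: "lie_isomorphic (cotangent_space M p) (isotropy_bracket M \<pi> p) sl2 commutator"
    and uni: "unimodular_near M \<pi> p"
  obtains w :: "real^3 \<Rightarrow> real^3" and k S where "smooth_at 0 w" "w 0 = 0" "det (jac_matrix w 0) \<noteq> 0"
    "openin (mtop M) S" "p \<in> S" "S \<subseteq> fst c" "\<And>x. x \<in> S \<Longrightarrow> smooth_at (snd c x - snd c p) w"
    "\<And>x i j. x \<in> S \<Longrightarrow> poisson_bracket M \<pi> (\<lambda>x. w (snd c x - snd c p) $ i) (\<lambda>x. w (snd c x - snd c p) $ j) x =
      (\<Sum>l\<in>UNIV. k i j l * w (snd c x - snd c p) $ l)"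
proof -
  obtain U \<mu> where \<mu>: "openin (mtop M) U" "p \<in> U" "volume_form M U \<mu>"
    and closed: "\<And>x u v. x \<in> U \<Longrightarrow> u \<in> tangent_space M x \<Longrightarrow> v \<in> tangent_space M x \<Longrightarrow> ext_deriv M (contraction M \<pi> \<mu>) x u v = 0"
    using uni unfolding unimodular_near_def by blast
  obtain T1 T2 T3 where T: "triple T1 T2 T3 \<noteq> 0"
    "\<And>l. triple T1 T2 (\<chi> k. dir_deriv (rep c (\<lambda>x. bivec \<pi> c x $ k)) (axis l 1) (snd c p)) = T3 $ l"
    "\<And>l. triple T2 T3 (\<chi> k. dir_deriv (rep c (\<lambda>x. bivec \<pi> c x $ k)) (axis l 1) (snd c p)) = - T1 $ l"
    "\<And>l. triple T3 T1 (\<chi> k. dir_deriv (rep c (\<lambda>x. bivec \<pi> c x $ k)) (axis l 1) (snd c p)) = - T2 $ l"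
    by (rule isotropy_sl2_basis[OF M \<pi> c z iso]) blast
  let ?a = "snd c p" and ?b = "\<lambda>k. rep c (\<lambda>x. bivec \<pi> c x $ k)" and ?V = "rep c (vol \<mu> c)"
  let ?A = "\<lambda>k. rep c (contr_comp \<pi> \<mu> c k)"
  have sV: "smooth_at ?a ?V" using smooth_near_vol[OF \<mu>(3,1) c \<mu>(2)] unfolding smooth_near_iff[OF c] .
  have sA: "smooth_at ?a (?A k)" for k using smooth_near_contr_comp[OF \<pi> \<mu>(3,1) c \<mu>(2)] unfolding smooth_near_iff[OF c] .
  have sb: "smooth_at ?a (?b k)" for k using smooth_near_bivec[OF \<pi> c] unfolding smooth_near_iff[OF c] .
  have AV: "?A k = (\<lambda>z. ?V z * ?b k z)" for k by (simp add: fun_eq_iff rep_apply contr_comp_def)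
  have evU: "\<forall>\<^sub>F z in nhds ?a. inv_into (fst c) (snd c) z \<in> fst c \<and> inv_into (fst c) (snd c) z \<in> U \<and> snd c (inv_into (fst c) (snd c) z) = z"
    using eventually_chart[OF c \<mu>(1,2), of "\<lambda>_. True"] by simp
  have cl: "\<forall>\<^sub>F z in nhds ?a. \<forall>j k. dir_deriv (?A k) (axis j 1) z = dir_deriv (?A j) (axis k 1) z"
    using evU
  proof eventually_elim
    case (elim z)
    show ?case using contraction_closed[OF \<pi> \<mu>(3,1) closed c(1), of "inv_into (fst c) (snd c) z"] elim by simp
  qed
  obtain F where F: "smooth F" "\<forall>\<^sub>F z in nhds ?a. \<forall>k. grad F z $ k = ?A k z"
    by (rule poincare_one_form[OF sA cl]) blast
  let ?f = "\<lambda>y. F (?a + y)" and ?g = "\<lambda>y. 1 / ?V (?a + y)"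
  have V0: "?V z \<noteq> 0" if "inv_into (fst c) (snd c) z \<in> fst c" "inv_into (fst c) (snd c) z \<in> U" for z
    using vol_nonzero[OF \<mu>(3) c(1) that] by (simp add: rep_apply)
  have inva: "inv_into (fst c) (snd c) ?a = p" by (rule chart_inv[OF c])
  have shift: "((\<lambda>y. ?a + y) has_derivative (\<lambda>h. h)) (at y)" for y by (auto intro!: derivative_eq_intros)
  have dshift: "dir_deriv (\<lambda>y. h (?a + y)) v y = dir_deriv h v (?a + y)" if "smooth_at (?a + y) h" for h :: "real^3 \<Rightarrow> real" and v y
    by (rule dir_deriv_eqI[OF smooth_at_has_derivative_compose[OF that shift]])
  have df: "dir_deriv ?f v = (\<lambda>y. dir_deriv F v (?a + y))" for v
    by (rule ext, rule dshift) (use F in blast)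
  have sf: "smooth_at 0 ?f" by (intro smooth_at_compose_smooth[OF F(1)] smooth_at_add smooth_at_const smooth_at_ident)
  have sg: "smooth_at 0 ?g"
  proof (intro smooth_at_divide smooth_at_const)
    show "smooth_at 0 (\<lambda>y. ?V (?a + y))"
      by (intro smooth_at_compose[of 0 "\<lambda>y. ?a + y" ?V] smooth_at_add smooth_at_const smooth_at_ident) (simp add: sV)
    show "?V (?a + 0) \<noteq> 0" using V0[of ?a] c(2) \<mu>(2) by (simp add: inva)
  qed
  have g0: "?g 0 \<noteq> 0" using V0[of ?a] c(2) \<mu>(2) by (simp add: inva)
  have b0: "?b k ?a = 0" for k using bivec_zero[where \<pi>=\<pi> and p=p and c=c, OF z] by (simp add: rep_apply inva)
  have gf0: "grad ?f 0 = 0"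
  proof -
    have "grad ?f 0 $ k = ?A k ?a" for k
      using eventually_nhds_x_imp_x[OF F(2)] by (simp add: grad_def df)
    then show ?thesis unfolding AV by (simp add: vec_eq_iff b0)
  qed
  \<comment> \<open>The form vanishes at the point, so the derivative of vol * bivec involves no
    derivative of vol. Closedness exchanges the indices, matching the gradient of the l-th partial
    derivative of F with the l-th derivative of \<open>bivec\<close>.\<close>
  have hess: "grad (dir_deriv ?f (axis l 1)) 0 = ?V ?a *\<^sub>R (\<chi> k. dir_deriv (?b k) (axis l 1) ?a)" for l
  proof -
    have sdF: "smooth (dir_deriv F (axis l 1))" using F(1) by (auto intro: smooth_at_dir_deriv)
    have ev: "\<forall>\<^sub>F z in nhds ?a. dir_deriv F (axis l 1) z = ?A l z"
      using F(2) by eventually_elim (simp add: grad_def)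
    have "grad (dir_deriv ?f (axis l 1)) 0 $ k = ?V ?a * dir_deriv (?b k) (axis l 1) ?a" for k
    proof -
      have "grad (dir_deriv ?f (axis l 1)) 0 $ k = dir_deriv (dir_deriv F (axis l 1)) (axis k 1) (?a + 0)"
        using dshift[of 0 "dir_deriv F (axis l 1)" "axis k 1"] sdF by (simp add: grad_def df)
      also have "\<dots> = dir_deriv (?A l) (axis k 1) ?a" using dir_deriv_cong_ev(1)[OF ev] by simp
      also have "\<dots> = dir_deriv (?A k) (axis l 1) ?a" using eventually_nhds_x_imp_x[OF cl] by simp
      also have "\<dots> = ?V ?a * dir_deriv (?b k) (axis l 1) ?a"
        unfolding AV dir_deriv_bilinear[OF bounded_bilinear_mult smooth_at_differentiable[OF sV] smooth_at_differentiable[OF sb]]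
        by (simp add: b0)
      finally show ?thesis .
    qed
    then show ?thesis by (simp add: vec_eq_iff)
  qed
  have gV: "?g 0 * triple u v (?V ?a *\<^sub>R w) = triple u v w" for u v w
    using g0 by (simp add: triple_scaleR)
  obtain w k where w: "linear_form ?g ?f w k"
    using exists_linear_form_sl2[OF sf gf0 sg g0 T(1), unfolded hess gV, OF T(2,3,4)] by blast
  have w1: "smooth_at 0 w" "w 0 = 0" "det (jac_matrix w 0) \<noteq> 0"
    and w2: "\<forall>\<^sub>F y in nhds 0. \<forall>i j. ?g y * triple (grad (\<lambda>x. w x $ i) y) (grad (\<lambda>x. w x $ j) y) (grad ?f y) =
        (\<Sum>l\<in>UNIV. k i j l * w y $ l)"
    using w unfolding linear_form_def by blast+
  have cm: "isCont (\<lambda>z. z - ?a) ?a" by (intro continuous_intros)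
  have "\<forall>\<^sub>F z in nhds ?a. smooth_at (z - ?a) w \<and> (\<forall>i j. ?g (z - ?a) * triple (grad (\<lambda>x. w x $ i) (z - ?a)) (grad (\<lambda>x. w x $ j) (z - ?a)) (grad ?f (z - ?a)) =
        (\<Sum>l\<in>UNIV. k i j l * w (z - ?a) $ l)) \<and> (\<forall>k. grad F z $ k = ?A k z) \<and> inv_into (fst c) (snd c) z \<in> U"
    using isCont_eventually[OF cm, unfolded diff_self, OF smooth_at_eventually[OF w1(1)]]
      isCont_eventually[OF cm, unfolded diff_self, OF w2] F(2) evU
    by eventually_elim blast
  then obtain S where S: "openin (mtop M) S" "p \<in> S" "S \<subseteq> fst c" and SP: "\<And>y. y \<in> S \<Longrightarrow> smooth_at (snd c y - ?a) w \<and>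
      (\<forall>i j. ?g (snd c y - ?a) * triple (grad (\<lambda>x. w x $ i) (snd c y - ?a)) (grad (\<lambda>x. w x $ j) (snd c y - ?a)) (grad ?f (snd c y - ?a)) =
        (\<Sum>l\<in>UNIV. k i j l * w (snd c y - ?a) $ l)) \<and> (\<forall>k. grad F (snd c y) $ k = ?A k (snd c y)) \<and> inv_into (fst c) (snd c) (snd c y) \<in> U"
    by (rule eventually_chart_source[OF c]) blast
  show thesis
  proof (rule that[OF w1 S])
    fix x assume x: "x \<in> S"
    then have xc: "x \<in> fst c" using S(3) by auto
    show sw: "smooth_at (snd c x - ?a) w" using SP[OF x] by simp
    fix i j
    let ?y = "snd c x - ?a" and ?W = "\<lambda>i x. w (snd c x - ?a) $ i"
    have repW: "\<forall>\<^sub>F z in nhds (snd c x). rep c (?W i) z = w (z - ?a) $ i" for i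
      using eventually_chart[OF c(1) xc, of "fst c" "\<lambda>_. True"] chart[OF c(1)] xc
      by (auto elim!: eventually_mono simp: rep_apply)
    have sw': "smooth_at ?y (\<lambda>x. w x $ i)" for i by (rule smooth_at_component[OF sw])
    have s1: "((\<lambda>z. z - ?a) has_derivative (\<lambda>h. h)) (at z)" for z by (auto intro!: derivative_eq_intros)
    have gW: "grad (rep c (?W i)) (snd c x) = grad (\<lambda>x. w x $ i) ?y" for i
      unfolding grad_cong_ev[OF repW]
      using dir_deriv_eqI[OF smooth_at_has_derivative_compose[OF sw' s1]] by (simp add: grad_def)
    have snW: "smooth_near M x (?W i)" for i
      unfolding smooth_near_iff[OF c(1) xc] smooth_at_cong[OF repW]
      by (intro smooth_at_compose[of _ "\<lambda>z. z - ?a" "\<lambda>x. w x $ i"] smooth_at_diff smooth_at_ident smooth_at_const sw')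
    have V1: "?V (snd c x) \<noteq> 0" using V0[of "snd c x"] SP[OF x] chart_inv[OF c(1) xc] xc by simp
    have "bivec \<pi> c x = ?g ?y *\<^sub>R grad ?f ?y"
    proof -
      have "grad ?f ?y $ l = ?V (snd c x) * ?b l (snd c x)" for l
        using SP[OF x] by (simp add: grad_def df AV)
      then show ?thesis using V1 by (simp add: vec_eq_iff rep_apply[of c "\<lambda>x. bivec \<pi> c x $ _"] chart_inv[OF c(1) xc])
    qed
    then show "poisson_bracket M \<pi> (?W i) (?W j) x = (\<Sum>l\<in>UNIV. k i j l * w ?y $ l)"
      unfolding poisson_bracket_triple[OF \<pi> c(1) xc snW snW] gW using SP[OF x] by (simp add: triple_scaleR)
  qed
qed

lemma pushforward_tangent:
  assumes N: "charted N" and d: "d \<in> atlas N" "F x \<in> fst d"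
    and F: "\<And>f. smooth_near N (F x) f \<Longrightarrow> smooth_near M x (f \<circ> F)" and v: "v \<in> tangent_space M x"
  shows "pushforward N F x v \<in> tangent_space N (F x)"
proof -
  interpret N: charted N by fact
  note sp = N.smooth_near_plus[OF d]
  have o: "(f + g) \<circ> F = (f \<circ> F) + (g \<circ> F)" "(r *\<^sub>R f) \<circ> F = r *\<^sub>R (f \<circ> F)" "(\<lambda>x. f x * g x) \<circ> F = (\<lambda>x. (f \<circ> F) x * (g \<circ> F) x)"
    for f g :: "'b \<Rightarrow> real" and r :: real by (auto simp: plus_fun_def scaleR_fun_def fun_eq_iff)
  have lin: "linear_on {f. smooth_near M x f} v"
    and mult: "\<And>f g. smooth_near M x f \<Longrightarrow> smooth_near M x g \<Longrightarrow> v (\<lambda>x. f x * g x) = f x * v g + g x * v f"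
    using v unfolding tangent_space_def by blast+
  have "v ((f + g) \<circ> F) = v (f \<circ> F) + v (g \<circ> F)" if "smooth_near N (F x) f" "smooth_near N (F x) g" for f g
    unfolding o using linear_onD(1)[OF lin] F that by simp
  moreover have "v ((r *\<^sub>R f) \<circ> F) = r * v (f \<circ> F)" if "smooth_near N (F x) f" for f r
    unfolding o using linear_onD(2)[OF lin] F that by simp
  moreover have "v ((\<lambda>x. f x * g x) \<circ> F) = f (F x) * v (g \<circ> F) + g (F x) * v (f \<circ> F)"
    if "smooth_near N (F x) f" "smooth_near N (F x) g" for f g
    unfolding o(3) using mult[OF F F] that by simp
  ultimately show ?thesis
    unfolding tangent_space_def linear_on_def pushforward_def using sp by auto
qed

end

subsection \<open>Vector spaces as manifolds\<close>

locale vector_space_3 =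
  fixes W :: "'v::real_vector set" and \<Theta> :: "'v \<Rightarrow> real^3"
  assumes add: "x \<in> W \<Longrightarrow> y \<in> W \<Longrightarrow> x + y \<in> W" and scale: "x \<in> W \<Longrightarrow> r *\<^sub>R x \<in> W"
    and \<Theta>: "\<Theta> \<in> linear_coords W"
begin

lemma bij: "\<phi> \<in> linear_coords W \<Longrightarrow> bij_betw \<phi> W UNIV" by (simp add: linear_coords_def)

lemma inv: "\<phi> \<in> linear_coords W \<Longrightarrow> inv_into W \<phi> z \<in> W" "\<phi> \<in> linear_coords W \<Longrightarrow> \<phi> (inv_into W \<phi> z) = z"
  "\<phi> \<in> linear_coords W \<Longrightarrow> x \<in> W \<Longrightarrow> inv_into W \<phi> (\<phi> x) = x"
  using bij_betw_imp_surj_on[OF bij, of \<phi>] bij_betw_imp_inj_on[OF bij, of \<phi>]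
  by (auto simp: inv_into_into f_inv_into_f)

lemma inv_add: "\<phi> \<in> linear_coords W \<Longrightarrow> inv_into W \<phi> (x + y) = inv_into W \<phi> x + inv_into W \<phi> y"
  and inv_scale: "\<phi> \<in> linear_coords W \<Longrightarrow> inv_into W \<phi> (r *\<^sub>R x) = r *\<^sub>R inv_into W \<phi> x"
proof -
  assume \<phi>: "\<phi> \<in> linear_coords W"
  then have lin: "linear_on W \<phi>" by (simp add: linear_coords_def)
  note i = inv[OF \<phi>]
  have "\<phi> (inv_into W \<phi> x + inv_into W \<phi> y) = x + y" using linear_onD(1)[OF lin i(1) i(1)] i(2) by simp
  then show "inv_into W \<phi> (x + y) = inv_into W \<phi> x + inv_into W \<phi> y" using i(3)[OF add[OF i(1) i(1)]] by metis
  have "\<phi> (r *\<^sub>R inv_into W \<phi> x) = r *\<^sub>R x" using linear_onD(2)[OF lin i(1)] i(2) by simp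
  then show "inv_into W \<phi> (r *\<^sub>R x) = r *\<^sub>R inv_into W \<phi> x" using i(3)[OF scale[OF i(1)]] by metis
qed

lemma linear_change:
  assumes "\<phi> \<in> linear_coords W" "\<psi> \<in> linear_coords W" shows "bounded_linear (\<lambda>z. \<psi> (inv_into W \<phi> z))"
proof (rule linear_conv_bounded_linear[THEN iffD1], rule linearI)
  have "linear_on W \<psi>" using assms by (simp add: linear_coords_def)
  then show "\<psi> (inv_into W \<phi> (x + y)) = \<psi> (inv_into W \<phi> x) + \<psi> (inv_into W \<phi> y)"
    "\<psi> (inv_into W \<phi> (r *\<^sub>R x)) = r *\<^sub>R \<psi> (inv_into W \<phi> x)" for x y r
    unfolding inv_add[OF assms(1)] inv_scale[OF assms(1)] using inv(1)[OF assms(1)] by (simp_all add: linear_onD)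
qed

text \<open>Any two linear coordinate systems differ by a linear, hence continuous, map, so a single
  one already describes the topology generated by all.\<close>

lemma openin_linear_manifold:
  assumes \<phi>: "\<phi> \<in> linear_coords W"
  shows "openin (mtop (linear_manifold W)) V \<longleftrightarrow> V \<subseteq> W \<and> open (\<phi> ` V)"
proof
  let ?B = "{W \<inter> \<psi> -` B | \<psi> B. \<psi> \<in> linear_coords W \<and> open B}"
  assume "openin (mtop (linear_manifold W)) V"
  then have "generate_topology_on ?B V" by (simp add: linear_manifold_def openin_topology_generated_by_iff)
  then show "V \<subseteq> W \<and> open (\<phi> ` V)"
  proof (induction V)
    case (Int A B)
    have "\<phi> ` (A \<inter> B) = \<phi> ` A \<inter> \<phi> ` B"
      using inj_on_image_Int[OF bij_betw_imp_inj_on[OF bij[OF \<phi>]]] Int by blast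
    then show ?case using Int by (auto intro: open_Int)
  next
    case (UN K)
    then show ?case by (auto simp: image_Union intro!: open_UN)
  next
    case (Basis A)
    then obtain \<psi> B where A: "A = W \<inter> \<psi> -` B" "\<psi> \<in> linear_coords W" "open B" by auto
    have "\<phi> ` A = (\<lambda>z. \<psi> (inv_into W \<phi> z)) -` B"
    proof (intro equalityI subsetI)
      fix z assume "z \<in> (\<lambda>z. \<psi> (inv_into W \<phi> z)) -` B"
      then have "inv_into W \<phi> z \<in> A" using A(1) inv(1)[OF \<phi>] by auto
      then show "z \<in> \<phi> ` A" using inv(2)[OF \<phi>] by (metis imageI)
    qed (use A(1) inv(3)[OF \<phi>] in auto)
    moreover have "open ((\<lambda>z. \<psi> (inv_into W \<phi> z)) -` B)"
      using linear_continuous_at[OF linear_change[OF \<phi> A(2)]] by (rule continuous_open_vimage[OF A(3)])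
    ultimately show ?case using A(1) by simp
  qed auto
next
  assume V: "V \<subseteq> W \<and> open (\<phi> ` V)"
  have "V = W \<inter> \<phi> -` (\<phi> ` V)" using V bij_betw_imp_inj_on[OF bij[OF \<phi>]] by (auto dest: inj_onD)
  then show "openin (mtop (linear_manifold W)) V"
    using V \<phi> unfolding linear_manifold_def by (auto intro!: topology_generated_by_Basis)
qed

lemma atlas: "atlas (linear_manifold W) = {W} \<times> linear_coords W"
  by (simp add: linear_manifold_def)

lemma mspc: "mspc (linear_manifold W) = W"
proof -
  have "openin (mtop (linear_manifold W)) W"
    unfolding openin_linear_manifold[OF \<Theta>] using bij_betw_imp_surj_on[OF bij[OF \<Theta>]] by simp
  moreover have "mspc (linear_manifold W) \<subseteq> W" using openin_linear_manifold[OF \<Theta>] openin_topspace by blast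
  ultimately show ?thesis using openin_subset by blast
qed

lemma charted: "charted (linear_manifold W)"
proof
  let ?N = "linear_manifold W"
  fix c :: "'v chart" assume "c \<in> atlas ?N"
  then obtain \<phi> where c: "c = (W, \<phi>)" "\<phi> \<in> linear_coords W" by (auto simp: atlas)
  have im: "\<phi> ` W = UNIV" using bij_betw_imp_surj_on[OF bij[OF c(2)]] .
  have "homeomorphic_map (mtop ?N) euclidean \<phi>"
  proof (rule bijective_open_imp_homeomorphic_map)
    show "continuous_map (mtop ?N) euclidean \<phi>"
      unfolding continuous_map_def
    proof (intro conjI allI impI)
      fix B :: "(real^3) set" assume "openin euclidean B"
      moreover have "\<phi> ` {x \<in> W. \<phi> x \<in> B} = B" using im by auto
      ultimately show "openin (mtop ?N) {x \<in> mspc ?N. \<phi> x \<in> B}" unfolding openin_linear_manifold[OF c(2)] mspc by auto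
    qed simp
    show "open_map (mtop ?N) euclidean \<phi>" unfolding open_map_def openin_linear_manifold[OF c(2)] by auto
  qed (use im bij_betw_imp_inj_on[OF bij[OF c(2)]] mspc in auto)
  moreover have "subtopology (mtop ?N) W = mtop ?N" using mspc by (metis subtopology_topspace)
  ultimately show "openin (mtop ?N) (fst c) \<and> open (snd c ` fst c) \<and>
      homeomorphic_map (subtopology (mtop ?N) (fst c)) (top_of_set (snd c ` fst c)) (snd c)"
    unfolding openin_linear_manifold[OF c(2)] by (simp add: c im)
  fix d :: "'v chart" assume "d \<in> atlas ?N"
  then obtain \<psi> where d: "d = (W, \<psi>)" "\<psi> \<in> linear_coords W" by (auto simp: atlas)
  show "smooth_on (snd c ` (fst c \<inter> fst d)) (rep c (snd d))"
    using linear_change[OF c(2) d(2)] by (intro smooth_onI) (simp add: c d rep_def o_def smooth_at_linear)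
qed

definition dual_coords :: "('v \<Rightarrow> real) \<Rightarrow> real^3" where
  "dual_coords \<xi> = (\<chi> i. \<xi> (inv_into W \<Theta> (axis i 1)))"

lemma dual_apply:
  assumes "\<xi> \<in> dual_space W" "x \<in> W" shows "\<xi> x = \<Theta> x \<bullet> dual_coords \<xi>"
proof -
  let ?e = "\<lambda>i. inv_into W \<Theta> (axis i 1)" and ?a = "\<Theta> x"
  have a: "?a = ?a$1 *\<^sub>R axis 1 1 + ?a$2 *\<^sub>R axis 2 1 + ?a$3 *\<^sub>R axis 3 1"
    by (simp add: vec_eq_iff forall_3 axis_def)
  have "x = inv_into W \<Theta> ?a" using inv(3)[OF \<Theta> assms(2)] by simp
  also have "\<dots> = ?a$1 *\<^sub>R ?e 1 + ?a$2 *\<^sub>R ?e 2 + ?a$3 *\<^sub>R ?e 3"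
    by (subst a) (simp only: inv_add[OF \<Theta>] inv_scale[OF \<Theta>])
  finally have x: "x = ?a$1 *\<^sub>R ?e 1 + ?a$2 *\<^sub>R ?e 2 + ?a$3 *\<^sub>R ?e 3" .
  have "linear_on W \<xi>" using assms(1) by (simp add: dual_space_def)
  from linear_on_comb3[OF this inv(1)[OF \<Theta>] inv(1)[OF \<Theta>] inv(1)[OF \<Theta>] add scale]
  have "\<xi> x = ?a$1 *\<^sub>R \<xi> (?e 1) + ?a$2 *\<^sub>R \<xi> (?e 2) + ?a$3 *\<^sub>R \<xi> (?e 3)"
    using arg_cong[OF x, of \<xi>] by metis
  then show ?thesis by (simp add: dual_coords_def inner_vec_def sum_3)
qed

lemma dual_vector_space: "vector_space_3 (dual_space W) dual_coords"
proof
  show "dual_coords \<in> linear_coords (dual_space W)"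
    unfolding linear_coords_def
  proof (intro CollectI conjI)
    show "linear_on (dual_space W) dual_coords"
      by (simp add: linear_on_def dual_coords_def vec_eq_iff plus_fun_def scaleR_fun_def)
    show "bij_betw dual_coords (dual_space W) UNIV"
    proof (intro bij_betw_imageI inj_onI equalityI subsetI)
      fix \<xi> \<eta> assume *: "\<xi> \<in> dual_space W" "\<eta> \<in> dual_space W" "dual_coords \<xi> = dual_coords \<eta>"
      have "\<xi> x = \<eta> x" for x
        using dual_apply[OF *(1)] dual_apply[OF *(2)] *(1,2) unfolding *(3) by (cases "x \<in> W") (auto simp: dual_space_def)
      then show "\<xi> = \<eta>" ..
    next
      fix y :: "real^3"
      let ?\<xi> = "\<lambda>x. if x \<in> W then \<Theta> x \<bullet> y else 0"
      have "linear_on W \<Theta>" using \<Theta> by (simp add: linear_coords_def)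
      then have \<xi>: "?\<xi> \<in> dual_space W"
        using add scale by (auto simp: dual_space_def linear_on_def inner_add_left)
      have "dual_coords ?\<xi> $ i = y $ i" for i
      proof -
        have "dual_coords ?\<xi> $ i = axis i 1 \<bullet> y"
          unfolding dual_coords_def vec_lambda_beta inv(2)[OF \<Theta>] if_P[OF inv(1)[OF \<Theta>]] ..
        then show ?thesis by (simp only: inner_axis' inner_real_def mult_1)
      qed
      then have "dual_coords ?\<xi> = y" unfolding vec_eq_iff by blast
      from rev_image_eqI[where f=dual_coords, OF \<xi> this[symmetric]] show "y \<in> dual_coords ` dual_space W" .
    qed auto
  qed
qed (auto intro: dual_space_add dual_space_scale)

lemma covector_to_lie_eq:
  assumes \<xi>: "\<xi> \<in> dual_space W" and \<alpha>: "\<alpha> \<in> cotangent_space (linear_manifold (dual_space W)) \<xi>"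
  shows "covector_to_lie W \<xi> \<alpha> =
    inv_into W \<Theta> (charted.covec (linear_manifold (dual_space W)) (dual_space W, dual_coords) \<xi> \<alpha>)"
proof -
  let ?N = "linear_manifold (dual_space W)" and ?d = "(dual_space W, dual_coords)"
  interpret D: vector_space_3 "dual_space W" dual_coords by (rule dual_vector_space)
  interpret N: charted ?N by (rule D.charted)
  have d: "?d \<in> atlas ?N" "\<xi> \<in> fst ?d" using \<xi> D.\<Theta> by (auto simp: D.atlas)
  have op: "openin (mtop ?N) (dual_space W)" using openin_topspace[of "mtop ?N"] unfolding D.mspc .
  have covec: "N.covec ?d \<xi> (differential ?N \<xi> (\<lambda>\<eta>. \<eta> X)) = \<Theta> X" if X: "X \<in> W" for X
  proof -
    \<comment> \<open>The evaluation at \<open>X\<close> is the linear combination \<open>?f\<close>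
      of coordinates on the dual space, but off it the two may differ. Their differentials agree
      because the dual space is open in the manifold.\<close>
    let ?f = "\<lambda>\<eta>. \<Theta> X $ 1 * coord ?d 1 \<eta> + \<Theta> X $ 2 * coord ?d 2 \<eta> + \<Theta> X $ 3 * coord ?d 3 \<eta>"
    note L = N.differential_lincomb[OF d N.smooth_near_coord[OF d] N.smooth_near_coord[OF d] N.smooth_near_coord[OF d],
        of "\<Theta> X $ 1" 1 "\<Theta> X $ 2" 2 "\<Theta> X $ 3" 3]
    have "?f \<eta> = \<eta> X" if "\<eta> \<in> dual_space W" for \<eta>
      unfolding dual_apply[OF that X] by (simp add: coord_def inner_vec_def sum_3)
    then have eq: "differential ?N \<xi> ?f = differential ?N \<xi> (\<lambda>\<eta>. \<eta> X)"
      by (rule N.differential_cong[OF d op \<xi> _ L(1)])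
    have "N.covec ?d \<xi> (differential ?N \<xi> (\<lambda>\<eta>. \<eta> X)) =
        \<Theta> X $ 1 *\<^sub>R axis 1 1 + \<Theta> X $ 2 *\<^sub>R axis 2 1 + \<Theta> X $ 3 *\<^sub>R axis 3 1"
      unfolding eq[symmetric] L(2) N.covec_add N.covec_scale N.covec_differential_coord[OF d] ..
    also have "\<dots> = \<Theta> X" by (simp add: vec_eq_iff forall_3 axis_def)
    finally show ?thesis .
  qed
  show ?thesis
    unfolding covector_to_lie_def
  proof (rule the_equality)
    show "inv_into W \<Theta> (N.covec ?d \<xi> \<alpha>) \<in> W \<and> differential ?N \<xi> (\<lambda>\<eta>. \<eta> (inv_into W \<Theta> (N.covec ?d \<xi> \<alpha>))) = \<alpha>"
      using inv(1,2)[OF \<Theta>] covec by (auto intro!: N.cotangent_eqI[OF d N.differential_cotangent \<alpha>])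
    show "X = inv_into W \<Theta> (N.covec ?d \<xi> \<alpha>)" if "X \<in> W \<and> differential ?N \<xi> (\<lambda>\<eta>. \<eta> X) = \<alpha>" for X
      using covec[of X] inv(3)[OF \<Theta>, of X] that by auto
  qed
qed

end

subsection \<open>The linearizing diffeomorphism\<close>

context charted begin

lemma differential_inner:
  assumes c: "c \<in> atlas M" "x \<in> fst c" and W: "\<And>i. smooth_near M x (\<lambda>y. W y $ i)"
  shows "smooth_near M x (\<lambda>y. a \<bullet> W y)"
    and "differential M x (\<lambda>y. a \<bullet> W y) = a$1 *\<^sub>R differential M x (\<lambda>y. W y $ 1)
      + a$2 *\<^sub>R differential M x (\<lambda>y. W y $ 2) + a$3 *\<^sub>R differential M x (\<lambda>y. W y $ (3::3))"
  using differential_lincomb[OF c W W W, of "a$1" 1 "a$2" 2 "a$3" 3] by (simp_all add: inner_vec_def sum_3)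

lemma poisson_bracket_inner:
  assumes \<pi>: "smooth_bivector_field M \<pi>" and c: "c \<in> atlas M" "x \<in> fst c"
    and W: "\<And>i. smooth_near M x (\<lambda>y. W y $ i)"
  shows "poisson_bracket M \<pi> (\<lambda>y. a \<bullet> W y) (\<lambda>y. b \<bullet> W y) x =
    (\<Sum>i\<in>UNIV. \<Sum>j\<in>UNIV. a $ i * b $ j * poisson_bracket M \<pi> (\<lambda>y. W y $ i) (\<lambda>y. W y $ (j::3)) x)"
  unfolding poisson_bracket_def
  unfolding bivector_triple[OF \<pi> c differential_cotangent differential_cotangent]
  unfolding differential_inner(2)[where W=W, OF c W]
  unfolding covec_add covec_scale triple_linear sum_3
  by (simp add: algebra_simps)



text \<open>A vector a gives the function a . W near \<open>p\<close> and the element E a of the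
  isotropy Lie algebra, its differential at \<open>p\<close>. The linearization \<Phi> sends x to
  the functional that takes E a to a . W(x). Linear functions on the dual thereby pull back to the
  functions a . W, whose brackets are again of this form.\<close>

theorem linear_coordinates_linearize:
  assumes M: "smooth_manifold M" and \<pi>: "smooth_bivector_field M \<pi>" and c: "c \<in> atlas M" "p \<in> fst c"
    and z: "\<forall>\<alpha>\<in>cotangent_space M p. \<forall>\<beta>\<in>cotangent_space M p. \<pi> p \<alpha> \<beta> = 0"
    and w: "smooth_at 0 w" "w 0 = 0" "det (jac_matrix w 0) \<noteq> 0"
    and S: "openin (mtop M) S" "p \<in> S" "S \<subseteq> fst c" "\<And>x. x \<in> S \<Longrightarrow> smooth_at (snd c x - snd c p) w"
    and br: "\<And>x i j. x \<in> S \<Longrightarrow> poisson_bracket M \<pi> (\<lambda>x. w (snd c x - snd c p) $ i) (\<lambda>x. w (snd c x - snd c p) $ j) x =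
      (\<Sum>l\<in>UNIV. k i j l * w (snd c x - snd c p) $ l)"
  shows "linearizable_at M \<pi> p"
proof -
  let ?a = "snd c p" and ?inv = "inv_into (fst c) (snd c)"
  let ?G = "cotangent_space M p" and ?br = "isotropy_bracket M \<pi> p"
  let ?J = "jac_matrix w 0"
  define W where "W x = w (snd c x - ?a)" for x
  have Wp: "W p = 0" by (simp add: W_def w)
  have repW: "\<forall>\<^sub>F z in nhds (snd c x). rep c (\<lambda>x. W x $ i) z = w (z - ?a) $ i" if "x \<in> S" for x i
  proof -
    have "x \<in> fst c" using that S(3) by auto
    from eventually_chart[OF c(1) this S(1) that, of "\<lambda>_. True"] show ?thesis
      by (auto elim!: eventually_mono simp: rep_apply W_def)
  qed
  have snW: "smooth_near M x (\<lambda>x. W x $ i)" if "x \<in> S" for x i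
  proof -
    have x: "x \<in> fst c" using that S(3) by auto
    show ?thesis unfolding smooth_near_iff[OF c(1) x] smooth_at_cong[OF repW[OF that]]
      by (intro smooth_at_compose[of _ "\<lambda>z. z - ?a" "\<lambda>x. w x $ i"] smooth_at_diff smooth_at_ident smooth_at_const
        smooth_at_component S(4) that)
  qed
  define E where "E a = differential M p (\<lambda>y. a \<bullet> W y)" for a :: "real^3"
  have covE: "covec c p (E b) = b v* ?J" for b
  proof -
    have s1: "((\<lambda>z. z - ?a) has_derivative (\<lambda>h. h)) (at z)" for z by (auto intro!: derivative_eq_intros)
    have "grad (rep c (\<lambda>x. W x $ i)) ?a = ?J $ i" for i
    proof -
      have "smooth_at (?a - ?a) (\<lambda>x. w x $ i)" using w(1) by (simp add: smooth_at_component)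
      from dir_deriv_eqI[OF smooth_at_has_derivative_compose[OF this s1]] show ?thesis
        unfolding grad_cong_ev[OF repW[OF S(2)]] jac_matrix_row[OF w(1)] by (simp add: grad_def)
    qed
    then show ?thesis
      unfolding E_def differential_inner(2)[where W=W, OF c snW[OF S(2)]] covec_add covec_scale covec_differential[OF c snW[OF S(2)]]
      by (simp add: vec_eq_iff vector_matrix_mult_def sum_3 mult.commute)
  qed
  have EG: "E b \<in> ?G" for b unfolding E_def by (rule differential_cotangent)
  obtain J' where J': "?J ** J' = mat 1" "J' ** ?J = mat 1"
    using w(3) unfolding invertible_det_nz[symmetric] invertible_def by blast
  \<comment> \<open>\<open>E\<close> is an isomorphism from R^3 onto the isotropy Lie algebra
    because the Jacobian matrix of \<open>w\<close> is invertible. Its inverse \<open>K\<close>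
    provides linear coordinates on the algebra, and the coordinates dual to them turn \<Phi> into
    \<open>W\<close>.\<close>
  define K where "K \<alpha> = covec c p \<alpha> v* J'" for \<alpha>
  have KE: "K (E b) = b" for b
    unfolding K_def covE vector_matrix_mul_assoc J'(1) by simp
  have EK: "E (K \<alpha>) = \<alpha>" if "\<alpha> \<in> ?G" for \<alpha>
    by (rule cotangent_eqI[OF c EG that])
      (simp add: covE, simp add: K_def vector_matrix_mul_assoc J'(2))
  have bijK: "bij_betw K ?G UNIV"
    by (rule bij_betw_byWitness[where f'=E]) (use KE EK EG in auto)
  interpret G: vector_space_3 ?G K
  proof
    have "linear_on ?G K"
      unfolding linear_on_def K_def covec_add covec_scale
      by (simp add: vec_eq_iff vector_matrix_mult_def distrib_left distrib_right sum.distrib sum_distrib_left mult.assoc)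
    then show "K \<in> linear_coords ?G" using bijK by (simp add: linear_coords_def)
  qed (auto intro: cotangent_add cotangent_scale)
  have Ginv: "inv_into ?G K b = E b" for b using G.inv(3)[OF G.\<Theta> EG[of b]] unfolding KE .

  let ?D = "dual_space ?G" and ?\<Theta> = "G.dual_coords"
  let ?N = "linear_manifold ?D" and ?d = "(?D, ?\<Theta>)"
  interpret D: vector_space_3 ?D ?\<Theta> by (rule G.dual_vector_space)
  interpret N: charted ?N by (rule D.charted)
  have dN: "?d \<in> atlas ?N" using D.\<Theta> by (auto simp: D.atlas)
  obtain U V g where U: "open U" "0 \<in> U" and V: "open V" and hom: "homeomorphism U V w g"
    and sU: "\<And>y. y \<in> U \<Longrightarrow> smooth_at y w" and sV: "\<And>y. y \<in> V \<Longrightarrow> smooth_at y g"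
    by (rule smooth_inverse_function[OF w(1,3)]) blast
  \<comment> \<open>Shrinks \<open>S\<close> to the part on which the local inverse \<open>g\<close>
    of \<open>w\<close> undoes \<open>W\<close>.\<close>
  define R where "R = S \<inter> {x \<in> fst c. snd c x \<in> (\<lambda>z. z - ?a) -` U}"
  have tr: "open ((\<lambda>z. z - ?a) -` T)" if "open T" for T
    by (rule continuous_open_vimage[OF that]) (intro continuous_intros)
  have R: "openin (mtop M) R" "p \<in> R" "R \<subseteq> S" "R \<subseteq> fst c" "R \<subseteq> mspc M"
    using S c U chart_open_preimage[OF c(1) tr[OF U(1)]] chart_subset[OF c(1)]
    by (auto simp: R_def intro!: openin_Int)
  have RU: "snd c x - ?a \<in> U" if "x \<in> R" for x using that by (simp add: R_def)
  have WV: "W x \<in> V" and gW: "g (W x) = snd c x - ?a" and retr: "?inv (?a + g (W x)) = x" if "x \<in> R" for x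
  proof -
    show "W x \<in> V" "g (W x) = snd c x - ?a" using hom RU[OF that] by (auto simp: W_def homeomorphism_def)
    then show "?inv (?a + g (W x)) = x" using chart_inv[OF c(1), of x] that R(4) by auto
  qed
  define \<Phi> where "\<Phi> x = inv_into ?D ?\<Theta> (W x)" for x
  have \<Phi>: "\<Phi> x \<in> ?D" "?\<Theta> (\<Phi> x) = W x" for x using D.inv(1,2)[OF D.\<Theta>] by (simp_all add: \<Phi>_def)
  have inj\<Phi>: "inj_on \<Phi> R" using retr \<Phi>(2) by (metis inj_onI)
  have opN: "openin (mtop ?N) X \<longleftrightarrow> X \<subseteq> ?D \<and> open (?\<Theta> ` X)" for X
    by (rule D.openin_linear_manifold[OF D.\<Theta>])
  have op\<Phi>: "openin (mtop ?N) (\<Phi> ` T)" if T: "openin (mtop M) T" "T \<subseteq> R" for T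
  proof -
    let ?X = "(\<lambda>z. z - ?a) ` (snd c ` (fst c \<inter> T))"
    have "open ?X" by (intro open_translation_subtract chart_open_image[OF c(1) T(1)])
    moreover have "?X \<subseteq> U" using T(2) RU by auto
    ultimately have "openin (top_of_set V) (w ` ?X)"
      by (intro homeomorphism_imp_open_map[OF hom]) (simp add: open_subset)
    then have "open (w ` ?X)" using V openin_open_trans by blast
    moreover have "w ` ?X = ?\<Theta> ` \<Phi> ` T" using T(2) R(4) by (auto simp: image_image \<Phi>(2) W_def)
    ultimately show ?thesis unfolding opN using \<Phi>(1) by auto
  qed
  have sW: "smooth_at (snd e x) (rep e W)" if "e \<in> atlas M" "x \<in> fst e" "x \<in> R" for e x
    using snW[of x] that R(3) unfolding smooth_near_iff[OF that(1,2)] smooth_at_vec_iff by (auto simp: rep_def o_def)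
  have map: "smooth_map M R ?N \<Phi>"
    unfolding smooth_map_def
  proof
    show "continuous_map (subtopology (mtop M) R) (mtop ?N) \<Phi>"
      unfolding continuous_map_def
    proof (intro conjI allI impI)
      show "\<Phi> \<in> topspace (subtopology (mtop M) R) \<rightarrow> mspc ?N" using \<Phi>(1) by (auto simp: D.mspc)
      fix X assume "openin (mtop ?N) X"
      then have X: "X \<subseteq> ?D" "open (?\<Theta> ` X)" unfolding opN by auto
      have "open (U \<inter> w -` (?\<Theta> ` X))"
        by (intro continuous_open_preimage[OF _ U(1) X(2)] smooth_at_continuous_on sU)
      from chart_open_preimage[OF c(1) tr[OF this]]
      have "openin (mtop M) (R \<inter> {x \<in> fst c. snd c x \<in> (\<lambda>z. z - ?a) -` (U \<inter> w -` (?\<Theta> ` X))})" using R(1) by blast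
      moreover have "\<Phi> x \<in> X \<longleftrightarrow> W x \<in> ?\<Theta> ` X" for x
        using X(1) \<Phi>(2)[of x] D.inv(3)[OF D.\<Theta>] by (auto simp: \<Phi>_def intro: rev_image_eqI)
      then have "{x \<in> topspace (subtopology (mtop M) R). \<Phi> x \<in> X} =
          (R \<inter> {x \<in> fst c. snd c x \<in> (\<lambda>z. z - ?a) -` (U \<inter> w -` (?\<Theta> ` X))}) \<inter> R"
        using R(4,5) RU by (auto simp: W_def)
      ultimately show "openin (subtopology (mtop M) R) {x \<in> topspace (subtopology (mtop M) R). \<Phi> x \<in> X}"
        unfolding openin_subtopology by blast
    qed
    have "smooth_on (snd e ` (fst e \<inter> R \<inter> \<Phi> -` ?D)) (\<psi> \<circ> \<Phi> \<circ> inv_into (fst e) (snd e))"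
      if "e \<in> atlas M" "\<psi> \<in> linear_coords ?D" for e \<psi>
    proof (rule smooth_onI)
      fix z assume "z \<in> snd e ` (fst e \<inter> R \<inter> \<Phi> -` ?D)"
      then obtain x where "x \<in> fst e" "x \<in> R" "z = snd e x" by auto
      with sW[OF that(1)] have "smooth_at z (rep e W)" by simp
      from smooth_at_bounded_linear_compose[OF D.linear_change[OF D.\<Theta> that(2)] this]
      show "smooth_at z (\<psi> \<circ> \<Phi> \<circ> inv_into (fst e) (snd e))" by (simp add: o_def \<Phi>_def rep_def)
    qed
    then show "\<forall>(U, \<phi>)\<in>atlas M. \<forall>(V, \<psi>)\<in>atlas ?N. smooth_on (\<phi> ` (U \<inter> R \<inter> \<Phi> -` V)) (\<psi> \<circ> \<Phi> \<circ> inv_into U \<phi>)"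
      unfolding D.atlas by fastforce
  qed
  let ?V = "\<Phi> ` R" and ?\<Psi> = "inv_into R \<Phi>"
  have \<Psi>: "?\<Psi> (\<Phi> x) = x" if "x \<in> R" for x by (rule inv_into_f_f[OF inj\<Phi> that])
  have map': "smooth_map ?N ?V M ?\<Psi>"
    unfolding smooth_map_def
  proof
    show "continuous_map (subtopology (mtop ?N) ?V) (mtop M) ?\<Psi>"
      unfolding continuous_map_def
    proof (intro conjI allI impI)
      show "?\<Psi> \<in> topspace (subtopology (mtop ?N) ?V) \<rightarrow> mspc M" using \<Psi> R(5) by auto
      fix T assume "openin (mtop M) T"
      then have "openin (mtop ?N) (\<Phi> ` (R \<inter> T))" using R(1) by (intro op\<Phi>) auto
      moreover have "{\<xi> \<in> topspace (subtopology (mtop ?N) ?V). ?\<Psi> \<xi> \<in> T} = \<Phi> ` (R \<inter> T) \<inter> ?V"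
        using \<Psi> \<Phi>(1) inj\<Phi> by (auto simp: D.mspc dest: inj_onD)
      ultimately show "openin (subtopology (mtop ?N) ?V) {\<xi> \<in> topspace (subtopology (mtop ?N) ?V). ?\<Psi> \<xi> \<in> T}"
        unfolding openin_subtopology by blast
    qed
    have "smooth_on (\<phi> ` (?D \<inter> ?V \<inter> ?\<Psi> -` fst e)) (snd e \<circ> ?\<Psi> \<circ> inv_into ?D \<phi>)"
      if e: "e \<in> atlas M" and \<phi>: "\<phi> \<in> linear_coords ?D" for e \<phi>
    proof (rule smooth_onI)
      fix z assume "z \<in> \<phi> ` (?D \<inter> ?V \<inter> ?\<Psi> -` fst e)"
      then obtain x where x: "x \<in> R" "x \<in> fst e" "z = \<phi> (\<Phi> x)" using \<Psi> by auto
      let ?L = "\<lambda>z. ?\<Theta> (inv_into ?D \<phi> z)"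
      have Lz: "?L z = W x" using D.inv(3)[OF \<phi> \<Phi>(1)] \<Phi>(2) x(3) by simp
      have xc: "x \<in> fst c" using R(4) x(1) by auto
      have "open (\<phi> ` ?V)" using op\<Phi>[OF R(1)] D.openin_linear_manifold[OF \<phi>] by blast
      \<comment> \<open>Near \<open>z\<close> the inverse of \<Phi> is \<open>g\<close> after a
        linear change of coordinates, followed by the transition to the chart \<open>e\<close>; this
        exhibits its smoothness.\<close>
      then have ev: "\<forall>\<^sub>F z in nhds z. (snd e \<circ> ?\<Psi> \<circ> inv_into ?D \<phi>) z = rep c (snd e) (?a + g (?L z))"
      proof (rule eventually_eq_open)
        show "z \<in> \<phi> ` ?V" using x by blast
        fix y assume "y \<in> \<phi> ` ?V"
        then obtain x' where "x' \<in> R" "y = \<phi> (\<Phi> x')" by auto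
        then show "(snd e \<circ> ?\<Psi> \<circ> inv_into ?D \<phi>) y = rep c (snd e) (?a + g (?L y))"
          using \<Psi> D.inv(3)[OF \<phi> \<Phi>(1)] \<Phi>(2) retr by (simp add: rep_apply)
      qed
      have "smooth_at z (\<lambda>z. rep c (snd e) (?a + g (?L z)))"
      proof (rule smooth_at_compose[of z "\<lambda>z. ?a + g (?L z)" "rep c (snd e)"])
        have "smooth_at z (\<lambda>z. g (?L z))"
          by (rule smooth_at_compose[OF smooth_at_linear[OF D.linear_change[OF \<phi> D.\<Theta>]]]) (simp add: Lz sV[OF WV[OF x(1)]])
        then show "smooth_at z (\<lambda>z. ?a + g (?L z))" by (intro smooth_at_add smooth_at_const)
        show "smooth_at (?a + g (?L z)) (rep c (snd e))"
          using transition_smooth_at[OF c(1) e xc x(2)] by (simp add: Lz gW[OF x(1)])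
      qed
      then show "smooth_at z (snd e \<circ> ?\<Psi> \<circ> inv_into ?D \<phi>)" unfolding smooth_at_cong[OF ev] .
    qed
    then show "\<forall>(U, \<phi>)\<in>atlas ?N. \<forall>(V, \<psi>)\<in>atlas M. smooth_on (\<phi> ` (U \<inter> ?V \<inter> ?\<Psi> -` V)) (\<psi> \<circ> ?\<Psi> \<circ> inv_into U \<phi>)"
      unfolding D.atlas by fastforce
  qed

  define B :: "real^3 \<Rightarrow> real^3 \<Rightarrow> real^3" where
    "B u v = (\<chi> l. \<Sum>i\<in>UNIV. \<Sum>j\<in>UNIV. u $ i * v $ j * k i j l)" for u v
  have brB: "poisson_bracket M \<pi> (\<lambda>y. u \<bullet> W y) (\<lambda>y. v \<bullet> W y) x = B u v \<bullet> W x" if "x \<in> S" for x u v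
  proof -
    have x: "x \<in> fst c" using that S(3) by auto
    show ?thesis
      unfolding poisson_bracket_inner[where W=W, OF \<pi> c(1) x snW[OF that]]
      unfolding br[OF that, folded W_def]
      by (simp add: B_def inner_vec_def sum_3 algebra_simps)
  qed
  \<comment> \<open>Taking differentials at \<open>p\<close> of the relation {u . W, v . W} = B u v
    . W identifies \<open>B\<close> with the isotropy bracket. So the constants \<open>k\<close> are
    automatically the structure constants of the isotropy Lie algebra.\<close>
  have brE: "?br (E u) (E v) = E (B u v)" for u v
  proof -
    note s = differential_inner(1)[where W=W, OF c snW[OF S(2)]]
    show ?thesis
      unfolding E_def isotropy_bracket_eq[OF M \<pi> c z s s]
      by (rule differential_cong[OF c S(1,2) brB smooth_near_bracket(2)[OF \<pi> c s s]])
  qed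
  have lin: "linear_poisson ?G ?br (\<Phi> x) \<alpha> \<beta> = B (N.covec ?d (\<Phi> x) \<alpha>) (N.covec ?d (\<Phi> x) \<beta>) \<bullet> W x"
    if "\<alpha> \<in> cotangent_space ?N (\<Phi> x)" "\<beta> \<in> cotangent_space ?N (\<Phi> x)" for x \<alpha> \<beta>
    unfolding linear_poisson_def G.covector_to_lie_eq[OF \<Phi>(1) that(1)] G.covector_to_lie_eq[OF \<Phi>(1) that(2)] Ginv brE
    using G.dual_apply[OF \<Phi>(1) EG] by (simp add: KE \<Phi>(2))
  \<comment> \<open>The components of a covector at \<Phi>(x) are its coefficients with respect to
    the linear coordinates, and these coordinates pull back to the components of
    \<open>W\<close>.\<close>
  have pull: "pullback M ?N \<Phi> x \<alpha> = differential M x (\<lambda>y. N.covec ?d (\<Phi> x) \<alpha> \<bullet> W y)"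
    if x: "x \<in> R" and \<alpha>: "\<alpha> \<in> cotangent_space ?N (\<Phi> x)" for x \<alpha>
  proof
    fix v
    let ?u = "N.covec ?d (\<Phi> x) \<alpha>"
    have xc: "x \<in> fst c" and xS: "x \<in> S" using R x by auto
    have \<Phi>d: "\<Phi> x \<in> fst ?d" using \<Phi>(1) by simp
    have comp: "smooth_near M x (f \<circ> \<Phi>)" if f: "smooth_near ?N (\<Phi> x) f" for f
    proof -
      have "smooth_at (?\<Theta> (\<Phi> x)) (rep ?d f)" using f unfolding N.smooth_near_iff[OF dN \<Phi>d] by simp
      then have "smooth_at (rep c W (snd c x)) (rep ?d f)"
        by (simp add: \<Phi>(2) rep_apply[of c] chart_inv[OF c(1) xc])
      from smooth_at_compose[OF sW[OF c(1) xc x] this]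
      show ?thesis unfolding smooth_near_iff[OF c(1) xc] by (simp add: rep_def o_def \<Phi>_def)
    qed
    show "pullback M ?N \<Phi> x \<alpha> v = differential M x (\<lambda>y. ?u \<bullet> W y) v"
    proof (cases "v \<in> tangent_space M x")
      case True
      let ?v = "pushforward ?N \<Phi> x v"
      have v: "?v \<in> tangent_space ?N (\<Phi> x)" by (rule pushforward_tangent[OF D.charted dN \<Phi>d comp True])
      have co: "coord ?d i \<circ> \<Phi> = (\<lambda>y. W y $ i)" for i by (simp add: fun_eq_iff coord_def \<Phi>(2))
      have "differential ?N (\<Phi> x) (coord ?d i) ?v = differential M x (\<lambda>y. W y $ i) v" for i
        using v True N.smooth_near_coord[OF dN \<Phi>d] by (simp add: differential_def pushforward_def co)
      moreover have "\<alpha> ?v = (?u $ 1 *\<^sub>R differential ?N (\<Phi> x) (coord ?d 1) + ?u $ 2 *\<^sub>R differential ?N (\<Phi> x) (coord ?d 2)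
          + ?u $ 3 *\<^sub>R differential ?N (\<Phi> x) (coord ?d 3)) ?v"
        by (rule arg_cong[OF N.cotangent_expand[OF dN \<Phi>d \<alpha>]])
      ultimately show ?thesis
        unfolding differential_inner(2)[where W=W, OF c(1) xc snW[OF xS]]
        using True by (simp add: pullback_def plus_fun_def scaleR_fun_def)
    qed (simp add: pullback_def differential_def)
  qed
  have "poisson_diffeo M \<pi> R ?N (linear_poisson ?G ?br) ?V \<Phi>"
    unfolding poisson_diffeo_def
  proof (intro conjI ballI map map')
    show "bij_betw \<Phi> R ?V" using inj\<Phi> by (simp add: bij_betw_def)
    fix x \<alpha> \<beta>
    assume x: "x \<in> R" and \<alpha>\<beta>: "\<alpha> \<in> cotangent_space ?N (\<Phi> x)" "\<beta> \<in> cotangent_space ?N (\<Phi> x)"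
    then have xS: "x \<in> S" using R(3) by blast
    show "linear_poisson ?G ?br (\<Phi> x) \<alpha> \<beta> = \<pi> x (pullback M ?N \<Phi> x \<alpha>) (pullback M ?N \<Phi> x \<beta>)"
      unfolding lin[OF \<alpha>\<beta>] pull[OF x \<alpha>\<beta>(1)] pull[OF x \<alpha>\<beta>(2)]
      using brB[OF xS] by (simp add: poisson_bracket_def)
  qed
  moreover have "\<Phi> p = 0"
    using D.inv_scale[OF D.\<Theta>, of 0 "W p"] by (simp add: \<Phi>_def Wp)
  moreover from this have "0 \<in> ?V" using R(2) by (metis imageI)
  moreover have "openin (mtop ?N) ?V" by (rule op\<Phi>[OF R(1)]) simp
  ultimately show ?thesis
    unfolding linearizable_at_def Let_def using R(1,2) by (intro exI[of _ R] exI[of _ ?V] exI[of _ \<Phi>] conjI)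
qed

end

theorem mainTheorem2:
  fixes M :: "'a manifold" and \<pi> :: "'a bivector_field" and p :: 'a
  assumes "smooth_manifold M"
    and "poisson_structure M \<pi>"
    and "p \<in> mspc M"
    and "\<forall>\<alpha>\<in>cotangent_space M p. \<forall>\<beta>\<in>cotangent_space M p. \<pi> p \<alpha> \<beta> = 0"
    and "lie_isomorphic (cotangent_space M p) (isotropy_bracket M \<pi> p) sl2 commutator"
    and "unimodular_near M \<pi> p"
  shows "linearizable_at M \<pi> p"
proof -
  interpret charted M by (rule smooth_manifold_charted[OF assms(1)])
  have \<pi>: "smooth_bivector_field M \<pi>" using assms(2) by (simp add: poisson_structure_def)
  obtain c where c: "c \<in> atlas M" "p \<in> fst c"
  proof -
    have "(\<Union>(U, \<phi>)\<in>atlas M. U) = mspc M" using assms(1) unfolding smooth_manifold_def by blast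
    then have "p \<in> (\<Union>(U, \<phi>)\<in>atlas M. U)" using assms(3) by simp
    then show thesis using that by auto
  qed
  obtain w k S where "smooth_at 0 w" "w 0 = 0" "det (jac_matrix w 0) \<noteq> 0"
    "openin (mtop M) S" "p \<in> S" "S \<subseteq> fst c" "\<And>x. x \<in> S \<Longrightarrow> smooth_at (snd c x - snd c p) w"
    "\<And>x i j. x \<in> S \<Longrightarrow> poisson_bracket M \<pi> (\<lambda>x. w (snd c x - snd c p) $ i) (\<lambda>x. w (snd c x - snd c p) $ j) x =
      (\<Sum>l\<in>UNIV. k i j l * w (snd c x - snd c p) $ l)"
    by (rule linear_poisson_coordinates[OF assms(1) \<pi> c assms(4-6)]) blast
  then show ?thesis by (rule linear_coordinates_linearize[OF assms(1) \<pi> c assms(4)])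
qed

end
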